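(* Let $R=\bigoplus_{n\geq 0}R_n$ be a graded commutative ring generated over a field $K=R_0$ by finitely many homogeneous elements of positive degrees. If $M$ and $N$ are finite graded $R$-modules such that $\operatorname{Ext}^i_R(M,N)=0$ for all $i\gg 0$, then there is an equality of rational functions $$\sum_{i}(-1)^i H_{\operatorname{Ext}^i_R(M,N)}(t)=\frac{H_M(t^{-1})\cdot H_N(t)}{H_R(t^{-1})}.$$
   Context: "Finite" module means finitely generated; graded modules are graded by $\mathbb{Z}$. If $R$ is generated over $K$ by homogeneous elements $x_1,\dots,x_e$ of positive degrees $d_1,\dots,d_e$, then for a finite graded $R$-module $M=\bigoplus_{n\in\mathbb{Z}}M_n$ the Hilbert series $\sum_{n\in\mathbb{Z}}(\operatorname{rank}_K M_n)t^n$ is the Laurent expansion around $0$ of a rational function $H_M(t)=q_M(t)/\prod_{i=1}^e(1-t^{d_i})$ with $q_M(t)\in\mathbb{Z}[t,t^{-1}]$; $H_M(t)$ denotes this rational function, and $H_M(t^{-1})$ the result of substituting $t^{-1}$ for $t$ in it. For finite graded $R$-modules $M,N$, $\operatorname{Hom}_R(M,N)$ is graded: $\operatorname{Hom}_R(M,N)_n$ consists of the homomorphisms $\alpha$ with $\alpha(M_j)\subseteq N_{n+j}$ for all $j\in\mathbb{Z}$. Computing $\operatorname{Ext}^i_R(M,N)$ from a resolution of $M$ by finite free graded $R$-modules and homomorphisms of degree $0$ makes each $\operatorname{Ext}^i_R(M,N)$ a finite graded $R$-module. *)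

theory Defs
  imports
    "HOL-Algebra.Algebra"
    "HOL-Computational_Algebra.Computational_Algebra"
    "HOL-Computational_Algebra.Field_as_Ring"
    "Jordan_Normal_Form.Missing_VectorSpace"
begin

section \<open>Graded rings and graded modules\<close>

text \<open>
  A family \<open>gM\<close> of additive subgroups of \<open>M\<close> indexed by the integers such that \<open>M\<close> is their
  internal direct sum.
\<close>

definition grading :: "('b, 's) ring_scheme \<Rightarrow> (int \<Rightarrow> 'b set) \<Rightarrow> bool" where
  "grading M gM \<longleftrightarrow>
     (\<forall>n. additive_subgroup (gM n) M) \<and>
     (\<forall>x\<in>carrier M. \<exists>!f. (\<forall>n. f n \<in> gM n) \<and> finite {n. f n \<noteq> \<zero>\<^bsub>M\<^esub>} \<and>
        x = (\<Oplus>\<^bsub>M\<^esub>n\<in>{n. f n \<noteq> \<zero>\<^bsub>M\<^esub>}. f n))"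

locale graded_ring = cring R for R (structure) +
  fixes gR :: "int \<Rightarrow> 'a set"
  assumes grading: "grading R gR"
    and graded_mult: "\<And>m n a b. \<lbrakk>a \<in> gR m; b \<in> gR n\<rbrakk> \<Longrightarrow> a \<otimes> b \<in> gR (m + n)"

locale graded_module = Module.module R M
  for R :: "('a, 'r) ring_scheme" and gR :: "int \<Rightarrow> 'a set"
    and M :: "('a, 'b, 's) module_scheme" and gM :: "int \<Rightarrow> 'b set" +
  assumes grading: "grading M gM"
    and graded_smult: "\<And>m n a x. \<lbrakk>a \<in> gR m; x \<in> gM n\<rbrakk> \<Longrightarrow> a \<odot>\<^bsub>M\<^esub> x \<in> gM (m + n)"

definition finite_graded_module ::
  "('a, 'r) ring_scheme \<Rightarrow> (int \<Rightarrow> 'a set) \<Rightarrow> ('a, 'b, 's) module_scheme \<Rightarrow> (int \<Rightarrow> 'b set) \<Rightarrow> bool" where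
  "finite_graded_module R gR M gM \<longleftrightarrow>
     graded_module R gR M gM \<and>
     (\<exists>A. finite A \<and> A \<subseteq> carrier M \<and> LinearCombinations.module.span R M A = carrier M)"

definition finite_free_graded_module ::
  "('a, 'r) ring_scheme \<Rightarrow> (int \<Rightarrow> 'a set) \<Rightarrow> ('a, 'b, 's) module_scheme \<Rightarrow> (int \<Rightarrow> 'b set) \<Rightarrow> bool" where
  "finite_free_graded_module R gR M gM \<longleftrightarrow>
     graded_module R gR M gM \<and>
     (\<exists>B. finite B \<and> B \<subseteq> (\<Union>n. gM n) \<and> LinearCombinations.module.span R M B = carrier M \<and>
          \<not> LinearCombinations.module.lin_dep R M B)"

definition ring_as_module :: "('a, 'r) ring_scheme \<Rightarrow> ('a, 'a) module" where
  "ring_as_module R =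
     \<lparr>carrier = carrier R, monoid.mult = monoid.mult R, one = one R, ring.zero = ring.zero R, ring.add = ring.add R, module.smult = monoid.mult R\<rparr>"

definition graded_hom0 ::
  "('a, 'r) ring_scheme \<Rightarrow> ('a, 'b, 's) module_scheme \<Rightarrow> (int \<Rightarrow> 'b set) \<Rightarrow>
   ('a, 'c, 't) module_scheme \<Rightarrow> (int \<Rightarrow> 'c set) \<Rightarrow> ('b \<Rightarrow> 'c) set" where
  "graded_hom0 R M gM N gN = {f \<in> module_hom R M N. \<forall>j. f ` gM j \<subseteq> gN j}"

section \<open>The graded modules \<open>Hom\<close> and \<open>Ext\<close>\<close>

text \<open>
  Homomorphisms are represented by functions that are \<open>undefined\<close> off the carrier, so that equal
  homomorphisms are equal functions. In module records the fields \<open>mult\<close> and \<open>one\<close> are irrelevant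
  and are filled with zeros.
\<close>

definition hom_module ::
  "('a, 'r) ring_scheme \<Rightarrow> ('a, 'b, 's) module_scheme \<Rightarrow> ('a, 'c, 't) module_scheme \<Rightarrow>
   ('a, 'b \<Rightarrow> 'c) module" where
  "hom_module R M N =
     \<lparr>carrier = module_hom R M N \<inter> extensional (carrier M),
      monoid.mult = (\<lambda>f g. \<lambda>x\<in>carrier M. \<zero>\<^bsub>N\<^esub>),
      one = (\<lambda>x\<in>carrier M. \<zero>\<^bsub>N\<^esub>),
      ring.zero = (\<lambda>x\<in>carrier M. \<zero>\<^bsub>N\<^esub>),
      ring.add = (\<lambda>f g. \<lambda>x\<in>carrier M. f x \<oplus>\<^bsub>N\<^esub> g x),
      module.smult = (\<lambda>r f. \<lambda>x\<in>carrier M. r \<odot>\<^bsub>N\<^esub> f x)\<rparr>"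

definition hom_grading ::
  "('a, 'r) ring_scheme \<Rightarrow> ('a, 'b, 's) module_scheme \<Rightarrow> (int \<Rightarrow> 'b set) \<Rightarrow>
   ('a, 'c, 't) module_scheme \<Rightarrow> (int \<Rightarrow> 'c set) \<Rightarrow> int \<Rightarrow> ('b \<Rightarrow> 'c) set" where
  "hom_grading R M gM N gN n =
     {f \<in> carrier (hom_module R M N). \<forall>j. f ` gM j \<subseteq> gN (n + j)}"

definition quotient_module :: "('a, 'b, 's) module_scheme \<Rightarrow> 'b set \<Rightarrow> ('a, 'b set) module" where
  "quotient_module M S =
     \<lparr>carrier = a_rcosets\<^bsub>M\<^esub> S,
      monoid.mult = (\<lambda>C D. S),
      one = S,
      ring.zero = S,
      ring.add = set_add M,
      module.smult = (\<lambda>r C. \<Union>x\<in>C. S +>\<^bsub>M\<^esub> (r \<odot>\<^bsub>M\<^esub> x))\<rparr>"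

text \<open>
  A resolution \<open>\<dots> \<rightarrow> F 2 \<rightarrow> F 1 \<rightarrow> F 0 \<rightarrow> M \<rightarrow> 0\<close> with \<open>d i : F (i + 1) \<rightarrow> F i\<close> and augmentation
  \<open>\<epsilon> : F 0 \<rightarrow> M\<close>.
\<close>

locale graded_free_resolution =
  fixes R :: "('a, 'r) ring_scheme" and gR :: "int \<Rightarrow> 'a set"
    and M :: "('a, 'b, 's) module_scheme" and gM :: "int \<Rightarrow> 'b set"
    and F :: "nat \<Rightarrow> ('a, 'f, 'u) module_scheme" and gF :: "nat \<Rightarrow> int \<Rightarrow> 'f set"
    and d :: "nat \<Rightarrow> 'f \<Rightarrow> 'f" and \<epsilon> :: "'f \<Rightarrow> 'b"
  assumes free: "\<And>i. finite_free_graded_module R gR (F i) (gF i)"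
    and d_hom: "\<And>i. d i \<in> graded_hom0 R (F (Suc i)) (gF (Suc i)) (F i) (gF i)"
    and \<epsilon>_hom: "\<epsilon> \<in> graded_hom0 R (F 0) (gF 0) M gM"
    and exact: "\<And>i. d (Suc i) ` carrier (F (Suc (Suc i))) =
                      {x \<in> carrier (F (Suc i)). d i x = \<zero>\<^bsub>F i\<^esub>}"
    and exact_0: "d 0 ` carrier (F (Suc 0)) = {x \<in> carrier (F 0). \<epsilon> x = \<zero>\<^bsub>M\<^esub>}"
    and surj: "\<epsilon> ` carrier (F 0) = carrier M"

text \<open>Cocycles and coboundaries of the complex \<open>Hom (F i) N\<close>.\<close>

definition cocycles ::
  "('a, 'r) ring_scheme \<Rightarrow> (nat \<Rightarrow> ('a, 'f, 'u) module_scheme) \<Rightarrow> (nat \<Rightarrow> 'f \<Rightarrow> 'f) \<Rightarrow>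
   ('a, 'c, 't) module_scheme \<Rightarrow> nat \<Rightarrow> ('f \<Rightarrow> 'c) set" where
  "cocycles R F d N i =
     {f \<in> carrier (hom_module R (F i) N).
        compose (carrier (F (Suc i))) f (d i) = \<zero>\<^bsub>hom_module R (F (Suc i)) N\<^esub>}"

fun coboundaries ::
  "('a, 'r) ring_scheme \<Rightarrow> (nat \<Rightarrow> ('a, 'f, 'u) module_scheme) \<Rightarrow> (nat \<Rightarrow> 'f \<Rightarrow> 'f) \<Rightarrow>
   ('a, 'c, 't) module_scheme \<Rightarrow> nat \<Rightarrow> ('f \<Rightarrow> 'c) set" where
  "coboundaries R F d N 0 = {\<zero>\<^bsub>hom_module R (F 0) N\<^esub>}"
| "coboundaries R F d N (Suc i) =
     (\<lambda>g. compose (carrier (F (Suc i))) g (d i)) ` carrier (hom_module R (F i) N)"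

definition Ext_module ::
  "('a, 'r) ring_scheme \<Rightarrow> (nat \<Rightarrow> ('a, 'f, 'u) module_scheme) \<Rightarrow> (nat \<Rightarrow> 'f \<Rightarrow> 'f) \<Rightarrow>
   ('a, 'c, 't) module_scheme \<Rightarrow> nat \<Rightarrow> ('a, ('f \<Rightarrow> 'c) set) module" where
  "Ext_module R F d N i =
     quotient_module ((hom_module R (F i) N)\<lparr>carrier := cocycles R F d N i\<rparr>)
       (coboundaries R F d N i)"

definition Ext_grading ::
  "('a, 'r) ring_scheme \<Rightarrow> (nat \<Rightarrow> ('a, 'f, 'u) module_scheme) \<Rightarrow> (nat \<Rightarrow> int \<Rightarrow> 'f set) \<Rightarrow>
   (nat \<Rightarrow> 'f \<Rightarrow> 'f) \<Rightarrow> ('a, 'c, 't) module_scheme \<Rightarrow> (int \<Rightarrow> 'c set) \<Rightarrow> nat \<Rightarrow> int \<Rightarrow>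
   ('f \<Rightarrow> 'c) set set" where
  "Ext_grading R F gF d N gN i n =
     (\<lambda>f. coboundaries R F d N i +>\<^bsub>hom_module R (F i) N\<^esub> f) `
       (cocycles R F d N i \<inter> hom_grading R (F i) (gF i) N gN n)"

section \<open>Hilbert series as rational functions\<close>

text \<open>
  The field of rational functions in \<open>t\<close> over the rationals is \<open>rat poly fract\<close>. The Laurent
  expansion around \<open>0\<close> of a rational function:
\<close>

definition laurent_expansion :: "rat poly fract \<Rightarrow> rat fls" where
  "laurent_expansion h =
     (case quot_of_fract h of (p, q) \<Rightarrow> fps_to_fls (fps_of_poly p) / fps_to_fls (fps_of_poly q))"

definition poly_at_inverse_t :: "rat poly \<Rightarrow> rat poly fract" where
  "poly_at_inverse_t p =
     poly (map_poly (\<lambda>c. to_fract [:c:]) p) (inverse (to_fract [:0, 1:]))"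

text \<open>The rational function \<open>h(1/t)\<close>.\<close>

definition subst_inverse_t :: "rat poly fract \<Rightarrow> rat poly fract" where
  "subst_inverse_t h =
     (case quot_of_fract h of (p, q) \<Rightarrow> poly_at_inverse_t p / poly_at_inverse_t q)"

text \<open>
  For a graded module \<open>M\<close> over \<open>R\<close>, each \<open>gM n\<close> is a vector space over \<open>gR 0\<close>, which
  is a field wherever the following definition is used.
\<close>

definition hilbert_function ::
  "('a, 'r) ring_scheme \<Rightarrow> (int \<Rightarrow> 'a set) \<Rightarrow> ('a, 'b, 's) module_scheme \<Rightarrow> (int \<Rightarrow> 'b set) \<Rightarrow>
   int \<Rightarrow> nat" where
  "hilbert_function R gR M gM n =
     vectorspace.dim (R\<lparr>carrier := gR 0\<rparr>) (M\<lparr>carrier := gM n\<rparr>)"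

definition hilbert_series ::
  "('a, 'r) ring_scheme \<Rightarrow> (int \<Rightarrow> 'a set) \<Rightarrow> ('a, 'b, 's) module_scheme \<Rightarrow> (int \<Rightarrow> 'b set) \<Rightarrow>
   rat poly fract" where
  "hilbert_series R gR M gM =
     (THE h. \<forall>n. fls_nth (laurent_expansion h) n = of_nat (hilbert_function R gR M gM n))"

end

theory Submission
  imports Defs "Jordan_Normal_Form.DL_Rank"
begin

text \<open>
  Let \<open>x\<^sub>1, \<dots>, x\<^sub>e\<close> generate \<open>R\<close> in positive degrees. Choose a resolution \<open>G\<close> of \<open>M\<close> by finite free graded
  modules whose \<open>i\<close>-th module is generated in degrees at least \<open>s + i\<close>; comparison with the given resolution
  shows that \<open>G\<close> computes the same graded modules \<open>Ext\<close>. Truncating the Euler characteristics at \<open>m\<close>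
  gives \<open>H_M(t) = P_m(t) H_R(t) + E_m(t)\<close> and
  \<open>\<Sum>(-1)\<^sup>i H_Ext\<^sup>i(t) = P_m(1/t) H_N(t) + Z_m(t)\<close>, where \<open>P_m\<close> is a Laurent polynomial,
  \<open>E_m\<close> is up to sign the Hilbert series of the \<open>m\<close>-th syzygy module, which starts in degree at least
  \<open>s + m\<close>, and \<open>Z_m\<close> is up to sign the Hilbert series of the \<open>m\<close>-cocycles of \<open>Hom(G, N)\<close>.

  The complex \<open>Hom(G, N)\<close> is exact in large cohomological degrees. There the Koszul complex of the cocycles is exact
  in internal degrees above \<open>c - s - m\<close>, by dimension shifting from the same property of the modules
  \<open>Hom(G\<^sub>i, N)\<close>, so that the Laurent polynomial \<open>\<Prod>(1 - t^d\<^sub>k) Z_m(t)\<close>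
  has degree at most \<open>c - s - m\<close>. After substituting \<open>1/t\<close> in the second equation, both errors vanish
  to arbitrarily high order, and eliminating \<open>P_m\<close> leaves the claimed identity.

  Graded submodules are represented throughout by their families of homogeneous pieces inside an ambient module.
\<close>

section \<open>Laurent expansions of rational functions\<close>

text \<open>The obstacle is that the resolution may be infinite: the polynomials P_m do not
  stabilize, and P_m(1/t) H_N(t) drifts towards ever lower degrees, so no limit can be taken in the
  equation for Ext as a series in t. The remedy is to clear the denominator, the product of the 1 -
  t^(d_k): numerators are Laurent polynomials, in which 1/t may be substituted coefficientwise. For
  the cocycles one needs a bound on the top degree of a numerator that decreases with m; finite
  generation of each single module gives some bound, without control as m grows. Koszul complexes
  give that control, because their Euler characteristic is the coefficient of the numerator and
  exactness in a given degree passes along short exact sequences. They also yield the rationality of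
  the Hilbert series. The finiteness of submodules behind this comes from a Hilbert basis argument
  in the modules themselves, without presenting R over a polynomial ring. Minimality of the
  resolution is replaced by a dimension count in the lowest degree.\<close>

definition poly_fls :: "rat poly \<Rightarrow> rat fls" where
  "poly_fls p = fps_to_fls (fps_of_poly p)"

lemma poly_fls_hom:
  "poly_fls (p + q) = poly_fls p + poly_fls q" "poly_fls (p * q) = poly_fls p * poly_fls q"
  "poly_fls (- p) = - poly_fls p" "poly_fls 0 = 0" "poly_fls 1 = 1"
  by (simp_all add: poly_fls_def fps_of_poly_add fps_of_poly_mult fps_of_poly_uminus
      fls_times_fps_to_fls flip: fps_to_fls_plus)

lemma poly_fls_eq_0_iff [simp]: "poly_fls p = 0 \<longleftrightarrow> p = 0"
  by (simp add: poly_fls_def fps_of_poly_eq_iff[of p 0, simplified])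

text \<open>\<open>quot_of_fract\<close> picks a normalized numerator and denominator.
  Cross-multiplication shows that every other representation has the same expansion, so the ring
  laws below can be checked on arbitrary representatives.\<close>

lemma laurent_expansion_quotient:
  assumes "q \<noteq> 0"
  shows "laurent_expansion (to_fract p / to_fract q) = poly_fls p / poly_fls q"
proof -
  obtain a b where ab: "quot_of_fract (to_fract p / to_fract q) = (a, b)" by fastforce
  have "b \<noteq> 0" using snd_quot_of_fract_nonzero[of "to_fract p / to_fract q"] ab by simp
  have "to_fract p / to_fract q = to_fract a / to_fract b"
    using Fract_quot_of_fract[of "to_fract p / to_fract q"] ab by (simp add: Fract_conv_to_fract)
  hence "to_fract (p * b) = to_fract (a * q)"
    using assms \<open>b \<noteq> 0\<close> by (simp add: frac_eq_eq)
  hence "p * b = a * q" by (simp only: to_fract_eq_iff)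
  hence "poly_fls p * poly_fls b = poly_fls a * poly_fls q" by (metis poly_fls_hom(2))
  thus ?thesis using assms \<open>b \<noteq> 0\<close>
    by (simp add: laurent_expansion_def ab frac_eq_eq flip: poly_fls_def)
qed

lemma fract_cases:
  obtains p q :: "rat poly" where "q \<noteq> 0" "h = to_fract p / to_fract q"
  using Fract_quot_of_fract[of h] snd_quot_of_fract_nonzero[of h]
  by (metis Fract_conv_to_fract)

lemma laurent_expansion_to_fract: "laurent_expansion (to_fract p) = poly_fls p"
  using laurent_expansion_quotient[of 1 p] by (simp add: poly_fls_hom)

lemma laurent_expansion_add: "laurent_expansion (x + y) = laurent_expansion x + laurent_expansion y"
proof -
  obtain a b where x: "b \<noteq> 0" "x = to_fract a / to_fract b" by (rule fract_cases)
  obtain c d where y: "d \<noteq> 0" "y = to_fract c / to_fract d" by (rule fract_cases)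
  have xy: "x + y = to_fract (a * d + c * b) / to_fract (b * d)"
    using x y by (simp add: field_simps)
  have nz: "b * d \<noteq> 0" using x y by simp
  have e: "laurent_expansion (x + y) = poly_fls (a * d + c * b) / poly_fls (b * d)"
    unfolding xy by (rule laurent_expansion_quotient[OF nz])
  show ?thesis
    unfolding e unfolding x(2) y(2) laurent_expansion_quotient[OF x(1)] laurent_expansion_quotient[OF y(1)]
    using x(1) y(1) by (simp add: poly_fls_hom field_simps)
qed

lemma laurent_expansion_mult: "laurent_expansion (x * y) = laurent_expansion x * laurent_expansion y"
proof -
  obtain a b where x: "b \<noteq> 0" "x = to_fract a / to_fract b" by (rule fract_cases)
  obtain c d where y: "d \<noteq> 0" "y = to_fract c / to_fract d" by (rule fract_cases)
  have xy: "x * y = to_fract (a * c) / to_fract (b * d)"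
    using x y by (simp add: field_simps)
  have nz: "b * d \<noteq> 0" using x y by simp
  have e: "laurent_expansion (x * y) = poly_fls (a * c) / poly_fls (b * d)"
    unfolding xy by (rule laurent_expansion_quotient[OF nz])
  show ?thesis
    unfolding e unfolding x(2) y(2) laurent_expansion_quotient[OF x(1)] laurent_expansion_quotient[OF y(1)]
    using x(1) y(1) by (simp add: poly_fls_hom field_simps)
qed

lemma laurent_expansion_0: "laurent_expansion 0 = 0"
  using laurent_expansion_to_fract[of 0] by (simp add: poly_fls_hom)

lemma laurent_expansion_1: "laurent_expansion 1 = 1"
  using laurent_expansion_to_fract[of 1] by (simp add: poly_fls_hom)

lemma laurent_expansion_uminus: "laurent_expansion (- x) = - laurent_expansion x"
  using laurent_expansion_add[of x "- x"] by (simp add: laurent_expansion_0 eq_neg_iff_add_eq_0 add.commute)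

lemma laurent_expansion_eq_0_iff: "laurent_expansion x = 0 \<longleftrightarrow> x = 0"
proof -
  obtain a b where x: "b \<noteq> 0" "x = to_fract a / to_fract b" by (rule fract_cases)
  thus ?thesis by (simp add: laurent_expansion_quotient)
qed

text \<open>The expansion is additive with trivial kernel. Injectivity makes the rational function
  described in \<open>hilbert_series\<close> unique, and it allows identities of rational functions
  to be checked on coefficients.\<close>

lemma laurent_expansion_inj: "laurent_expansion x = laurent_expansion y \<Longrightarrow> x = y"
  using laurent_expansion_eq_0_iff[of "x + - y"] laurent_expansion_add[of x "- y"]
  by (simp add: laurent_expansion_uminus)

lemma laurent_expansion_sum: "laurent_expansion (sum f A) = (\<Sum>x\<in>A. laurent_expansion (f x))"
  by (induction A rule: infinite_finite_induct)
    (simp_all add: laurent_expansion_0 laurent_expansion_add)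

lemma laurent_expansion_power: "laurent_expansion (x ^ n) = laurent_expansion x ^ n"
  by (induction n) (simp_all add: laurent_expansion_1 laurent_expansion_mult)

lemma laurent_expansion_inverse: "laurent_expansion (inverse x) = inverse (laurent_expansion x)"
proof (cases "x = 0")
  case False
  hence "laurent_expansion x * laurent_expansion (inverse x) = 1"
    by (simp add: laurent_expansion_1 flip: laurent_expansion_mult)
  thus ?thesis by (metis inverse_unique)
qed (simp add: laurent_expansion_0)

definition fract_t :: "rat poly fract" where "fract_t = to_fract [:0, 1:]"

lemma fract_t_nonzero [simp]: "fract_t \<noteq> 0" by (simp add: fract_t_def)

lemma fls_X_powi: "(fls_X :: rat fls) powi n = fls_X_intpow n"
proof (cases "n \<ge> 0")
  case True
  thus ?thesis by (simp add: power_int_def fls_X_power_conv_shift_1)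
next
  case False
  hence "(fls_X :: rat fls) powi n = inverse fls_X ^ nat (- n)" by (simp add: power_int_def)
  also have "\<dots> = fls_X_intpow n"
    using False by (simp add: fls_inverse_X fls_X_inv_power_conv_shift_1)
  finally show ?thesis .
qed

lemma laurent_expansion_t: "laurent_expansion fract_t = fls_X"
  by (simp add: fract_t_def laurent_expansion_to_fract poly_fls_def)

lemma laurent_expansion_powi: "laurent_expansion (x powi n) = laurent_expansion x powi n"
  by (simp add: power_int_def laurent_expansion_power laurent_expansion_inverse)

lemma laurent_expansion_t_powi: "laurent_expansion (fract_t powi n) = fls_X_intpow n"
  by (simp add: laurent_expansion_powi laurent_expansion_t fls_X_powi)

definition fract_const :: "rat \<Rightarrow> rat poly fract" where "fract_const c = to_fract [:c:]"

lemma laurent_expansion_const: "laurent_expansion (fract_const c) = fls_const c"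
  by (simp add: fract_const_def laurent_expansion_to_fract poly_fls_def fps_of_poly_const
      fps_const_to_fls)

lemma fract_const_hom [simp]:
  "fract_const 0 = 0" "fract_const 1 = 1"
  "fract_const (a + b) = fract_const a + fract_const b"
  "fract_const (a * b) = fract_const a * fract_const b"
  by (simp_all add: fract_const_def flip: to_fract_add to_fract_mult one_pCons)

section \<open>Substitution of 1/t\<close>

lemma poly_at_inverse_t_pCons:
  "poly_at_inverse_t (pCons a p) = fract_const a + inverse fract_t * poly_at_inverse_t p"
  by (simp add: poly_at_inverse_t_def map_poly_pCons fract_const_def fract_t_def)

lemma poly_at_inverse_t_0 [simp]: "poly_at_inverse_t 0 = 0"
  by (simp add: poly_at_inverse_t_def)

lemma poly_at_inverse_t_add: "poly_at_inverse_t (p + q) = poly_at_inverse_t p + poly_at_inverse_t q"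
  by (induction p q rule: poly_induct2) (simp_all add: poly_at_inverse_t_pCons algebra_simps)

lemma poly_at_inverse_t_smult: "poly_at_inverse_t (smult c p) = fract_const c * poly_at_inverse_t p"
  by (induction p) (simp_all add: poly_at_inverse_t_pCons algebra_simps)

lemma poly_at_inverse_t_mult: "poly_at_inverse_t (p * q) = poly_at_inverse_t p * poly_at_inverse_t q"
  by (induction p) (simp_all add: poly_at_inverse_t_pCons poly_at_inverse_t_add
      poly_at_inverse_t_smult algebra_simps)

text \<open>A polynomial in 1/t is its own expansion: \<open>coeff p k\<close> sits at the exponent
  -k. The use is the next lemma, by which denominators stay nonzero under the substitution.\<close>

lemma laurent_expansion_poly_at_inverse_t:
  "fls_nth (laurent_expansion (poly_at_inverse_t p)) n = (if n \<le> 0 then coeff p (nat (- n)) else 0)"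
proof (induction p arbitrary: n)
  case 0
  thus ?case by (simp add: laurent_expansion_0)
next
  case (pCons a p)
  have "laurent_expansion (inverse fract_t) = fls_X_intpow (- 1)"
    using laurent_expansion_t_powi[of "- 1"] by simp
  hence "fls_nth (laurent_expansion (poly_at_inverse_t (pCons a p))) n =
      (if n = 0 then a else 0) + fls_nth (laurent_expansion (poly_at_inverse_t p)) (n + 1)"
    by (simp add: poly_at_inverse_t_pCons laurent_expansion_add laurent_expansion_const
        laurent_expansion_mult fls_X_intpow_times_conv_shift(1)[of "- 1", simplified])
  also have "\<dots> = (if n \<le> 0 then coeff (pCons a p) (nat (- n)) else 0)"
  proof (cases "n < 0")
    case True
    hence "nat (- n) = Suc (nat (- (n + 1)))" by linarith
    thus ?thesis using True by (simp only: pCons.IH) simp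
  qed (auto simp: pCons.IH)
  finally show ?case .
qed

lemma poly_at_inverse_t_eq_0_iff: "poly_at_inverse_t p = 0 \<longleftrightarrow> p = 0"
proof
  assume 0: "poly_at_inverse_t p = 0"
  have "coeff p n = 0" for n
    using laurent_expansion_poly_at_inverse_t[of p "- int n"] by (simp add: 0 laurent_expansion_0)
  thus "p = 0" by (simp add: poly_eq_iff)
qed simp

lemma subst_inverse_t_quotient:
  assumes "q \<noteq> 0"
  shows "subst_inverse_t (to_fract p / to_fract q) = poly_at_inverse_t p / poly_at_inverse_t q"
proof -
  obtain a b where ab: "quot_of_fract (to_fract p / to_fract q) = (a, b)" by fastforce
  have "b \<noteq> 0" using snd_quot_of_fract_nonzero[of "to_fract p / to_fract q"] ab by simp
  have "to_fract p / to_fract q = to_fract a / to_fract b"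
    using Fract_quot_of_fract[of "to_fract p / to_fract q"] ab by (simp add: Fract_conv_to_fract)
  hence "to_fract (p * b) = to_fract (a * q)"
    using assms \<open>b \<noteq> 0\<close> by (simp add: frac_eq_eq)
  hence "p * b = a * q" by (simp only: to_fract_eq_iff)
  hence "poly_at_inverse_t p * poly_at_inverse_t b = poly_at_inverse_t a * poly_at_inverse_t q"
    by (metis poly_at_inverse_t_mult)
  thus ?thesis using assms \<open>b \<noteq> 0\<close>
    by (simp add: subst_inverse_t_def ab frac_eq_eq poly_at_inverse_t_eq_0_iff)
qed

lemma subst_inverse_t_to_fract: "subst_inverse_t (to_fract p) = poly_at_inverse_t p"
  using subst_inverse_t_quotient[of 1 p] poly_at_inverse_t_pCons[of 1 0]
  by (simp flip: one_pCons)

lemma subst_inverse_t_add: "subst_inverse_t (x + y) = subst_inverse_t x + subst_inverse_t y"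
proof -
  obtain a b where x: "b \<noteq> 0" "x = to_fract a / to_fract b" by (rule fract_cases)
  obtain c d where y: "d \<noteq> 0" "y = to_fract c / to_fract d" by (rule fract_cases)
  have xy: "x + y = to_fract (a * d + c * b) / to_fract (b * d)"
    using x y by (simp add: field_simps)
  have nz: "b * d \<noteq> 0" using x y by simp
  have e: "subst_inverse_t (x + y) = poly_at_inverse_t (a * d + c * b) / poly_at_inverse_t (b * d)"
    unfolding xy by (rule subst_inverse_t_quotient[OF nz])
  show ?thesis
    unfolding e unfolding x(2) y(2) subst_inverse_t_quotient[OF x(1)] subst_inverse_t_quotient[OF y(1)]
    using x(1) y(1) by (simp add: poly_at_inverse_t_add poly_at_inverse_t_mult poly_at_inverse_t_eq_0_iff field_simps)
qed

lemma subst_inverse_t_mult: "subst_inverse_t (x * y) = subst_inverse_t x * subst_inverse_t y"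
proof -
  obtain a b where x: "b \<noteq> 0" "x = to_fract a / to_fract b" by (rule fract_cases)
  obtain c d where y: "d \<noteq> 0" "y = to_fract c / to_fract d" by (rule fract_cases)
  have xy: "x * y = to_fract (a * c) / to_fract (b * d)"
    using x y by (simp add: field_simps)
  have nz: "b * d \<noteq> 0" using x y by simp
  have e: "subst_inverse_t (x * y) = poly_at_inverse_t (a * c) / poly_at_inverse_t (b * d)"
    unfolding xy by (rule subst_inverse_t_quotient[OF nz])
  show ?thesis
    unfolding e unfolding x(2) y(2) subst_inverse_t_quotient[OF x(1)] subst_inverse_t_quotient[OF y(1)]
    using x(1) y(1) by (simp add: poly_at_inverse_t_add poly_at_inverse_t_mult poly_at_inverse_t_eq_0_iff field_simps)
qed

lemma subst_inverse_t_eq_0_iff: "subst_inverse_t x = 0 \<longleftrightarrow> x = 0"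
proof -
  obtain a b where x: "b \<noteq> 0" "x = to_fract a / to_fract b" by (rule fract_cases)
  thus ?thesis by (simp add: subst_inverse_t_quotient poly_at_inverse_t_eq_0_iff)
qed

lemma subst_inverse_t_0 [simp]: "subst_inverse_t 0 = 0"
  by (simp add: subst_inverse_t_eq_0_iff)

lemma subst_inverse_t_const [simp]: "subst_inverse_t (fract_const c) = fract_const c"
  by (simp add: fract_const_def subst_inverse_t_to_fract poly_at_inverse_t_pCons)

lemma subst_inverse_t_t: "subst_inverse_t fract_t = inverse fract_t"
  by (simp add: fract_t_def subst_inverse_t_to_fract)
    (simp add: poly_at_inverse_t_pCons fract_t_def)

lemma subst_inverse_t_1 [simp]: "subst_inverse_t 1 = 1"
  using subst_inverse_t_const[of 1] by simp

lemma subst_inverse_t_inverse: "subst_inverse_t (inverse x) = inverse (subst_inverse_t x)"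
proof (cases "x = 0")
  case False
  hence "subst_inverse_t x * subst_inverse_t (inverse x) = 1"
    by (simp flip: subst_inverse_t_mult)
  thus ?thesis by (metis inverse_unique)
qed simp

lemma subst_inverse_t_power: "subst_inverse_t (x ^ n) = subst_inverse_t x ^ n"
  by (induction n) (simp_all add: subst_inverse_t_mult)

lemma subst_inverse_t_powi: "subst_inverse_t (fract_t powi n) = fract_t powi (- n)"
  by (simp add: power_int_def subst_inverse_t_power subst_inverse_t_inverse subst_inverse_t_t)

lemma subst_inverse_t_sum: "subst_inverse_t (sum f A) = (\<Sum>x\<in>A. subst_inverse_t (f x))"
  by (induction A rule: infinite_finite_induct) (simp_all add: subst_inverse_t_add)

text \<open>For infinite support the sum is 0 by convention, so that the substitution rule below
  holds for every coefficient function; reading off coefficients requires finite support.\<close>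

definition laurent_poly :: "(int \<Rightarrow> rat) \<Rightarrow> rat poly fract" where
  "laurent_poly f = (\<Sum>n | f n \<noteq> 0. fract_const (f n) * fract_t powi n)"

lemma subst_inverse_t_laurent_poly:
  "subst_inverse_t (laurent_poly f) = laurent_poly (\<lambda>n. f (- n))"
proof -
  have "bij_betw uminus {n. f (- n) \<noteq> 0} {n. f n \<noteq> 0}"
    by (rule bij_betwI[where g = uminus]) auto
  from sum.reindex_bij_betw[OF this, of "\<lambda>n. fract_const (f n) * fract_t powi (- n)"]
  show ?thesis
    by (simp add: laurent_poly_def subst_inverse_t_sum subst_inverse_t_mult subst_inverse_t_powi)
qed

lemma fls_nth_sum: "fls_nth (sum f A) n = (\<Sum>x\<in>A. fls_nth (f x) n)"
  by (induction A rule: infinite_finite_induct) auto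

lemma laurent_expansion_laurent_poly:
  assumes "finite {n. f n \<noteq> 0}"
  shows "fls_nth (laurent_expansion (laurent_poly f)) n = f n"
proof -
  have "fls_nth (laurent_expansion (laurent_poly f)) n =
      (\<Sum>k | f k \<noteq> 0. f k * (if n = k then 1 else 0))"
    by (simp add: laurent_poly_def laurent_expansion_sum laurent_expansion_mult fls_nth_sum
        laurent_expansion_const laurent_expansion_t_powi)
  also have "\<dots> = f n"
    using assms by (cases "f n = 0") (simp_all add: sum.delta if_distrib cong: if_cong)
  finally show ?thesis .
qed

section \<open>Rationality with a fixed denominator\<close>

definition bounded_below :: "(int \<Rightarrow> rat) \<Rightarrow> bool" where
  "bounded_below h \<longleftrightarrow> (\<exists>b. \<forall>n<b. h n = 0)"

lemma fls_nth_Abs_fls: "bounded_below h \<Longrightarrow> fls_nth (Abs_fls h) n = h n"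
  unfolding bounded_below_def by (rule nth_Abs_fls_ex_lower_bound)

lemma fls_mult_vanish_below:
  fixes F G :: "rat fls"
  assumes "\<forall>n<a. fls_nth F n = 0" "\<forall>n<b. fls_nth G n = 0" "n < a + b"
  shows "fls_nth (F * G) n = 0"
proof (cases "F = 0 \<or> G = 0")
  case False
  hence "a \<le> fls_subdegree F" "b \<le> fls_subdegree G"
    using assms by (auto intro!: fls_subdegree_geI)
  thus ?thesis using assms(3) by (intro fls_times_nth_eq0) linarith
qed auto

text \<open>Multiplication by the Laurent polynomial \<open>denom\<close> acts on coefficients as
  the operator \<open>\<phi>\<close>. The denominator of the Hilbert series is kept in this expanded
  form because the Euler characteristic of the Koszul complex produces it so: \<open>s\<close> will
  run over the sets of generators, with \<open>\<tau> s\<close> the sum of their degrees.\<close>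

locale difference_operator =
  fixes I :: "'i set" and sg :: "'i \<Rightarrow> rat" and \<tau> :: "'i \<Rightarrow> int"
  assumes finI: "finite I"
    and denom_nonzero: "(\<Sum>s\<in>I. fract_const (sg s) * fract_t powi \<tau> s) \<noteq> 0"
begin

definition denom :: "rat poly fract" where
  "denom = (\<Sum>s\<in>I. fract_const (sg s) * fract_t powi \<tau> s)"

definition \<phi> :: "(int \<Rightarrow> rat) \<Rightarrow> int \<Rightarrow> rat" where
  "\<phi> h a = (\<Sum>s\<in>I. sg s * h (a - \<tau> s))"

lemma fls_const_powi_nth:
  "fls_nth (fls_const c * (fls_X_intpow k * F)) n = c * fls_nth (F :: rat fls) (n - k)"
  by (simp add: fls_X_intpow_times_conv_shift(1))

lemma laurent_expansion_denom:
  "fls_nth (laurent_expansion denom * F) n = (\<Sum>s\<in>I. sg s * fls_nth F (n - \<tau> s))"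
  by (simp only: denom_def laurent_expansion_sum sum_distrib_right fls_nth_sum
      laurent_expansion_mult laurent_expansion_const laurent_expansion_t_powi mult.assoc
      fls_const_powi_nth)

text \<open>The expansion of \<open>denom\<close> is nonzero and may be cancelled. Finiteness of
  \<open>\<phi> h\<close> says that \<open>denom\<close> times the series of \<open>h\<close> is a
  Laurent polynomial, and injectivity of the expansion returns from series to rational
  functions.\<close>

lemma rational_iff:
  assumes "bounded_below h" "finite {a. \<phi> h a \<noteq> 0}"
  shows "(\<forall>n. fls_nth (laurent_expansion H) n = h n) \<longleftrightarrow> denom * H = laurent_poly (\<phi> h)"
proof -
  have 1: "laurent_expansion (laurent_poly (\<phi> h)) = laurent_expansion denom * Abs_fls h"
    using assms by (intro fls_eqI)
      (simp add: laurent_expansion_laurent_poly laurent_expansion_denom fls_nth_Abs_fls \<phi>_def)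
  have "laurent_expansion denom \<noteq> 0"
    using denom_nonzero by (simp add: denom_def laurent_expansion_eq_0_iff)
  hence "denom * H = laurent_poly (\<phi> h) \<longleftrightarrow> laurent_expansion H = Abs_fls h"
    by (metis 1 laurent_expansion_inj laurent_expansion_mult mult_left_cancel)
  thus ?thesis
    using assms(1) by (auto simp: fls_nth_Abs_fls intro!: fls_eqI)
qed

text \<open>The description used in \<open>hilbert_series\<close>, detached from modules: on the Ext
  side the coefficients are differences of dimensions and alternating sums of these.\<close>

definition rational_series :: "(int \<Rightarrow> rat) \<Rightarrow> rat poly fract" where
  "rational_series h = (THE H. \<forall>n. fls_nth (laurent_expansion H) n = h n)"

lemma rational_series:
  assumes "bounded_below h" "finite {a. \<phi> h a \<noteq> 0}"
  shows "fls_nth (laurent_expansion (rational_series h)) n = h n"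
    and "denom * rational_series h = laurent_poly (\<phi> h)"
proof -
  have "denom \<noteq> 0" using denom_nonzero by (simp add: denom_def)
  hence "\<exists>!H. denom * H = laurent_poly (\<phi> h)"
    by (intro ex1I[of _ "laurent_poly (\<phi> h) / denom"]) (auto simp: field_simps)
  hence "\<exists>!H. \<forall>n. fls_nth (laurent_expansion H) n = h n"
    by (simp only: rational_iff[OF assms])
  from theI'[OF this, folded rational_series_def]
  have *: "\<forall>n. fls_nth (laurent_expansion (rational_series h)) n = h n" .
  thus "fls_nth (laurent_expansion (rational_series h)) n = h n" by simp
  from * show "denom * rational_series h = laurent_poly (\<phi> h)"
    by (simp only: rational_iff[OF assms])
qed

lemma \<phi>_add: "\<phi> (\<lambda>a. f a + g a) a = \<phi> f a + \<phi> g a"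
  by (simp add: \<phi>_def sum.distrib algebra_simps)

text \<open>\<open>\<phi>\<close> commutes with shifts, so an approximation of a coefficient
  function by shifts of another one passes to the numerators.\<close>

lemma \<phi>_sum_shift: "\<phi> (\<lambda>a. \<Sum>j\<in>J. s j * f (a + \<delta> j)) a = (\<Sum>j\<in>J. s j * \<phi> f (a + \<delta> j))"
  unfolding \<phi>_def sum_distrib_left by (subst sum.swap) (simp add: algebra_simps)

text \<open>
  Both sides of the claimed equation are approximated by the same Laurent polynomial, with errors
  that vanish to arbitrarily high order as power series in \<open>1/t\<close>.
\<close>

lemma approximation_identity:
  assumes M: "bounded_below hM" "finite {a. \<phi> hM a \<noteq> 0}"
    and N: "bounded_below hN" "finite {a. \<phi> hN a \<noteq> 0}"
    and R: "bounded_below hR" "finite {a. \<phi> hR a \<noteq> 0}"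
    and X: "bounded_below hX" "finite {a. \<phi> hX a \<noteq> 0}"
    and approx: "\<And>k. \<exists>(J::(nat \<times> int \<times> nat) set) s \<delta> E Z. finite J \<and>
      (\<forall>a. hM a = (\<Sum>j\<in>J. s j * hR (a - \<delta> j)) + E a) \<and> (\<forall>a<k. E a = 0) \<and>
      (\<forall>a. hX a = (\<Sum>j\<in>J. s j * hN (a + \<delta> j)) + Z a) \<and> (\<forall>a>-k. \<phi> Z a = 0)"
  shows "rational_series hX * subst_inverse_t (rational_series hR) =
    subst_inverse_t (rational_series hM) * rational_series hN"
proof -
  have fin_rev: "finite {n. f (- n) \<noteq> 0}" if "finite {n. f n \<noteq> 0}" for f :: "int \<Rightarrow> rat"
    using finite_vimageI[OF that, of uminus] by (simp add: inj_def vimage_def)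
  \<comment> \<open>\<open>n'\<close> and \<open>x'\<close> are the numerators belonging to
    \<open>hN\<close> and \<open>hX\<close> with 1/t substituted, while \<open>m'\<close> and
    \<open>r'\<close> remain full series in t. Exponents are reversed only for the finite functions
    \<open>\<phi> hN\<close> and \<open>\<phi> hX\<close>; \<open>hN\<close> and \<open>hX\<close>
    themselves may be unbounded above.\<close>
  define n' where "n' = laurent_expansion (laurent_poly (\<lambda>n. \<phi> hN (- n)))"
  define x' where "x' = laurent_expansion (laurent_poly (\<lambda>n. \<phi> hX (- n)))"
  define m' where "m' = laurent_expansion (rational_series hM)"
  define r' where "r' = laurent_expansion (rational_series hR)"
  have nth: "fls_nth n' n = \<phi> hN (- n)" "fls_nth x' n = \<phi> hX (- n)"
      "fls_nth m' n = hM n" "fls_nth r' n = hR n" for n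
    unfolding n'_def x'_def m'_def r'_def using fin_rev[OF N(2)] fin_rev[OF X(2)] M R
    by (simp_all add: laurent_expansion_laurent_poly rational_series)
  obtain bn br where bn: "\<forall>n<bn. fls_nth n' n = 0" and br: "\<forall>n<br. fls_nth r' n = 0"
    by (meson fls_nth_vanishes_belowE)
  have "fls_nth (n' * m' - x' * r') n = 0" for n
  proof -
    \<comment> \<open>Each error starts in degree \<open>k\<close> and gets multiplied by a series
      that starts in degree \<open>bn\<close> or \<open>br\<close>; this \<open>k\<close> puts both
      products above degree \<open>n\<close>.\<close>
    define k where "k = max (n - bn) (n - br) + 1"
    obtain J s \<delta> E Z where J: "finite (J :: (nat \<times> int \<times> nat) set)"
      "\<forall>a. hM a = (\<Sum>j\<in>J. s j * hR (a - \<delta> j)) + E a" "\<forall>a<k. E a = 0"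
      "\<forall>a. hX a = (\<Sum>j\<in>J. s j * hN (a + \<delta> j)) + Z a" "\<forall>a>-k. \<phi> Z a = 0"
      using approx[of k] by blast
    \<comment> \<open>The Laurent polynomial common to both approximations. It depends on
      \<open>k\<close>, hence on \<open>n\<close>.\<close>
    define p where "p = (\<Sum>j\<in>J. fls_const (s j) * fls_X_intpow (\<delta> j))"
    have p: "fls_nth (p * F) n = (\<Sum>j\<in>J. s j * fls_nth F (n - \<delta> j))" for F n
      by (simp only: p_def sum_distrib_right fls_nth_sum mult.assoc fls_const_powi_nth)
    have "\<forall>n<k. fls_nth (m' - p * r') n = 0"
      using J(2,3) by (simp add: p nth)
    moreover have "\<phi> hX a = (\<Sum>j\<in>J. s j * \<phi> hN (a + \<delta> j)) + \<phi> Z a" for a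
    proof -
      have "hX = (\<lambda>a. (\<Sum>j\<in>J. s j * hN (a + \<delta> j)) + Z a)" using J(4) by blast
      thus ?thesis by (simp only: \<phi>_add \<phi>_sum_shift)
    qed
    hence "\<forall>n<k. fls_nth (x' - p * n') n = 0"
      using J(5) by (simp add: p nth)
    moreover have lt: "n < bn + k" "n < k + br" by (simp_all add: k_def)
    ultimately have "fls_nth (n' * (m' - p * r')) n = 0" "fls_nth ((x' - p * n') * r') n = 0"
      using bn br by (blast intro: fls_mult_vanish_below[of bn _ k] fls_mult_vanish_below[of k _ br] lt)+
    \<comment> \<open>The multiples of \<open>p\<close> cancel. Both products that remain have an
      error as a factor, and the left-hand side no longer mentions \<open>p\<close>.\<close>
    moreover have "n' * m' - x' * r' = n' * (m' - p * r') - (x' - p * n') * r'"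
      by (simp add: algebra_simps)
    ultimately show ?thesis by simp
  qed
  hence "n' * m' - x' * r' = 0" by (intro fls_eqI) simp
  hence "n' * m' = x' * r'" by simp
  hence "laurent_poly (\<lambda>n. \<phi> hN (- n)) * rational_series hM =
      laurent_poly (\<lambda>n. \<phi> hX (- n)) * rational_series hR"
    unfolding n'_def x'_def m'_def r'_def
    by (intro laurent_expansion_inj) (simp add: laurent_expansion_mult)
  from arg_cong[OF this, of subst_inverse_t]
  have "laurent_poly (\<phi> hN) * subst_inverse_t (rational_series hM) =
      laurent_poly (\<phi> hX) * subst_inverse_t (rational_series hR)"
    by (simp add: subst_inverse_t_mult subst_inverse_t_laurent_poly)
  hence "denom * (rational_series hN * subst_inverse_t (rational_series hM)) =
      denom * (rational_series hX * subst_inverse_t (rational_series hR))"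
    by (simp add: rational_series(2)[OF N, symmetric] rational_series(2)[OF X, symmetric] mult.assoc)
  thus ?thesis using denom_nonzero by (simp add: denom_def mult.commute)
qed

text \<open>The approximation argument treats the Ext side as one series with alternating
  coefficients, while the claim adds up the rational functions of the single Ext modules; uniqueness
  of expansions reconciles the two.\<close>

lemma rational_series_sum:
  assumes "\<And>i. i \<in> A \<Longrightarrow> bounded_below (h i)" "\<And>i. i \<in> A \<Longrightarrow> finite {a. \<phi> (h i) a \<noteq> 0}"
  assumes "bounded_below hX" "finite {a. \<phi> hX a \<noteq> 0}"
    and "\<And>a. hX a = (\<Sum>i\<in>A. (- 1) ^ i * h i a)"
  shows "rational_series hX = (\<Sum>i\<in>A. (- 1) ^ i * rational_series (h i))"
proof -
  have m1: "laurent_expansion ((- 1) ^ i) = fls_const ((- 1) ^ i)" for i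
    by (cases "even i") (simp_all add: laurent_expansion_uminus laurent_expansion_1)
  show ?thesis
  proof (intro laurent_expansion_inj fls_eqI)
    fix n
    have "fls_nth (laurent_expansion (\<Sum>i\<in>A. (- 1) ^ i * rational_series (h i))) n
        = (\<Sum>i\<in>A. (- 1) ^ i * fls_nth (laurent_expansion (rational_series (h i))) n)"
      by (simp only: laurent_expansion_sum fls_nth_sum laurent_expansion_mult m1 fls_mult_const_nth)
    also have "\<dots> = hX n"
      unfolding assms(5) by (intro sum.cong refl) (simp add: rational_series(1)[OF assms(1,2)])
    also have "\<dots> = fls_nth (laurent_expansion (rational_series hX)) n"
      by (rule rational_series(1)[OF assms(3,4), symmetric])
    finally show "fls_nth (laurent_expansion (rational_series hX)) n =
      fls_nth (laurent_expansion (\<Sum>i\<in>A. (- 1) ^ i * rational_series (h i))) n" by simp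
  qed
qed

end

section \<open>Graded algebras and dimensions over the degree zero field\<close>

text \<open>A set that is independent in \<open>W\<close> is independent in \<open>V\<close>, so
  independent subsets of \<open>W\<close> have bounded size and a maximal one is a basis of
  \<open>W\<close>. If its size is \<open>dim\<close>, it is also a basis of
  \<open>V\<close>.\<close>

lemma (in vectorspace) subspace_finite_dimensional:
  assumes K_fin: "fin_dim" and sub: "subspace K W V"
  shows "vectorspace.fin_dim K (vs W)" "vectorspace.dim K (vs W) \<le> dim"
    "vectorspace.dim K (vs W) = dim \<Longrightarrow> W = carrier V"
proof -
  interpret W: vectorspace K "vs W" by (rule subspace_is_vs[OF sub])
  have subm: "submodule K W V" using sub by (rule is_module)
  have WV: "W \<subseteq> carrier V" using subm by (simp add: submodule_def)
  have li: "lin_indpt A" if "A \<subseteq> W" "W.lin_indpt A" for A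
    using span_li_not_depend(2)[OF that(1) subm] that(2) by simp
  have "\<exists>A. finite A \<and> maximal A (\<lambda>S. S \<subseteq> carrier (vs W) \<and> W.lin_indpt S)"
  proof (rule maximal_exists[where N = dim and B = "{}"])
    show "finite A \<and> card A \<le> dim" if "A \<subseteq> carrier (vs W) \<and> W.lin_indpt A" for A
      using that WV li[of A] K_fin by (auto intro!: li_le_dim)
    show "{} \<subseteq> carrier (vs W) \<and> W.lin_indpt {}"
      by (auto simp: W.lin_dep_def)
  qed
  then obtain A where "finite A" and m: "maximal A (\<lambda>S. S \<subseteq> carrier (vs W) \<and> W.lin_indpt S)"
    by blast
  with W.max_li_is_basis[OF m] have A: "finite A" "W.basis A" by simp_all
  hence AW: "A \<subseteq> W" "W.lin_indpt A" "W.span A = W" by (auto simp: W.basis_def)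
  hence AV: "A \<subseteq> carrier V" "lin_indpt A" using WV li by auto
  show "vectorspace.fin_dim K (vs W)" unfolding W.fin_dim_def using A AW by auto
  have dimW: "W.dim = card A" by (rule W.dim_basis[OF A])
  show "W.dim \<le> dim" unfolding dimW using K_fin AV by (rule li_le_dim)
  assume eq: "W.dim = dim"
  have "basis A" using K_fin A(1) AV dimW eq by (intro dim_li_is_basis) auto
  hence "span A = carrier V" by (simp add: basis_def)
  moreover have "span A = W.span A" using span_li_not_depend(1)[OF AW(1) subm] by simp
  ultimately show "W = carrier V" using AW by simp
qed

lemma additive_subgroup_iff:
  assumes "abelian_group A"
  shows "additive_subgroup V A \<longleftrightarrow> V \<subseteq> carrier A \<and> \<zero>\<^bsub>A\<^esub> \<in> V \<and> (\<forall>u\<in>V. \<forall>v\<in>V. u \<oplus>\<^bsub>A\<^esub> v \<in> V) \<and>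
    (\<forall>v\<in>V. \<ominus>\<^bsub>A\<^esub> v \<in> V)"
proof
  interpret abelian_group A by fact
  show "V \<subseteq> carrier A \<and> \<zero>\<^bsub>A\<^esub> \<in> V \<and> (\<forall>u\<in>V. \<forall>v\<in>V. u \<oplus>\<^bsub>A\<^esub> v \<in> V) \<and> (\<forall>v\<in>V. \<ominus>\<^bsub>A\<^esub> v \<in> V)"
    if "additive_subgroup V A"
    using additive_subgroup.a_subset[OF that] additive_subgroup.a_closed[OF that]
      additive_subgroup.zero_closed[OF that] additive_subgroup.a_inv_closed[OF that] by blast
  show "additive_subgroup V A"
    if "V \<subseteq> carrier A \<and> \<zero>\<^bsub>A\<^esub> \<in> V \<and> (\<forall>u\<in>V. \<forall>v\<in>V. u \<oplus>\<^bsub>A\<^esub> v \<in> V) \<and> (\<forall>v\<in>V. \<ominus>\<^bsub>A\<^esub> v \<in> V)"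
    using that by (auto simp: additive_subgroup_def subgroup_def a_inv_def)
qed

locale graded_algebra = graded_ring R gR for R (structure) and gR +
  assumes neg_degree: "n < 0 \<Longrightarrow> gR n = {\<zero>}"
    and degree_0_subfield: "subfield (gR 0) R"
begin

abbreviation K where "K \<equiv> R\<lparr>carrier := gR 0\<rparr>"

lemma K_field: "field K" using degree_0_subfield by (rule subfield_iff(2))

lemma gR_carrier: "r \<in> gR n \<Longrightarrow> r \<in> carrier R"
  using grading unfolding grading_def by (meson additive_subgroup.a_subset subsetD)

lemma gR_0: "\<zero> \<in> gR n" and gR_add: "r \<in> gR n \<Longrightarrow> s \<in> gR n \<Longrightarrow> r \<oplus> s \<in> gR n"
  and gR_minus: "r \<in> gR n \<Longrightarrow> \<ominus> r \<in> gR n"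
proof -
  have "additive_subgroup (gR n) R" using grading by (simp add: grading_def)
  thus "\<zero> \<in> gR n" "r \<in> gR n \<Longrightarrow> s \<in> gR n \<Longrightarrow> r \<oplus> s \<in> gR n"
    "r \<in> gR n \<Longrightarrow> \<ominus> r \<in> gR n"
    by (simp_all add: additive_subgroup_iff[OF abelian_group_axioms])
qed

lemma gR_1: "\<one> \<in> gR 0" and K_minus_1: "\<ominus> \<one> \<in> gR 0"
  using subringE[OF subfieldE(1)[OF degree_0_subfield]] gR_minus by auto

section \<open>Subspaces over the degree zero field inside modules over R\<close>

definition K_sub :: "('a, 'x, 's) module_scheme \<Rightarrow> 'x set \<Rightarrow> bool" where
  "K_sub A V \<longleftrightarrow> Module.module R A \<and> V \<subseteq> carrier A \<and> \<zero>\<^bsub>A\<^esub> \<in> V \<and>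
    (\<forall>u\<in>V. \<forall>v\<in>V. u \<oplus>\<^bsub>A\<^esub> v \<in> V) \<and> (\<forall>k\<in>gR 0. \<forall>v\<in>V. k \<odot>\<^bsub>A\<^esub> v \<in> V)"

abbreviation res :: "('a, 'x, 's) module_scheme \<Rightarrow> 'x set \<Rightarrow> ('a, 'x, 's) module_scheme" where
  "res A V \<equiv> A\<lparr>carrier := V\<rparr>"

definition K_fin :: "('a, 'x, 's) module_scheme \<Rightarrow> 'x set \<Rightarrow> bool" where
  "K_fin A V \<longleftrightarrow> vectorspace.fin_dim K (res A V)"

definition K_dim :: "('a, 'x, 's) module_scheme \<Rightarrow> 'x set \<Rightarrow> nat" where
  "K_dim A V = vectorspace.dim K (res A V)"

lemma module_K:
  assumes "Module.module R A" shows "Module.module K A"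
proof -
  interpret A: Module.module R A by fact
  show ?thesis
    using K_field gR_carrier
    by (intro moduleI) (auto simp: field_def domain_def A.abelian_group_axioms A.smult_l_distr
        A.smult_r_distr A.smult_assoc1)
qed

lemma vectorspace_K: "Module.module R A \<Longrightarrow> vectorspace K A"
  using module_K[of A] K_field by (simp add: vectorspace_def)

lemma K_sub_subspace:
  assumes "K_sub A V" shows "subspace K V A"
  using assms vectorspace_K[of A] module_K[of A]
  by (auto simp: K_sub_def subspace_def submodule_def)

lemma K_sub_vectorspace: "K_sub A V \<Longrightarrow> vectorspace K (res A V)"
  using K_sub_subspace[of A V] vectorspace.subspace_is_vs[of K A V] vectorspace_K[of A]
  by (simp add: K_sub_def)

text \<open>Negation is the action of the scalar \<open>\<ominus> \<one>\<close>, which lies in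
  \<open>gR 0\<close>.\<close>

lemma K_sub_neg:
  assumes "K_sub A V" "v \<in> V" shows "\<ominus>\<^bsub>A\<^esub> v \<in> V"
proof -
  interpret A: Module.module R A using assms by (simp add: K_sub_def)
  have "\<ominus>\<^bsub>A\<^esub> v = (\<ominus> \<one>) \<odot>\<^bsub>A\<^esub> v"
    using assms by (subst A.smult_l_minus) (auto simp: K_sub_def)
  thus ?thesis using assms K_minus_1 by (auto simp: K_sub_def)
qed

lemma K_sub_sub_vectorspace:
  assumes "K_sub A V" "K_sub A W" "W \<subseteq> V" shows "subspace K W (res A V)"
proof -
  have v: "vectorspace K (res A V)" by (rule K_sub_vectorspace[OF assms(1)])
  hence "Module.module K (res A V)" by (simp add: vectorspace_def)
  with v show ?thesis using assms by (auto simp: K_sub_def subspace_def submodule_def)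
qed

lemma K_fin_subspace:
  assumes "K_sub A V" "K_sub A W" "W \<subseteq> V" "K_fin A V"
  shows "K_fin A W" "K_dim A W \<le> K_dim A V" "K_dim A W = K_dim A V \<Longrightarrow> W = V"
  using vectorspace.subspace_finite_dimensional[OF K_sub_vectorspace[OF assms(1)] _
      K_sub_sub_vectorspace[OF assms(1-3)]] assms(4)
  by (simp_all add: K_fin_def K_dim_def)

text \<open>The target is an arbitrary vector space over \<open>K\<close> because the pieces of Ext
  will be met only as such; for targets inside a module over \<open>R\<close> there is
  \<open>K_dim_ker_im\<close>.\<close>

lemma rank_nullity:
  assumes V: "K_sub A V" "K_fin A V" and W: "vectorspace K W"
    and f: "\<And>v. v \<in> V \<Longrightarrow> f v \<in> carrier W" "f ` V = carrier W"
    and add: "\<And>u v. u \<in> V \<Longrightarrow> v \<in> V \<Longrightarrow> f (u \<oplus>\<^bsub>A\<^esub> v) = f u \<oplus>\<^bsub>W\<^esub> f v"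
    and smult: "\<And>k v. k \<in> gR 0 \<Longrightarrow> v \<in> V \<Longrightarrow> f (k \<odot>\<^bsub>A\<^esub> v) = k \<odot>\<^bsub>W\<^esub> f v"
  shows "vectorspace.fin_dim K W"
    "K_dim A V = vectorspace.dim K W + K_dim A {v \<in> V. f v = \<zero>\<^bsub>W\<^esub>}"
proof -
  have v: "vectorspace K (res A V)" by (rule K_sub_vectorspace[OF V(1)])
  have "mod_hom K (res A V) W f"
    using v W f add smult
    by (auto simp: mod_hom_def mod_hom_axioms_def vectorspace_def module_hom_def)
  then interpret f: linear_map K "res A V" W f
    using v W by (simp add: linear_map_def)
  have im: "f.im = carrier W" using f(2) by (simp add: f.im_def)
  have ker: "f.ker = {v \<in> V. f v = \<zero>\<^bsub>W\<^esub>}" by (simp add: f.ker_def)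
  show "vectorspace.fin_dim K W"
    using V(2) f(2) by (intro f.rank_nullity_main(2)) (simp_all add: K_fin_def)
  show "K_dim A V = vectorspace.dim K W + K_dim A {v \<in> V. f v = \<zero>\<^bsub>W\<^esub>}"
    using f.rank_nullity_main(1) V(2) by (simp add: im ker K_fin_def K_dim_def)
qed

definition K_lin :: "('a, 'x, 's) module_scheme \<Rightarrow> 'x set \<Rightarrow> ('a, 'y, 't) module_scheme \<Rightarrow> ('x \<Rightarrow> 'y) \<Rightarrow> bool" where
  "K_lin A V B f \<longleftrightarrow> Module.module R B \<and> f ` V \<subseteq> carrier B \<and>
    (\<forall>u\<in>V. \<forall>v\<in>V. f (u \<oplus>\<^bsub>A\<^esub> v) = f u \<oplus>\<^bsub>B\<^esub> f v) \<and>
    (\<forall>k\<in>gR 0. \<forall>v\<in>V. f (k \<odot>\<^bsub>A\<^esub> v) = k \<odot>\<^bsub>B\<^esub> f v)"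

lemma K_lin_zero:
  assumes "K_sub A V" "K_lin A V B f" shows "f \<zero>\<^bsub>A\<^esub> = \<zero>\<^bsub>B\<^esub>"
proof -
  interpret A: Module.module R A using assms by (simp add: K_sub_def)
  interpret B: Module.module R B using assms by (simp add: K_lin_def)
  have z: "\<zero>\<^bsub>A\<^esub> \<in> V" using assms by (simp add: K_sub_def)
  hence "f \<zero>\<^bsub>A\<^esub> \<oplus>\<^bsub>B\<^esub> f \<zero>\<^bsub>A\<^esub> = f \<zero>\<^bsub>A\<^esub>" "f \<zero>\<^bsub>A\<^esub> \<in> carrier B"
    using assms(2) A.l_zero[OF A.zero_closed] by (fastforce simp: K_lin_def)+
  thus ?thesis using B.add.l_cancel_one' by metis
qed

lemma K_sub_image:
  assumes "K_sub A V" "K_lin A V B f" shows "K_sub B (f ` V)"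
  unfolding K_sub_def
proof (intro conjI ballI)
  show "Module.module R B" "f ` V \<subseteq> carrier B" using assms by (auto simp: K_lin_def)
  show "\<zero>\<^bsub>B\<^esub> \<in> f ` V"
    using K_lin_zero[OF assms] assms(1) by (metis imageI K_sub_def)
  show "u \<oplus>\<^bsub>B\<^esub> v \<in> f ` V" if "u \<in> f ` V" "v \<in> f ` V" for u v
    using that assms by (auto simp: K_lin_def K_sub_def) (metis imageI)
  show "k \<odot>\<^bsub>B\<^esub> v \<in> f ` V" if "k \<in> gR 0" "v \<in> f ` V" for k v
    using that assms by (auto simp: K_lin_def K_sub_def) (metis imageI)
qed

lemma K_sub_kernel:
  assumes "K_sub A V" "K_lin A V B f" shows "K_sub A {v \<in> V. f v = \<zero>\<^bsub>B\<^esub>}"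
proof -
  interpret B: Module.module R B using assms by (simp add: K_lin_def)
  show ?thesis using assms K_lin_zero[OF assms] gR_carrier by (auto simp: K_lin_def K_sub_def)
qed

lemma K_dim_ker_im:
  assumes "K_sub A V" "K_fin A V" "K_lin A V B f"
  shows "K_fin B (f ` V)" "K_fin A {v \<in> V. f v = \<zero>\<^bsub>B\<^esub>}"
    "K_dim A V = K_dim B (f ` V) + K_dim A {v \<in> V. f v = \<zero>\<^bsub>B\<^esub>}"
proof -
  have "vectorspace K (res B (f ` V))"
    by (rule K_sub_vectorspace[OF K_sub_image[OF assms(1,3)]])
  from rank_nullity[OF assms(1,2) this, of f] assms(3)
  show "K_fin B (f ` V)" "K_dim A V = K_dim B (f ` V) + K_dim A {v \<in> V. f v = \<zero>\<^bsub>B\<^esub>}"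
    by (simp_all add: K_lin_def K_fin_def K_dim_def)
  show "K_fin A {v \<in> V. f v = \<zero>\<^bsub>B\<^esub>}"
    by (rule K_fin_subspace(1)[OF assms(1) K_sub_kernel[OF assms(1,3)] _ assms(2)]) auto
qed

lemma K_fin_zero: assumes "Module.module R A" shows "K_sub A {\<zero>\<^bsub>A\<^esub>}" "K_fin A {\<zero>\<^bsub>A\<^esub>}" "K_dim A {\<zero>\<^bsub>A\<^esub>} = 0"
proof -
  interpret A: Module.module R A by fact
  show k: "K_sub A {\<zero>\<^bsub>A\<^esub>}" using assms gR_carrier by (auto simp: K_sub_def)
  interpret V: vectorspace K "res A {\<zero>\<^bsub>A\<^esub>}" by (rule K_sub_vectorspace[OF k])
  have g: "V.gen_set {}" using V.span_empty by simp
  show "K_fin A {\<zero>\<^bsub>A\<^esub>}" unfolding K_fin_def V.fin_dim_def using g by (intro exI[of _ "{}"]) simp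
  show "K_dim A {\<zero>\<^bsub>A\<^esub>} = 0" using V.gen_ge_dim[of "{}"] g by (simp add: K_dim_def)
qed

lemma K_dim_0_imp: assumes "K_sub A V" "K_fin A V" "K_dim A V = 0" shows "V = {\<zero>\<^bsub>A\<^esub>}"
  using K_fin_subspace(3)[OF assms(1) K_fin_zero(1) _ assms(2)] K_fin_zero(3)[of A] assms
  by (auto simp: K_sub_def)

lemma K_dim_injective:
  assumes "K_sub A V" "K_fin A V" "K_lin A V B f" "\<And>v. v \<in> V \<Longrightarrow> f v = \<zero>\<^bsub>B\<^esub> \<Longrightarrow> v = \<zero>\<^bsub>A\<^esub>"
  shows "K_dim B (f ` V) = K_dim A V"
proof -
  have "{v \<in> V. f v = \<zero>\<^bsub>B\<^esub>} = {\<zero>\<^bsub>A\<^esub>}"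
    using assms K_lin_zero[OF assms(1,3)] by (auto simp: K_sub_def)
  thus ?thesis using K_dim_ker_im(3)[OF assms(1-3)] K_fin_zero(3)[of A] assms(1) by (simp add: K_sub_def)
qed

end

section \<open>Graded families in modules of functions\<close>

text \<open>One ambient module of all functions serves for the free modules, the Koszul chains and
  the homomorphisms alike. Conditions on support, degree or linearity are imposed by the families
  that live inside it.\<close>

definition fun_mod :: "('a, 'x, 's) module_scheme \<Rightarrow> ('a, 'i \<Rightarrow> 'x) module" where
  "fun_mod A = \<lparr>carrier = {f. \<forall>i. f i \<in> carrier A}, monoid.mult = (\<lambda>f g. f), one = (\<lambda>_. \<zero>\<^bsub>A\<^esub>),
     ring.zero = (\<lambda>_. \<zero>\<^bsub>A\<^esub>), ring.add = (\<lambda>f g i. f i \<oplus>\<^bsub>A\<^esub> g i),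
     module.smult = (\<lambda>r f i. r \<odot>\<^bsub>A\<^esub> f i)\<rparr>"

lemma fun_mod_simps [simp]:
  "f \<in> carrier (fun_mod A) \<longleftrightarrow> (\<forall>i. f i \<in> carrier A)" "\<zero>\<^bsub>fun_mod A\<^esub> = (\<lambda>_. \<zero>\<^bsub>A\<^esub>)"
  "f \<oplus>\<^bsub>fun_mod A\<^esub> g = (\<lambda>i. f i \<oplus>\<^bsub>A\<^esub> g i)" "r \<odot>\<^bsub>fun_mod A\<^esub> f = (\<lambda>i. r \<odot>\<^bsub>A\<^esub> f i)"
  by (simp_all add: fun_mod_def)

lemma module_fun_mod:
  assumes "Module.module R A" shows "Module.module R (fun_mod A)"
proof -
  interpret A: Module.module R A by fact
  show ?thesis
  proof (rule moduleI)
    show "abelian_group (fun_mod A)"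
    proof (rule abelian_groupI)
      fix f assume "f \<in> carrier (fun_mod A)"
      thus "\<exists>g\<in>carrier (fun_mod A). g \<oplus>\<^bsub>fun_mod A\<^esub> f = \<zero>\<^bsub>fun_mod A\<^esub>"
        by (intro bexI[of _ "\<lambda>i. \<ominus>\<^bsub>A\<^esub> f i"]) (auto simp: A.l_neg)
    qed (auto simp: fun_eq_iff A.a_ac)
  qed (auto simp: A.smult_l_distr A.smult_r_distr A.smult_assoc1 A.is_cring)
qed

lemma fun_mod_minus:
  assumes "Module.module R A" "f \<in> carrier (fun_mod A)"
  shows "\<ominus>\<^bsub>fun_mod A\<^esub> f = (\<lambda>i. \<ominus>\<^bsub>A\<^esub> f i)"
proof -
  interpret A: Module.module R A by fact
  interpret P: Module.module R "fun_mod A" by (rule module_fun_mod[OF assms(1)])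
  show ?thesis
    using assms(2) by (intro P.minus_equality) (auto simp: A.l_neg)
qed

lemma fun_mod_finsum:
  assumes "Module.module R A" "finite J" "\<And>j. j \<in> J \<Longrightarrow> F j \<in> carrier (fun_mod A)"
  shows "finsum (fun_mod A) F J i = finsum A (\<lambda>j. F j i) J"
proof -
  interpret A: Module.module R A by fact
  interpret P: Module.module R "fun_mod A" by (rule module_fun_mod[OF assms(1)])
  show ?thesis using assms(2,3)
  proof (induction J)
    case (insert j J)
    thus ?case
      by (subst P.finsum_insert) (auto simp: Pi_def)
  qed auto
qed

text \<open>The piece of degree \<open>n\<close> of \<open>x 0\<close> U + ... +
  \<open>x (k - 1)\<close> U. The recursion on the number of generators is what the chain condition,
  the Nakayama arguments and the Koszul boundaries induct on.\<close>

fun ideal_smult :: "('a, 'x, 's) module_scheme \<Rightarrow> (nat \<Rightarrow> 'a) \<Rightarrow> (nat \<Rightarrow> int) \<Rightarrow> nat \<Rightarrow> (int \<Rightarrow> 'x set) \<Rightarrow> int \<Rightarrow> 'x set" where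
  "ideal_smult A x dg 0 U n = {\<zero>\<^bsub>A\<^esub>}"
| "ideal_smult A x dg (Suc k) U n = {w \<oplus>\<^bsub>A\<^esub> x k \<odot>\<^bsub>A\<^esub> v | w v. w \<in> ideal_smult A x dg k U n \<and> v \<in> U (n - dg k)}"

context graded_algebra begin

lemma K_fin_sum:
  assumes "K_sub A V" "K_sub A W" "K_fin A V" "K_fin A W"
  shows "K_sub A {v \<oplus>\<^bsub>A\<^esub> w | v w. v \<in> V \<and> w \<in> W}" "K_fin A {v \<oplus>\<^bsub>A\<^esub> w | v w. v \<in> V \<and> w \<in> W}"
proof -
  have mA: "Module.module R A" using assms(1) by (simp add: K_sub_def)
  interpret A: vectorspace K A by (rule vectorspace_K[OF mA])
  have eq: "A.subspace_sum V W = {v \<oplus>\<^bsub>A\<^esub> w | v w. v \<in> V \<and> w \<in> W}"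
    by (auto simp: A.submodule_sum_def)
  have sub: "subspace K (A.subspace_sum V W) A"
    using assms by (intro A.sum_is_subspace K_sub_subspace)
  show "K_sub A {v \<oplus>\<^bsub>A\<^esub> w | v w. v \<in> V \<and> w \<in> W}"
    using sub mA unfolding eq subspace_def submodule_def K_sub_def
    by (simp add: Ball_def)
  show "K_fin A {v \<oplus>\<^bsub>A\<^esub> w | v w. v \<in> V \<and> w \<in> W}"
    using A.fin_dim_subspace_sum[of V W] assms unfolding K_fin_def eq
    by (auto intro: K_sub_subspace)
qed

abbreviation RM where "RM \<equiv> ring_as_module R"

lemma RM_simps [simp]:
  "carrier RM = carrier R" "\<zero>\<^bsub>RM\<^esub> = \<zero>" "(\<oplus>\<^bsub>RM\<^esub>) = (\<oplus>)" "(\<odot>\<^bsub>RM\<^esub>) = (\<otimes>)"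
  by (simp_all add: ring_as_module_def)

lemma module_RM: "Module.module R RM"
proof (rule moduleI)
  show "abelian_group RM"
    by (rule abelian_groupI) (auto simp: a_ac intro: bexI[of _ "\<ominus> _"] l_neg)
qed (auto simp: l_distr r_distr m_assoc is_cring)

text \<open>Pieces are handled one degree at a time, so only closure properties appear. Directness
  of the sum enters later through \<open>graded_mod\<close>, where homogeneous components are
  taken.\<close>

definition graded_sub :: "('a, 'x, 's) module_scheme \<Rightarrow> (int \<Rightarrow> 'x set) \<Rightarrow> bool" where
  "graded_sub A U \<longleftrightarrow> Module.module R A \<and> (\<forall>n. U n \<subseteq> carrier A \<and> \<zero>\<^bsub>A\<^esub> \<in> U n) \<and>
    (\<forall>n. \<forall>u\<in>U n. \<forall>v\<in>U n. u \<oplus>\<^bsub>A\<^esub> v \<in> U n) \<and>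
    (\<forall>m n. \<forall>r\<in>gR m. \<forall>u\<in>U n. r \<odot>\<^bsub>A\<^esub> u \<in> U (m + n))"

lemma graded_subD:
  assumes "graded_sub A U"
  shows "Module.module R A" "u \<in> U n \<Longrightarrow> u \<in> carrier A" "\<zero>\<^bsub>A\<^esub> \<in> U n"
    "u \<in> U n \<Longrightarrow> v \<in> U n \<Longrightarrow> u \<oplus>\<^bsub>A\<^esub> v \<in> U n"
    "r \<in> gR m \<Longrightarrow> u \<in> U n \<Longrightarrow> r \<odot>\<^bsub>A\<^esub> u \<in> U (m + n)"
    "r \<in> gR m \<Longrightarrow> u \<in> U n \<Longrightarrow> k = m + n \<Longrightarrow> r \<odot>\<^bsub>A\<^esub> u \<in> U k"
    "U n \<subseteq> carrier A"
  using assms by (auto simp: graded_sub_def)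

lemma graded_sub_K_sub: "graded_sub A U \<Longrightarrow> K_sub A (U n)"
  using graded_subD(6)[of A U _ 0 _ n n] by (auto simp: graded_sub_def K_sub_def)

lemma graded_sub_neg: "graded_sub A U \<Longrightarrow> u \<in> U n \<Longrightarrow> \<ominus>\<^bsub>A\<^esub> u \<in> U n"
  using graded_sub_K_sub K_sub_neg by metis

lemma graded_sub_diff: "graded_sub A U \<Longrightarrow> u \<in> U n \<Longrightarrow> v \<in> U n \<Longrightarrow> u \<ominus>\<^bsub>A\<^esub> v \<in> U n"
  by (simp add: a_minus_def graded_subD graded_sub_neg)

lemma finsum_in:
  assumes U: "graded_sub A U" and f: "\<And>j. j \<in> J \<Longrightarrow> f j \<in> U n"
  shows "finsum A f J \<in> U n"
proof -
  interpret A: Module.module R A by (rule graded_subD(1)[OF U])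
  show ?thesis using f
  proof (induction J rule: infinite_finite_induct)
    case (insert j J)
    have "f \<in> insert j J \<rightarrow> carrier A" using insert.prems graded_subD(2)[OF U] by blast
    thus ?case using insert graded_subD(4)[OF U] by (simp add: A.finsum_insert Pi_def)
  qed (use graded_subD(3)[OF U] in \<open>simp_all add: A.finsum_infinite\<close>)
qed

lemma graded_sub_RM: "graded_sub RM gR"
  using module_RM gR_carrier gR_0 gR_add graded_mult by (auto simp: graded_sub_def)

text \<open>The direct sum of shifted copies of \<open>U\<close>: the summand of index
  \<open>j\<close> is moved up by \<open>\<delta> j\<close>, so that for U = R the basis vector
  \<open>j\<close> has degree \<open>\<delta> j\<close>.\<close>

definition fun_family :: "('a, 'x, 's) module_scheme \<Rightarrow> (int \<Rightarrow> 'x set) \<Rightarrow> 'i set \<Rightarrow> ('i \<Rightarrow> int) \<Rightarrow> int \<Rightarrow> ('i \<Rightarrow> 'x) set" where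
  "fun_family A U J \<delta> n = {f. (\<forall>j\<in>J. f j \<in> U (n - \<delta> j)) \<and> (\<forall>j. j \<notin> J \<longrightarrow> f j = \<zero>\<^bsub>A\<^esub>)}"

lemma graded_sub_fun_family:
  assumes "graded_sub A U" shows "graded_sub (fun_mod A) (fun_family A U J \<delta>)"
proof -
  interpret A: Module.module R A using assms by (rule graded_subD)
  have 1: "f i \<in> carrier A" if "f \<in> fun_family A U J \<delta> n" for f i n
    using that graded_subD(2)[OF assms] by (cases "i \<in> J") (auto simp: fun_family_def)
  have 2: "r \<odot>\<^bsub>A\<^esub> f j \<in> U (m + n - \<delta> j)" if "r \<in> gR m" "f j \<in> U (n - \<delta> j)" for r m n f j
    using graded_subD(6)[OF assms that] by (simp add: algebra_simps)
  show ?thesis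
    unfolding graded_sub_def
  proof (intro conjI allI ballI)
    show "Module.module R (fun_mod A)" by (rule module_fun_mod[OF graded_subD(1)[OF assms]])
    show "fun_family A U J \<delta> n \<subseteq> carrier (fun_mod A)" for n using 1 by auto
    show "\<zero>\<^bsub>fun_mod A\<^esub> \<in> fun_family A U J \<delta> n" for n
      using graded_subD(3)[OF assms] by (auto simp: fun_family_def)
    show "f \<oplus>\<^bsub>fun_mod A\<^esub> g \<in> fun_family A U J \<delta> n" if "f \<in> fun_family A U J \<delta> n" "g \<in> fun_family A U J \<delta> n" for n f g
      using that graded_subD(4)[OF assms] by (auto simp: fun_family_def)
    show "r \<odot>\<^bsub>fun_mod A\<^esub> f \<in> fun_family A U J \<delta> (m + n)" if "r \<in> gR m" "f \<in> fun_family A U J \<delta> n" for m n r f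
      using that 2 gR_carrier by (auto simp: fun_family_def)
  qed
qed

lemma K_lin_eval:
  assumes "graded_sub A U" "V \<subseteq> carrier (fun_mod A)" shows "K_lin (fun_mod A) V A (\<lambda>f. f i)"
  using assms graded_subD(1)[OF assms(1)] by (auto simp: K_lin_def)

text \<open>By induction on \<open>J\<close>. The family is the sum of the part supported at the new
  index and the part supported on the rest, hence finite-dimensional; evaluation at the new index
  has the piece of \<open>U\<close> as image and the functions supported on the rest as
  kernel.\<close>

lemma fun_family_dim:
  assumes U: "graded_sub A U" and "finite J" "\<And>j. j \<in> J \<Longrightarrow> K_fin A (U (n - \<delta> j))"
  shows "K_fin (fun_mod A) (fun_family A U J \<delta> n)" "K_dim (fun_mod A) (fun_family A U J \<delta> n) = (\<Sum>j\<in>J. K_dim A (U (n - \<delta> j)))"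
proof -
  interpret A: Module.module R A using U by (rule graded_subD)
  have fun_mod: "Module.module R (fun_mod A)" by (rule module_fun_mod[OF graded_subD(1)[OF U]])
  have "K_fin (fun_mod A) (fun_family A U J \<delta> n) \<and> K_dim (fun_mod A) (fun_family A U J \<delta> n) = (\<Sum>j\<in>J. K_dim A (U (n - \<delta> j)))"
    using assms(2,3)
  proof (induction J)
    case empty
    have "fun_family A U {} \<delta> n = {\<zero>\<^bsub>fun_mod A\<^esub>}" by (auto simp: fun_family_def)
    thus ?case using K_fin_zero(2,3)[OF fun_mod] by simp
  next
    case (insert i J)
    let ?s = "\<lambda>u j. if j = i then u else \<zero>\<^bsub>A\<^esub>"
    let ?V = "fun_family A U (insert i J) \<delta> n" and ?W = "fun_family A U J \<delta> n"
    have k: "K_sub A (U (n - \<delta> i))" "K_sub (fun_mod A) ?W" "K_sub (fun_mod A) ?V"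
      using graded_sub_K_sub[OF U] graded_sub_K_sub[OF graded_sub_fun_family[OF U]] by blast+
    have s: "K_lin A (U (n - \<delta> i)) (fun_mod A) ?s"
      using fun_mod graded_subD[OF U] gR_carrier by (auto simp: K_lin_def fun_eq_iff)
    have sum: "?V = {v \<oplus>\<^bsub>fun_mod A\<^esub> w | v w. v \<in> ?s ` U (n - \<delta> i) \<and> w \<in> ?W}" (is "_ = ?S")
    proof
      show "?V \<subseteq> ?S"
      proof
        fix f assume f: "f \<in> ?V"
        have "f j \<in> carrier A" for j
          using f graded_subD(2)[OF U] by (cases "j \<in> insert i J") (auto simp: fun_family_def)
        hence "f = ?s (f i) \<oplus>\<^bsub>fun_mod A\<^esub> (f(i := \<zero>\<^bsub>A\<^esub>))" by (auto simp: fun_eq_iff)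
        moreover have "f(i := \<zero>\<^bsub>A\<^esub>) \<in> ?W" "f i \<in> U (n - \<delta> i)"
          using f insert.hyps by (auto simp: fun_family_def)
        ultimately show "f \<in> ?S" by blast
      qed
      show "?S \<subseteq> ?V" using insert.hyps graded_subD(2,4,3)[OF U]
        by (auto simp: fun_family_def)
    qed
    have "K_fin (fun_mod A) ?W" and dW: "K_dim (fun_mod A) ?W = (\<Sum>j\<in>J. K_dim A (U (n - \<delta> j)))"
      using insert by auto
    hence fdV: "K_fin (fun_mod A) ?V"
      unfolding sum using k s insert.prems by (intro K_fin_sum K_sub_image K_dim_ker_im(1)) auto
    have ev: "K_lin (fun_mod A) ?V A (\<lambda>f. f i)"
      using graded_sub_fun_family[OF U, of "insert i J" \<delta>] by (intro K_lin_eval[OF U]) (rule graded_subD(7))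
    have ker: "{f \<in> ?V. f i = \<zero>\<^bsub>A\<^esub>} = ?W"
      using insert.hyps graded_subD(3)[OF U] unfolding fun_family_def by fastforce
    have im: "(\<lambda>f. f i) ` ?V = U (n - \<delta> i)"
    proof
      show "(\<lambda>f. f i) ` ?V \<subseteq> U (n - \<delta> i)" by (auto simp: fun_family_def)
      have "?s u \<in> ?V" if "u \<in> U (n - \<delta> i)" for u
        using that graded_subD(3)[OF U] by (auto simp: fun_family_def)
      thus "U (n - \<delta> i) \<subseteq> (\<lambda>f. f i) ` ?V" by (force intro: rev_image_eqI)
    qed
    show ?case
      using K_dim_ker_im(3)[OF k(3) fdV ev] fdV insert.hyps by (simp add: ker im dW)
  qed
  thus "K_fin (fun_mod A) (fun_family A U J \<delta> n)" "K_dim (fun_mod A) (fun_family A U J \<delta> n) = (\<Sum>j\<in>J. K_dim A (U (n - \<delta> j)))"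
    by auto
qed

end

section \<open>Chain conditions for graded submodules\<close>

lemma (in abelian_group) add_diff_cancel:
  assumes "a \<in> carrier G" "b \<in> carrier G"
  shows "(a \<oplus> b) \<ominus> a = b" "a \<oplus> (b \<ominus> a) = b" "(a \<ominus> b) \<oplus> b = a"
proof -
  show "(a \<oplus> b) \<ominus> a = b"
    using assms by (simp add: minus_eq a_comm[of "a \<oplus> b" "\<ominus> a"] l_neg flip: a_assoc)
  have "b \<ominus> a = \<ominus> a \<oplus> b" using assms by (simp add: minus_eq a_comm)
  thus "a \<oplus> (b \<ominus> a) = b" using assms by (simp add: r_neg flip: a_assoc)
  show "(a \<ominus> b) \<oplus> b = a" using assms by (simp add: minus_eq a_assoc l_neg)
qed

locale graded_algebra_elements = graded_algebra +
  fixes x :: "nat \<Rightarrow> 'a" and e :: nat and dg :: "nat \<Rightarrow> int"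
  assumes x_deg: "k < e \<Longrightarrow> x k \<in> gR (dg k)" and dg_pos: "k < e \<Longrightarrow> 0 < dg k"
begin

abbreviation gens_smult where "gens_smult A \<equiv> ideal_smult A x dg"
abbreviation max_smult where "max_smult A \<equiv> ideal_smult A x dg e"

lemma graded_sub_gens_smult:
  assumes "graded_sub A U" "k \<le> e"
  shows "graded_sub A (gens_smult A k U)" "gens_smult A k U n \<subseteq> U n"
proof -
  interpret A: Module.module R A using assms(1) by (rule graded_subD)
  have "graded_sub A (gens_smult A k U) \<and> (\<forall>n. gens_smult A k U n \<subseteq> U n)" using assms(2)
  proof (induction k)
    case 0
    show ?case using A.module_axioms graded_subD(3)[OF assms(1)] gR_carrier by (auto simp: graded_sub_def)
  next
    case (Suc k)
    hence IH: "graded_sub A (gens_smult A k U)" "\<And>n. gens_smult A k U n \<subseteq> U n" and xk: "x k \<in> gR (dg k)"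
      using x_deg by auto
    have xU: "x k \<odot>\<^bsub>A\<^esub> v \<in> U n" if "v \<in> U (n - dg k)" for v n
      using graded_subD(6)[OF assms(1) xk that] by simp
    have xc: "x k \<in> carrier R" using xk by (rule gR_carrier)
    show ?case
    proof (intro conjI allI)
      show sub: "gens_smult A (Suc k) U n \<subseteq> U n" for n
        using IH(2)[of n] xU graded_subD(4)[OF assms(1)] by auto
      show "graded_sub A (gens_smult A (Suc k) U)"
        unfolding graded_sub_def
      proof (intro conjI allI ballI)
        show "gens_smult A (Suc k) U n \<subseteq> carrier A" for n
          using sub graded_subD(7)[OF assms(1)] by blast
        show "\<zero>\<^bsub>A\<^esub> \<in> gens_smult A (Suc k) U n" for n
          using graded_subD(3)[OF IH(1)] graded_subD(3)[OF assms(1)] xc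
          by (auto intro!: exI[of _ "\<zero>\<^bsub>A\<^esub>"])
      next
        fix n u v assume u: "u \<in> gens_smult A (Suc k) U n" and v: "v \<in> gens_smult A (Suc k) U n"
        obtain u0 u1 where u: "u0 \<in> gens_smult A k U n" "u1 \<in> U (n - dg k)" "u = u0 \<oplus>\<^bsub>A\<^esub> x k \<odot>\<^bsub>A\<^esub> u1"
          using u by auto
        obtain v0 v1 where v: "v0 \<in> gens_smult A k U n" "v1 \<in> U (n - dg k)" "v = v0 \<oplus>\<^bsub>A\<^esub> x k \<odot>\<^bsub>A\<^esub> v1"
          using v by auto
        have c: "u0 \<in> carrier A" "v0 \<in> carrier A" "u1 \<in> carrier A" "v1 \<in> carrier A"
          using u v graded_subD(2)[OF IH(1)] graded_subD(2)[OF assms(1)] by auto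
        have "u \<oplus>\<^bsub>A\<^esub> v = (u0 \<oplus>\<^bsub>A\<^esub> v0) \<oplus>\<^bsub>A\<^esub> x k \<odot>\<^bsub>A\<^esub> (u1 \<oplus>\<^bsub>A\<^esub> v1)"
          using c xc by (simp add: u v A.smult_r_distr A.a_ac)
        moreover have "u0 \<oplus>\<^bsub>A\<^esub> v0 \<in> gens_smult A k U n" "u1 \<oplus>\<^bsub>A\<^esub> v1 \<in> U (n - dg k)"
          using u v graded_subD(4)[OF IH(1)] graded_subD(4)[OF assms(1)] by auto
        ultimately show "u \<oplus>\<^bsub>A\<^esub> v \<in> gens_smult A (Suc k) U n"
          unfolding ideal_smult.simps by blast
      next
        fix m n r u assume r: "r \<in> gR m" and u: "u \<in> gens_smult A (Suc k) U n"
        obtain u0 u1 where u: "u0 \<in> gens_smult A k U n" "u1 \<in> U (n - dg k)" "u = u0 \<oplus>\<^bsub>A\<^esub> x k \<odot>\<^bsub>A\<^esub> u1"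
          using u by auto
        have c: "u0 \<in> carrier A" "u1 \<in> carrier A" "r \<in> carrier R"
          using u r graded_subD(2)[OF IH(1)] graded_subD(2)[OF assms(1)] gR_carrier by auto
        have "r \<odot>\<^bsub>A\<^esub> u = r \<odot>\<^bsub>A\<^esub> u0 \<oplus>\<^bsub>A\<^esub> x k \<odot>\<^bsub>A\<^esub> (r \<odot>\<^bsub>A\<^esub> u1)"
          using c xc by (simp add: u A.smult_r_distr m_comm flip: A.smult_assoc1)
        moreover have "r \<odot>\<^bsub>A\<^esub> u1 \<in> U (m + n - dg k)"
          using graded_subD(6)[OF assms(1) r u(2)] by (simp add: algebra_simps)
        ultimately show "r \<odot>\<^bsub>A\<^esub> u \<in> gens_smult A (Suc k) U (m + n)"
          using u graded_subD(5)[OF IH(1) r u(1)] by auto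
      qed (rule A.module_axioms)
    qed
  qed
  thus "graded_sub A (gens_smult A k U)" "gens_smult A k U n \<subseteq> U n" by auto
qed

end

text \<open>Generation in graded form: elements of positive degree lie in the ideal of the
  \<open>x k\<close>, with homogeneous cofactors. It is derived from generation as a ring in
  \<open>generated\<close>, which is why the elements alone form a locale of their own.\<close>

locale generated_graded_algebra = graded_algebra_elements +
  assumes gR_generated: "0 < n \<Longrightarrow> gR n \<subseteq> ideal_smult RM x dg e gR n"
begin

text \<open>A scalar of positive degree is a combination of the generators; its cofactors are moved
  onto \<open>u\<close>.\<close>

lemma max_smult_smult:
  assumes U: "graded_sub A U" and r: "r \<in> gR m" "0 < m" and u: "u \<in> U n"
  shows "r \<odot>\<^bsub>A\<^esub> u \<in> max_smult A U (m + n)"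
proof -
  interpret A: Module.module R A using U by (rule graded_subD)
  have uc: "u \<in> carrier A" using graded_subD(2)[OF U u] .
  have "r \<odot>\<^bsub>A\<^esub> u \<in> gens_smult A k U (m + n)" if "k \<le> e" "r \<in> gens_smult RM k gR m" for k r
    using that
  proof (induction k arbitrary: r)
    case 0
    thus ?case using uc by simp
  next
    case (Suc k)
    obtain r0 r1 where r: "r0 \<in> gens_smult RM k gR m" "r1 \<in> gR (m - dg k)" "r = r0 \<oplus> x k \<otimes> r1"
      using Suc.prems by auto
    have xk: "x k \<in> carrier R" using x_deg[of k] gR_carrier Suc.prems by auto
    have c: "r0 \<in> carrier R" "r1 \<in> carrier R"
      using r graded_sub_gens_smult(2)[OF graded_sub_RM, of k m] Suc.prems gR_carrier by auto
    have "r \<odot>\<^bsub>A\<^esub> u = r0 \<odot>\<^bsub>A\<^esub> u \<oplus>\<^bsub>A\<^esub> x k \<odot>\<^bsub>A\<^esub> (r1 \<odot>\<^bsub>A\<^esub> u)"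
      using c xk uc by (simp add: r(3) A.smult_l_distr A.smult_assoc1)
    moreover have "r1 \<odot>\<^bsub>A\<^esub> u \<in> U (m + n - dg k)"
      using graded_subD(6)[OF U r(2) u] by (simp add: algebra_simps)
    ultimately show ?case using Suc r by auto
  qed
  thus ?thesis using r gR_generated by blast
qed

text \<open>The lower bound \<open>W\<close> is what the induction moves: it descends from the
  multiples of all generators in \<open>V\<close> to zero, giving up one generator at a
  time.\<close>

definition asc_chain :: "('a, 'x, 's) module_scheme \<Rightarrow> (int \<Rightarrow> 'x set) \<Rightarrow> (int \<Rightarrow> 'x set) \<Rightarrow> bool" where
  "asc_chain A W V \<longleftrightarrow> (\<forall>C :: nat \<Rightarrow> int \<Rightarrow> 'x set.
    (\<forall>i. graded_sub A (C i) \<and> (\<forall>n. W n \<subseteq> C i n \<and> C i n \<subseteq> V n \<and> C i n \<subseteq> C (Suc i) n)) \<longrightarrow>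
    (\<exists>m. \<forall>i\<ge>m. C i = C m))"

lemma chain_mono:
  assumes "\<And>i n. C i n \<subseteq> C (Suc i) (n :: int)" "i \<le> j" shows "C i n \<subseteq> C j n"
  using assms(2) by (induction rule: dec_induct) (use assms(1) in blast)+

text \<open>
  The submodule of those \<open>v\<close> for which \<open>x\<^sup>k v\<close> is the leading term, for the \<open>x\<close>-adic filtration, of
  an element of \<open>C\<close>.
\<close>

definition lead :: "('a, 'x, 's) module_scheme \<Rightarrow> (int \<Rightarrow> 'x set) \<Rightarrow> nat \<Rightarrow> nat \<Rightarrow> (int \<Rightarrow> 'x set) \<Rightarrow> int \<Rightarrow> 'x set" where
  "lead A V i k C n = {v \<in> V n. \<exists>u\<in>C (n + int k * dg i). \<exists>v'\<in>V (n - dg i).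
    (x i [^] k) \<odot>\<^bsub>A\<^esub> v = u \<oplus>\<^bsub>A\<^esub> (x i [^] Suc k) \<odot>\<^bsub>A\<^esub> v'}"

lemma pow_deg: "r \<in> gR d \<Longrightarrow> r [^] (k::nat) \<in> gR (int k * d)"
proof (induction k)
  case (Suc k)
  thus ?case using graded_mult[of "r [^] k" "int k * d" r d] by (simp add: algebra_simps)
qed (simp add: gR_1)

context
  fixes A :: "('a, 'x, 's) module_scheme" and V :: "int \<Rightarrow> 'x set" and i :: nat
  assumes V: "graded_sub A V" and i: "i < e"
begin

lemma graded_sub_lead:
  assumes C: "graded_sub A C"
  shows "graded_sub A (lead A V i k C)"
proof -
  interpret A: Module.module R A using V by (rule graded_subD)
  have xc: "x i \<in> carrier R" using x_deg[OF i] by (rule gR_carrier)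
  show ?thesis
    unfolding graded_sub_def
  proof (intro conjI allI ballI)
    show "lead A V i k C n \<subseteq> carrier A" for n
      using graded_subD(2)[OF V] by (auto simp: lead_def)
    show "\<zero>\<^bsub>A\<^esub> \<in> lead A V i k C n" for n
      using graded_subD(3)[OF V] graded_subD(3)[OF C] xc
      by (auto simp: lead_def intro!: bexI[of _ "\<zero>\<^bsub>A\<^esub>"])
  next
    fix n u v assume "u \<in> lead A V i k C n" "v \<in> lead A V i k C n"
    then obtain p p' q q' where u: "u \<in> V n" "p \<in> C (n + int k * dg i)" "p' \<in> V (n - dg i)"
      "(x i [^] k) \<odot>\<^bsub>A\<^esub> u = p \<oplus>\<^bsub>A\<^esub> (x i [^] Suc k) \<odot>\<^bsub>A\<^esub> p'"
      and v: "v \<in> V n" "q \<in> C (n + int k * dg i)" "q' \<in> V (n - dg i)"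
      "(x i [^] k) \<odot>\<^bsub>A\<^esub> v = q \<oplus>\<^bsub>A\<^esub> (x i [^] Suc k) \<odot>\<^bsub>A\<^esub> q'"
      by (auto simp: lead_def)
    have c: "u \<in> carrier A" "v \<in> carrier A" "p \<in> carrier A" "p' \<in> carrier A" "q \<in> carrier A" "q' \<in> carrier A"
      using u v graded_subD(2)[OF V] graded_subD(2)[OF C] by auto
    have "(x i [^] k) \<odot>\<^bsub>A\<^esub> (u \<oplus>\<^bsub>A\<^esub> v) = (p \<oplus>\<^bsub>A\<^esub> q) \<oplus>\<^bsub>A\<^esub> (x i [^] Suc k) \<odot>\<^bsub>A\<^esub> (p' \<oplus>\<^bsub>A\<^esub> q')"
      using c xc by (simp add: A.smult_r_distr u(4) v(4) A.a_ac del: nat_pow_Suc)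
    thus "u \<oplus>\<^bsub>A\<^esub> v \<in> lead A V i k C n"
      unfolding lead_def using u v graded_subD(4)[OF V] graded_subD(4)[OF C] by blast
  next
    fix m n r u assume r: "r \<in> gR m" and "u \<in> lead A V i k C n"
    then obtain p p' where u: "u \<in> V n" "p \<in> C (n + int k * dg i)" "p' \<in> V (n - dg i)"
      "(x i [^] k) \<odot>\<^bsub>A\<^esub> u = p \<oplus>\<^bsub>A\<^esub> (x i [^] Suc k) \<odot>\<^bsub>A\<^esub> p'"
      by (auto simp: lead_def)
    have c: "u \<in> carrier A" "p \<in> carrier A" "p' \<in> carrier A" "r \<in> carrier R"
      using u r graded_subD(2)[OF V] graded_subD(2)[OF C] gR_carrier by auto
    have comm: "y \<odot>\<^bsub>A\<^esub> (r \<odot>\<^bsub>A\<^esub> w) = r \<odot>\<^bsub>A\<^esub> (y \<odot>\<^bsub>A\<^esub> w)" if "y \<in> carrier R" "w \<in> carrier A" for y w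
      using that c by (simp add: m_comm flip: A.smult_assoc1)
    have "(x i [^] k) \<odot>\<^bsub>A\<^esub> (r \<odot>\<^bsub>A\<^esub> u) = r \<odot>\<^bsub>A\<^esub> p \<oplus>\<^bsub>A\<^esub> (x i [^] Suc k) \<odot>\<^bsub>A\<^esub> (r \<odot>\<^bsub>A\<^esub> p')"
      using c xc by (simp add: comm u(4) A.smult_r_distr del: nat_pow_Suc)
    moreover have "r \<odot>\<^bsub>A\<^esub> u \<in> V (m + n)" "r \<odot>\<^bsub>A\<^esub> p \<in> C (m + n + int k * dg i)"
      "r \<odot>\<^bsub>A\<^esub> p' \<in> V (m + n - dg i)"
      using graded_subD(5)[OF V r u(1)] graded_subD(5)[OF C r u(2)] graded_subD(5)[OF V r u(3)]
      by (simp_all add: algebra_simps)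
    ultimately show "r \<odot>\<^bsub>A\<^esub> u \<in> lead A V i k C (m + n)"
      unfolding lead_def by blast
  qed (rule A.module_axioms)
qed

text \<open>The defining relation is multiplied by \<open>x i\<close>. As in the basis theorem of
  Hilbert, this makes the leading submodules increase with the exponent as well as with the
  chain.\<close>

lemma lead_Suc:
  assumes C: "graded_sub A C"
  shows "lead A V i k C n \<subseteq> lead A V i (Suc k) C n"
proof
  interpret A: Module.module R A using V by (rule graded_subD)
  have xc: "x i \<in> carrier R" using x_deg[OF i] by (rule gR_carrier)
  fix u assume "u \<in> lead A V i k C n"
  then obtain p p' where u: "u \<in> V n" "p \<in> C (n + int k * dg i)" "p' \<in> V (n - dg i)"
    "(x i [^] k) \<odot>\<^bsub>A\<^esub> u = p \<oplus>\<^bsub>A\<^esub> (x i [^] Suc k) \<odot>\<^bsub>A\<^esub> p'"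
    by (auto simp: lead_def)
  have c: "u \<in> carrier A" "p \<in> carrier A" "p' \<in> carrier A"
    using u graded_subD(2)[OF V] graded_subD(2)[OF C] by auto
  have pow: "(x i [^] Suc l) \<odot>\<^bsub>A\<^esub> w = x i \<odot>\<^bsub>A\<^esub> ((x i [^] l) \<odot>\<^bsub>A\<^esub> w)" if "w \<in> carrier A" for l :: nat and w
    unfolding nat_pow_Suc2[OF xc] using that xc by (simp add: A.smult_assoc1)
  have "(x i [^] Suc k) \<odot>\<^bsub>A\<^esub> u = x i \<odot>\<^bsub>A\<^esub> p \<oplus>\<^bsub>A\<^esub> (x i [^] Suc (Suc k)) \<odot>\<^bsub>A\<^esub> p'"
    unfolding pow[OF c(1), of k] pow[OF c(3), of "Suc k"] u(4)
    using c xc by (simp add: A.smult_r_distr del: nat_pow_Suc)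
  moreover have "x i \<odot>\<^bsub>A\<^esub> p \<in> C (n + int (Suc k) * dg i)"
    using graded_subD(6)[OF C x_deg[OF i] u(2)] by (simp add: algebra_simps)
  ultimately show "u \<in> lead A V i (Suc k) C n"
    unfolding lead_def using u by blast
qed

text \<open>The leading submodules of members of a chain above \<open>W\<close> all contain W +
  \<open>x i\<close> V, so the hypothesis applies to them. They stabilize for all exponents
  simultaneously, and equal leading submodules force equal members: an element is corrected by
  leading terms until the remainder is divisible by a power of \<open>x i\<close> too high for the
  lower degree bound.\<close>

lemma asc_chain_step:
  assumes W: "graded_sub A W" and bdd: "\<And>n. n < s \<Longrightarrow> V n = {\<zero>\<^bsub>A\<^esub>}"
    and asc_chain: "asc_chain A (\<lambda>n. {w \<oplus>\<^bsub>A\<^esub> x i \<odot>\<^bsub>A\<^esub> v | w v. w \<in> W n \<and> v \<in> V (n - dg i)}) V"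
  shows "asc_chain A W V"
  unfolding asc_chain_def
proof (intro allI impI)
  interpret A: Module.module R A using V by (rule graded_subD)
  have xc: "x i \<in> carrier R" using x_deg[OF i] by (rule gR_carrier)
  fix C :: "nat \<Rightarrow> int \<Rightarrow> 'x set"
  assume "\<forall>i. graded_sub A (C i) \<and> (\<forall>n. W n \<subseteq> C i n \<and> C i n \<subseteq> V n \<and> C i n \<subseteq> C (Suc i) n)"
  hence C: "\<And>i. graded_sub A (C i)" "\<And>i n. W n \<subseteq> C i n" "\<And>i n. C i n \<subseteq> V n" "\<And>i n. C i n \<subseteq> C (Suc i) n"
    by auto
  let ?L = "\<lambda>k j. lead A V i k (C j)"
  have Lmono: "?L k j n \<subseteq> ?L k' j' n" if "k \<le> k'" "j \<le> j'" for k k' j j' n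
  proof -
    have "?L k j n \<subseteq> ?L k' j n"
      using chain_mono[of "\<lambda>k. ?L k j" k k' n] lead_Suc[OF C(1)] that by blast
    also have "\<dots> \<subseteq> ?L k' j' n"
      using chain_mono[where C = C, OF C(4) that(2)] unfolding lead_def by blast
    finally show ?thesis .
  qed
  \<comment> \<open>This places the leading submodules in the interval to which the hypothesis on
    chains refers.\<close>
  have low: "w \<oplus>\<^bsub>A\<^esub> x i \<odot>\<^bsub>A\<^esub> v \<in> ?L k j n" if "w \<in> W n" "v \<in> V (n - dg i)" for k j n w v
  proof -
    have wC: "w \<in> C j n" using that C(2) by blast
    have c: "w \<in> carrier A" "v \<in> carrier A" using wC that graded_subD(2)[OF C(1)] graded_subD(2)[OF V] by auto
    have "x i \<odot>\<^bsub>A\<^esub> v \<in> V n" using graded_subD(6)[OF V x_deg[OF i] that(2)] by simp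
    hence 1: "w \<oplus>\<^bsub>A\<^esub> x i \<odot>\<^bsub>A\<^esub> v \<in> V n" using wC C(3) graded_subD(4)[OF V] by blast
    have "(x i [^] k) \<odot>\<^bsub>A\<^esub> (w \<oplus>\<^bsub>A\<^esub> x i \<odot>\<^bsub>A\<^esub> v) = (x i [^] k) \<odot>\<^bsub>A\<^esub> w \<oplus>\<^bsub>A\<^esub> (x i [^] Suc k) \<odot>\<^bsub>A\<^esub> v"
      using c xc by (simp add: A.smult_r_distr A.smult_assoc1)
    moreover have "(x i [^] k) \<odot>\<^bsub>A\<^esub> w \<in> C j (n + int k * dg i)"
      using graded_subD(6)[OF C(1) pow_deg[OF x_deg[OF i]] wC] by (simp add: add.commute)
    ultimately show ?thesis using 1 that unfolding lead_def by blast
  qed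
  have stable: "\<exists>m. \<forall>l\<ge>m. D l = D m"
    if "\<And>l. \<exists>k j. D l = ?L k j" "\<And>l n. D l n \<subseteq> D (Suc l) n" for D
  proof -
    have "graded_sub A (D l)" "D l n \<subseteq> V n"
      "{w \<oplus>\<^bsub>A\<^esub> x i \<odot>\<^bsub>A\<^esub> v | w v. w \<in> W n \<and> v \<in> V (n - dg i)} \<subseteq> D l n" for l n
      using that(1)[of l] graded_sub_lead[OF C(1)] low by (auto simp: lead_def)
    thus ?thesis using that(2) by (intro asc_chain[unfolded asc_chain_def, rule_format] conjI allI) auto
  qed
  \<comment> \<open>The doubly indexed family is controlled by its diagonal for large exponents, and
    by one chain for each of the finitely many exponents up to \<open>m\<close>.\<close>
  have "\<exists>m. \<forall>l\<ge>m. ?L l l = ?L m m"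
  proof (rule stable)
    show "?L l l n \<subseteq> ?L (Suc l) (Suc l) n" for l n by (rule Lmono) auto
    show "\<exists>k j. ?L l l = ?L k j" for l by (intro exI) (rule refl)
  qed
  then obtain m where m': "\<forall>l\<ge>m. ?L l l = ?L m m" by (rule exE)
  have m: "?L l l = ?L m m" if "m \<le> l" for l using m' that by blast
  have "\<exists>mk. \<forall>j\<ge>mk. ?L k j = ?L k mk" for k
  proof (rule stable)
    show "?L k j n \<subseteq> ?L k (Suc j) n" for j n by (rule Lmono) auto
  qed blast
  then obtain mk where mk: "\<And>k j. j \<ge> mk k \<Longrightarrow> ?L k j = ?L k (mk k)" by metis
  define M where "M = Max (insert m (mk ` {..m}))"
  have M: "m \<le> M" unfolding M_def by (rule Max_ge) auto
  have Mk: "mk k \<le> M" if "k \<le> m" for k unfolding M_def using that by (intro Max_ge) auto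
  have LM: "?L k j = ?L k M" if "M \<le> j" for k j
  proof (cases "k \<le> m")
    case True
    hence "mk k \<le> M" by (rule Mk)
    thus ?thesis using mk[of k j] mk[of k M] that by simp
  next
    case False
    \<comment> \<open>Squeezed between two members of the stable diagonal.\<close>
    have L: "?L k j' = ?L m m" if "m \<le> j'" for j'
    proof
      fix n
      have "?L m m n \<subseteq> ?L k j' n" using False that by (intro Lmono) auto
      moreover have "?L k j' n \<subseteq> ?L (max k j') (max k j') n" by (intro Lmono) auto
      moreover have "?L (max k j') (max k j') = ?L m m" using that by (intro m) simp
      ultimately show "?L k j' n = ?L m m n" by auto
    qed
    show ?thesis using L[of j] L[of M] M that by simp
  qed
  have CM: "u \<in> C M n" if j: "M \<le> j" and u: "u \<in> C j n" for j n u
  proof -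
    \<comment> \<open>Downward induction on the exponent. An element of \<open>C j\<close> that lies
      in \<open>W\<close> up to a multiple of the k-th power of \<open>x i\<close> is changed by
      some \<open>p\<close> in \<open>C M\<close> with the same leading term, which raises the power
      by one.\<close>
    have key: "\<forall>u\<in>C j n. \<forall>w\<in>W n. \<forall>v\<in>V (n - int k * dg i). u = w \<oplus>\<^bsub>A\<^esub> (x i [^] k) \<odot>\<^bsub>A\<^esub> v \<longrightarrow> u \<in> C M n"
      if "k \<le> nat (n - s) + 1" for k
      using that
    proof (induction rule: inc_induct)
      case base
      \<comment> \<open>At this power the cofactor has degree below \<open>s\<close>, as
        \<open>dg i\<close> is at least 1, and so it is zero; only the part in \<open>W\<close>
        remains.\<close>
      define N where "N = nat (n - s) + 1"
      have "int N \<le> int N * dg i" using dg_pos[OF i] mult_left_mono[of 1 "dg i" "int N"] by simp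
      moreover have "n - s < int N" by (simp add: N_def)
      ultimately have V0: "V (n - int N * dg i) = {\<zero>\<^bsub>A\<^esub>}" by (intro bdd) linarith
      show ?case
        using C(2) xc graded_subD(2)[OF W] unfolding V0[unfolded N_def] by auto
    next
      case (step k)
      show ?case
      proof (intro ballI impI)
        fix u w v assume u: "u \<in> C j n" and w: "w \<in> W n" and v: "v \<in> V (n - int k * dg i)"
          and uwv: "u = w \<oplus>\<^bsub>A\<^esub> (x i [^] k) \<odot>\<^bsub>A\<^esub> v"
        have wC: "w \<in> C j n" using w C(2) by blast
        have c: "u \<in> carrier A" "w \<in> carrier A" "v \<in> carrier A"
          using u w v graded_subD(2)[OF C(1)] graded_subD(2)[OF W] graded_subD(2)[OF V] by auto
        let ?n = "n - int k * dg i"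
        have xv: "(x i [^] k) \<odot>\<^bsub>A\<^esub> v = u \<ominus>\<^bsub>A\<^esub> w"
          using c xc by (simp add: uwv A.add_diff_cancel)
        have "(x i [^] k) \<odot>\<^bsub>A\<^esub> v = (u \<ominus>\<^bsub>A\<^esub> w) \<oplus>\<^bsub>A\<^esub> (x i [^] Suc k) \<odot>\<^bsub>A\<^esub> \<zero>\<^bsub>A\<^esub>"
          using c xc by (simp add: xv)
        moreover have "u \<ominus>\<^bsub>A\<^esub> w \<in> C j (?n + int k * dg i)"
          using graded_sub_diff[OF C(1) u wC] by simp
        ultimately have "v \<in> ?L k j ?n"
          unfolding lead_def using v graded_subD(3)[OF V] by blast
        hence "v \<in> ?L k M ?n" using LM[OF j] by simp
        then obtain p p' where p: "p \<in> C M n" "p' \<in> V (?n - dg i)"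
          "(x i [^] k) \<odot>\<^bsub>A\<^esub> v = p \<oplus>\<^bsub>A\<^esub> (x i [^] Suc k) \<odot>\<^bsub>A\<^esub> p'"
          by (auto simp: lead_def)
        have pj: "p \<in> C j n" using p(1) chain_mono[where C = C, OF C(4) j] by blast
        have pc: "p \<in> carrier A" "p' \<in> carrier A" using p graded_subD(2)[OF C(1)] graded_subD(2)[OF V] by auto
        have "u \<ominus>\<^bsub>A\<^esub> p = w \<oplus>\<^bsub>A\<^esub> (x i [^] Suc k) \<odot>\<^bsub>A\<^esub> p'"
        proof -
          have "u = p \<oplus>\<^bsub>A\<^esub> (w \<oplus>\<^bsub>A\<^esub> (x i [^] Suc k) \<odot>\<^bsub>A\<^esub> p')"
            using c pc xc by (simp add: uwv p(3) A.a_ac del: nat_pow_Suc)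
          thus ?thesis using c pc xc
            by (simp add: A.add_diff_cancel del: nat_pow_Suc)
        qed
        moreover have "p' \<in> V (n - int (Suc k) * dg i)" using p(2) by (simp add: algebra_simps)
        ultimately have "u \<ominus>\<^bsub>A\<^esub> p \<in> C M n"
          using step.IH graded_sub_diff[OF C(1) u pj] w by blast
        hence "p \<oplus>\<^bsub>A\<^esub> (u \<ominus>\<^bsub>A\<^esub> p) \<in> C M n" using p(1) graded_subD(4)[OF C(1)] by blast
        moreover have "p \<oplus>\<^bsub>A\<^esub> (u \<ominus>\<^bsub>A\<^esub> p) = u"
          using c pc by (simp add: A.add_diff_cancel)
        ultimately show "u \<in> C M n" by simp
      qed
    qed
    have "u = \<zero>\<^bsub>A\<^esub> \<oplus>\<^bsub>A\<^esub> (x i [^] (0::nat)) \<odot>\<^bsub>A\<^esub> u" using u graded_subD(2)[OF C(1)] by simp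
    moreover have "u \<in> V (n - int 0 * dg i)" using u C(3) by auto
    ultimately show ?thesis using key[of 0] u graded_subD(3)[OF W] by blast
  qed
  have "C j = C M" if "M \<le> j" for j
    using CM[OF that] chain_mono[where C = C, OF C(4) that] by (intro ext) blast
  thus "\<exists>m. \<forall>i\<ge>m. C i = C m" by blast
qed

end

text \<open>Above the multiples of all generators a chain can grow only in the finitely many degrees
  from \<open>s\<close> to \<open>c\<close>, and there only within finite-dimensional pieces. From
  this, \<open>asc_chain_step\<close> removes the generators from the lower bound one after the
  other.\<close>

lemma asc_chain_generated:
  assumes V: "graded_sub A V" and bdd: "\<And>n. n < s \<Longrightarrow> V n = {\<zero>\<^bsub>A\<^esub>}"
    and fdV: "\<And>n. K_fin A (V n)" and gen: "\<And>n. c < n \<Longrightarrow> V n \<subseteq> max_smult A V n"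
  shows "asc_chain A (\<lambda>_. {\<zero>\<^bsub>A\<^esub>}) V"
proof -
  have base: "asc_chain A (max_smult A V) V"
    unfolding asc_chain_def
  proof (intro allI impI)
    fix C
    assume "\<forall>i. graded_sub A (C i) \<and> (\<forall>n. max_smult A V n \<subseteq> C i n \<and> C i n \<subseteq> V n \<and> C i n \<subseteq> C (Suc i) n)"
    hence C: "\<And>i. graded_sub A (C i)" "\<And>i n. max_smult A V n \<subseteq> C i n" "\<And>i n. C i n \<subseteq> V n" "\<And>i n. C i n \<subseteq> C (Suc i) n"
      by auto
    have "\<exists>m. \<forall>i\<ge>m. C i n = C m n" for n
    proof -
      have kC: "K_sub A (C i n)" for i using graded_sub_K_sub[OF C(1)] .
      have kV: "K_sub A (V n)" using graded_sub_K_sub[OF V] .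
      have fdC: "K_fin A (C i n)" for i by (rule K_fin_subspace(1)[OF kV kC C(3) fdV])
      define d where "d = Max (range (\<lambda>i. K_dim A (C i n)))"
      have "range (\<lambda>i. K_dim A (C i n)) \<subseteq> {..K_dim A (V n)}"
        using K_fin_subspace(2)[OF kV kC C(3) fdV] by auto
      hence fin: "finite (range (\<lambda>i. K_dim A (C i n)))" by (rule finite_subset) simp
      have "d \<in> range (\<lambda>i. K_dim A (C i n))" unfolding d_def using fin by (intro Max_in) auto
      then obtain m where m: "K_dim A (C m n) = d" by auto
      have "C i n = C m n" if "m \<le> i" for i
      proof -
        have le: "C m n \<subseteq> C i n" using chain_mono[where C = C, OF C(4) that] .
        have "K_dim A (C m n) \<le> K_dim A (C i n)" using K_fin_subspace(2)[OF kC kC le fdC] .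
        moreover have "K_dim A (C i n) \<le> d" unfolding d_def using fin by (intro Max_ge) auto
        ultimately show ?thesis using K_fin_subspace(3)[OF kC kC le fdC] m by simp
      qed
      thus ?thesis by blast
    qed
    then obtain m where m: "\<And>n i. m n \<le> i \<Longrightarrow> C i n = C (m n) n" by metis
    \<comment> \<open>Below \<open>s\<close> all members are zero and above \<open>c\<close> they
      all equal \<open>V\<close>, so finitely many degrees have to become stable; inserting 0 covers
      an empty range.\<close>
    define M where "M = Max (insert 0 (m ` {s..c}))"
    have M: "m n \<le> M" if "n \<in> {s..c}" for n unfolding M_def using that by (intro Max_ge) auto
    have "C i n = C M n" if "M \<le> i" for i n
    proof (cases "n \<in> {s..c}")
      case True
      thus ?thesis using m[of n i] m[of n M] M[OF True] that by simp
    next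
      case False
      have "C j n = V n" for j
      proof (cases "n < s")
        case True
        thus ?thesis using bdd[OF True] C(3)[of j n] graded_subD(3)[OF C(1)[of j], of n] by auto
      next
        case F: False
        thus ?thesis using False gen[of n] C(2)[of n j] C(3)[of j n] by auto
      qed
      thus ?thesis by simp
    qed
    thus "\<exists>m. \<forall>i\<ge>m. C i = C m" by (intro exI[of _ M]) auto
  qed
  \<comment> \<open>\<open>j\<close> counts the generators already removed from the lower
    bound.\<close>
  have "asc_chain A (gens_smult A (e - j) V) V" if "j \<le> e" for j
    using that
  proof (induction j)
    case 0
    thus ?case using base by simp
  next
    case (Suc j)
    have k: "e - j = Suc (e - Suc j)" using Suc by simp
    have eq: "gens_smult A (e - j) V = (\<lambda>n. {w \<oplus>\<^bsub>A\<^esub> x (e - Suc j) \<odot>\<^bsub>A\<^esub> v | w v. w \<in> gens_smult A (e - Suc j) V n \<and>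
        v \<in> V (n - dg (e - Suc j))})"
      unfolding k by (intro ext) simp
    have "asc_chain A (gens_smult A (e - j) V) V" using Suc by simp
    thus ?case unfolding eq
      using Suc.prems by (intro asc_chain_step[OF V _ graded_sub_gens_smult(1)[OF V] bdd]) auto
  qed
  moreover have "gens_smult A 0 V = (\<lambda>_. {\<zero>\<^bsub>A\<^esub>})" by (intro ext) simp
  ultimately show ?thesis using diff_self_eq_0[of e] by (metis order_refl)
qed

text \<open>
  By graded Nakayama, a family bounded below with finite-dimensional pieces is finitely generated if and
  only if \<open>U = x\<^sub>1 U + \<dots> + x\<^sub>e U\<close> in all large degrees.
\<close>

definition fin_gen :: "('a, 'x, 's) module_scheme \<Rightarrow> (int \<Rightarrow> 'x set) \<Rightarrow> bool" where
  "fin_gen A U \<longleftrightarrow> graded_sub A U \<and> (\<exists>s. \<forall>n<s. U n = {\<zero>\<^bsub>A\<^esub>}) \<and> (\<forall>n. K_fin A (U n)) \<and>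
    (\<exists>c. \<forall>n>c. U n \<subseteq> max_smult A U n)"

lemma fin_genD:
  assumes "fin_gen A U" shows "graded_sub A U" "K_fin A (U n)" "K_sub A (U n)"
  using assms graded_sub_K_sub by (auto simp: fin_gen_def)

text \<open>The chain consists of the submodules \<open>C i\<close> that agree with \<open>U\<close>
  up to degree \<open>i\<close> and with the multiples of the generators in \<open>U\<close> beyond.
  They are submodules because scalars of positive degree map \<open>U\<close> into those multiples.
  Once the chain is stable at \<open>M\<close>, both descriptions agree in all degrees above
  \<open>M\<close>.\<close>

lemma fin_gen_subfamily:
  assumes V: "fin_gen A V" and U: "graded_sub A U" and UV: "\<And>n. U n \<subseteq> V n"
  shows "fin_gen A U"
proof -
  have gV: "graded_sub A V" and fdV: "\<And>n. K_fin A (V n)" using V by (auto simp: fin_gen_def)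
  obtain s c where s: "\<And>n. n < s \<Longrightarrow> V n = {\<zero>\<^bsub>A\<^esub>}" and c: "\<And>n. c < n \<Longrightarrow> V n \<subseteq> max_smult A V n"
    using V by (auto simp: fin_gen_def)
  have sU: "U n = {\<zero>\<^bsub>A\<^esub>}" if "n < s" for n
    using UV[of n] s[OF that] graded_subD(3)[OF U, of n] by auto
  have fdU: "K_fin A (U n)" for n
    by (rule K_fin_subspace(1)[OF graded_sub_K_sub[OF gV] graded_sub_K_sub[OF U] UV fdV])
  note max_smult = graded_sub_gens_smult[OF U order_refl]
  define C where "C i n = (if n \<le> int i then U n else max_smult A U n)" for i n
  have CU: "C i n \<subseteq> U n" for i n using max_smult(2) by (auto simp: C_def)
  have mxC: "max_smult A U n \<subseteq> C i n" for i n using max_smult(2) by (auto simp: C_def)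
  have gC: "graded_sub A (C i)" for i
    unfolding graded_sub_def
  proof (intro conjI allI ballI)
    show "Module.module R A" "C i n \<subseteq> carrier A" for n
      using graded_subD(1,7)[OF U] CU by blast+
    show "\<zero>\<^bsub>A\<^esub> \<in> C i n" for n using graded_subD(3)[OF U] graded_subD(3)[OF max_smult(1)] by (auto simp: C_def)
    show "u \<oplus>\<^bsub>A\<^esub> v \<in> C i n" if "u \<in> C i n" "v \<in> C i n" for n u v
      using that graded_subD(4)[OF U] graded_subD(4)[OF max_smult(1)] by (auto simp: C_def split: if_splits)
    fix m n r u assume r: "r \<in> gR m" and u: "u \<in> C i n"
    show "r \<odot>\<^bsub>A\<^esub> u \<in> C i (m + n)"
    proof (cases "0 < m")
      case True
      have "u \<in> U n" using u CU by blast
      from max_smult_smult[OF U r True this] show ?thesis using mxC by blast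
    next
      case False
      consider "m < 0" | "m = 0" using False by linarith
      thus ?thesis
      proof cases
        case 1
        hence "r = \<zero>" using r neg_degree by auto
        moreover have "u \<in> carrier A" using u CU graded_subD(2)[OF U] by blast
        ultimately have "r \<odot>\<^bsub>A\<^esub> u = \<zero>\<^bsub>A\<^esub>"
          using module.smult_l_null[OF graded_subD(1)[OF U]] by simp
        thus ?thesis using graded_subD(3)[OF U] graded_subD(3)[OF max_smult(1)] by (auto simp: C_def)
      next
        case 2
        thus ?thesis using u graded_subD(5)[OF U r] graded_subD(5)[OF max_smult(1) r]
          by (auto simp: C_def split: if_splits)
      qed
    qed
  qed
  have "asc_chain A (\<lambda>_. {\<zero>\<^bsub>A\<^esub>}) V" by (rule asc_chain_generated[OF gV s fdV c])
  moreover have "C i n \<subseteq> V n" for i n using CU UV by blast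
  moreover have "C i n \<subseteq> C (Suc i) n" "{\<zero>\<^bsub>A\<^esub>} \<subseteq> C i n" for i n
    using graded_subD(3)[OF gC] max_smult(2)[of n] by (auto simp: C_def)
  ultimately obtain M where M: "\<And>i. M \<le> i \<Longrightarrow> C i = C M"
    unfolding asc_chain_def using gC by meson
  have "U n \<subseteq> max_smult A U n" if "int M < n" for n
  proof -
    have "U n = C (nat n) n" using that by (simp add: C_def)
    also have "C (nat n) = C M" using that by (intro M) linarith
    also have "C M n = max_smult A U n" using that by (simp add: C_def)
    finally show ?thesis by simp
  qed
  thus ?thesis unfolding fin_gen_def using U sU fdU by blast
qed

lemma fin_gen_fun_family:
  assumes U: "fin_gen A U" and J: "finite J"
  shows "fin_gen (fun_mod A) (fun_family A U J \<delta>)"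
proof -
  have gU: "graded_sub A U" and fdU: "\<And>n. K_fin A (U n)" using U by (auto simp: fin_gen_def)
  interpret A: Module.module R A using gU by (rule graded_subD)
  obtain s c where s: "\<And>n. n < s \<Longrightarrow> U n = {\<zero>\<^bsub>A\<^esub>}" and c: "\<And>n. c < n \<Longrightarrow> U n \<subseteq> max_smult A U n"
    using U by (auto simp: fin_gen_def)
  \<comment> \<open>Zero is inserted so that the extrema exist for empty \<open>J\<close>
    too.\<close>
  define lo where "lo = Min (insert 0 (\<delta> ` J))"
  define hi where "hi = Max (insert 0 (\<delta> ` J))"
  have lo: "lo \<le> \<delta> j" if "j \<in> J" for j unfolding lo_def using J that by (intro Min_le) auto
  have hi: "\<delta> j \<le> hi" if "j \<in> J" for j unfolding hi_def using J that by (intro Max_ge) auto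
  have "fun_family A U J \<delta> n = {\<zero>\<^bsub>fun_mod A\<^esub>}" if n: "n < s + lo" for n
  proof -
    have "f = (\<lambda>_. \<zero>\<^bsub>A\<^esub>)" if f: "f \<in> fun_family A U J \<delta> n" for f
    proof
      fix j show "f j = \<zero>\<^bsub>A\<^esub>"
        using f n lo[of j] s[of "n - \<delta> j"] by (cases "j \<in> J") (auto simp: fun_family_def)
    qed
    moreover have "\<zero>\<^bsub>fun_mod A\<^esub> \<in> fun_family A U J \<delta> n" using graded_subD(3)[OF graded_sub_fun_family[OF gU]] .
    ultimately show ?thesis unfolding fun_mod_simps by blast
  qed
  moreover have "f \<in> gens_smult (fun_mod A) k (fun_family A U J \<delta>) n"
    if "k \<le> e" "\<forall>j\<in>J. f j \<in> gens_smult A k U (n - \<delta> j)" "\<forall>j. j \<notin> J \<longrightarrow> f j = \<zero>\<^bsub>A\<^esub>" for k n f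
    using that
  proof (induction k arbitrary: f)
    case 0
    hence "f = (\<lambda>_. \<zero>\<^bsub>A\<^esub>)" by (auto simp: fun_eq_iff)
    thus ?case by simp
  next
    case (Suc k)
    have "\<forall>j\<in>J. \<exists>w v. w \<in> gens_smult A k U (n - \<delta> j) \<and> v \<in> U (n - \<delta> j - dg k) \<and> f j = w \<oplus>\<^bsub>A\<^esub> x k \<odot>\<^bsub>A\<^esub> v"
      using Suc.prems(2) by auto
    then obtain w v where wv: "\<And>j. j \<in> J \<Longrightarrow> w j \<in> gens_smult A k U (n - \<delta> j)"
      "\<And>j. j \<in> J \<Longrightarrow> v j \<in> U (n - \<delta> j - dg k)" "\<And>j. j \<in> J \<Longrightarrow> f j = w j \<oplus>\<^bsub>A\<^esub> x k \<odot>\<^bsub>A\<^esub> v j"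
      by metis
    define w' where "w' j = (if j \<in> J then w j else \<zero>\<^bsub>A\<^esub>)" for j
    define v' where "v' j = (if j \<in> J then v j else \<zero>\<^bsub>A\<^esub>)" for j
    have "x k \<in> carrier R" using x_deg[of k] gR_carrier Suc.prems by auto
    hence "f = w' \<oplus>\<^bsub>fun_mod A\<^esub> x k \<odot>\<^bsub>fun_mod A\<^esub> v'"
      using wv(3) Suc.prems(3) by (auto simp: w'_def v'_def fun_eq_iff)
    moreover have "w' \<in> gens_smult (fun_mod A) k (fun_family A U J \<delta>) n"
      using wv(1) Suc.prems by (intro Suc.IH) (auto simp: w'_def)
    moreover have "v' \<in> fun_family A U J \<delta> (n - dg k)"
      using wv(2) by (auto simp: v'_def fun_family_def algebra_simps)
    ultimately show ?case unfolding ideal_smult.simps by blast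
  qed
  hence "fun_family A U J \<delta> n \<subseteq> max_smult (fun_mod A) (fun_family A U J \<delta>) n" if "c + hi < n" for n
    using c hi that unfolding fun_family_def
    by (smt (verit, ccfv_threshold) mem_Collect_eq order_refl subset_iff)
  ultimately show ?thesis
    unfolding fin_gen_def using graded_sub_fun_family[OF gU] fun_family_dim(1)[OF gU J fdU] by blast
qed

end

section \<open>The Koszul complex\<close>

context graded_algebra begin

text \<open>
  Nothing is required of the values outside of the pieces \<open>U n\<close>.
\<close>

definition graded_hom :: "('a, 'x, 's) module_scheme \<Rightarrow> (int \<Rightarrow> 'x set) \<Rightarrow> ('a, 'y, 't) module_scheme \<Rightarrow> (int \<Rightarrow> 'y set) \<Rightarrow> int \<Rightarrow> ('x \<Rightarrow> 'y) set" where
  "graded_hom A U B W a = {f. (\<forall>n. \<forall>u\<in>U n. f u \<in> W (a + n)) \<and>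
    (\<forall>n. \<forall>u\<in>U n. \<forall>v\<in>U n. f (u \<oplus>\<^bsub>A\<^esub> v) = f u \<oplus>\<^bsub>B\<^esub> f v) \<and>
    (\<forall>m n. \<forall>r\<in>gR m. \<forall>u\<in>U n. f (r \<odot>\<^bsub>A\<^esub> u) = r \<odot>\<^bsub>B\<^esub> f u)}"

lemma graded_homD:
  assumes "f \<in> graded_hom A U B W a"
  shows "u \<in> U n \<Longrightarrow> f u \<in> W (a + n)"
    "u \<in> U n \<Longrightarrow> v \<in> U n \<Longrightarrow> f (u \<oplus>\<^bsub>A\<^esub> v) = f u \<oplus>\<^bsub>B\<^esub> f v"
    "r \<in> gR m \<Longrightarrow> u \<in> U n \<Longrightarrow> f (r \<odot>\<^bsub>A\<^esub> u) = r \<odot>\<^bsub>B\<^esub> f u"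
  using assms by (auto simp: graded_hom_def)

lemma graded_homD0: "f \<in> graded_hom A U B W 0 \<Longrightarrow> u \<in> U n \<Longrightarrow> f u \<in> W n"
  using graded_homD(1)[of f A U B W 0 u n] by simp

lemma graded_hom_K_lin:
  assumes "graded_sub B W" "f \<in> graded_hom A U B W a" shows "K_lin A (U n) B f"
  using graded_homD[OF assms(2)] graded_subD[OF assms(1)] unfolding K_lin_def by blast

lemma graded_hom_zero:
  assumes "graded_sub A U" "graded_sub B W" "f \<in> graded_hom A U B W a" shows "f \<zero>\<^bsub>A\<^esub> = \<zero>\<^bsub>B\<^esub>"
  using K_lin_zero[OF graded_sub_K_sub[OF assms(1)] graded_hom_K_lin[OF assms(2,3)]] .

lemma graded_hom_minus:
  assumes "graded_sub A U" "graded_sub B W" "f \<in> graded_hom A U B W a" "u \<in> U n"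
  shows "f (\<ominus>\<^bsub>A\<^esub> u) = \<ominus>\<^bsub>B\<^esub> f u"
proof -
  interpret A: Module.module R A using assms(1) by (rule graded_subD)
  interpret B: Module.module R B using assms(2) by (rule graded_subD)
  have u: "u \<in> carrier A" "f u \<in> carrier B"
    using graded_subD(2)[OF assms(1,4)] graded_subD(2)[OF assms(2) graded_homD(1)[OF assms(3,4)]] by auto
  have nu: "\<ominus>\<^bsub>A\<^esub> u \<in> U n" by (rule graded_sub_neg[OF assms(1,4)])
  have "f (\<ominus>\<^bsub>A\<^esub> u) \<oplus>\<^bsub>B\<^esub> f u = \<zero>\<^bsub>B\<^esub>"
    using graded_homD(2)[OF assms(3) nu assms(4)] u graded_hom_zero[OF assms(1-3)] by (simp add: A.l_neg)
  moreover have "f (\<ominus>\<^bsub>A\<^esub> u) \<in> carrier B"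
    using graded_subD(2)[OF assms(2)] graded_homD(1)[OF assms(3) nu] by blast
  ultimately show ?thesis using B.minus_equality u(2) by metis
qed

lemma graded_hom_diff:
  assumes "graded_sub A U" "graded_sub B W" "f \<in> graded_hom A U B W a" "u \<in> U n" "v \<in> U n"
  shows "f (u \<ominus>\<^bsub>A\<^esub> v) = f u \<ominus>\<^bsub>B\<^esub> f v"
  using graded_homD(2)[OF assms(3,4) graded_sub_neg[OF assms(1,5)]] graded_hom_minus[OF assms(1-3,5)]
  by (simp add: a_minus_def)

lemma graded_hom_comp:
  assumes "f \<in> graded_hom A U B W a" "g \<in> graded_hom B W C Z b"
  shows "(\<lambda>u. g (f u)) \<in> graded_hom A U C Z (b + a)"
  unfolding graded_hom_def
proof (intro CollectI conjI allI ballI)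
  show "g (f u) \<in> Z (b + a + n)" if "u \<in> U n" for n u
    using graded_homD(1)[OF assms(2) graded_homD(1)[OF assms(1) that]] by (simp add: add.assoc)
  show "g (f (u \<oplus>\<^bsub>A\<^esub> v)) = g (f u) \<oplus>\<^bsub>C\<^esub> g (f v)" if "u \<in> U n" "v \<in> U n" for n u v
    using graded_homD(2)[OF assms(1) that] graded_homD(2)[OF assms(2) graded_homD(1)[OF assms(1) that(1)] graded_homD(1)[OF assms(1) that(2)]]
    by simp
  show "g (f (r \<odot>\<^bsub>A\<^esub> u)) = r \<odot>\<^bsub>C\<^esub> g (f u)" if "r \<in> gR m" "u \<in> U n" for m n r u
    using graded_homD(3)[OF assms(1) that] graded_homD(3)[OF assms(2) that(1) graded_homD(1)[OF assms(1) that(2)]] by simp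
qed

end

context generated_graded_algebra begin

text \<open>
  Chains are functions on the subsets of \<open>{..<k}\<close>. Splitting a chain as \<open>(f\<^sub>0, f\<^sub>1)\<close> according to whether the
  last index belongs to the subset, the differential is \<open>(f\<^sub>0, f\<^sub>1) \<mapsto> (d f\<^sub>0 + x f\<^sub>1, - d f\<^sub>1)\<close>.
\<close>

fun koszul_map :: "('a, 'x, 's) module_scheme \<Rightarrow> nat \<Rightarrow> (nat set \<Rightarrow> 'x) \<Rightarrow> nat set \<Rightarrow> 'x" where
  "koszul_map A 0 f S = \<zero>\<^bsub>A\<^esub>"
| "koszul_map A (Suc k) f S = (if k \<in> S then \<ominus>\<^bsub>A\<^esub> koszul_map A k (\<lambda>T. f (insert k T)) (S - {k})
     else koszul_map A k f S \<oplus>\<^bsub>A\<^esub> x k \<odot>\<^bsub>A\<^esub> f (insert k S))"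

text \<open>
  The homotopy that shows multiplication by \<open>x i\<close> to be zero on Koszul homology.
\<close>

fun koszul_homotopy :: "('a, 'x, 's) module_scheme \<Rightarrow> nat \<Rightarrow> nat \<Rightarrow> (nat set \<Rightarrow> 'x) \<Rightarrow> nat set \<Rightarrow> 'x" where
  "koszul_homotopy A 0 i f S = \<zero>\<^bsub>A\<^esub>"
| "koszul_homotopy A (Suc k) i f S = (if i = k then (if k \<in> S then f (S - {k}) else \<zero>\<^bsub>A\<^esub>)
     else (if k \<in> S then \<ominus>\<^bsub>A\<^esub> koszul_homotopy A k i (\<lambda>T. f (insert k T)) (S - {k}) else koszul_homotopy A k i f S))"

lemma koszul_map_cong:
  "(\<And>S. S \<subseteq> {..<k} \<Longrightarrow> f S = g S) \<Longrightarrow> S \<subseteq> {..<k} \<Longrightarrow> koszul_map A k f S = koszul_map A k g S"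
proof (induction k arbitrary: f g S)
  case (Suc k)
  have eq: "f T = g T" if "T \<subseteq> {..<Suc k}" for T by (rule Suc.prems(1)[OF that])
  have 1: "koszul_map A k (\<lambda>T. f (insert k T)) (S - {k}) = koszul_map A k (\<lambda>T. g (insert k T)) (S - {k})"
  proof (rule Suc.IH)
    show "f (insert k T) = g (insert k T)" if "T \<subseteq> {..<k}" for T
      using that by (intro eq) (auto simp: less_Suc_eq)
    show "S - {k} \<subseteq> {..<k}" using Suc.prems(2) by (auto simp: less_Suc_eq)
  qed
  have 2: "koszul_map A k f S = koszul_map A k g S" if "k \<notin> S"
  proof (rule Suc.IH)
    show "f T = g T" if "T \<subseteq> {..<k}" for T
      using that by (intro eq) (auto simp: less_Suc_eq)
    show "S \<subseteq> {..<k}" using Suc.prems(2) that by (auto simp: less_Suc_eq)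
  qed
  have 3: "f (insert k S) = g (insert k S)" using Suc.prems(2) by (intro eq) auto
  show ?case using 1 2 3 by (cases "k \<in> S") simp_all
qed simp

lemma koszul_homotopy_cong:
  "(\<And>S. S \<subseteq> {..<k} \<Longrightarrow> f S = g S) \<Longrightarrow> S \<subseteq> {..<k} \<Longrightarrow> koszul_homotopy A k i f S = koszul_homotopy A k i g S"
proof (induction k arbitrary: f g S)
  case (Suc k)
  have eq: "f T = g T" if "T \<subseteq> {..<Suc k}" for T by (rule Suc.prems(1)[OF that])
  have 1: "koszul_homotopy A k i (\<lambda>T. f (insert k T)) (S - {k}) = koszul_homotopy A k i (\<lambda>T. g (insert k T)) (S - {k})"
  proof (rule Suc.IH)
    show "f (insert k T) = g (insert k T)" if "T \<subseteq> {..<k}" for T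
      using that by (intro eq) (auto simp: less_Suc_eq)
    show "S - {k} \<subseteq> {..<k}" using Suc.prems(2) by (auto simp: less_Suc_eq)
  qed
  have 2: "koszul_homotopy A k i f S = koszul_homotopy A k i g S" if "k \<notin> S"
  proof (rule Suc.IH)
    show "f T = g T" if "T \<subseteq> {..<k}" for T
      using that by (intro eq) (auto simp: less_Suc_eq)
    show "S \<subseteq> {..<k}" using Suc.prems(2) that by (auto simp: less_Suc_eq)
  qed
  have 3: "f (S - {k}) = g (S - {k})" using Suc.prems(2) by (intro eq) auto
  show ?case using 1 2 3 by (cases "k \<in> S"; cases "i = k") simp_all
qed simp

lemma x_carrier: "k < e \<Longrightarrow> x k \<in> carrier R"
  using x_deg gR_carrier by blast

context
  fixes A :: "('a, 'x, 's) module_scheme"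
  assumes mA: "Module.module R A"
begin

interpretation A: Module.module R A by (rule mA)

lemma koszul_map_closed: "k \<le> e \<Longrightarrow> (\<And>S. f S \<in> carrier A) \<Longrightarrow> koszul_map A k f S \<in> carrier A"
  by (induction k arbitrary: f S) (simp_all add: x_carrier)

lemma koszul_homotopy_closed: "(\<And>S. f S \<in> carrier A) \<Longrightarrow> koszul_homotopy A k i f S \<in> carrier A"
  by (induction k arbitrary: f S) simp_all

lemma koszul_map_add:
  "k \<le> e \<Longrightarrow> (\<And>S. f S \<in> carrier A) \<Longrightarrow> (\<And>S. g S \<in> carrier A) \<Longrightarrow>
   koszul_map A k (\<lambda>S. f S \<oplus>\<^bsub>A\<^esub> g S) S = koszul_map A k f S \<oplus>\<^bsub>A\<^esub> koszul_map A k g S"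
  by (induction k arbitrary: f g S)
    (simp_all add: x_carrier koszul_map_closed A.minus_add A.smult_r_distr A.a_ac)

lemma koszul_map_smult:
  "k \<le> e \<Longrightarrow> r \<in> carrier R \<Longrightarrow> (\<And>S. f S \<in> carrier A) \<Longrightarrow>
   koszul_map A k (\<lambda>S. r \<odot>\<^bsub>A\<^esub> f S) S = r \<odot>\<^bsub>A\<^esub> koszul_map A k f S"
proof (induction k arbitrary: f S)
  case (Suc k)
  have "x k \<odot>\<^bsub>A\<^esub> (r \<odot>\<^bsub>A\<^esub> f (insert k S)) = r \<odot>\<^bsub>A\<^esub> (x k \<odot>\<^bsub>A\<^esub> f (insert k S))"
    using Suc.prems by (simp add: x_carrier m_comm flip: A.smult_assoc1)
  thus ?case using Suc by (simp add: x_carrier koszul_map_closed A.smult_r_distr A.smult_r_minus)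
qed simp

lemma koszul_homotopy_add:
  "(\<And>S. f S \<in> carrier A) \<Longrightarrow> (\<And>S. g S \<in> carrier A) \<Longrightarrow>
   koszul_homotopy A k i (\<lambda>S. f S \<oplus>\<^bsub>A\<^esub> g S) S = koszul_homotopy A k i f S \<oplus>\<^bsub>A\<^esub> koszul_homotopy A k i g S"
  by (induction k arbitrary: f g S) (simp_all add: koszul_homotopy_closed A.minus_add)

lemma koszul_homotopy_smult:
  "r \<in> carrier R \<Longrightarrow> (\<And>S. f S \<in> carrier A) \<Longrightarrow>
   koszul_homotopy A k i (\<lambda>S. r \<odot>\<^bsub>A\<^esub> f S) S = r \<odot>\<^bsub>A\<^esub> koszul_homotopy A k i f S"
  by (induction k arbitrary: f S) (simp_all add: koszul_homotopy_closed A.smult_r_minus)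

lemma minus_as_smult: "u \<in> carrier A \<Longrightarrow> \<ominus>\<^bsub>A\<^esub> u = (\<ominus> \<one>) \<odot>\<^bsub>A\<^esub> u"
  by (subst A.smult_l_minus) auto

lemma koszul_map_minus:
  assumes "k \<le> e" "\<And>S. f S \<in> carrier A"
  shows "koszul_map A k (\<lambda>S. \<ominus>\<^bsub>A\<^esub> f S) S = \<ominus>\<^bsub>A\<^esub> koszul_map A k f S"
proof -
  have "(\<lambda>S. \<ominus>\<^bsub>A\<^esub> f S) = (\<lambda>S. (\<ominus> \<one>) \<odot>\<^bsub>A\<^esub> f S)"
    using assms by (intro ext minus_as_smult)
  thus ?thesis using koszul_map_smult[OF assms(1) _ assms(2), of "\<ominus> \<one>"] minus_as_smult koszul_map_closed[OF assms]
    by simp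
qed

lemma koszul_homotopy_minus:
  assumes "\<And>S. f S \<in> carrier A"
  shows "koszul_homotopy A k i (\<lambda>S. \<ominus>\<^bsub>A\<^esub> f S) S = \<ominus>\<^bsub>A\<^esub> koszul_homotopy A k i f S"
proof -
  have "(\<lambda>S. \<ominus>\<^bsub>A\<^esub> f S) = (\<lambda>S. (\<ominus> \<one>) \<odot>\<^bsub>A\<^esub> f S)"
    using assms by (intro ext minus_as_smult)
  thus ?thesis using koszul_homotopy_smult[OF _ assms, of "\<ominus> \<one>"] minus_as_smult koszul_homotopy_closed[OF assms]
    by simp
qed

text \<open>In terms of the splitting, the square of the differential sends the pair (f0, f1) to (d
  d f0 + d (x f1) - x d f1, d d f1); the two mixed terms cancel by linearity and the rest vanishes
  by induction.\<close>

lemma koszul_map_koszul_map: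
  "k \<le> e \<Longrightarrow> (\<And>S. f S \<in> carrier A) \<Longrightarrow> S \<subseteq> {..<k} \<Longrightarrow> koszul_map A k (koszul_map A k f) S = \<zero>\<^bsub>A\<^esub>"
proof (induction k arbitrary: f S)
  case (Suc k)
  have k: "k \<le> e" "x k \<in> carrier R" using Suc.prems x_carrier[of k] by auto
  let ?f1 = "\<lambda>T. f (insert k T)"
  have fc: "f T \<in> carrier A" for T by (rule Suc.prems(2))
  note kc = koszul_map_closed[OF k(1) fc]
  show ?case
  proof (cases "k \<in> S")
    case True
    have S: "S - {k} \<subseteq> {..<k}" using Suc.prems by (auto simp: less_Suc_eq)
    have 1: "koszul_map A k (\<lambda>T. koszul_map A (Suc k) f (insert k T)) (S - {k}) = koszul_map A k (\<lambda>T. \<ominus>\<^bsub>A\<^esub> koszul_map A k ?f1 T) (S - {k})"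
    proof (rule koszul_map_cong[OF _ S])
      fix T assume "T \<subseteq> {..<k}"
      hence "insert k T - {k} = T" by auto
      thus "koszul_map A (Suc k) f (insert k T) = \<ominus>\<^bsub>A\<^esub> koszul_map A k ?f1 T" by simp
    qed
    have 2: "koszul_map A k (\<lambda>T. \<ominus>\<^bsub>A\<^esub> koszul_map A k ?f1 T) (S - {k}) = \<ominus>\<^bsub>A\<^esub> koszul_map A k (koszul_map A k ?f1) (S - {k})"
      by (rule koszul_map_minus[OF k(1) kc])
    have "koszul_map A (Suc k) (koszul_map A (Suc k) f) S = \<ominus>\<^bsub>A\<^esub> koszul_map A k (\<lambda>T. koszul_map A (Suc k) f (insert k T)) (S - {k})"
      by (simp only: koszul_map.simps(2)[of A k "koszul_map A (Suc k) f" S] True if_True)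
    hence "koszul_map A (Suc k) (koszul_map A (Suc k) f) S = \<ominus>\<^bsub>A\<^esub> (\<ominus>\<^bsub>A\<^esub> koszul_map A k (koszul_map A k ?f1) (S - {k}))"
      by (simp only: 1 2)
    also have "\<dots> = \<zero>\<^bsub>A\<^esub>" by (simp add: Suc.IH[OF k(1) fc S])
    finally show ?thesis .
  next
    case False
    have S: "S \<subseteq> {..<k}" using Suc.prems False by (auto simp: less_Suc_eq)
    have 1: "koszul_map A k (koszul_map A (Suc k) f) S = koszul_map A k (\<lambda>T. koszul_map A k f T \<oplus>\<^bsub>A\<^esub> x k \<odot>\<^bsub>A\<^esub> ?f1 T) S"
      by (rule koszul_map_cong[OF _ S]) (auto simp: subset_iff)
    have 2: "koszul_map A k (\<lambda>T. koszul_map A k f T \<oplus>\<^bsub>A\<^esub> x k \<odot>\<^bsub>A\<^esub> ?f1 T) S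
        = koszul_map A k (koszul_map A k f) S \<oplus>\<^bsub>A\<^esub> koszul_map A k (\<lambda>T. x k \<odot>\<^bsub>A\<^esub> ?f1 T) S"
      using kc fc k by (intro koszul_map_add) auto
    have 3: "koszul_map A k (\<lambda>T. x k \<odot>\<^bsub>A\<^esub> ?f1 T) S = x k \<odot>\<^bsub>A\<^esub> koszul_map A k ?f1 S"
      by (rule koszul_map_smult[OF k fc])
    have "insert k S - {k} = S" using False by simp
    hence "koszul_map A (Suc k) (koszul_map A (Suc k) f) S = koszul_map A k (koszul_map A (Suc k) f) S \<oplus>\<^bsub>A\<^esub> x k \<odot>\<^bsub>A\<^esub> (\<ominus>\<^bsub>A\<^esub> koszul_map A k ?f1 S)"
      using False by (simp only: koszul_map.simps(2)[of A k "koszul_map A (Suc k) f" S] koszul_map.simps(2)[of A k f "insert k S"]) simp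
    hence "koszul_map A (Suc k) (koszul_map A (Suc k) f) S =
        (koszul_map A k (koszul_map A k f) S \<oplus>\<^bsub>A\<^esub> x k \<odot>\<^bsub>A\<^esub> koszul_map A k ?f1 S) \<oplus>\<^bsub>A\<^esub> x k \<odot>\<^bsub>A\<^esub> (\<ominus>\<^bsub>A\<^esub> koszul_map A k ?f1 S)"
      by (simp only: 1 2 3)
    also have "\<dots> = \<zero>\<^bsub>A\<^esub>"
      using kc k by (simp add: Suc.IH[OF k(1) fc S] A.smult_r_minus A.r_neg)
    finally show ?thesis .
  qed
qed simp

text \<open>For the last index the homotopy is (f0, f1) \<mapsto> (0, f0), and the terms with d f0
  cancel. For an earlier index it is (f0, f1) \<mapsto> (h f0, - h f1), and its sign makes the terms
  containing \<open>x k\<close> cancel, so that induction applies to both halves.\<close>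

lemma koszul_map_koszul_homotopy:
  "k \<le> e \<Longrightarrow> i < k \<Longrightarrow> (\<And>S. f S \<in> carrier A) \<Longrightarrow> S \<subseteq> {..<k} \<Longrightarrow>
   koszul_map A k (koszul_homotopy A k i f) S \<oplus>\<^bsub>A\<^esub> koszul_homotopy A k i (koszul_map A k f) S = x i \<odot>\<^bsub>A\<^esub> f S"
proof (induction k arbitrary: f S)
  case (Suc k)
  have k: "k \<le> e" "x k \<in> carrier R" using Suc.prems x_carrier[of k] by auto
  let ?f1 = "\<lambda>T. f (insert k T)"
  have fc: "f T \<in> carrier A" for T by (rule Suc.prems(3))
  note kc = koszul_map_closed[OF k(1) fc]
  note hc = koszul_homotopy_closed[OF fc]
  have ins: "T - {k} = T" if "T \<subseteq> {..<k}" for T using that by auto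
  have S': "S - {k} \<subseteq> {..<k}" using Suc.prems by (auto simp: less_Suc_eq)
  have S: "S \<subseteq> {..<k}" if "k \<notin> S" using Suc.prems that by (auto simp: less_Suc_eq)
  show ?case
  proof (cases "i = k")
    case True
    show ?thesis
    proof (cases "k \<in> S")
      case k1: True
      have "koszul_map A k (\<lambda>T. koszul_homotopy A (Suc k) i f (insert k T)) (S - {k}) = koszul_map A k f (S - {k})"
        by (rule koszul_map_cong[OF _ S']) (simp add: ins True)
      hence "koszul_map A (Suc k) (koszul_homotopy A (Suc k) i f) S = \<ominus>\<^bsub>A\<^esub> koszul_map A k f (S - {k})"
        by (simp only: koszul_map.simps(2)[of A k "koszul_homotopy A (Suc k) i f" S] k1 if_True)
      moreover have "koszul_homotopy A (Suc k) i (koszul_map A (Suc k) f) S = koszul_map A k f (S - {k}) \<oplus>\<^bsub>A\<^esub> x k \<odot>\<^bsub>A\<^esub> f S"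
        using k1 True by (simp add: insert_absorb)
      ultimately have "koszul_map A (Suc k) (koszul_homotopy A (Suc k) i f) S \<oplus>\<^bsub>A\<^esub> koszul_homotopy A (Suc k) i (koszul_map A (Suc k) f) S =
          \<ominus>\<^bsub>A\<^esub> koszul_map A k f (S - {k}) \<oplus>\<^bsub>A\<^esub> (koszul_map A k f (S - {k}) \<oplus>\<^bsub>A\<^esub> x k \<odot>\<^bsub>A\<^esub> f S)"
        by (simp only:)
      also have "\<dots> = x i \<odot>\<^bsub>A\<^esub> f S"
        using True kc fc k by (simp add: A.l_neg flip: A.a_assoc)
      finally show ?thesis .
    next
      case k0: False
      \<comment> \<open>The zero chain is written as \<open>\<zero>\<close> times \<open>f\<close>,
        so that linearity of the differential evaluates it.\<close>
      have 1: "koszul_map A k (koszul_homotopy A (Suc k) i f) S = koszul_map A k (\<lambda>T. \<zero> \<odot>\<^bsub>A\<^esub> f T) S"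
        by (rule koszul_map_cong[OF _ S[OF k0]]) (auto simp: True fc)
      have 2: "koszul_map A k (\<lambda>T. \<zero> \<odot>\<^bsub>A\<^esub> f T) S = \<zero>\<^bsub>A\<^esub>"
        using koszul_map_smult[where f = f, OF k(1) zero_closed fc] kc by simp
      have 3: "koszul_homotopy A (Suc k) i f (insert k S) = f S" using True ins[OF S[OF k0]] by simp
      have 4: "koszul_homotopy A (Suc k) i (koszul_map A (Suc k) f) S = \<zero>\<^bsub>A\<^esub>" using True k0 by simp
      have "koszul_map A (Suc k) (koszul_homotopy A (Suc k) i f) S = \<zero>\<^bsub>A\<^esub> \<oplus>\<^bsub>A\<^esub> x k \<odot>\<^bsub>A\<^esub> f S"
        by (simp only: koszul_map.simps(2)[of A k "koszul_homotopy A (Suc k) i f" S] k0 if_False 1 2 3)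
      hence "koszul_map A (Suc k) (koszul_homotopy A (Suc k) i f) S \<oplus>\<^bsub>A\<^esub> koszul_homotopy A (Suc k) i (koszul_map A (Suc k) f) S =
          (\<zero>\<^bsub>A\<^esub> \<oplus>\<^bsub>A\<^esub> x k \<odot>\<^bsub>A\<^esub> f S) \<oplus>\<^bsub>A\<^esub> \<zero>\<^bsub>A\<^esub>"
        by (simp only: 4)
      also have "\<dots> = x i \<odot>\<^bsub>A\<^esub> f S" using True fc k by simp
      finally show ?thesis .
    qed
  next
    case False
    hence ik: "i < k" using Suc.prems by simp
    note IH = Suc.IH[OF k(1) ik fc]
    show ?thesis
    proof (cases "k \<in> S")
      case k1: True
      have "koszul_map A k (\<lambda>T. koszul_homotopy A (Suc k) i f (insert k T)) (S - {k}) = koszul_map A k (\<lambda>T. \<ominus>\<^bsub>A\<^esub> koszul_homotopy A k i ?f1 T) (S - {k})"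
        by (rule koszul_map_cong[OF _ S']) (simp add: ins False)
      moreover have "koszul_map A k (\<lambda>T. \<ominus>\<^bsub>A\<^esub> koszul_homotopy A k i ?f1 T) (S - {k}) = \<ominus>\<^bsub>A\<^esub> koszul_map A k (koszul_homotopy A k i ?f1) (S - {k})"
        by (rule koszul_map_minus[OF k(1) hc])
      ultimately have 1: "koszul_map A (Suc k) (koszul_homotopy A (Suc k) i f) S = koszul_map A k (koszul_homotopy A k i ?f1) (S - {k})"
        using koszul_map_closed[where f = "koszul_homotopy A k i ?f1", OF k(1) hc]
        by (simp only: koszul_map.simps(2)[of A k "koszul_homotopy A (Suc k) i f" S] k1 if_True A.minus_minus)
      have "koszul_homotopy A k i (\<lambda>T. koszul_map A (Suc k) f (insert k T)) (S - {k}) = koszul_homotopy A k i (\<lambda>T. \<ominus>\<^bsub>A\<^esub> koszul_map A k ?f1 T) (S - {k})"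
        by (rule koszul_homotopy_cong[OF _ S']) (simp add: ins)
      moreover have "koszul_homotopy A k i (\<lambda>T. \<ominus>\<^bsub>A\<^esub> koszul_map A k ?f1 T) (S - {k}) = \<ominus>\<^bsub>A\<^esub> koszul_homotopy A k i (koszul_map A k ?f1) (S - {k})"
        by (rule koszul_homotopy_minus[OF kc])
      ultimately have 2: "koszul_homotopy A (Suc k) i (koszul_map A (Suc k) f) S = koszul_homotopy A k i (koszul_map A k ?f1) (S - {k})"
        using koszul_homotopy_closed[where f = "koszul_map A k ?f1", OF kc] False
        by (simp only: koszul_homotopy.simps(2)[of A k i "koszul_map A (Suc k) f" S] k1 if_True if_False A.minus_minus)
      show ?thesis unfolding 1 2 using IH[OF S'] k1 by (simp add: insert_absorb)
    next
      case k0: False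
      note S = S[OF k0]
      have "koszul_map A k (koszul_homotopy A (Suc k) i f) S = koszul_map A k (koszul_homotopy A k i f) S"
        by (rule koszul_map_cong[OF _ S]) (auto simp: False subset_iff)
      moreover have "koszul_homotopy A (Suc k) i f (insert k S) = \<ominus>\<^bsub>A\<^esub> koszul_homotopy A k i ?f1 S"
        using False ins[OF S] by simp
      ultimately have 1: "koszul_map A (Suc k) (koszul_homotopy A (Suc k) i f) S = koszul_map A k (koszul_homotopy A k i f) S \<oplus>\<^bsub>A\<^esub> \<ominus>\<^bsub>A\<^esub> (x k \<odot>\<^bsub>A\<^esub> koszul_homotopy A k i ?f1 S)"
        using k0 hc k by (simp only: koszul_map.simps(2)[of A k "koszul_homotopy A (Suc k) i f" S] if_False A.smult_r_minus)
      have "koszul_homotopy A k i (koszul_map A (Suc k) f) S = koszul_homotopy A k i (\<lambda>T. koszul_map A k f T \<oplus>\<^bsub>A\<^esub> x k \<odot>\<^bsub>A\<^esub> ?f1 T) S"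
        by (rule koszul_homotopy_cong[OF _ S]) (auto simp: subset_iff)
      moreover have "koszul_homotopy A k i (\<lambda>T. koszul_map A k f T \<oplus>\<^bsub>A\<^esub> x k \<odot>\<^bsub>A\<^esub> ?f1 T) S = koszul_homotopy A k i (koszul_map A k f) S \<oplus>\<^bsub>A\<^esub> koszul_homotopy A k i (\<lambda>T. x k \<odot>\<^bsub>A\<^esub> ?f1 T) S"
        using kc fc k by (intro koszul_homotopy_add) auto
      moreover have "koszul_homotopy A k i (\<lambda>T. x k \<odot>\<^bsub>A\<^esub> ?f1 T) S = x k \<odot>\<^bsub>A\<^esub> koszul_homotopy A k i ?f1 S"
        by (rule koszul_homotopy_smult[OF k(2) fc])
      ultimately have 2: "koszul_homotopy A (Suc k) i (koszul_map A (Suc k) f) S = koszul_homotopy A k i (koszul_map A k f) S \<oplus>\<^bsub>A\<^esub> x k \<odot>\<^bsub>A\<^esub> koszul_homotopy A k i ?f1 S"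
        using k0 False by (simp only: koszul_homotopy.simps(2)[of A k i "koszul_map A (Suc k) f" S] if_False)
      have "(u \<oplus>\<^bsub>A\<^esub> \<ominus>\<^bsub>A\<^esub> w) \<oplus>\<^bsub>A\<^esub> (v \<oplus>\<^bsub>A\<^esub> w) = u \<oplus>\<^bsub>A\<^esub> v" if "u \<in> carrier A" "v \<in> carrier A" "w \<in> carrier A" for u v w
        using that by (simp add: A.a_assoc A.a_comm[of v w] A.a_lcomm[of _ w v] A.l_neg flip: A.a_assoc[of _ w])
      thus ?thesis unfolding 1 2
        using IH[OF S] koszul_map_closed[where f = "koszul_homotopy A k i f", OF k(1) hc] koszul_homotopy_closed[where f = "koszul_map A k f", OF kc] hc k by simp
    qed
  qed
qed simp

end

section \<open>The Koszul complex of a graded family\<close>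

abbreviation dS :: "nat set \<Rightarrow> int" where "dS \<equiv> sum dg"

definition KS :: "nat \<Rightarrow> nat set set" where "KS j = {S. S \<subseteq> {..<e} \<and> card S = j}"

text \<open>Moving the summand of \<open>S\<close> up by the total degree of its generators makes
  the differential homogeneous of degree 0.\<close>

abbreviation koszul :: "('a, 'x, 's) module_scheme \<Rightarrow> (int \<Rightarrow> 'x set) \<Rightarrow> nat \<Rightarrow> int \<Rightarrow> (nat set \<Rightarrow> 'x) set" where
  "koszul A U j \<equiv> fun_family A U (KS j) dS"

text \<open>The recursion is meaningful on subsets of \<open>{..<e}\<close>; the value zero
  elsewhere puts the result into the family \<open>koszul\<close>.\<close>

definition koszul_diff :: "('a, 'x, 's) module_scheme \<Rightarrow> (nat set \<Rightarrow> 'x) \<Rightarrow> nat set \<Rightarrow> 'x" where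
  "koszul_diff A f S = (if S \<subseteq> {..<e} then koszul_map A e f S else \<zero>\<^bsub>A\<^esub>)"

lemma finite_KS: "finite (KS j)"
  unfolding KS_def by (rule finite_subset[of _ "Pow {..<e}"]) auto

lemma KS_empty: assumes "e < j" shows "KS j = {}"
proof -
  have False if "S \<in> KS j" for S
    using card_mono[of "{..<e}" S] that assms by (simp add: KS_def)
  thus ?thesis by blast
qed

lemma koszul_carrier: "graded_sub A U \<Longrightarrow> f \<in> koszul A U j n \<Longrightarrow> f S \<in> carrier A"
  using graded_subD(2)[OF graded_sub_fun_family, of A U f "KS j" dS n] by simp

lemma koszul_deg: "graded_sub A U \<Longrightarrow> f \<in> koszul A U j n \<Longrightarrow> f S \<in> U (n - dS S)"
  using graded_subD(3)[of A U] by (cases "S \<in> KS j") (auto simp: fun_family_def)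

lemma koszul_card: "f \<in> koszul A U j n \<Longrightarrow> int (card S) \<noteq> int j \<Longrightarrow> f S = \<zero>\<^bsub>A\<^esub>"
  by (auto simp: fun_family_def KS_def)

lemma sum_dg_insert: "T \<subseteq> {..<k} \<Longrightarrow> dS (insert k T) = dg k + dS T"
  by (rule sum.insert) (auto intro: finite_subset)

lemma sum_dg_remove: "S \<subseteq> {..<Suc k} \<Longrightarrow> k \<in> S \<Longrightarrow> dS S = dg k + dS (S - {k})"
  by (rule sum.remove) (auto intro: finite_subset)

lemma koszul_map_deg:
  assumes U: "graded_sub A U"
  shows "k \<le> e \<Longrightarrow> (\<And>S. S \<subseteq> {..<k} \<Longrightarrow> f S \<in> U (n - dS S)) \<Longrightarrow> S \<subseteq> {..<k} \<Longrightarrow>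
    koszul_map A k f S \<in> U (n - dS S)"
proof (induction k arbitrary: f n S)
  case 0
  thus ?case using graded_subD(3)[OF U] by simp
next
  case (Suc k)
  have f: "f T \<in> U (n - dS T)" if "T \<subseteq> {..<Suc k}" for T by (rule Suc.prems(2)[OF that])
  show ?case
  proof (cases "k \<in> S")
    case True
    have "koszul_map A k (\<lambda>T. f (insert k T)) (S - {k}) \<in> U ((n - dg k) - dS (S - {k}))"
    proof (rule Suc.IH)
      show "f (insert k T) \<in> U ((n - dg k) - dS T)" if "T \<subseteq> {..<k}" for T
        using f[of "insert k T"] that by (simp add: sum_dg_insert algebra_simps) (force simp: subset_iff)
    qed (use Suc.prems in \<open>auto simp: less_Suc_eq\<close>)
    thus ?thesis using True graded_sub_neg[OF U] sum_dg_remove[OF Suc.prems(3) True]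
      by (simp add: algebra_simps)
  next
    case False
    have S: "S \<subseteq> {..<k}" using Suc.prems(3) False by (auto simp: less_Suc_eq)
    have "koszul_map A k f S \<in> U (n - dS S)"
    proof (rule Suc.IH)
      show "f T \<in> U (n - dS T)" if "T \<subseteq> {..<k}" for T
        using that by (intro f) (force simp: subset_iff)
    qed (use Suc.prems S in auto)
    moreover have "f (insert k S) \<in> U (n - dS S - dg k)"
      using f[of "insert k S"] Suc.prems(3) S by (simp add: sum_dg_insert algebra_simps)
    hence "x k \<odot>\<^bsub>A\<^esub> f (insert k S) \<in> U (n - dS S)"
      using graded_subD(6)[OF U x_deg[of k], of _ "n - dS S - dg k"] Suc.prems by auto
    ultimately show ?thesis using False graded_subD(4)[OF U] by simp
  qed
qed

text \<open>Cardinalities are compared as integers, so that \<open>j - 1\<close> stays meaningful at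
  0, where the lemma says that the differential kills the chains of position 0.\<close>

lemma koszul_map_card:
  assumes mA: "Module.module R A"
  shows "k \<le> e \<Longrightarrow> (\<And>S. S \<subseteq> {..<k} \<Longrightarrow> int (card S) \<noteq> j \<Longrightarrow> f S = \<zero>\<^bsub>A\<^esub>) \<Longrightarrow> S \<subseteq> {..<k} \<Longrightarrow>
    int (card S) \<noteq> j - 1 \<Longrightarrow> koszul_map A k f S = \<zero>\<^bsub>A\<^esub>"
proof (induction k arbitrary: f j S)
  case (Suc k)
  interpret A: Module.module R A by fact
  have f: "f T = \<zero>\<^bsub>A\<^esub>" if "T \<subseteq> {..<Suc k}" "int (card T) \<noteq> j" for T by (rule Suc.prems(2)[OF that])
  show ?case
  proof (cases "k \<in> S")
    case True
    have fin: "finite S" using Suc.prems(3) by (rule finite_subset) simp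
    have "koszul_map A k (\<lambda>T. f (insert k T)) (S - {k}) = \<zero>\<^bsub>A\<^esub>"
    proof (rule Suc.IH)
      fix T assume T: "T \<subseteq> {..<k}" "int (card T) \<noteq> j - 1"
      have "card (insert k T) = Suc (card T)" using T by (subst card_insert_disjoint) (auto intro: finite_subset)
      thus "f (insert k T) = \<zero>\<^bsub>A\<^esub>" using T by (intro f) (force simp: subset_iff)+
    next
      have "card S = Suc (card (S - {k}))" using True fin by (metis card_Suc_Diff1)
      thus "int (card (S - {k})) \<noteq> j - 1 - 1" using Suc.prems(4) by simp
    qed (use Suc.prems in \<open>auto simp: less_Suc_eq\<close>)
    thus ?thesis using True by simp
  next
    case False
    have S: "S \<subseteq> {..<k}" using Suc.prems(3) False by (auto simp: less_Suc_eq)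
    have "koszul_map A k f S = \<zero>\<^bsub>A\<^esub>"
    proof (rule Suc.IH[of j])
      show "f T = \<zero>\<^bsub>A\<^esub>" if "T \<subseteq> {..<k}" "int (card T) \<noteq> j" for T
        using that by (intro f) (force simp: subset_iff)+
    qed (use Suc.prems S in auto)
    moreover have "card (insert k S) = Suc (card S)"
      using S False by (subst card_insert_disjoint) (auto intro: finite_subset)
    hence "f (insert k S) = \<zero>\<^bsub>A\<^esub>" using Suc.prems by (intro f) auto
    ultimately show ?thesis using False x_carrier[of k] Suc.prems(1) by simp
  qed
qed simp

lemma koszul_map_graded_hom:
  assumes U: "graded_sub A U" and W: "graded_sub B W" and p: "p \<in> graded_hom A U B W a"
  shows "k \<le> e \<Longrightarrow> (\<And>S. S \<subseteq> {..<k} \<Longrightarrow> f S \<in> U (n - dS S)) \<Longrightarrow> S \<subseteq> {..<k} \<Longrightarrow>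
    p (koszul_map A k f S) = koszul_map B k (\<lambda>S. p (f S)) S"
proof (induction k arbitrary: f n S)
  case 0
  thus ?case using graded_hom_zero[OF U W p] by simp
next
  case (Suc k)
  have f: "f T \<in> U (n - dS T)" if "T \<subseteq> {..<Suc k}" for T by (rule Suc.prems(2)[OF that])
  have k: "k \<le> e" "k < e" using Suc.prems by auto
  show ?case
  proof (cases "k \<in> S")
    case True
    have f1: "f (insert k T) \<in> U ((n - dg k) - dS T)" if "T \<subseteq> {..<k}" for T
      using f[of "insert k T"] that by (simp add: sum_dg_insert algebra_simps) (force simp: subset_iff)
    have S: "S - {k} \<subseteq> {..<k}" using Suc.prems by (auto simp: less_Suc_eq)
    show ?thesis
      using True Suc.IH[OF k(1) f1 S] graded_hom_minus[OF U W p koszul_map_deg[OF U k(1) f1 S]] by simp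
  next
    case False
    have S: "S \<subseteq> {..<k}" using Suc.prems(3) False by (auto simp: less_Suc_eq)
    have f0: "f T \<in> U (n - dS T)" if "T \<subseteq> {..<k}" for T
      using that by (intro f) (force simp: subset_iff)
    have fi: "f (insert k S) \<in> U (n - dS S - dg k)"
      using f[of "insert k S"] Suc.prems(3) S by (simp add: sum_dg_insert algebra_simps)
    have xf: "x k \<odot>\<^bsub>A\<^esub> f (insert k S) \<in> U (n - dS S)"
      using graded_subD(6)[OF U x_deg[OF k(2)] fi] by simp
    show ?thesis
      using False Suc.IH[OF k(1) f0 S] graded_homD(2)[OF p koszul_map_deg[OF U k(1) f0 S] xf] graded_homD(3)[OF p x_deg[OF k(2)] fi]
      by simp
  qed
qed

lemma koszul_diff_koszul:
  assumes U: "graded_sub A U" and f: "f \<in> koszul A U (Suc j) n"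
  shows "koszul_diff A f \<in> koszul A U j n"
proof -
  have "koszul_map A e f S \<in> U (n - dS S)" if "S \<subseteq> {..<e}" for S
    using koszul_map_deg[OF U order_refl _ that] koszul_deg[OF U f] by blast
  moreover have "koszul_map A e f S = \<zero>\<^bsub>A\<^esub>" if "S \<subseteq> {..<e}" "card S \<noteq> j" for S
    using koszul_map_card[OF graded_subD(1)[OF U] order_refl, of "int (Suc j)" f S] koszul_card[OF f] that by auto
  ultimately show ?thesis by (auto simp: fun_family_def koszul_diff_def KS_def)
qed

lemma koszul_diff_koszul_0:
  assumes U: "graded_sub A U" and f: "f \<in> koszul A U 0 n"
  shows "koszul_diff A f = (\<lambda>_. \<zero>\<^bsub>A\<^esub>)"
  using koszul_map_card[OF graded_subD(1)[OF U] order_refl, of 0 f] koszul_card[OF f]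
  by (auto simp: koszul_diff_def fun_eq_iff)

lemma koszul_diff_koszul_diff:
  assumes U: "graded_sub A U" and f: "f \<in> koszul A U j n"
  shows "koszul_diff A (koszul_diff A f) = (\<lambda>_. \<zero>\<^bsub>A\<^esub>)"
proof
  fix S
  show "koszul_diff A (koszul_diff A f) S = \<zero>\<^bsub>A\<^esub>"
  proof (cases "S \<subseteq> {..<e}")
    case True
    have "koszul_map A e (koszul_diff A f) S = koszul_map A e (koszul_map A e f) S"
      by (rule koszul_map_cong[OF _ True]) (simp add: koszul_diff_def)
    thus ?thesis using koszul_map_koszul_map[OF graded_subD(1)[OF U] order_refl koszul_carrier[OF U f] True] True
      by (simp add: koszul_diff_def)
  qed (simp add: koszul_diff_def)
qed

lemma K_lin_koszul_diff: assumes U: "graded_sub A U" shows "K_lin (fun_mod A) (koszul A U j n) (fun_mod A) (koszul_diff A)"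
proof -
  have mA: "Module.module R A" by (rule graded_subD(1)[OF U])
  interpret A: Module.module R A by (rule mA)
  show ?thesis
    unfolding K_lin_def
  proof (intro conjI ballI)
    show "Module.module R (fun_mod A)" by (rule module_fun_mod[OF mA])
    show "koszul_diff A ` koszul A U j n \<subseteq> carrier (fun_mod A)"
      using koszul_map_closed[OF mA order_refl koszul_carrier[OF U]] by (auto simp: koszul_diff_def)
    show "koszul_diff A (f \<oplus>\<^bsub>fun_mod A\<^esub> g) = koszul_diff A f \<oplus>\<^bsub>fun_mod A\<^esub> koszul_diff A g"
      if "f \<in> koszul A U j n" "g \<in> koszul A U j n" for f g
      using koszul_map_add[OF mA order_refl koszul_carrier[OF U that(1)] koszul_carrier[OF U that(2)]]
      by (auto simp: koszul_diff_def fun_eq_iff)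
    show "koszul_diff A (r \<odot>\<^bsub>fun_mod A\<^esub> f) = r \<odot>\<^bsub>fun_mod A\<^esub> koszul_diff A f"
      if "r \<in> gR 0" "f \<in> koszul A U j n" for r f
      using koszul_map_smult[OF mA order_refl gR_carrier[OF that(1)] koszul_carrier[OF U that(2)]] gR_carrier[OF that(1)]
      by (auto simp: koszul_diff_def fun_eq_iff)
  qed
qed

lemma koszul_diff_graded_hom: assumes U: "graded_sub A U" shows "koszul_diff A \<in> graded_hom (fun_mod A) (koszul A U (Suc j)) (fun_mod A) (koszul A U j) 0"
proof -
  have mA: "Module.module R A" by (rule graded_subD(1)[OF U])
  interpret A: Module.module R A by (rule mA)
  show ?thesis
    unfolding graded_hom_def
  proof (intro CollectI conjI allI ballI)
    show "koszul_diff A f \<in> koszul A U j (0 + n)" if "f \<in> koszul A U (Suc j) n" for f n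
      using koszul_diff_koszul[OF U that] by simp
    show "koszul_diff A (f \<oplus>\<^bsub>fun_mod A\<^esub> g) = koszul_diff A f \<oplus>\<^bsub>fun_mod A\<^esub> koszul_diff A g"
      if "f \<in> koszul A U (Suc j) n" "g \<in> koszul A U (Suc j) n" for f g n
      using K_lin_koszul_diff[OF U, of "Suc j" n] that unfolding K_lin_def by blast
    show "koszul_diff A (r \<odot>\<^bsub>fun_mod A\<^esub> f) = r \<odot>\<^bsub>fun_mod A\<^esub> koszul_diff A f"
      if "r \<in> gR m" "f \<in> koszul A U (Suc j) n" for r f m n
      using koszul_map_smult[OF mA order_refl gR_carrier[OF that(1)] koszul_carrier[OF U that(2)]] gR_carrier[OF that(1)]
      by (auto simp: koszul_diff_def fun_eq_iff)
  qed
qed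

lemma koszul_diff_compose:
  assumes U: "graded_sub A U" and W: "graded_sub B W" and p: "p \<in> graded_hom A U B W a" and f: "f \<in> koszul A U j n"
  shows "(\<lambda>S. p (koszul_diff A f S)) = koszul_diff B (\<lambda>S. p (f S))"
proof
  fix S
  show "p (koszul_diff A f S) = koszul_diff B (\<lambda>S. p (f S)) S"
    using koszul_map_graded_hom[OF U W p order_refl, of f n S] koszul_deg[OF U f] graded_hom_zero[OF U W p]
    by (auto simp: koszul_diff_def)
qed

lemma koszul_compose:
  assumes U: "graded_sub A U" and W: "graded_sub B W" and p: "p \<in> graded_hom A U B W a" and f: "f \<in> koszul A U j n"
  shows "(\<lambda>S. p (f S)) \<in> koszul B W j (a + n)"
proof -
  have "p (f S) \<in> W (a + n - dS S)" for S
    using graded_homD(1)[OF p koszul_deg[OF U f, of S]] by (simp add: algebra_simps)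
  thus ?thesis using f graded_hom_zero[OF U W p] by (auto simp: fun_family_def)
qed

definition koszul_exact :: "('a, 'x, 's) module_scheme \<Rightarrow> (int \<Rightarrow> 'x set) \<Rightarrow> nat \<Rightarrow> int \<Rightarrow> bool" where
  "koszul_exact A U j n \<longleftrightarrow>
    (\<forall>z\<in>koszul A U j n. koszul_diff A z = (\<lambda>_. \<zero>\<^bsub>A\<^esub>) \<longrightarrow> (\<exists>w\<in>koszul A U (Suc j) n. koszul_diff A w = z))"

lemma koszul_exact_large:
  assumes "graded_sub A U" "e < j" shows "koszul_exact A U j n"
proof -
  have "(\<lambda>_. \<zero>\<^bsub>A\<^esub>) \<in> koszul A U (Suc j) n" using assms(2) by (simp add: fun_family_def KS_empty)
  moreover have "z = (\<lambda>_. \<zero>\<^bsub>A\<^esub>)" if "z \<in> koszul A U j n" for z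
    using that assms(2) by (auto simp: fun_family_def KS_empty)
  moreover have "koszul_diff A (\<lambda>_. \<zero>\<^bsub>A\<^esub>) = (\<lambda>_. \<zero>\<^bsub>A\<^esub>)"
    using K_lin_zero[OF graded_sub_K_sub[OF graded_sub_fun_family[OF assms(1)]] K_lin_koszul_diff[OF assms(1)]] by simp
  ultimately show ?thesis unfolding koszul_exact_def by metis
qed

text \<open>Exactness identifies the boundaries in position \<open>j\<close> with the cycles, so
  that the chains in position \<open>Suc j\<close> have the dimension of the cycles in positions
  \<open>j\<close> and \<open>Suc j\<close> together. The alternating sum telescopes and ends at
  zero, as no set has more than \<open>e\<close> elements. The left-hand side is
  \<open>\<phi>\<close> of the Hilbert function.\<close>

lemma koszul_euler:
  assumes U: "graded_sub A U" and fdU: "\<And>m. K_fin A (U m)" and ex: "\<And>j. koszul_exact A U j n"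
  shows "(\<Sum>S\<in>Pow {..<e}. (- 1) ^ card S * (of_nat (K_dim A (U (n - dS S))) :: rat)) = 0"
proof -
  let ?k = "\<lambda>j. of_nat (K_dim (fun_mod A) (koszul A U j n)) :: rat"
  let ?Z = "\<lambda>j. {f \<in> koszul A U j n. koszul_diff A f = \<zero>\<^bsub>fun_mod A\<^esub>}"
  let ?z = "\<lambda>j. of_nat (K_dim (fun_mod A) (?Z j)) :: rat"
  have ks: "K_sub (fun_mod A) (koszul A U j n)" for j by (rule graded_sub_K_sub[OF graded_sub_fun_family[OF U]])
  have fdk: "K_fin (fun_mod A) (koszul A U j n)" for j by (rule fun_family_dim(1)[OF U finite_KS fdU])
  have k: "?k j = (\<Sum>S\<in>KS j. of_nat (K_dim A (U (n - dS S))))" for j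
    using fun_family_dim(2)[OF U finite_KS fdU, of j dS n] by simp
  have rn: "K_dim (fun_mod A) (koszul A U j n) = K_dim (fun_mod A) (koszul_diff A ` koszul A U j n) + K_dim (fun_mod A) (?Z j)" for j
    by (rule K_dim_ker_im(3)[OF ks fdk K_lin_koszul_diff[OF U]])
  have im: "koszul_diff A ` koszul A U (Suc j) n = ?Z j" for j
    using ex[of j] koszul_diff_koszul[OF U] koszul_diff_koszul_diff[OF U] by (auto simp: koszul_exact_def)
  have k0: "?k 0 = ?z 0"
  proof -
    have "?Z 0 = koszul A U 0 n" using koszul_diff_koszul_0[OF U] by auto
    thus ?thesis by simp
  qed
  have kS: "?k (Suc j) = ?z j + ?z (Suc j)" for j
    using rn[of "Suc j"] im[of j] by simp
  have partial: "(\<Sum>j\<le>m. (- 1) ^ j * ?k j) = (- 1) ^ m * ?z m" for m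
    by (induction m) (simp_all add: k0 kS algebra_simps)
  have "koszul A U (Suc e) n = {\<zero>\<^bsub>fun_mod A\<^esub>}" by (auto simp: fun_family_def KS_empty)
  hence "?k (Suc e) = 0" using K_fin_zero(3)[OF module_fun_mod[OF graded_subD(1)[OF U]]] by simp
  hence "?z e = 0" using kS[of e] by simp
  hence "0 = (\<Sum>j\<le>e. (- 1) ^ j * ?k j)" by (simp add: partial)
  also have "\<dots> = (\<Sum>j\<le>e. \<Sum>S\<in>KS j. (- 1) ^ card S * of_nat (K_dim A (U (n - dS S))))"
    unfolding k sum_distrib_left by (intro sum.cong refl) (auto simp: KS_def)
  also have "\<dots> = (\<Sum>S\<in>Pow {..<e}. (- 1) ^ card S * of_nat (K_dim A (U (n - dS S))))"
  proof -
    have "card ` Pow {..<e} \<subseteq> {..e}" using card_mono[of "{..<e}"] by auto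
    from sum.group[OF _ _ this, of "\<lambda>S. (- 1) ^ card S * of_nat (K_dim A (U (n - dS S)))"]
    show ?thesis by (simp add: KS_def)
  qed
  finally show ?thesis by simp
qed

text \<open>
  Dimension shift along \<open>0 \<rightarrow> U \<rightarrow> V \<rightarrow> U' \<rightarrow> 0\<close>.
\<close>

lemma koszul_exact_shift:
  assumes V: "graded_sub A V" and U': "graded_sub B U'" and p: "p \<in> graded_hom A V B U' 0"
    and surj: "\<And>n. p ` V n = U' n"
    and UV: "graded_sub A U" "\<And>n. U n = {v \<in> V n. p v = \<zero>\<^bsub>B\<^esub>}"
    and exV: "koszul_exact A V j n" and exU': "koszul_exact B U' (Suc j) n"
  shows "koszul_exact A U j n"
  unfolding koszul_exact_def
proof (intro ballI impI)
  fix z assume z: "z \<in> koszul A U j n" and dz: "koszul_diff A z = (\<lambda>_. \<zero>\<^bsub>A\<^esub>)"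
  interpret A: Module.module R A by (rule graded_subD(1)[OF V])
  interpret B: Module.module R B by (rule graded_subD(1)[OF U'])
  interpret P: Module.module R "fun_mod A" by (rule module_fun_mod[OF A.module_axioms])
  have pc: "(\<lambda>S. p (f S)) \<in> koszul B U' i n" if "f \<in> koszul A V i n" for f i
    using koszul_compose[OF V U' p that] by simp
  have kU: "f \<in> koszul A U i n \<longleftrightarrow> f \<in> koszul A V i n \<and> (\<forall>S. p (f S) = \<zero>\<^bsub>B\<^esub>)" for f i
    using graded_hom_zero[OF V U' p] by (auto simp: fun_family_def UV(2))
  have zV: "z \<in> koszul A V j n" "\<And>S. p (z S) = \<zero>\<^bsub>B\<^esub>" using z by (auto simp: kU)
  obtain w where w: "w \<in> koszul A V (Suc j) n" "koszul_diff A w = z"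
    using exV zV dz unfolding koszul_exact_def by blast
  have "koszul_diff B (\<lambda>S. p (w S)) = (\<lambda>_. \<zero>\<^bsub>B\<^esub>)"
    using koszul_diff_compose[OF V U' p w(1)] w(2) zV(2) by simp
  then obtain v where v: "v \<in> koszul B U' (Suc (Suc j)) n" "koszul_diff B v = (\<lambda>S. p (w S))"
    using exU' pc[OF w(1)] unfolding koszul_exact_def by blast
  \<comment> \<open>A lift of \<open>v\<close> is chosen separately for every subset, by
    surjectivity in the corresponding degree.\<close>
  have "\<exists>v'. v' \<in> koszul A V (Suc (Suc j)) n \<and> (\<forall>S. p (v' S) = v S)"
  proof -
    have "\<forall>S\<in>KS (Suc (Suc j)). \<exists>u\<in>V (n - dS S). p u = v S"
    proof
      fix S assume "S \<in> KS (Suc (Suc j))"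
      hence "v S \<in> p ` V (n - dS S)" using v(1) by (simp add: fun_family_def surj)
      thus "\<exists>u\<in>V (n - dS S). p u = v S" by auto
    qed
    then obtain u where u: "\<And>S. S \<in> KS (Suc (Suc j)) \<Longrightarrow> u S \<in> V (n - dS S) \<and> p (u S) = v S" by metis
    have "(\<lambda>S. if S \<in> KS (Suc (Suc j)) then u S else \<zero>\<^bsub>A\<^esub>) \<in> koszul A V (Suc (Suc j)) n"
      using u by (auto simp: fun_family_def)
    moreover have "p (if S \<in> KS (Suc (Suc j)) then u S else \<zero>\<^bsub>A\<^esub>) = v S" for S
      using u v(1) graded_hom_zero[OF V U' p] by (auto simp: fun_family_def)
    ultimately show ?thesis by (intro exI[of _ "\<lambda>S. if S \<in> KS (Suc (Suc j)) then u S else \<zero>\<^bsub>A\<^esub>"]) auto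
  qed
  then obtain v' where v': "v' \<in> koszul A V (Suc (Suc j)) n" "\<And>S. p (v' S) = v S" by blast
  have dv': "koszul_diff A v' \<in> koszul A V (Suc j) n" by (rule koszul_diff_koszul[OF V v'(1)])
  have gk: "graded_sub (fun_mod A) (koszul A V i)" for i by (rule graded_sub_fun_family[OF V])
  \<comment> \<open>The image of \<open>w\<close> is the boundary of \<open>v\<close>. Subtracting
    the boundary of a lift of \<open>v\<close> moves \<open>w\<close> into \<open>U\<close> and
    leaves its own boundary unchanged.\<close>
  let ?w = "w \<ominus>\<^bsub>fun_mod A\<^esub> koszul_diff A v'"
  have w': "?w \<in> koszul A V (Suc j) n" by (rule graded_sub_diff[OF gk w(1) dv'])
  have "p (?w S) = \<zero>\<^bsub>B\<^esub>" for S
  proof -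
    have "?w S = w S \<ominus>\<^bsub>A\<^esub> koszul_diff A v' S"
      using fun_mod_minus[OF A.module_axioms, of "koszul_diff A v'"] koszul_carrier[OF V dv'] by (simp add: a_minus_def)
    hence "p (?w S) = p (w S) \<ominus>\<^bsub>B\<^esub> p (koszul_diff A v' S)"
      using graded_hom_diff[OF V U' p koszul_deg[OF V w(1)] koszul_deg[OF V dv']] by simp
    also have "p (koszul_diff A v' S) = koszul_diff B (\<lambda>S. p (v' S)) S"
      using fun_cong[OF koszul_diff_compose[OF V U' p v'(1)], of S] by simp
    also have "\<dots> = p (w S)" using v' v(2) by simp
    finally show ?thesis using koszul_carrier[OF U' pc[OF w(1)], of S] by (simp add: a_minus_def B.r_neg)
  qed
  hence "?w \<in> koszul A U (Suc j) n" using w' kU by blast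
  moreover have "koszul_diff A ?w = z"
  proof -
    have "koszul_diff A ?w = koszul_diff A w \<ominus>\<^bsub>fun_mod A\<^esub> koszul_diff A (koszul_diff A v')"
      by (rule graded_hom_diff[OF gk gk koszul_diff_graded_hom[OF V] w(1) dv'])
    also have "koszul_diff A (koszul_diff A v') = \<zero>\<^bsub>fun_mod A\<^esub>" using koszul_diff_koszul_diff[OF V v'(1)] by simp
    moreover have "\<ominus>\<^bsub>fun_mod A\<^esub> \<zero>\<^bsub>fun_mod A\<^esub> = (\<zero>\<^bsub>fun_mod A\<^esub> :: nat set \<Rightarrow> _)"
      by (rule P.minus_equality[OF P.r_zero]) (rule P.zero_closed)+
    ultimately show ?thesis using w(2) P.r_zero[OF graded_subD(2)[OF gk zV(1)]]
      by (simp only: a_minus_def)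
  qed
  ultimately show "\<exists>w\<in>koszul A U (Suc j) n. koszul_diff A w = z" by blast
qed

section \<open>Multiples of Koszul cycles and exactness in large degrees\<close>

lemma koszul_homotopy_deg:
  assumes U: "graded_sub A U"
  shows "i < k \<Longrightarrow> k \<le> e \<Longrightarrow> (\<And>S. S \<subseteq> {..<k} \<Longrightarrow> f S \<in> U (n - dS S)) \<Longrightarrow> S \<subseteq> {..<k} \<Longrightarrow>
    koszul_homotopy A k i f S \<in> U (n + dg i - dS S)"
proof (induction k arbitrary: f n S)
  case (Suc k)
  have f: "f T \<in> U (n - dS T)" if "T \<subseteq> {..<Suc k}" for T by (rule Suc.prems(3)[OF that])
  have S': "S - {k} \<subseteq> {..<k}" using Suc.prems by (auto simp: less_Suc_eq)
  show ?case
  proof (cases "i = k")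
    case True
    show ?thesis
    proof (cases "k \<in> S")
      case k: True
      have "f (S - {k}) \<in> U (n - dS (S - {k}))" using S' by (intro f) (force simp: subset_iff)
      thus ?thesis using k True sum_dg_remove[OF Suc.prems(4) k] by (simp add: algebra_simps)
    qed (use True graded_subD(3)[OF U] in simp)
  next
    case False
    hence ik: "i < k" "k \<le> e" using Suc.prems by auto
    show ?thesis
    proof (cases "k \<in> S")
      case True
      have f1: "f (insert k T) \<in> U ((n - dg k) - dS T)" if "T \<subseteq> {..<k}" for T
        using f[of "insert k T"] that by (simp add: sum_dg_insert algebra_simps) (force simp: subset_iff)
      from Suc.IH[OF ik f1 S'] show ?thesis
        using True False graded_sub_neg[OF U] sum_dg_remove[OF Suc.prems(4) True] by (simp add: algebra_simps)
    next
      case k: False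
      have S: "S \<subseteq> {..<k}" using Suc.prems(4) k by (auto simp: less_Suc_eq)
      have f0: "f T \<in> U (n - dS T)" if "T \<subseteq> {..<k}" for T
        using that by (intro f) (force simp: subset_iff)
      from Suc.IH[OF ik f0 S] show ?thesis using k False by simp
    qed
  qed
qed simp

lemma koszul_homotopy_card:
  assumes mA: "Module.module R A"
  shows "i < k \<Longrightarrow> (\<And>S. S \<subseteq> {..<k} \<Longrightarrow> int (card S) \<noteq> j \<Longrightarrow> f S = \<zero>\<^bsub>A\<^esub>) \<Longrightarrow> S \<subseteq> {..<k} \<Longrightarrow>
    int (card S) \<noteq> j + 1 \<Longrightarrow> koszul_homotopy A k i f S = \<zero>\<^bsub>A\<^esub>"
proof (induction k arbitrary: f j S)
  case (Suc k)
  interpret A: Module.module R A by fact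
  have f: "f T = \<zero>\<^bsub>A\<^esub>" if "T \<subseteq> {..<Suc k}" "int (card T) \<noteq> j" for T by (rule Suc.prems(2)[OF that])
  have S': "S - {k} \<subseteq> {..<k}" using Suc.prems by (auto simp: less_Suc_eq)
  have fin: "finite S" using Suc.prems(3) by (rule finite_subset) simp
  have cS: "card S = Suc (card (S - {k}))" if "k \<in> S" using that fin by (metis card_Suc_Diff1)
  show ?case
  proof (cases "i = k")
    case True
    have "S - {k} \<subseteq> {..<Suc k}" using Suc.prems(3) by blast
    hence "f (S - {k}) = \<zero>\<^bsub>A\<^esub>" if "k \<in> S"
      using cS[OF that] Suc.prems(4) by (intro f) simp_all
    thus ?thesis using True by simp
  next
    case False
    hence ik: "i < k" using Suc.prems by auto
    show ?thesis
    proof (cases "k \<in> S")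
      case True
      have f1: "f (insert k T) = \<zero>\<^bsub>A\<^esub>" if T: "T \<subseteq> {..<k}" "int (card T) \<noteq> j - 1" for T
      proof -
        have "card (insert k T) = Suc (card T)" using T by (subst card_insert_disjoint) (auto intro: finite_subset)
        thus ?thesis using T by (intro f) (force simp: subset_iff)+
      qed
      have "int (card (S - {k})) \<noteq> j - 1 + 1" using cS[OF True] Suc.prems(4) by simp
      from Suc.IH[OF ik f1 S' this] show ?thesis using True False by simp
    next
      case k: False
      have S: "S \<subseteq> {..<k}" using Suc.prems(3) k by (auto simp: less_Suc_eq)
      have f0: "f T = \<zero>\<^bsub>A\<^esub>" if "T \<subseteq> {..<k}" "int (card T) \<noteq> j" for T
        using that by (intro f) (force simp: subset_iff)+
      from Suc.IH[OF ik f0 S Suc.prems(4)] show ?thesis using k False by simp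
    qed
  qed
qed simp

text \<open>On a cycle the homotopy identity reduces to d (h f) = \<open>x i\<close> f. The chain
  \<open>f\<close> sits in degree \<open>n - dg i\<close> because \<open>h\<close> raises degrees by
  \<open>dg i\<close>.\<close>

lemma smult_cycle_boundary:
  assumes U: "graded_sub A U" and i: "i < e" and f: "f \<in> koszul A U j (n - dg i)" and df: "koszul_diff A f = (\<lambda>_. \<zero>\<^bsub>A\<^esub>)"
  shows "\<exists>w\<in>koszul A U (Suc j) n. koszul_diff A w = x i \<odot>\<^bsub>fun_mod A\<^esub> f"
proof
  have mA: "Module.module R A" by (rule graded_subD(1)[OF U])
  interpret A: Module.module R A by (rule mA)
  let ?w = "\<lambda>S. if S \<subseteq> {..<e} then koszul_homotopy A e i f S else \<zero>\<^bsub>A\<^esub>"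
  have "koszul_homotopy A e i f S \<in> U (n - dS S)" if "S \<subseteq> {..<e}" for S
    using koszul_homotopy_deg[OF U i order_refl koszul_deg[OF U f] that] by simp
  moreover have "koszul_homotopy A e i f S = \<zero>\<^bsub>A\<^esub>" if "S \<subseteq> {..<e}" "card S \<noteq> Suc j" for S
    using koszul_homotopy_card[OF mA i, of "int j" f S] koszul_card[OF f] that by auto
  ultimately show "?w \<in> koszul A U (Suc j) n" by (auto simp: fun_family_def KS_def)
  show "koszul_diff A ?w = x i \<odot>\<^bsub>fun_mod A\<^esub> f"
  proof
    fix S
    show "koszul_diff A ?w S = (x i \<odot>\<^bsub>fun_mod A\<^esub> f) S"
    proof (cases "S \<subseteq> {..<e}")
      case True
      have 1: "koszul_map A e ?w S = koszul_map A e (koszul_homotopy A e i f) S" by (rule koszul_map_cong[OF _ True]) simp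
      have "koszul_map A e f T = \<zero> \<odot>\<^bsub>A\<^esub> f T" if "T \<subseteq> {..<e}" for T
        using fun_cong[OF df, of T] that koszul_carrier[OF U f] by (simp add: koszul_diff_def)
      hence "koszul_homotopy A e i (koszul_map A e f) S = koszul_homotopy A e i (\<lambda>T. \<zero> \<odot>\<^bsub>A\<^esub> f T) S" by (rule koszul_homotopy_cong[OF _ True])
      also have "\<dots> = \<zero>\<^bsub>A\<^esub>"
        using koszul_homotopy_smult[OF mA zero_closed koszul_carrier[OF U f]] koszul_homotopy_closed[OF mA koszul_carrier[OF U f]] by simp
      finally have 2: "koszul_homotopy A e i (koszul_map A e f) S = \<zero>\<^bsub>A\<^esub>" .
      have "koszul_map A e (koszul_homotopy A e i f) S \<in> carrier A"
        using koszul_map_closed[OF mA order_refl koszul_homotopy_closed[OF mA koszul_carrier[OF U f]]] .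
      thus ?thesis using koszul_map_koszul_homotopy[where f = f, OF mA order_refl i koszul_carrier[OF U f] True] 1 2 True
        by (simp add: koszul_diff_def)
    next
      case False
      hence "f S = \<zero>\<^bsub>A\<^esub>" using f by (auto simp: fun_family_def KS_def)
      thus ?thesis using False x_carrier[OF i] by (simp add: koszul_diff_def)
    qed
  qed
qed

lemma graded_sub_kernel:
  assumes U: "graded_sub A U" and W: "graded_sub B W" and p: "p \<in> graded_hom A U B W a"
  shows "graded_sub A (\<lambda>n. {u \<in> U n. p u = \<zero>\<^bsub>B\<^esub>})"
proof -
  interpret B: Module.module R B by (rule graded_subD(1)[OF W])
  show ?thesis
    unfolding graded_sub_def
  proof (intro conjI allI ballI)
    show "Module.module R A" by (rule graded_subD(1)[OF U])
    show "{u \<in> U n. p u = \<zero>\<^bsub>B\<^esub>} \<subseteq> carrier A" for n using graded_subD(7)[OF U] by blast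
    show "\<zero>\<^bsub>A\<^esub> \<in> {u \<in> U n. p u = \<zero>\<^bsub>B\<^esub>}" for n using graded_subD(3)[OF U] graded_hom_zero[OF U W p] by simp
    show "u \<oplus>\<^bsub>A\<^esub> v \<in> {u \<in> U n. p u = \<zero>\<^bsub>B\<^esub>}"
      if "u \<in> {u \<in> U n. p u = \<zero>\<^bsub>B\<^esub>}" "v \<in> {u \<in> U n. p u = \<zero>\<^bsub>B\<^esub>}" for n u v
      using that graded_homD(2)[OF p, of u n v] graded_subD(4)[OF U] by simp
    show "r \<odot>\<^bsub>A\<^esub> u \<in> {u \<in> U (m + n). p u = \<zero>\<^bsub>B\<^esub>}"
      if "r \<in> gR m" "u \<in> {u \<in> U n. p u = \<zero>\<^bsub>B\<^esub>}" for m n r u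
      using that graded_homD(3)[OF p, of r m u n] graded_subD(5)[OF U] gR_carrier by simp
  qed
qed

lemma graded_sub_image:
  assumes U: "graded_sub A U" and W: "graded_sub B W" and p: "p \<in> graded_hom A U B W 0"
  shows "graded_sub B (\<lambda>n. p ` U n)"
proof -
  interpret B: Module.module R B by (rule graded_subD(1)[OF W])
  show ?thesis
    unfolding graded_sub_def
  proof (intro conjI allI ballI)
    show "Module.module R B" by (rule graded_subD(1)[OF W])
    show "p ` U n \<subseteq> carrier B" for n using graded_subD(2)[OF W graded_homD(1)[OF p]] by auto
    show "\<zero>\<^bsub>B\<^esub> \<in> p ` U n" for n using graded_subD(3)[OF U] graded_hom_zero[OF U W p] by (metis imageI)
    show "u \<oplus>\<^bsub>B\<^esub> v \<in> p ` U n" if "u \<in> p ` U n" "v \<in> p ` U n" for n u v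
      using that graded_homD(2)[OF p, symmetric] graded_subD(4)[OF U] by auto
    show "r \<odot>\<^bsub>B\<^esub> u \<in> p ` U (m + n)" if "r \<in> gR m" "u \<in> p ` U n" for m n r u
      using that graded_homD(3)[OF p, symmetric] graded_subD(5)[OF U] by auto
  qed
qed

text \<open>The cycles are a submodule of a finitely generated module, so in large degrees each
  cycle is a combination of generators times cycles, and such multiples are boundaries.\<close>

lemma koszul_exact_eventually:
  assumes "fin_gen A U" shows "\<exists>c. \<forall>n>c. \<forall>j. koszul_exact A U j n"
proof -
  have U: "graded_sub A U" using assms by (rule fin_genD)
  interpret P: Module.module R "fun_mod A" by (rule module_fun_mod[OF graded_subD(1)[OF U]])
  let ?Z = "\<lambda>j n. {f \<in> koszul A U j n. koszul_diff A f = \<zero>\<^bsub>fun_mod A\<^esub>}"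
  have gk: "graded_sub (fun_mod A) (koszul A U j)" for j by (rule graded_sub_fun_family[OF U])
  have gZ: "graded_sub (fun_mod A) (?Z j)" for j
  proof (cases j)
    case 0
    have "?Z j = koszul A U j" using koszul_diff_koszul_0[OF U] 0 by auto
    thus ?thesis using gk by simp
  next
    case (Suc j)
    thus ?thesis using graded_sub_kernel[OF gk gk koszul_diff_graded_hom[OF U]] by simp
  qed
  have "fin_gen (fun_mod A) (?Z j)" for j
    by (rule fin_gen_subfamily[OF fin_gen_fun_family[OF assms finite_KS] gZ]) auto
  hence "\<forall>j. \<exists>c. \<forall>n>c. ?Z j n \<subseteq> max_smult (fun_mod A) (?Z j) n" by (simp add: fin_gen_def)
  then obtain c where "\<forall>j. \<forall>n>c j. ?Z j n \<subseteq> max_smult (fun_mod A) (?Z j) n" by (rule choice[THEN exE])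
  hence c: "?Z j n \<subseteq> max_smult (fun_mod A) (?Z j) n" if "c j < n" for j n using that by blast
  have bd: "\<exists>w\<in>koszul A U (Suc j) n. koszul_diff A w = z" if "k \<le> e" "z \<in> gens_smult (fun_mod A) k (?Z j) n" for k z j n
    using that
  proof (induction k arbitrary: z)
    case 0
    have z: "z = \<zero>\<^bsub>fun_mod A\<^esub>" using 0(2) by (simp only: ideal_smult.simps singleton_iff)
    show ?case unfolding z
      using graded_hom_zero[OF gk gk koszul_diff_graded_hom[OF U]] by (rule bexI[where x = "\<zero>\<^bsub>fun_mod A\<^esub>"]) (rule graded_subD(3)[OF gk])
  next
    case (Suc k)
    obtain z0 z1 where z: "z0 \<in> gens_smult (fun_mod A) k (?Z j) n" "z1 \<in> ?Z j (n - dg k)" "z = z0 \<oplus>\<^bsub>fun_mod A\<^esub> x k \<odot>\<^bsub>fun_mod A\<^esub> z1"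
      using Suc.prems(2) by auto
    obtain w0 where w0: "w0 \<in> koszul A U (Suc j) n" "koszul_diff A w0 = z0" using Suc z by auto
    obtain w1 where w1: "w1 \<in> koszul A U (Suc j) n" "koszul_diff A w1 = x k \<odot>\<^bsub>fun_mod A\<^esub> z1"
      using smult_cycle_boundary[OF U, of k z1 j n] z(2) Suc.prems by auto
    have "koszul_diff A (w0 \<oplus>\<^bsub>fun_mod A\<^esub> w1) = z" using graded_homD(2)[OF koszul_diff_graded_hom[OF U] w0(1) w1(1)] w0 w1 z by simp
    thus ?case using graded_subD(4)[OF gk w0(1) w1(1)] by blast
  qed
  \<comment> \<open>Positions above \<open>e\<close> carry no chains, so finitely many bounds have
    to be combined.\<close>
  define C where "C = Max (c ` {..e})"
  have "koszul_exact A U j n" if "C < n" for j n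
  proof (cases "j \<le> e")
    case True
    have "c j \<le> C" unfolding C_def using True by (intro Max_ge) auto
    hence "?Z j n \<subseteq> max_smult (fun_mod A) (?Z j) n" using that by (intro c) linarith
    thus ?thesis using bd[OF order_refl] unfolding koszul_exact_def by auto
  next
    case False
    thus ?thesis by (intro koszul_exact_large[OF U]) simp
  qed
  thus ?thesis by blast
qed

lemma dS_nonneg: "S \<subseteq> {..<e} \<Longrightarrow> 0 \<le> dS S"
  using dg_pos by (intro sum_nonneg) (force simp: subset_iff)

lemma dS_pos: "S \<subseteq> {..<e} \<Longrightarrow> S \<noteq> {} \<Longrightarrow> 0 < dS S"
  using dg_pos finite_subset[of S "{..<e}"] by (intro sum_pos) auto

text \<open>The sum over subsets is the expanded product of the 1 - t^(\<open>dg k\<close>). Only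
  the empty set has degree 0, so its constant coefficient is 1 and it is nonzero.\<close>

sublocale difference_operator "Pow {..<e}" "\<lambda>S. (- 1) ^ card S" dS
proof
  let ?d = "\<Sum>S\<in>Pow {..<e}. fract_const ((- 1) ^ card S) * fract_t powi dS S"
  have "fls_nth (laurent_expansion ?d) 0 = (\<Sum>S\<in>Pow {..<e}. (- 1) ^ card S * (if dS S = 0 then 1 else 0))"
    by (simp add: laurent_expansion_sum laurent_expansion_mult fls_nth_sum
        laurent_expansion_const laurent_expansion_t_powi)
  also have "\<dots> = (\<Sum>S\<in>Pow {..<e}. if S = {} then 1 else 0)"
  proof (rule sum.cong[OF refl])
    fix S assume "S \<in> Pow {..<e}"
    thus "(- 1) ^ card S * (if dS S = 0 then 1 else 0) = (if S = {} then 1 else (0::rat))"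
      using dS_pos[of S] by (cases "S = {}") auto
  qed
  also have "\<dots> = 1" by (simp add: sum.delta)
  finally show "?d \<noteq> 0" by (auto simp: laurent_expansion_0)
qed simp

section \<open>Rationality of Hilbert functions\<close>

definition hilb :: "('a, 'x, 's) module_scheme \<Rightarrow> (int \<Rightarrow> 'x set) \<Rightarrow> int \<Rightarrow> rat" where
  "hilb A U n = of_nat (K_dim A (U n))"

lemma koszul_exact_\<phi>:
  assumes "fin_gen A U" "\<And>j. koszul_exact A U j n" shows "\<phi> (hilb A U) n = 0"
  using koszul_euler[OF fin_genD(1,2)[OF assms(1)] assms(2)] by (simp add: \<phi>_def hilb_def)

text \<open>The theorem of Hilbert and Serre: the numerator vanishes in large degrees by Koszul
  exactness, and in low degrees because all the shifts \<open>dS S\<close> are nonnegative.\<close>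

lemma fin_gen_hilb:
  assumes "fin_gen A U" shows "bounded_below (hilb A U)" "finite {n. \<phi> (hilb A U) n \<noteq> 0}"
proof -
  have mA: "Module.module R A" using fin_genD(1)[OF assms] by (rule graded_subD)
  obtain s where s: "\<And>n. n < s \<Longrightarrow> U n = {\<zero>\<^bsub>A\<^esub>}" using assms by (auto simp: fin_gen_def)
  have z: "hilb A U n = 0" if "n < s" for n using s[OF that] K_fin_zero(3)[OF mA] by (simp add: hilb_def)
  thus "bounded_below (hilb A U)" by (auto simp: bounded_below_def)
  obtain c where c: "\<And>n. c < n \<Longrightarrow> \<phi> (hilb A U) n = 0"
    using koszul_exact_eventually[OF assms] koszul_exact_\<phi>[OF assms] by blast
  have "\<phi> (hilb A U) n = 0" if "n < s" for n
    unfolding \<phi>_def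
  proof (rule sum.neutral, rule ballI)
    fix S assume "S \<in> Pow {..<e}"
    hence "hilb A U (n - dS S) = 0" using dS_nonneg[of S] that by (intro z) simp
    thus "(- 1) ^ card S * hilb A U (n - dS S) = 0" by simp
  qed
  hence "{n. \<phi> (hilb A U) n \<noteq> 0} \<subseteq> {s..c}" using c linorder_not_less by fastforce
  thus "finite {n. \<phi> (hilb A U) n \<noteq> 0}" by (rule finite_subset) simp
qed


lemma RM_one_dim: "K_dim RM (gR 0) = 1" "K_fin RM (gR 0)"
proof -
  have k: "K_sub RM (gR 0)" by (rule graded_sub_K_sub[OF graded_sub_RM])
  interpret V: vectorspace K "res RM (gR 0)" by (rule K_sub_vectorspace[OF k])
  have "v \<in> V.span {\<one>}" if "v \<in> gR 0" for v
  proof -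
    have "v = V.lincomb (\<lambda>_. v) {\<one>}"
      using that gR_carrier[OF that] gR_1 by (simp add: V.lincomb_def)
    moreover have "V.span {\<one>} = {V.lincomb a {\<one>} | a. a \<in> {\<one>} \<rightarrow> carrier K}"
      using gR_1 by (intro V.finite_span) auto
    moreover have "(\<lambda>_. v) \<in> {\<one>} \<rightarrow> carrier K" using that by simp
    ultimately show ?thesis by blast
  qed
  hence g: "V.gen_set {\<one>}" using V.span_is_subset2[of "{\<one>}"] gR_1 by auto
  have "\<one> \<noteq> \<zero>" using degree_0_subfield subfieldE(6) by auto
  thus "K_dim RM (gR 0) = 1" unfolding K_dim_def using V.dim1I[OF g] gR_1 by simp
  show "K_fin RM (gR 0)" unfolding K_fin_def V.fin_dim_def using g gR_1 by (intro exI[of _ "{\<one>}"]) simp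
qed

text \<open>The generators have positive degree, so the piece in degree \<open>n\<close> is built
  from pieces of lower degree. This drives the induction on degrees in
  \<open>fin_gen_RM\<close>.\<close>

lemma K_fin_gens_smult:
  assumes U: "graded_sub A U" and fdU: "\<And>m. m < n \<Longrightarrow> K_fin A (U m)"
  shows "k \<le> e \<Longrightarrow> K_fin A (gens_smult A k U n)"
proof (induction k)
  case 0
  show ?case using K_fin_zero(2)[OF graded_subD(1)[OF U]] by simp
next
  case (Suc k)
  interpret A: Module.module R A by (rule graded_subD(1)[OF U])
  have k: "k < e" "k \<le> e" using Suc.prems by auto
  have xk: "x k \<in> carrier R" by (rule x_carrier[OF k(1)])
  have kU: "K_sub A (U (n - dg k))" by (rule graded_sub_K_sub[OF U])
  have l: "K_lin A (U (n - dg k)) A (\<lambda>u. x k \<odot>\<^bsub>A\<^esub> u)"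
    unfolding K_lin_def
  proof (intro conjI ballI)
    show "Module.module R A" by (rule A.module_axioms)
    show "(\<lambda>u. x k \<odot>\<^bsub>A\<^esub> u) ` U (n - dg k) \<subseteq> carrier A" using xk graded_subD(2)[OF U] by auto
    show "x k \<odot>\<^bsub>A\<^esub> (u \<oplus>\<^bsub>A\<^esub> v) = x k \<odot>\<^bsub>A\<^esub> u \<oplus>\<^bsub>A\<^esub> x k \<odot>\<^bsub>A\<^esub> v"
      if "u \<in> U (n - dg k)" "v \<in> U (n - dg k)" for u v
      using that xk graded_subD(2)[OF U] by (intro A.smult_r_distr) auto
    show "x k \<odot>\<^bsub>A\<^esub> (r \<odot>\<^bsub>A\<^esub> u) = r \<odot>\<^bsub>A\<^esub> (x k \<odot>\<^bsub>A\<^esub> u)" if "r \<in> gR 0" "u \<in> U (n - dg k)" for r u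
      using that xk graded_subD(2)[OF U] gR_carrier by (simp add: m_comm flip: A.smult_assoc1)
  qed
  have "K_fin A (U (n - dg k))" using fdU dg_pos[OF k(1)] by simp
  hence i: "K_sub A ((\<lambda>u. x k \<odot>\<^bsub>A\<^esub> u) ` U (n - dg k))" "K_fin A ((\<lambda>u. x k \<odot>\<^bsub>A\<^esub> u) ` U (n - dg k))"
    using K_sub_image[OF kU l] K_dim_ker_im(1)[OF kU _ l] by auto
  have "gens_smult A (Suc k) U n = {v \<oplus>\<^bsub>A\<^esub> w | v w. v \<in> gens_smult A k U n \<and> w \<in> (\<lambda>u. x k \<odot>\<^bsub>A\<^esub> u) ` U (n - dg k)}"
    by auto
  thus ?case
    using K_fin_sum(2)[OF graded_sub_K_sub[OF graded_sub_gens_smult(1)[OF U k(2)]] i(1) Suc.IH[OF k(2)] i(2)] by simp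
qed

lemma fin_gen_RM: "fin_gen RM gR"
proof -
  have "K_fin RM (gR n)" if "n < int m" for n m
    using that
  proof (induction m arbitrary: n)
    case 0
    hence "gR n = {\<zero>\<^bsub>RM\<^esub>}" using neg_degree by simp
    thus ?case using K_fin_zero(2)[OF module_RM] by simp
  next
    case (Suc m)
    consider "n < int m" | "n = 0" | "n = int m" "0 < n" using Suc.prems by linarith
    thus ?case
    proof cases
      case 3
      have "gR n = max_smult RM gR n"
        using gR_generated[OF 3(2)] graded_sub_gens_smult(2)[OF graded_sub_RM order_refl] by blast
      moreover have "K_fin RM (max_smult RM gR n)" using Suc.IH 3 by (intro K_fin_gens_smult[OF graded_sub_RM]) auto
      ultimately show ?thesis by simp
    qed (use Suc.IH RM_one_dim in auto)
  qed
  from this[of n "Suc (nat n)" for n] have "K_fin RM (gR n)" for n by simp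
  thus ?thesis
    unfolding fin_gen_def using graded_sub_RM gR_generated neg_degree by (metis RM_simps(2))
qed

section \<open>Linear combinations and the homomorphisms they define\<close>

definition lin_comb :: "('a, 'x, 's) module_scheme \<Rightarrow> 'j set \<Rightarrow> ('j \<Rightarrow> 'a) \<Rightarrow> ('j \<Rightarrow> 'x) \<Rightarrow> 'x" where
  "lin_comb A J c y = finsum A (\<lambda>j. c j \<odot>\<^bsub>A\<^esub> y j) J"

lemma lin_comb_in:
  assumes W: "graded_sub B W" and "\<And>j. j \<in> J \<Longrightarrow> c j \<in> gR (n - \<delta> j)" "\<And>j. j \<in> J \<Longrightarrow> y j \<in> W (a + \<delta> j)"
  shows "lin_comb B J c y \<in> W (a + n)"
  unfolding lin_comb_def
proof (rule finsum_in[OF W])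
  show "c j \<odot>\<^bsub>B\<^esub> y j \<in> W (a + n)" if "j \<in> J" for j
    using graded_subD(5)[OF W assms(2)[OF that] assms(3)[OF that]] by (simp add: algebra_simps)
qed

text \<open>Serves for maps out of a free family, where \<open>co\<close> is the identity, and for
  maps out of a module with a dual basis, where \<open>co\<close> gives the coordinates.\<close>

lemma lin_comb_graded_hom:
  assumes W: "graded_sub B W" and J: "finite J" and y: "\<And>j. j \<in> J \<Longrightarrow> y j \<in> W (a + \<delta> j)"
    and co: "\<And>n u j. j \<in> J \<Longrightarrow> u \<in> U n \<Longrightarrow> co u j \<in> gR (n - \<delta> j)"
    and add: "\<And>n u v j. j \<in> J \<Longrightarrow> u \<in> U n \<Longrightarrow> v \<in> U n \<Longrightarrow> co (u \<oplus>\<^bsub>A\<^esub> v) j = co u j \<oplus> co v j"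
    and smult: "\<And>m n r u j. j \<in> J \<Longrightarrow> r \<in> gR m \<Longrightarrow> u \<in> U n \<Longrightarrow> co (r \<odot>\<^bsub>A\<^esub> u) j = r \<otimes> co u j"
  shows "(\<lambda>u. lin_comb B J (co u) y) \<in> graded_hom A U B W a"
proof -
  interpret B: Module.module R B by (rule graded_subD(1)[OF W])
  have yc: "y j \<in> carrier B" if "j \<in> J" for j using graded_subD(2)[OF W y[OF that]] .
  have cc: "co u j \<in> carrier R" if "j \<in> J" "u \<in> U n" for u j n using gR_carrier[OF co[OF that]] .
  show ?thesis
    unfolding graded_hom_def
  proof (intro CollectI conjI allI ballI)
    show "lin_comb B J (co u) y \<in> W (a + n)" if "u \<in> U n" for u n
      using co[OF _ that] y by (rule lin_comb_in[OF W])
    show "lin_comb B J (co (u \<oplus>\<^bsub>A\<^esub> v)) y = lin_comb B J (co u) y \<oplus>\<^bsub>B\<^esub> lin_comb B J (co v) y"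
      if "u \<in> U n" "v \<in> U n" for u v n
    proof -
      have "lin_comb B J (co (u \<oplus>\<^bsub>A\<^esub> v)) y = finsum B (\<lambda>j. co u j \<odot>\<^bsub>B\<^esub> y j \<oplus>\<^bsub>B\<^esub> co v j \<odot>\<^bsub>B\<^esub> y j) J"
        unfolding lin_comb_def using cc[OF _ that(1)] cc[OF _ that(2)] yc
        by (intro B.finsum_cong') (auto simp: add[OF _ that] B.smult_l_distr)
      also have "\<dots> = lin_comb B J (co u) y \<oplus>\<^bsub>B\<^esub> lin_comb B J (co v) y"
        unfolding lin_comb_def using cc[OF _ that(1)] cc[OF _ that(2)] yc by (intro B.finsum_addf) auto
      finally show ?thesis .
    qed
    show "lin_comb B J (co (r \<odot>\<^bsub>A\<^esub> u)) y = r \<odot>\<^bsub>B\<^esub> lin_comb B J (co u) y"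
      if "r \<in> gR m" "u \<in> U n" for r u m n
    proof -
      have rc: "r \<in> carrier R" by (rule gR_carrier[OF that(1)])
      have "lin_comb B J (co (r \<odot>\<^bsub>A\<^esub> u)) y = finsum B (\<lambda>j. r \<odot>\<^bsub>B\<^esub> (co u j \<odot>\<^bsub>B\<^esub> y j)) J"
        unfolding lin_comb_def using cc[OF _ that(2)] yc rc
        by (intro B.finsum_cong') (auto simp: smult[OF _ that] B.smult_assoc1)
      also have "\<dots> = r \<odot>\<^bsub>B\<^esub> lin_comb B J (co u) y"
        unfolding lin_comb_def using cc[OF _ that(2)] yc rc J
        by (intro B.finsum_smult_ldistr[symmetric]) auto
      finally show ?thesis .
    qed
  qed
qed

lemma graded_hom_finsum:
  assumes U: "graded_sub A U" and W: "graded_sub B W" and p: "p \<in> graded_hom A U B W a" and "finite J"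
    and f: "\<And>j. j \<in> J \<Longrightarrow> f j \<in> U n"
  shows "p (finsum A f J) = finsum B (\<lambda>j. p (f j)) J"
proof -
  interpret A: Module.module R A by (rule graded_subD(1)[OF U])
  interpret B: Module.module R B by (rule graded_subD(1)[OF W])
  show ?thesis using \<open>finite J\<close> f
  proof (induction J)
    case empty
    thus ?case using graded_hom_zero[OF U W p] by simp
  next
    case (insert j J)
    have fc: "f \<in> J \<rightarrow> carrier A" "f j \<in> carrier A" using insert.prems graded_subD(2)[OF U] by blast+
    have pc: "(\<lambda>j. p (f j)) \<in> J \<rightarrow> carrier B" "p (f j) \<in> carrier B"
      using insert.prems graded_subD(2)[OF W graded_homD(1)[OF p]] by blast+
    have "finsum A f J \<in> U n" using insert.prems by (intro finsum_in[OF U]) auto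
    thus ?case using insert fc pc graded_homD(2)[OF p, of "f j" n "finsum A f J"] by simp
  qed
qed

lemma graded_hom_lin_comb:
  assumes U: "graded_sub A U" and W: "graded_sub B W" and p: "p \<in> graded_hom A U B W a" and J: "finite J"
    and c: "\<And>j. j \<in> J \<Longrightarrow> c j \<in> gR (n - \<delta> j)" and y: "\<And>j. j \<in> J \<Longrightarrow> y j \<in> U (\<delta> j)"
  shows "p (lin_comb A J c y) = lin_comb B J c (\<lambda>j. p (y j))"
proof -
  interpret B: Module.module R B by (rule graded_subD(1)[OF W])
  have "c j \<odot>\<^bsub>A\<^esub> y j \<in> U n" if "j \<in> J" for j
    using graded_subD(6)[OF U c[OF that] y[OF that]] by simp
  hence "p (lin_comb A J c y) = finsum B (\<lambda>j. p (c j \<odot>\<^bsub>A\<^esub> y j)) J"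
    unfolding lin_comb_def by (rule graded_hom_finsum[OF U W p J])
  also have "\<dots> = lin_comb B J c (\<lambda>j. p (y j))"
    unfolding lin_comb_def
    using graded_homD(3)[OF p c y] gR_carrier[OF c] graded_subD(2)[OF W graded_homD(1)[OF p y]]
    by (intro B.finsum_cong') auto
  finally show ?thesis .
qed

end

section \<open>Free covers and resolutions\<close>

context generated_graded_algebra begin

lemma fun_family_off: "f \<in> fun_family A U J \<delta> n \<Longrightarrow> j \<notin> J \<Longrightarrow> f j = \<zero>\<^bsub>A\<^esub>"
  and fun_family_on: "f \<in> fun_family A U J \<delta> n \<Longrightarrow> j \<in> J \<Longrightarrow> f j \<in> U (n - \<delta> j)"
  by (auto simp: fun_family_def)

lemma fun_family_carrier: "graded_sub A U \<Longrightarrow> f \<in> fun_family A U J \<delta> n \<Longrightarrow> f j \<in> carrier A"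
  using graded_subD(2)[OF graded_sub_fun_family, of A U f J \<delta> n] by simp

text \<open>What is retained of a basis is that it spans and the number of its vectors; the number
  is used in the dimension count of \<open>cover\<close>.\<close>

lemma basis_enum:
  assumes V: "K_sub A V" "K_fin A V"
  shows "\<exists>y :: nat \<Rightarrow> _. (\<forall>i<K_dim A V. y i \<in> V) \<and>
    (\<forall>v\<in>V. \<exists>c. (\<forall>i<K_dim A V. c i \<in> gR 0) \<and> v = lin_comb A {..<K_dim A V} c y)"
proof -
  interpret A: Module.module R A using V(1) by (simp add: K_sub_def)
  interpret AK: Module.module K A by (rule module_K[OF A.module_axioms])
  interpret V: vectorspace K "res A V" by (rule K_sub_vectorspace[OF V(1)])
  have sm: "submodule K V A" using K_sub_subspace[OF V(1)] by (simp add: subspace_def)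
  have VA: "V \<subseteq> carrier A" using V(1) by (simp add: K_sub_def)
  obtain b where b: "finite b" "V.basis b"
    using V.finite_basis_exists V(2) by (auto simp: K_fin_def)
  have bV: "b \<subseteq> V" "V.span b = V" using b(2) by (auto simp: V.basis_def)
  have d: "K_dim A V = card b" unfolding K_dim_def by (rule V.dim_basis[OF b])
  obtain h where h: "bij_betw h {..<card b} b" using ex_bij_betw_nat_finite[OF b(1)] by (auto simp: atLeast0LessThan)
  have "\<exists>c. (\<forall>i<card b. c i \<in> gR 0) \<and> v = lin_comb A {..<card b} c h" if "v \<in> V" for v
  proof -
    have "v \<in> V.span b" using that bV by simp
    then obtain a where a: "a \<in> b \<rightarrow> gR 0" "V.lincomb a b = v"
      using V.finite_in_span[OF b(1), of v] bV by auto
    have "V.lincomb a b = AK.lincomb a b"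
      using AK.lincomb_not_depend[OF b(1) bV(1) sm] a(1) by simp
    have ab: "a u \<in> carrier R" if "u \<in> b" for u using a(1) that gR_carrier by blast
    from \<open>V.lincomb a b = AK.lincomb a b\<close> have v: "v = finsum A (\<lambda>u. a u \<odot>\<^bsub>A\<^esub> u) (h ` {..<card b})"
      using a(2) h by (simp add: AK.lincomb_def bij_betw_def)
    also have "\<dots> = finsum A (\<lambda>i. a (h i) \<odot>\<^bsub>A\<^esub> h i) {..<card b}"
    proof (rule A.finsum_reindex)
      show "(\<lambda>u. a u \<odot>\<^bsub>A\<^esub> u) \<in> h ` {..<card b} \<rightarrow> carrier A"
        using ab h bV VA by (auto simp: bij_betw_def)
    qed (use h in \<open>simp add: bij_betw_def\<close>)
    finally have c1: "v = lin_comb A {..<card b} (\<lambda>i. a (h i)) h" by (simp add: lin_comb_def)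
    have c2: "a (h i) \<in> gR 0" if "i < card b" for i
    proof -
      have "h i \<in> b" using bij_betwE[OF h] that by simp
      thus ?thesis using a(1) by (rule Pi_mem[rotated])
    qed
    show ?thesis by (rule exI[of _ "\<lambda>i. a (h i)"]) (use c1 c2 in simp)
  qed
  moreover have "h i \<in> V" if "i < card b" for i using bij_betwE[OF h] bV that by blast
  ultimately show ?thesis unfolding d by (intro exI[of _ h]) blast
qed

text \<open>An index is a degree together with a counter, so that the degree of a basis vector can
  be read off as \<open>fst\<close>.\<close>

abbreviation free_family :: "(int \<times> nat) set \<Rightarrow> int \<Rightarrow> (int \<times> nat \<Rightarrow> 'a) set" where
  "free_family J \<equiv> fun_family RM gR J fst"

lemma graded_sub_free_family: "graded_sub (fun_mod RM) (free_family J)" by (rule graded_sub_fun_family[OF graded_sub_RM])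

lemma fin_gen_free_family: "finite J \<Longrightarrow> fin_gen (fun_mod RM) (free_family J)" by (rule fin_gen_fun_family[OF fin_gen_RM])

lemma free_family_vanish:
  assumes "\<And>j. j \<in> J \<Longrightarrow> s \<le> fst j" "n < s" "c \<in> free_family J n" shows "c = \<zero>\<^bsub>fun_mod RM\<^esub>"
proof -
  have "c j = \<zero>" for j
  proof (cases "j \<in> J")
    case True
    hence "gR (n - fst j) = {\<zero>}" using assms(1)[OF True] assms(2) by (intro neg_degree) simp
    thus ?thesis using fun_family_on[OF assms(3) True] by simp
  qed (use fun_family_off[OF assms(3)] in simp)
  thus ?thesis by (simp add: fun_eq_iff)
qed

lemma lin_comb_free_family_graded_hom:
  assumes "graded_sub B W" "finite J" "\<And>j. j \<in> J \<Longrightarrow> y j \<in> W (a + fst j)"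
  shows "(\<lambda>c. lin_comb B J c y) \<in> graded_hom (fun_mod RM) (free_family J) B W a"
  using assms by (intro lin_comb_graded_hom[where \<delta> = fst]) (auto simp: fun_family_def)

text \<open>There is one basis vector of the free module for each vector of a basis of
  \<open>L n\<close>, in all degrees from \<open>s\<close> up to a bound past which the generators
  of the ring produce everything. Taking no more than a basis in degree \<open>s\<close> makes the
  map injective there, so that the kernel starts one degree later.\<close>

lemma cover:
  assumes L: "fin_gen A L" and s: "\<forall>n<s. L n = {\<zero>\<^bsub>A\<^esub>}"
  shows "\<exists>J y. finite J \<and> (\<forall>j\<in>J. s \<le> fst j \<and> y j \<in> L (fst j)) \<and>
    (\<forall>n. (\<lambda>c. lin_comb A J c y) ` free_family J n = L n) \<and>
    (\<forall>n<s + 1. {c \<in> free_family J n. lin_comb A J c y = \<zero>\<^bsub>A\<^esub>} = {\<zero>\<^bsub>fun_mod RM\<^esub>})"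
proof -
  have gL: "graded_sub A L" by (rule fin_genD(1)[OF L])
  interpret A: Module.module R A by (rule graded_subD(1)[OF gL])
  obtain c0 where c0: "\<And>n. c0 < n \<Longrightarrow> L n \<subseteq> max_smult A L n" using L by (auto simp: fin_gen_def)
  \<comment> \<open>The maximum ensures that degree \<open>s\<close> itself is among the degrees for
    which a basis is taken; the dimension count below relies on it.\<close>
  define b where "b = max s c0"
  have "\<forall>n. \<exists>y :: nat \<Rightarrow> _. (\<forall>i<K_dim A (L n). y i \<in> L n) \<and>
    (\<forall>v\<in>L n. \<exists>c. (\<forall>i<K_dim A (L n). c i \<in> gR 0) \<and> v = lin_comb A {..<K_dim A (L n)} c y)"
    using basis_enum[OF fin_genD(3,2)[OF L]] by blast
  then obtain Y where Y: "\<forall>n. (\<forall>i<K_dim A (L n). Y n i \<in> L n) \<and>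
    (\<forall>v\<in>L n. \<exists>c. (\<forall>i<K_dim A (L n). c i \<in> gR 0) \<and> v = lin_comb A {..<K_dim A (L n)} c (Y n))"
    by (rule choice[THEN exE])
  define y where "y j = Y (fst j) (snd j)" for j :: "int \<times> nat"
  define J where "J = (SIGMA n:{s..b}. {..<K_dim A (L n)})"
  have J: "finite J" unfolding J_def by auto
  have Js: "s \<le> fst j" "y j \<in> L (fst j)" if "j \<in> J" for j
    using that Y by (auto simp: J_def y_def)
  let ?p = "\<lambda>c. lin_comb A J c y"
  have p: "?p \<in> graded_hom (fun_mod RM) (free_family J) A L 0" using Js by (intro lin_comb_free_family_graded_hom[OF gL J]) auto
  have gI: "graded_sub A (\<lambda>n. ?p ` free_family J n)" by (rule graded_sub_image[OF graded_sub_free_family gL p])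
  have IL: "?p ` free_family J n \<subseteq> L n" for n using graded_homD0[OF p] by blast
  have mid: "L n \<subseteq> ?p ` free_family J n" if n: "s \<le> n" "n \<le> b" for n
  proof
    fix v assume v: "v \<in> L n"
    let ?I = "{..<K_dim A (L n)}"
    obtain c where "(\<forall>i<K_dim A (L n). c i \<in> gR 0) \<and> v = lin_comb A ?I c (Y n)" using Y v by blast
    hence c: "\<And>i. i \<in> ?I \<Longrightarrow> c i \<in> gR 0" "v = lin_comb A ?I c (Y n)" by auto
    define c' where "c' j = (if j \<in> J \<and> fst j = n then c (snd j) else \<zero>)" for j
    have c': "c' \<in> free_family J n"
      using c(1) gR_0 by (auto simp: fun_family_def c'_def J_def)
    have yc: "y j \<in> carrier A" if "j \<in> J" for j using graded_subD(2)[OF gL Js(2)[OF that]] .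
    have c'c: "c' j \<in> carrier R" for j using fun_family_carrier[OF graded_sub_RM c'] by simp
    have "?p c' = finsum A (\<lambda>j. c' j \<odot>\<^bsub>A\<^esub> y j) (Pair n ` ?I)"
      unfolding lin_comb_def
    proof (rule A.add.finprod_mono_neutral_cong_right[OF J])
      show "Pair n ` ?I \<subseteq> J" using n by (auto simp: J_def)
      show "c' j \<odot>\<^bsub>A\<^esub> y j = \<zero>\<^bsub>A\<^esub>" if "j \<in> J - Pair n ` ?I" for j
      proof -
        have "fst j \<noteq> n" using that by (auto simp: J_def)
        thus ?thesis using yc that by (simp add: c'_def)
      qed
      show "(\<lambda>j. c' j \<odot>\<^bsub>A\<^esub> y j) \<in> J \<rightarrow> carrier A" using yc c'c by auto
    qed simp
    also have "\<dots> = finsum A (\<lambda>i. c' (n, i) \<odot>\<^bsub>A\<^esub> y (n, i)) ?I"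
      using yc c'c n by (intro A.finsum_reindex) (auto simp: J_def inj_on_def)
    also have "\<dots> = lin_comb A ?I c (Y n)"
      unfolding lin_comb_def
    proof (rule A.finsum_cong'[OF refl])
      show "(\<lambda>i. c i \<odot>\<^bsub>A\<^esub> Y n i) \<in> ?I \<rightarrow> carrier A"
        using c(1) gR_carrier Y graded_subD(2)[OF gL] by blast
      show "c' (n, i) \<odot>\<^bsub>A\<^esub> y (n, i) = c i \<odot>\<^bsub>A\<^esub> Y n i" if "i \<in> ?I" for i
        using that n by (simp add: c'_def y_def J_def)
    qed
    finally have "v = ?p c'" using c(2) by simp
    thus "v \<in> ?p ` free_family J n" using c' by (rule image_eqI)
  qed
  \<comment> \<open>Induction on the distance from \<open>s\<close>: past \<open>b\<close> every
    element is a combination of generators times elements of lower degree.\<close>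
  have surj: "L n \<subseteq> ?p ` free_family J n" if "n < s + int m" for n m
    using that
  proof (induction m arbitrary: n)
    case 0
    thus ?case using s graded_subD(3)[OF gI, of n] by auto
  next
    case (Suc m)
    note IHm = Suc.IH
    consider "n < s + int m" | "s \<le> n" "n \<le> b" | "n = s + int m" "b < n" using Suc.prems by linarith
    thus ?case
    proof cases
      case 3
      have "v \<in> ?p ` free_family J n" if "k \<le> e" "v \<in> gens_smult A k L n" for k v
        using that
      proof (induction k arbitrary: v)
        case 0
        thus ?case using graded_subD(3)[OF gI, of n] by simp
      next
        case (Suc k)
        then obtain v0 v1 where v: "v0 \<in> gens_smult A k L n" "v1 \<in> L (n - dg k)" "v = v0 \<oplus>\<^bsub>A\<^esub> x k \<odot>\<^bsub>A\<^esub> v1"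
          by auto
        have k: "k < e" using Suc.prems by simp
        have "n - dg k < s + int m" using 3 dg_pos[OF k] by simp
        from IHm[OF this] have "v1 \<in> ?p ` free_family J (n - dg k)" using v(2) by blast
        from graded_subD(6)[OF gI x_deg[OF k] this, of n] have "x k \<odot>\<^bsub>A\<^esub> v1 \<in> ?p ` free_family J n" by simp
        thus ?case unfolding v(3) using Suc v(1) by (intro graded_subD(4)[OF gI]) auto
      qed
      thus ?thesis using c0[of n] 3 by (auto simp: b_def)
    qed (use Suc.IH mid in auto)
  qed
  have pL: "?p ` free_family J n = L n" for n
    using IL[of n] surj[of n "nat (n - s) + 1"] by auto
  have ker: "{c \<in> free_family J n. ?p c = \<zero>\<^bsub>A\<^esub>} = {\<zero>\<^bsub>fun_mod RM\<^esub>}" if "n < s + 1" for n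
  proof (cases "n < s")
    case True
    have "c = \<zero>\<^bsub>fun_mod RM\<^esub>" if "c \<in> free_family J n" for c using free_family_vanish[OF Js(1) True that] .
    moreover have "?p \<zero>\<^bsub>fun_mod RM\<^esub> = \<zero>\<^bsub>A\<^esub>" by (rule graded_hom_zero[OF graded_sub_free_family gL p])
    ultimately show ?thesis using graded_subD(3)[OF graded_sub_free_family, of J n] by blast
  next
    case False
    hence n: "n = s" using that by simp
    have k: "K_sub (fun_mod RM) (free_family J s)" "K_fin (fun_mod RM) (free_family J s)" using fin_genD[OF fin_gen_free_family[OF J]] by auto
    have l: "K_lin (fun_mod RM) (free_family J s) A ?p" by (rule graded_hom_K_lin[OF gL p])
    \<comment> \<open>In degree \<open>s\<close> only the basis vectors of degree \<open>s\<close>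
      contribute, each with \<open>gR 0\<close>. Their number is the dimension of
      \<open>L s\<close>, so the surjection has trivial kernel there.\<close>
    have "K_dim (fun_mod RM) (free_family J s) = (\<Sum>j\<in>J. K_dim RM (gR (s - fst j)))"
      by (rule fun_family_dim(2)[OF graded_sub_RM J fin_genD(2)[OF fin_gen_RM]])
    also have "\<dots> = (\<Sum>j\<in>J. if fst j = s then 1 else 0)"
    proof (rule sum.cong[OF refl])
      fix j assume j: "j \<in> J"
      show "K_dim RM (gR (s - fst j)) = (if fst j = s then 1 else 0)"
      proof (cases "fst j = s")
        case False
        hence "gR (s - fst j) = {\<zero>\<^bsub>RM\<^esub>}" using Js(1)[OF j] neg_degree[of "s - fst j"] by simp
        thus ?thesis using False K_fin_zero(3)[OF module_RM] by simp
      qed (simp add: RM_one_dim)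
    qed
    also have "\<dots> = card {j \<in> J. fst j = s}" by (simp add: sum.If_cases J Int_def)
    also have "{j \<in> J. fst j = s} = Pair s ` {..<K_dim A (L s)}" by (auto simp: J_def b_def)
    also have "card \<dots> = K_dim A (L s)" by (subst card_image) (auto simp: inj_on_def)
    finally have "K_dim (fun_mod RM) {c \<in> free_family J s. ?p c = \<zero>\<^bsub>A\<^esub>} = 0"
      using K_dim_ker_im(3)[OF k l] by (simp add: pL)
    thus ?thesis unfolding n
      by (rule K_dim_0_imp[OF K_sub_kernel[OF k(1) l] K_dim_ker_im(2)[OF k l]])
  qed
  show ?thesis using J Js pL ker by (intro exI[of _ J] exI[of _ y]) auto
qed

text \<open>
  A finite homogeneous dual basis. It makes the given free modules and the families \<open>free_family J\<close> instances
  of one notion, although their ambient types differ.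
\<close>

definition proj :: "('a, 'x, 's) module_scheme \<Rightarrow> (int \<Rightarrow> 'x set) \<Rightarrow> bool" where
  "proj A P \<longleftrightarrow> graded_sub A P \<and> (\<exists>(J :: (int \<times> nat) set) y co. finite J \<and> (\<forall>j\<in>J. y j \<in> P (fst j)) \<and>
    (\<forall>n. \<forall>u\<in>P n. \<forall>j\<in>J. co u j \<in> gR (n - fst j)) \<and>
    (\<forall>n. \<forall>u\<in>P n. \<forall>v\<in>P n. \<forall>j\<in>J. co (u \<oplus>\<^bsub>A\<^esub> v) j = co u j \<oplus> co v j) \<and>
    (\<forall>m n. \<forall>r\<in>gR m. \<forall>u\<in>P n. \<forall>j\<in>J. co (r \<odot>\<^bsub>A\<^esub> u) j = r \<otimes> co u j) \<and>
    (\<forall>n. \<forall>u\<in>P n. u = lin_comb A J (co u) y))"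

lemma proj_graded_sub: "proj A P \<Longrightarrow> graded_sub A P" by (simp add: proj_def)

definition unit_vec :: "'j \<Rightarrow> 'j \<Rightarrow> 'a" where "unit_vec j = (\<lambda>i. if i = j then \<one> else \<zero>)"

lemma unit_vec_free_family: "j \<in> J \<Longrightarrow> unit_vec j \<in> free_family J (fst j)"
  using gR_1 gR_0 by (auto simp: unit_vec_def fun_family_def)

lemma lin_comb_unit_vec:
  assumes J: "finite J" and c: "c \<in> free_family J n"
  shows "c = lin_comb (fun_mod RM) J c unit_vec"
proof
  interpret M: Module.module R RM by (rule module_RM)
  interpret P: Module.module R "fun_mod RM" by (rule module_fun_mod[OF module_RM])
  fix i
  have cc: "c j \<in> carrier R" for j using fun_family_carrier[OF graded_sub_RM c] by simp
  have "lin_comb (fun_mod RM) J c unit_vec i = finsum RM (\<lambda>j. c j \<otimes> unit_vec j i) J"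
    unfolding lin_comb_def using cc by (subst fun_mod_finsum[OF module_RM J]) (auto simp: unit_vec_def)
  also have "\<dots> = finsum RM (\<lambda>j. if i = j then c j else \<zero>\<^bsub>RM\<^esub>) J"
    using cc by (intro M.finsum_cong') (auto simp: unit_vec_def)
  also have "\<dots> = c i"
  proof (cases "i \<in> J")
    case True
    thus ?thesis using M.finsum_singleton[OF True J, of c] cc by auto
  next
    case False
    hence "finsum RM (\<lambda>j. if i = j then c j else \<zero>\<^bsub>RM\<^esub>) J = finsum RM (\<lambda>j. \<zero>\<^bsub>RM\<^esub>) J"
      by (intro M.finsum_cong') auto
    thus ?thesis using fun_family_off[OF c False] by simp
  qed
  finally show "c i = lin_comb (fun_mod RM) J c unit_vec i" by simp
qed

lemma proj_free_family: assumes "finite J" shows "proj (fun_mod RM) (free_family J)"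
  unfolding proj_def
proof (intro conjI exI[of _ J] exI[of _ unit_vec] exI[of _ "\<lambda>c. c"])
  show "\<forall>n. \<forall>u\<in>free_family J n. u = lin_comb (fun_mod RM) J u unit_vec" using lin_comb_unit_vec[OF assms] by blast
qed (use assms graded_sub_free_family unit_vec_free_family in \<open>auto simp: fun_family_def\<close>)

text \<open>A preimage \<open>w j\<close> is chosen for each value on the dual basis, and the
  coordinate functions, being additive and homogeneous, extend the choice to a homomorphism.\<close>

lemma lifting:
  assumes P: "proj A P" and W: "graded_sub B W" and Z: "graded_sub C Z" and f: "f \<in> graded_hom A P C Z a"
    and p: "p \<in> graded_hom B W C Z 0" and im: "\<And>n u. u \<in> P n \<Longrightarrow> f u \<in> p ` W (a + n)"
  shows "\<exists>g\<in>graded_hom A P B W a. \<forall>n. \<forall>u\<in>P n. p (g u) = f u"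
proof -
  have gP: "graded_sub A P" by (rule proj_graded_sub[OF P])
  obtain J :: "(int \<times> nat) set" and y co where J: "finite J" "\<forall>j\<in>J. y j \<in> P (fst j)"
    "\<forall>n. \<forall>u\<in>P n. \<forall>j\<in>J. co u j \<in> gR (n - fst j)"
    "\<forall>n. \<forall>u\<in>P n. \<forall>v\<in>P n. \<forall>j\<in>J. co (u \<oplus>\<^bsub>A\<^esub> v) j = co u j \<oplus> co v j"
    "\<forall>m n. \<forall>r\<in>gR m. \<forall>u\<in>P n. \<forall>j\<in>J. co (r \<odot>\<^bsub>A\<^esub> u) j = r \<otimes> co u j"
    "\<forall>n. \<forall>u\<in>P n. u = lin_comb A J (co u) y"
    using P unfolding proj_def by blast
  have "\<forall>j\<in>J. \<exists>w. w \<in> W (a + fst j) \<and> p w = f (y j)"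
    using im J(2) by fastforce
  then obtain w where w: "\<forall>j\<in>J. w j \<in> W (a + fst j) \<and> p (w j) = f (y j)" by (rule bchoice[THEN exE])
  define g where "g = (\<lambda>u. lin_comb B J (co u) w)"
  have g: "g \<in> graded_hom A P B W a"
    unfolding g_def using w J by (intro lin_comb_graded_hom[OF W J(1), where \<delta> = fst]) auto
  interpret C: Module.module R C by (rule graded_subD(1)[OF Z])
  have "p (g u) = f u" if u: "u \<in> P n" for u n
  proof -
    have "p (g u) = lin_comb C J (co u) (\<lambda>j. p (w j))"
      unfolding g_def using w J(3) u
      by (intro graded_hom_lin_comb[OF W Z p J(1), where n = "a + n" and \<delta> = "\<lambda>j. a + fst j"]) auto
    also have "\<dots> = lin_comb C J (co u) (\<lambda>j. f (y j))"
      unfolding lin_comb_def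
    proof (rule C.finsum_cong'[OF refl])
      have "co u j \<in> carrier R" "f (y j) \<in> carrier C" if "j \<in> J" for j
        using J(2,3) u that gR_carrier graded_subD(2)[OF Z graded_homD(1)[OF f]] by blast+
      thus "(\<lambda>j. co u j \<odot>\<^bsub>C\<^esub> f (y j)) \<in> J \<rightarrow> carrier C" by auto
    qed (use w in simp)
    also have "\<dots> = f (lin_comb A J (co u) y)"
      using J u by (intro graded_hom_lin_comb[OF gP Z f J(1), where n = n and \<delta> = fst, symmetric]) auto
    also have "\<dots> = f u" using J(6) u by metis
    finally show ?thesis .
  qed
  thus ?thesis using g by blast
qed


text \<open>The degreewise counterpart of \<open>graded_free_resolution\<close>. With
  \<open>proj\<close> in place of freeness it covers both the given resolution and the one
  constructed below, so comparison works in either direction.\<close>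

definition resolution :: "(nat \<Rightarrow> ('a, 'x, 's) module_scheme) \<Rightarrow> (nat \<Rightarrow> int \<Rightarrow> 'x set) \<Rightarrow> (nat \<Rightarrow> 'x \<Rightarrow> 'x) \<Rightarrow>
    ('x \<Rightarrow> 'y) \<Rightarrow> ('a, 'y, 't) module_scheme \<Rightarrow> (int \<Rightarrow> 'y set) \<Rightarrow> bool" where
  "resolution A P d \<epsilon> M L \<longleftrightarrow> graded_sub M L \<and> (\<forall>i. proj (A i) (P i)) \<and>
    (\<forall>i. d i \<in> graded_hom (A (Suc i)) (P (Suc i)) (A i) (P i) 0) \<and> \<epsilon> \<in> graded_hom (A 0) (P 0) M L 0 \<and>
    (\<forall>i n. d (Suc i) ` P (Suc (Suc i)) n = {u \<in> P (Suc i) n. d i u = \<zero>\<^bsub>A i\<^esub>}) \<and>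
    (\<forall>n. d 0 ` P (Suc 0) n = {u \<in> P 0 n. \<epsilon> u = \<zero>\<^bsub>M\<^esub>}) \<and> (\<forall>n. \<epsilon> ` P 0 n = L n)"

lemma resolutionD:
  assumes "resolution A P d \<epsilon> M L"
  shows "graded_sub M L" "proj (A i) (P i)" "graded_sub (A i) (P i)"
    "d i \<in> graded_hom (A (Suc i)) (P (Suc i)) (A i) (P i) 0" "\<epsilon> \<in> graded_hom (A 0) (P 0) M L 0"
    "d (Suc i) ` P (Suc (Suc i)) n = {u \<in> P (Suc i) n. d i u = \<zero>\<^bsub>A i\<^esub>}"
    "d 0 ` P (Suc 0) n = {u \<in> P 0 n. \<epsilon> u = \<zero>\<^bsub>M\<^esub>}" "\<epsilon> ` P 0 n = L n"
    "u \<in> P (Suc (Suc i)) n \<Longrightarrow> d i (d (Suc i) u) = \<zero>\<^bsub>A i\<^esub>"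
    "u \<in> P (Suc 0) n \<Longrightarrow> \<epsilon> (d 0 u) = \<zero>\<^bsub>M\<^esub>"
proof -
  note a = assms[unfolded resolution_def]
  show "graded_sub M L" "proj (A i) (P i)" "d i \<in> graded_hom (A (Suc i)) (P (Suc i)) (A i) (P i) 0"
    "\<epsilon> \<in> graded_hom (A 0) (P 0) M L 0" "\<epsilon> ` P 0 n = L n" using a by simp_all
  thus "graded_sub (A i) (P i)" by (simp add: proj_graded_sub)
  show 1: "d (Suc i) ` P (Suc (Suc i)) n = {u \<in> P (Suc i) n. d i u = \<zero>\<^bsub>A i\<^esub>}" using a by simp
  show 2: "d 0 ` P (Suc 0) n = {u \<in> P 0 n. \<epsilon> u = \<zero>\<^bsub>M\<^esub>}" using a by simp
  show "d i (d (Suc i) u) = \<zero>\<^bsub>A i\<^esub>" if "u \<in> P (Suc (Suc i)) n"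
    using imageI[OF that, of "d (Suc i)"] unfolding 1 by simp
  show "\<epsilon> (d 0 u) = \<zero>\<^bsub>M\<^esub>" if "u \<in> P (Suc 0) n"
    using imageI[OF that, of "d 0"] unfolding 2 by simp
qed

section \<open>Comparison maps and homotopies\<close>

lemma graded_hom_id: "graded_sub A U \<Longrightarrow> (\<lambda>u. u) \<in> graded_hom A U A U 0"
  by (simp add: graded_hom_def)

lemma graded_hom_sub:
  assumes U: "graded_sub A U" and W: "graded_sub B W" and f: "f \<in> graded_hom A U B W a" and g: "g \<in> graded_hom A U B W a"
  shows "(\<lambda>u. f u \<ominus>\<^bsub>B\<^esub> g u) \<in> graded_hom A U B W a"
proof -
  interpret B: Module.module R B by (rule graded_subD(1)[OF W])
  have fc: "f u \<in> carrier B" "g u \<in> carrier B" if "u \<in> U n" for u n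
    using graded_subD(2)[OF W graded_homD(1)[OF f that]] graded_subD(2)[OF W graded_homD(1)[OF g that]] by auto
  show ?thesis
    unfolding graded_hom_def
  proof (intro CollectI conjI allI ballI)
    show "f u \<ominus>\<^bsub>B\<^esub> g u \<in> W (a + n)" if "u \<in> U n" for u n
      by (rule graded_sub_diff[OF W graded_homD(1)[OF f that] graded_homD(1)[OF g that]])
    show "f (u \<oplus>\<^bsub>A\<^esub> v) \<ominus>\<^bsub>B\<^esub> g (u \<oplus>\<^bsub>A\<^esub> v) = (f u \<ominus>\<^bsub>B\<^esub> g u) \<oplus>\<^bsub>B\<^esub> (f v \<ominus>\<^bsub>B\<^esub> g v)"
      if "u \<in> U n" "v \<in> U n" for u v n
      using fc[OF that(1)] fc[OF that(2)] graded_homD(2)[OF f that] graded_homD(2)[OF g that]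
      by (simp add: a_minus_def B.minus_add B.a_ac)
    show "f (r \<odot>\<^bsub>A\<^esub> u) \<ominus>\<^bsub>B\<^esub> g (r \<odot>\<^bsub>A\<^esub> u) = r \<odot>\<^bsub>B\<^esub> (f u \<ominus>\<^bsub>B\<^esub> g u)"
      if "r \<in> gR m" "u \<in> U n" for r u m n
      using fc[OF that(2)] gR_carrier[OF that(1)] graded_homD(3)[OF f that] graded_homD(3)[OF g that]
      by (simp add: a_minus_def B.smult_r_distr B.smult_r_minus)
  qed
qed

lemma graded_hom_comp0:
  assumes "f \<in> graded_hom A U B W a" "g \<in> graded_hom B W C Z 0" shows "(\<lambda>u. g (f u)) \<in> graded_hom A U C Z a"
  using graded_hom_comp[OF assms] by simp

lemma comparison:
  assumes P: "resolution A P d \<epsilon> M L" and Q: "resolution B Q d' \<epsilon>' M L"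
  shows "\<exists>f. (\<forall>i. f i \<in> graded_hom (A i) (P i) (B i) (Q i) 0) \<and> (\<forall>n. \<forall>u\<in>P 0 n. \<epsilon>' (f 0 u) = \<epsilon> u) \<and>
    (\<forall>i n. \<forall>u\<in>P (Suc i) n. d' i (f (Suc i) u) = f i (d i u))"
proof -
  note P' = resolutionD[OF P] and Q' = resolutionD[OF Q]
  \<comment> \<open>The invariant records that \<open>f\<close> after \<open>d i\<close> takes
    values in the image of \<open>d' i\<close>, which is the condition for lifting in the next
    position.\<close>
  let ?P = "\<lambda>i f. f \<in> graded_hom (A i) (P i) (B i) (Q i) 0 \<and> (i = 0 \<longrightarrow> (\<forall>n. \<forall>u\<in>P 0 n. \<epsilon>' (f u) = \<epsilon> u)) \<and>
    (\<forall>n. \<forall>u\<in>P (Suc i) n. f (d i u) \<in> d' i ` Q (Suc i) n)"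
  have "\<exists>f. \<forall>i. ?P i (f i) \<and> (\<forall>n. \<forall>u\<in>P (Suc i) n. d' i (f (Suc i) u) = f i (d i u))"
  proof (rule dependent_nat_choice)
    have "\<epsilon> u \<in> \<epsilon>' ` Q 0 (0 + n)" if "u \<in> P 0 n" for n u
      using graded_homD0[OF P'(5) that] Q'(8) by simp
    from lifting[OF P'(2) Q'(3) P'(1) P'(5) Q'(5) this] obtain f
      where f: "f \<in> graded_hom (A 0) (P 0) (B 0) (Q 0) 0" "\<forall>n. \<forall>u\<in>P 0 n. \<epsilon>' (f u) = \<epsilon> u" by blast
    have "f (d 0 u) \<in> d' 0 ` Q (Suc 0) n" if "u \<in> P (Suc 0) n" for n u
      unfolding Q'(7) using graded_homD0[OF f(1) graded_homD0[OF P'(4) that]] f(2) graded_homD0[OF P'(4) that] P'(10)[OF that] by simp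
    thus "\<exists>f. ?P 0 f" using f by blast
  next
    fix f i assume f: "?P i f"
    have fh: "f \<in> graded_hom (A i) (P i) (B i) (Q i) 0" using f by (rule conjunct1)
    have "(\<lambda>u. f (d i u)) \<in> graded_hom (A (Suc i)) (P (Suc i)) (B i) (Q i) 0"
      by (rule graded_hom_comp0[OF P'(4) fh])
    moreover have "f (d i u) \<in> d' i ` Q (Suc i) (0 + n)" if "u \<in> P (Suc i) n" for n u using f that by simp
    ultimately obtain g where g: "g \<in> graded_hom (A (Suc i)) (P (Suc i)) (B (Suc i)) (Q (Suc i)) 0"
      "\<forall>n. \<forall>u\<in>P (Suc i) n. d' i (g u) = f (d i u)"
      using lifting[OF P'(2) Q'(3) Q'(3) _ Q'(4)] by blast
    have "g (d (Suc i) u) \<in> d' (Suc i) ` Q (Suc (Suc i)) n" if u: "u \<in> P (Suc (Suc i)) n" for n u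
    proof -
      have du: "d (Suc i) u \<in> P (Suc i) n" by (rule graded_homD0[OF P'(4) u])
      have "d' i (g (d (Suc i) u)) = f (d i (d (Suc i) u))" using g(2) du by blast
      also have "\<dots> = \<zero>\<^bsub>B i\<^esub>" unfolding P'(9)[OF u] by (rule graded_hom_zero[OF P'(3) Q'(3) fh])
      finally show ?thesis unfolding Q'(6) using graded_homD0[OF g(1) du] by simp
    qed
    thus "\<exists>g. ?P (Suc i) g \<and> (\<forall>n. \<forall>u\<in>P (Suc i) n. d' i (g u) = f (d i u))"
      by (intro exI[of _ g] conjI allI ballI impI) (use g in auto)
  qed
  then obtain f where f: "\<forall>i. ?P i (f i) \<and> (\<forall>n. \<forall>u\<in>P (Suc i) n. d' i (f (Suc i) u) = f i (d i u))"
    by (rule exE)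
  have f': "?P i (f i)" "\<forall>n. \<forall>u\<in>P (Suc i) n. d' i (f (Suc i) u) = f i (d i u)" for i
    using spec[OF f, of i] by (rule conjunct1, rule conjunct2)
  show ?thesis
    by (intro exI[of _ f] conjI allI ballI) (use f'(1)[THEN conjunct1] f'(1)[of 0] f'(2) in simp_all)
qed

text \<open>Once \<open>h\<close> solves the equation in one position, the difference of
  \<open>w (Suc i) u\<close> and \<open>h (d i u)\<close> is a cycle, so exactness makes it
  liftable. The invariant of the recursion carries this along.\<close>

lemma homotopy:
  assumes P: "resolution A P d \<epsilon> M L"
    and w: "\<And>i. w i \<in> graded_hom (A i) (P i) (A i) (P i) 0" "\<And>n u. u \<in> P 0 n \<Longrightarrow> \<epsilon> (w 0 u) = \<zero>\<^bsub>M\<^esub>"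
    "\<And>i n u. u \<in> P (Suc i) n \<Longrightarrow> d i (w (Suc i) u) = w i (d i u)"
  shows "\<exists>h. (\<forall>i. h i \<in> graded_hom (A i) (P i) (A (Suc i)) (P (Suc i)) 0) \<and> (\<forall>n. \<forall>u\<in>P 0 n. d 0 (h 0 u) = w 0 u) \<and>
    (\<forall>i n. \<forall>u\<in>P (Suc i) n. d (Suc i) (h (Suc i) u) = w (Suc i) u \<ominus>\<^bsub>A (Suc i)\<^esub> h i (d i u))"
proof -
  note P' = resolutionD[OF P]
  let ?P = "\<lambda>i h. h \<in> graded_hom (A i) (P i) (A (Suc i)) (P (Suc i)) 0 \<and> (i = 0 \<longrightarrow> (\<forall>n. \<forall>u\<in>P 0 n. d 0 (h u) = w 0 u)) \<and>
    (\<forall>n. \<forall>u\<in>P (Suc i) n. w (Suc i) u \<ominus>\<^bsub>A (Suc i)\<^esub> h (d i u) \<in> d (Suc i) ` P (Suc (Suc i)) n)"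
  have step: "w (Suc i) u \<ominus>\<^bsub>A (Suc i)\<^esub> h (d i u) \<in> d (Suc i) ` P (Suc (Suc i)) n"
    if h: "h \<in> graded_hom (A i) (P i) (A (Suc i)) (P (Suc i)) 0" and u: "u \<in> P (Suc i) n"
      and eq: "d i (h (d i u)) = w i (d i u)" for h i n u
  proof -
    interpret Ai: Module.module R "A i" by (rule graded_subD(1)[OF P'(3)])
    have wu: "w (Suc i) u \<in> P (Suc i) n" and hu: "h (d i u) \<in> P (Suc i) n"
      using graded_homD0[OF w(1) u] graded_homD0[OF h graded_homD0[OF P'(4) u]] by auto
    have "d i (w (Suc i) u \<ominus>\<^bsub>A (Suc i)\<^esub> h (d i u)) = w i (d i u) \<ominus>\<^bsub>A i\<^esub> w i (d i u)"
      using graded_hom_diff[OF P'(3) P'(3) P'(4) wu hu] w(3)[OF u] eq by simp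
    also have "\<dots> = \<zero>\<^bsub>A i\<^esub>"
      using graded_subD(2)[OF P'(3) graded_homD0[OF w(1) graded_homD0[OF P'(4) u]]] by (simp add: a_minus_def Ai.r_neg)
    finally show ?thesis unfolding P'(6) using graded_sub_diff[OF P'(3) wu hu] by simp
  qed
  have "\<exists>h. \<forall>i. ?P i (h i) \<and> (\<forall>n. \<forall>u\<in>P (Suc i) n. d (Suc i) (h (Suc i) u) = w (Suc i) u \<ominus>\<^bsub>A (Suc i)\<^esub> h i (d i u))"
  proof (rule dependent_nat_choice)
    have "w 0 u \<in> d 0 ` P (Suc 0) (0 + n)" if "u \<in> P 0 n" for n u
      unfolding P'(7) using graded_homD0[OF w(1) that] w(2)[OF that] by simp
    from lifting[OF P'(2) P'(3) P'(3) w(1) P'(4) this] obtain h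
      where h: "h \<in> graded_hom (A 0) (P 0) (A (Suc 0)) (P (Suc 0)) 0" "\<forall>n. \<forall>u\<in>P 0 n. d 0 (h u) = w 0 u" by blast
    have "w (Suc 0) u \<ominus>\<^bsub>A (Suc 0)\<^esub> h (d 0 u) \<in> d (Suc 0) ` P (Suc (Suc 0)) n" if "u \<in> P (Suc 0) n" for n u
      using h(2) graded_homD0[OF P'(4) that] by (intro step[OF h(1) that]) blast
    thus "\<exists>h. ?P 0 h" using h by blast
  next
    fix h i assume h: "?P i h"
    have hh: "h \<in> graded_hom (A i) (P i) (A (Suc i)) (P (Suc i)) 0" using h by (rule conjunct1)
    have "(\<lambda>u. w (Suc i) u \<ominus>\<^bsub>A (Suc i)\<^esub> h (d i u)) \<in> graded_hom (A (Suc i)) (P (Suc i)) (A (Suc i)) (P (Suc i)) 0"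
      by (rule graded_hom_sub[OF P'(3) P'(3) w(1) graded_hom_comp0[OF P'(4) hh]])
    moreover have "w (Suc i) u \<ominus>\<^bsub>A (Suc i)\<^esub> h (d i u) \<in> d (Suc i) ` P (Suc (Suc i)) (0 + n)"
      if "u \<in> P (Suc i) n" for n u using h that by simp
    ultimately obtain g where g: "g \<in> graded_hom (A (Suc i)) (P (Suc i)) (A (Suc (Suc i))) (P (Suc (Suc i))) 0"
      "\<forall>n. \<forall>u\<in>P (Suc i) n. d (Suc i) (g u) = w (Suc i) u \<ominus>\<^bsub>A (Suc i)\<^esub> h (d i u)"
      using lifting[OF P'(2) P'(3) P'(3) _ P'(4)] by blast
    have "w (Suc (Suc i)) u \<ominus>\<^bsub>A (Suc (Suc i))\<^esub> g (d (Suc i) u) \<in> d (Suc (Suc i)) ` P (Suc (Suc (Suc i))) n"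
      if u: "u \<in> P (Suc (Suc i)) n" for n u
    proof (rule step[OF g(1) u])
      interpret A1: Module.module R "A (Suc i)" by (rule graded_subD(1)[OF P'(3)])
      have du: "d (Suc i) u \<in> P (Suc i) n" by (rule graded_homD0[OF P'(4) u])
      have "d (Suc i) (g (d (Suc i) u)) = w (Suc i) (d (Suc i) u) \<ominus>\<^bsub>A (Suc i)\<^esub> h (d i (d (Suc i) u))"
        using g(2) du by blast
      also have "h (d i (d (Suc i) u)) = \<zero>\<^bsub>A (Suc i)\<^esub>"
        unfolding P'(9)[OF u] by (rule graded_hom_zero[OF P'(3) P'(3) hh])
      finally show "d (Suc i) (g (d (Suc i) u)) = w (Suc i) (d (Suc i) u)"
        using graded_subD(2)[OF P'(3) graded_homD0[OF w(1) du]] by (simp add: a_minus_def)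
    qed
    thus "\<exists>g. ?P (Suc i) g \<and> (\<forall>n. \<forall>u\<in>P (Suc i) n. d (Suc i) (g u) = w (Suc i) u \<ominus>\<^bsub>A (Suc i)\<^esub> h (d i u))"
      by (intro exI[of _ g] conjI allI ballI impI) (use g in auto)
  qed
  then obtain h where h: "\<forall>i. ?P i (h i) \<and> (\<forall>n. \<forall>u\<in>P (Suc i) n. d (Suc i) (h (Suc i) u) = w (Suc i) u \<ominus>\<^bsub>A (Suc i)\<^esub> h i (d i u))"
    by (rule exE)
  have h': "?P i (h i)" "\<forall>n. \<forall>u\<in>P (Suc i) n. d (Suc i) (h (Suc i) u) = w (Suc i) u \<ominus>\<^bsub>A (Suc i)\<^esub> h i (d i u)" for i
    using spec[OF h, of i] by (rule conjunct1, rule conjunct2)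
  show ?thesis
    by (intro exI[of _ h] conjI allI ballI) (use h'(1)[THEN conjunct1] h'(1)[of 0] h'(2) in simp_all)
qed

text \<open>The state of the recursion is an index set together with the kernel of its map. By
  \<open>cover\<close> each kernel starts at least one degree later than the preceding one; this
  growth is what makes the truncation errors small.\<close>

lemma resolution_exists:
  assumes M: "fin_gen M L" and s: "\<forall>n<s. L n = {\<zero>\<^bsub>M\<^esub>}"
  shows "\<exists>J d \<epsilon>. resolution (\<lambda>_. fun_mod RM) (\<lambda>i. free_family (J i)) d \<epsilon> M L \<and> (\<forall>i. finite (J i)) \<and>
    (\<forall>i. \<forall>j\<in>J i. s + int i \<le> fst j)"
proof -
  have gM: "graded_sub M L" by (rule fin_genD(1)[OF M])
  obtain J0 y0 where J0: "finite J0" "\<forall>j\<in>J0. s \<le> fst j \<and> y0 j \<in> L (fst j)"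
    "\<forall>n. (\<lambda>c. lin_comb M J0 c y0) ` free_family J0 n = L n"
    "\<forall>n<s + 1. {c \<in> free_family J0 n. lin_comb M J0 c y0 = \<zero>\<^bsub>M\<^esub>} = {\<zero>\<^bsub>fun_mod RM\<^esub>}"
    using cover[OF M s] by (elim exE conjE) (rule that; assumption)
  define \<epsilon> where "\<epsilon> = (\<lambda>c. lin_comb M J0 c y0)"
  define L0 where "L0 = (\<lambda>n. {c \<in> free_family J0 n. \<epsilon> c = \<zero>\<^bsub>M\<^esub>})"
  have \<epsilon>: "\<epsilon> \<in> graded_hom (fun_mod RM) (free_family J0) M L 0" unfolding \<epsilon>_def using J0 by (intro lin_comb_free_family_graded_hom[OF gM]) auto
  \<comment> \<open>The clause for \<open>i = 0\<close> fixes the initial state, so that the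
    sequence of kernels starts with the kernel of \<open>\<epsilon>\<close>.\<close>
  let ?P = "\<lambda>i \<sigma>. (i = 0 \<longrightarrow> \<sigma> = (J0, L0)) \<and> finite (fst \<sigma>) \<and> (\<forall>j\<in>fst \<sigma>. s + int i \<le> fst j) \<and>
    graded_sub (fun_mod RM) (snd \<sigma>) \<and> (\<forall>n. snd \<sigma> n \<subseteq> free_family (fst \<sigma>) n) \<and>
    (\<forall>n<s + int i + 1. snd \<sigma> n = {\<zero>\<^bsub>fun_mod RM\<^esub>})"
  let ?Q = "\<lambda>\<sigma> \<sigma>'. \<exists>y. (\<forall>j\<in>fst \<sigma>'. y j \<in> snd \<sigma> (fst j)) \<and>
    (\<forall>n. (\<lambda>c. lin_comb (fun_mod RM) (fst \<sigma>') c y) ` free_family (fst \<sigma>') n = snd \<sigma> n) \<and>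
    snd \<sigma>' = (\<lambda>n. {c \<in> free_family (fst \<sigma>') n. lin_comb (fun_mod RM) (fst \<sigma>') c y = \<zero>\<^bsub>fun_mod RM\<^esub>})"
  have "\<exists>\<sigma>. \<forall>i. ?P i (\<sigma> i) \<and> ?Q (\<sigma> i) (\<sigma> (Suc i))"
  proof (rule dependent_nat_choice)
    have "graded_sub (fun_mod RM) L0" unfolding L0_def by (rule graded_sub_kernel[OF graded_sub_free_family gM \<epsilon>])
    thus "\<exists>\<sigma>. ?P 0 \<sigma>"
      using J0 by (intro exI[of _ "(J0, L0)"]) (simp add: L0_def \<epsilon>_def del: fun_mod_simps)
  next
    fix \<sigma> i assume \<sigma>: "?P i \<sigma>"
    have f: "fin_gen (fun_mod RM) (snd \<sigma>)" using \<sigma> by (intro fin_gen_subfamily[OF fin_gen_free_family[of "fst \<sigma>"]]) blast+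
    have v: "\<forall>n<s + int i + 1. snd \<sigma> n = {\<zero>\<^bsub>fun_mod RM\<^esub>}" using \<sigma> by blast
    obtain J y where J: "finite J" "\<forall>j\<in>J. s + int i + 1 \<le> fst j \<and> y j \<in> snd \<sigma> (fst j)"
      "\<forall>n. (\<lambda>c. lin_comb (fun_mod RM) J c y) ` free_family J n = snd \<sigma> n"
      "\<forall>n<s + int i + 1 + 1. {c \<in> free_family J n. lin_comb (fun_mod RM) J c y = \<zero>\<^bsub>fun_mod RM\<^esub>} = {\<zero>\<^bsub>fun_mod RM\<^esub>}"
      using cover[OF f v] by (elim exE conjE) (rule that; assumption)
    have h: "(\<lambda>c. lin_comb (fun_mod RM) J c y) \<in> graded_hom (fun_mod RM) (free_family J) (fun_mod RM) (snd \<sigma>) 0"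
      using J by (intro lin_comb_free_family_graded_hom[OF fin_genD(1)[OF f]]) auto
    let ?\<tau> = "(J, \<lambda>n. {c \<in> free_family J n. lin_comb (fun_mod RM) J c y = \<zero>\<^bsub>fun_mod RM\<^esub>})"
    have P: "?P (Suc i) ?\<tau>"
      using J graded_sub_kernel[OF graded_sub_free_family fin_genD(1)[OF f] h] by (simp add: algebra_simps del: fun_mod_simps)
    have Q: "?Q \<sigma> ?\<tau>" using J by (intro exI[of _ y]) (simp del: fun_mod_simps)
    show "\<exists>\<tau>. ?P (Suc i) \<tau> \<and> ?Q \<sigma> \<tau>" by (rule exI[of _ ?\<tau>]) (rule conjI[OF P Q])
  qed
  then obtain \<sigma> where \<sigma>: "\<forall>i. ?P i (\<sigma> i) \<and> ?Q (\<sigma> i) (\<sigma> (Suc i))" by (rule exE)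
  have \<sigma>1: "?P i (\<sigma> i)" for i using spec[OF \<sigma>, of i] by (rule conjunct1)
  define J where "J i = fst (\<sigma> i)" for i
  define K' where "K' i = snd (\<sigma> i)" for i
  have "\<sigma> 0 = (J0, L0)" using \<sigma>[THEN spec[of _ 0]] by simp
  hence start: "J 0 = J0" "K' 0 = L0" by (simp_all add: J_def K'_def)
  have JK: "finite (J i)" "\<forall>j\<in>J i. s + int i \<le> fst j" "graded_sub (fun_mod RM) (K' i)" "K' i n \<subseteq> free_family (J i) n" for i n
    using \<sigma>1[of i] unfolding J_def K'_def by simp_all
  have "\<forall>i. \<exists>y. (\<forall>j\<in>J (Suc i). y j \<in> K' i (fst j)) \<and>
    (\<forall>n. (\<lambda>c. lin_comb (fun_mod RM) (J (Suc i)) c y) ` free_family (J (Suc i)) n = K' i n) \<and>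
    K' (Suc i) = (\<lambda>n. {c \<in> free_family (J (Suc i)) n. lin_comb (fun_mod RM) (J (Suc i)) c y = \<zero>\<^bsub>fun_mod RM\<^esub>})"
    using \<sigma> unfolding J_def K'_def by blast
  then obtain y where y: "\<forall>i. (\<forall>j\<in>J (Suc i). y i j \<in> K' i (fst j)) \<and>
    (\<forall>n. (\<lambda>c. lin_comb (fun_mod RM) (J (Suc i)) c (y i)) ` free_family (J (Suc i)) n = K' i n) \<and>
    K' (Suc i) = (\<lambda>n. {c \<in> free_family (J (Suc i)) n. lin_comb (fun_mod RM) (J (Suc i)) c (y i) = \<zero>\<^bsub>fun_mod RM\<^esub>})"
    by (rule choice[THEN exE])
  define d where "d i = (\<lambda>c. lin_comb (fun_mod RM) (J (Suc i)) c (y i))" for i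
  have im: "d i ` free_family (J (Suc i)) n = K' i n" for i n using y unfolding d_def by blast
  have ker: "K' (Suc i) n = {c \<in> free_family (J (Suc i)) n. d i c = \<zero>\<^bsub>fun_mod RM\<^esub>}" for i n
    using y unfolding d_def by metis
  have "resolution (\<lambda>_. fun_mod RM) (\<lambda>i. free_family (J i)) d \<epsilon> M L"
    unfolding resolution_def
  proof (intro conjI allI)
    show "graded_sub M L" by (rule gM)
    show "proj (fun_mod RM) (free_family (J i))" for i by (rule proj_free_family[OF JK(1)])
    show "d i \<in> graded_hom (fun_mod RM) (free_family (J (Suc i))) (fun_mod RM) (free_family (J i)) 0" for i
      unfolding d_def using y JK(4) by (intro lin_comb_free_family_graded_hom[OF graded_sub_free_family JK(1)]) (simp, blast)
    show "\<epsilon> \<in> graded_hom (fun_mod RM) (free_family (J 0)) M L 0" using \<epsilon> start by simp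
    show "d (Suc i) ` free_family (J (Suc (Suc i))) n = {u \<in> free_family (J (Suc i)) n. d i u = \<zero>\<^bsub>fun_mod RM\<^esub>}" for i n
      unfolding im by (rule ker)
    show "d 0 ` free_family (J (Suc 0)) n = {u \<in> free_family (J 0) n. \<epsilon> u = \<zero>\<^bsub>M\<^esub>}" for n
      unfolding im start L0_def by simp
    show "\<epsilon> ` free_family (J 0) n = L n" for n using J0(3) start by (simp add: \<epsilon>_def)
  qed
  thus ?thesis using JK(1,2) by blast
qed

end

section \<open>The complex of homomorphisms from a free resolution\<close>

context generated_graded_algebra begin

lemma fin_gen_image:
  assumes U: "fin_gen A U" and W: "graded_sub B W" and p: "p \<in> graded_hom A U B W 0" and im: "\<And>n. p ` U n = W n"
  shows "fin_gen B W"
proof -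
  have gU: "graded_sub A U" by (rule fin_genD(1)[OF U])
  obtain s where s: "\<And>n. n < s \<Longrightarrow> U n = {\<zero>\<^bsub>A\<^esub>}" using U by (auto simp: fin_gen_def)
  obtain c where c: "\<And>n. c < n \<Longrightarrow> U n \<subseteq> max_smult A U n" using U by (auto simp: fin_gen_def)
  have W0: "W n = {\<zero>\<^bsub>B\<^esub>}" if "n < s" for n
    using im[of n] s[OF that] graded_hom_zero[OF gU W p] by simp
  have fdW: "K_fin B (W n)" for n
    using K_dim_ker_im(1)[OF fin_genD(3,2)[OF U] graded_hom_K_lin[OF W p], of n] by (simp add: im)
  have mxp: "p u \<in> gens_smult B k W n" if "k \<le> e" "u \<in> gens_smult A k U n" for k u n
    using that
  proof (induction k arbitrary: u)
    case 0
    thus ?case using graded_hom_zero[OF gU W p] by simp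
  next
    case (Suc k)
    then obtain v w where v: "v \<in> gens_smult A k U n" "w \<in> U (n - dg k)" "u = v \<oplus>\<^bsub>A\<^esub> x k \<odot>\<^bsub>A\<^esub> w" by auto
    have k: "k < e" using Suc.prems by simp
    have vU: "v \<in> U n" using graded_sub_gens_smult(2)[OF gU less_imp_le[OF k]] v(1) by (rule subsetD)
    have "x k \<odot>\<^bsub>A\<^esub> w \<in> U n" using graded_subD(6)[OF gU x_deg[OF k] v(2)] by simp
    hence "p u = p v \<oplus>\<^bsub>B\<^esub> x k \<odot>\<^bsub>B\<^esub> p w"
      unfolding v(3) by (simp add: graded_homD(2)[OF p vU] graded_homD(3)[OF p x_deg[OF k] v(2)])
    moreover have "p v \<in> gens_smult B k W n" using Suc v(1) by simp
    ultimately show ?case using graded_homD0[OF p v(2)] by auto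
  qed
  have mxW: "W n \<subseteq> max_smult B W n" if "c < n" for n
  proof
    fix w assume "w \<in> W n"
    then obtain u where u: "u \<in> U n" "w = p u" using im[of n] by blast
    show "w \<in> max_smult B W n" unfolding u(2) by (rule mxp[OF le_refl subsetD[OF c[OF that] u(1)]])
  qed
  have "\<exists>s. \<forall>n<s. W n = {\<zero>\<^bsub>B\<^esub>}" using W0 by (intro exI[of _ s]) simp
  moreover have "\<exists>c. \<forall>n>c. W n \<subseteq> max_smult B W n" using mxW by (intro exI[of _ c]) simp
  ultimately show ?thesis unfolding fin_gen_def using W fdW by simp
qed

text \<open>A cycle is transported along \<open>q\<close>, bounded there, and the bounding chain is
  brought back along \<open>p\<close>.\<close>

lemma koszul_exact_retract:
  assumes U: "graded_sub A U" and W: "graded_sub B W" and p: "p \<in> graded_hom A U B W 0" and q: "q \<in> graded_hom B W A U 0"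
    and pq: "\<And>n w. w \<in> W n \<Longrightarrow> p (q w) = w" and ex: "koszul_exact A U j n"
  shows "koszul_exact B W j n"
  unfolding koszul_exact_def
proof (intro ballI impI)
  fix z assume z: "z \<in> koszul B W j n" "koszul_diff B z = (\<lambda>_. \<zero>\<^bsub>B\<^esub>)"
  have qz: "(\<lambda>S. q (z S)) \<in> koszul A U j n" using koszul_compose[OF W U q z(1)] by simp
  have "koszul_diff A (\<lambda>S. q (z S)) = (\<lambda>S. q (koszul_diff B z S))" by (rule koszul_diff_compose[OF W U q z(1), symmetric])
  also have "\<dots> = (\<lambda>_. \<zero>\<^bsub>A\<^esub>)" using z(2) graded_hom_zero[OF W U q] by simp
  finally obtain w where w: "w \<in> koszul A U (Suc j) n" "koszul_diff A w = (\<lambda>S. q (z S))"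
    using ex qz unfolding koszul_exact_def by blast
  have "koszul_diff B (\<lambda>S. p (w S)) = (\<lambda>S. p (koszul_diff A w S))" by (rule koszul_diff_compose[OF U W p w(1), symmetric])
  also have "\<dots> = z" using w(2) pq[OF koszul_deg[OF W z(1)]] by simp
  finally show "\<exists>w\<in>koszul B W (Suc j) n. koszul_diff B w = z" using koszul_compose[OF U W p w(1)] by auto
qed

lemma eval_graded_hom:
  assumes "graded_sub A U" shows "i \<in> J \<Longrightarrow> (\<lambda>f. f i) \<in> graded_hom (fun_mod A) (fun_family A U J \<delta>) A U (- \<delta> i)"
  by (auto simp: graded_hom_def fun_family_def)

text \<open>The Koszul complex of a direct sum is solved coordinate by coordinate, each in its
  shifted degree.\<close>

lemma koszul_exact_fun_family:
  assumes U: "graded_sub A U" and ex: "\<And>i. i \<in> J \<Longrightarrow> koszul_exact A U j (n - \<delta> i)"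
  shows "koszul_exact (fun_mod A) (fun_family A U J \<delta>) j n"
  unfolding koszul_exact_def
proof (intro ballI impI)
  note P = graded_sub_fun_family[OF U, of J \<delta>]
  fix z assume z: "z \<in> koszul (fun_mod A) (fun_family A U J \<delta>) j n" "koszul_diff (fun_mod A) z = (\<lambda>_. \<zero>\<^bsub>fun_mod A\<^esub>)"
  have "\<forall>i\<in>J. \<exists>w. w \<in> koszul A U (Suc j) (n - \<delta> i) \<and> koszul_diff A w = (\<lambda>S. z S i)"
  proof
    fix i assume i: "i \<in> J"
    note ev = eval_graded_hom[OF U i, of \<delta>]
    have zi: "(\<lambda>S. z S i) \<in> koszul A U j (n - \<delta> i)" using koszul_compose[OF P U ev z(1)] by simp
    have "koszul_diff A (\<lambda>S. z S i) = (\<lambda>S. koszul_diff (fun_mod A) z S i)" by (rule koszul_diff_compose[OF P U ev z(1), symmetric])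
    hence "koszul_diff A (\<lambda>S. z S i) = (\<lambda>_. \<zero>\<^bsub>A\<^esub>)" using z(2) by simp
    thus "\<exists>w. w \<in> koszul A U (Suc j) (n - \<delta> i) \<and> koszul_diff A w = (\<lambda>S. z S i)"
      using ex[OF i] zi unfolding koszul_exact_def by blast
  qed
  then obtain w where w: "\<forall>i\<in>J. w i \<in> koszul A U (Suc j) (n - \<delta> i) \<and> koszul_diff A (w i) = (\<lambda>S. z S i)"
    by (rule bchoice[THEN exE])
  define v where "v S i = (if i \<in> J then w i S else \<zero>\<^bsub>A\<^esub>)" for S i
  have "v S \<in> fun_family A U J \<delta> (n - dS S)" for S
  proof -
    have "w i S \<in> U (n - dS S - \<delta> i)" if "i \<in> J" for i
      using koszul_deg[OF U, of "w i" "Suc j" "n - \<delta> i" S] w that by (simp add: algebra_simps)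
    thus ?thesis by (auto simp: fun_family_def v_def)
  qed
  moreover have "v S = \<zero>\<^bsub>fun_mod A\<^esub>" if "S \<notin> KS (Suc j)" for S
    using w fun_family_off[OF _ that] by (fastforce simp: v_def)
  ultimately have v: "v \<in> koszul (fun_mod A) (fun_family A U J \<delta>) (Suc j) n" by (auto simp: fun_family_def[of "fun_mod A"])
  have "koszul_diff (fun_mod A) v S i = z S i" for S i
  proof (cases "i \<in> J")
    case True
    have "koszul_diff (fun_mod A) v S i = koszul_diff A (\<lambda>S. v S i) S"
      using koszul_diff_compose[OF P U eval_graded_hom[OF U True] v] by (rule fun_cong)
    thus ?thesis using True w by (simp add: v_def)
  next
    case False
    note g = graded_sub_fun_family[OF P, of "KS j" dS]
    show ?thesis
      using fun_family_off[OF koszul_deg[OF P koszul_diff_koszul[OF P v]] False] fun_family_off[OF koszul_deg[OF P z(1)] False] by simp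
  qed
  thus "\<exists>w\<in>koszul (fun_mod A) (fun_family A U J \<delta>) (Suc j) n. koszul_diff (fun_mod A) w = z" using v by blast
qed

text \<open>
  The value \<open>\<zero>\<close> outside of the pieces makes homomorphisms with equal values on the pieces equal.
\<close>

definition Hom_family :: "('a, 'x, 's) module_scheme \<Rightarrow> (int \<Rightarrow> 'x set) \<Rightarrow> ('a, 'y, 't) module_scheme \<Rightarrow> (int \<Rightarrow> 'y set) \<Rightarrow>
    int \<Rightarrow> ('x \<Rightarrow> 'y) set" where
  "Hom_family A U B W a = {f \<in> graded_hom A U B W a. \<forall>u. u \<notin> (\<Union>n. U n) \<longrightarrow> f u = \<zero>\<^bsub>B\<^esub>}"

definition zero_extend :: "(int \<Rightarrow> 'x set) \<Rightarrow> ('a, 'y, 't) module_scheme \<Rightarrow> ('x \<Rightarrow> 'y) \<Rightarrow> 'x \<Rightarrow> 'y" where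
  "zero_extend U B f u = (if u \<in> (\<Union>n. U n) then f u else \<zero>\<^bsub>B\<^esub>)"

lemma zero_extend_on: "u \<in> U n \<Longrightarrow> zero_extend U B f u = f u" by (auto simp: zero_extend_def)

lemma Hom_family_graded_hom: "f \<in> Hom_family A U B W a \<Longrightarrow> f \<in> graded_hom A U B W a" by (simp add: Hom_family_def)

lemma Hom_family_eqI:
  assumes "f \<in> Hom_family A U B W a" "g \<in> Hom_family A U B W b" "\<And>n u. u \<in> U n \<Longrightarrow> f u = g u" shows "f = g"
proof
  fix u show "f u = g u" using assms by (cases "u \<in> (\<Union>n. U n)") (auto simp: Hom_family_def)
qed

lemma graded_hom_cong:
  assumes U: "graded_sub A U" and f: "f \<in> graded_hom A U B W a" and eq: "\<And>n u. u \<in> U n \<Longrightarrow> g u = f u"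
  shows "g \<in> graded_hom A U B W a"
  unfolding graded_hom_def
proof (intro CollectI conjI allI ballI)
  show "g u \<in> W (a + n)" if "u \<in> U n" for u n using graded_homD(1)[OF f that] eq[OF that] by simp
  show "g (u \<oplus>\<^bsub>A\<^esub> v) = g u \<oplus>\<^bsub>B\<^esub> g v" if "u \<in> U n" "v \<in> U n" for u v n
    using graded_homD(2)[OF f that] eq[OF that(1)] eq[OF that(2)] eq[OF graded_subD(4)[OF U that]] by simp
  show "g (r \<odot>\<^bsub>A\<^esub> u) = r \<odot>\<^bsub>B\<^esub> g u" if "r \<in> gR m" "u \<in> U n" for r u m n
    using graded_homD(3)[OF f that] eq[OF that(2)] eq[OF graded_subD(5)[OF U that]] by simp
qed

lemma zero_extend_Hom_family: "graded_sub A U \<Longrightarrow> f \<in> graded_hom A U B W a \<Longrightarrow> zero_extend U B f \<in> Hom_family A U B W a"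
  unfolding Hom_family_def using graded_hom_cong[of A U f B W a "zero_extend U B f"] zero_extend_on[of _ U _ B f]
  by (auto simp: zero_extend_def)

lemma graded_sub_Hom_family:
  assumes U: "graded_sub A U" and W: "graded_sub B W" shows "graded_sub (fun_mod B) (Hom_family A U B W)"
proof -
  interpret B: Module.module R B by (rule graded_subD(1)[OF W])
  have bc: "f u \<in> carrier B" if "f \<in> Hom_family A U B W a" for f u a
  proof (cases "u \<in> (\<Union>n. U n)")
    case True
    then obtain n where "u \<in> U n" by blast
    thus ?thesis using graded_subD(2)[OF W graded_homD(1)[OF Hom_family_graded_hom[OF that]]] by blast
  qed (use that in \<open>simp add: Hom_family_def\<close>)
  show ?thesis
    unfolding graded_sub_def
  proof (intro conjI allI ballI)
    show "Module.module R (fun_mod B)" by (rule module_fun_mod[OF B.module_axioms])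
    show "Hom_family A U B W n \<subseteq> carrier (fun_mod B)" for n using bc by auto
    show "\<zero>\<^bsub>fun_mod B\<^esub> \<in> Hom_family A U B W n" for n
      using graded_subD(3)[OF W] gR_carrier by (auto simp: Hom_family_def graded_hom_def)
    show "f \<oplus>\<^bsub>fun_mod B\<^esub> g \<in> Hom_family A U B W a" if f: "f \<in> Hom_family A U B W a" and g: "g \<in> Hom_family A U B W a" for f g a
    proof -
      note f' = graded_homD[OF Hom_family_graded_hom[OF f]] and g' = graded_homD[OF Hom_family_graded_hom[OF g]]
      have "f \<oplus>\<^bsub>fun_mod B\<^esub> g \<in> graded_hom A U B W a"
        unfolding graded_hom_def
      proof (intro CollectI conjI allI ballI)
        show "(f \<oplus>\<^bsub>fun_mod B\<^esub> g) u \<in> W (a + n)" if "u \<in> U n" for u n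
          using graded_subD(4)[OF W f'(1)[OF that] g'(1)[OF that]] by simp
        show "(f \<oplus>\<^bsub>fun_mod B\<^esub> g) (u \<oplus>\<^bsub>A\<^esub> v) = (f \<oplus>\<^bsub>fun_mod B\<^esub> g) u \<oplus>\<^bsub>B\<^esub> (f \<oplus>\<^bsub>fun_mod B\<^esub> g) v"
          if "u \<in> U n" "v \<in> U n" for u v n
          using f'(2)[OF that] g'(2)[OF that] bc[OF f] bc[OF g] by (simp add: B.a_ac)
        show "(f \<oplus>\<^bsub>fun_mod B\<^esub> g) (r \<odot>\<^bsub>A\<^esub> u) = r \<odot>\<^bsub>B\<^esub> (f \<oplus>\<^bsub>fun_mod B\<^esub> g) u"
          if "r \<in> gR m" "u \<in> U n" for r u m n
          using f'(3)[OF that] g'(3)[OF that] bc[OF f] bc[OF g] gR_carrier[OF that(1)]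
          by (simp add: B.smult_r_distr)
      qed
      thus ?thesis using f g by (simp add: Hom_family_def)
    qed
    show "r \<odot>\<^bsub>fun_mod B\<^esub> f \<in> Hom_family A U B W (m + a)" if r: "r \<in> gR m" and f: "f \<in> Hom_family A U B W a" for r m f a
    proof -
      note f' = graded_homD[OF Hom_family_graded_hom[OF f]] and rc = gR_carrier[OF r]
      have "r \<odot>\<^bsub>fun_mod B\<^esub> f \<in> graded_hom A U B W (m + a)"
        unfolding graded_hom_def
      proof (intro CollectI conjI allI ballI)
        show "(r \<odot>\<^bsub>fun_mod B\<^esub> f) u \<in> W (m + a + n)" if "u \<in> U n" for u n
          using graded_subD(5)[OF W r f'(1)[OF that]] by (simp add: add.assoc)
        show "(r \<odot>\<^bsub>fun_mod B\<^esub> f) (u \<oplus>\<^bsub>A\<^esub> v) = (r \<odot>\<^bsub>fun_mod B\<^esub> f) u \<oplus>\<^bsub>B\<^esub> (r \<odot>\<^bsub>fun_mod B\<^esub> f) v"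
          if "u \<in> U n" "v \<in> U n" for u v n
          using f'(2)[OF that] bc[OF f] rc by (simp add: B.smult_r_distr)
        show "(r \<odot>\<^bsub>fun_mod B\<^esub> f) (q \<odot>\<^bsub>A\<^esub> u) = q \<odot>\<^bsub>B\<^esub> (r \<odot>\<^bsub>fun_mod B\<^esub> f) u"
          if "q \<in> gR k" "u \<in> U n" for q u k n
          using f'(3)[OF that] bc[OF f] gR_carrier[OF that(1)] rc
          by (simp add: m_comm flip: B.smult_assoc1)
      qed
      thus ?thesis using f rc by (simp add: Hom_family_def)
    qed
  qed
qed

lemma precompose_graded_hom:
  assumes U: "graded_sub A U" and V: "graded_sub C V" and W: "graded_sub B W" and d: "d \<in> graded_hom A U C V 0"
  shows "(\<lambda>g. zero_extend U B (\<lambda>u. g (d u))) \<in> graded_hom (fun_mod B) (Hom_family C V B W) (fun_mod B) (Hom_family A U B W) 0"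
proof -
  interpret B: Module.module R B by (rule graded_subD(1)[OF W])
  show ?thesis
    unfolding graded_hom_def
  proof (intro CollectI conjI allI ballI)
    show "zero_extend U B (\<lambda>u. g (d u)) \<in> Hom_family A U B W (0 + n)" if "g \<in> Hom_family C V B W n" for g n
      using zero_extend_Hom_family[OF U graded_hom_comp[OF d Hom_family_graded_hom[OF that]]] by simp
  next
    fix n g h assume "g \<in> Hom_family C V B W n" "h \<in> Hom_family C V B W n"
    show "zero_extend U B (\<lambda>u. (g \<oplus>\<^bsub>fun_mod B\<^esub> h) (d u)) = zero_extend U B (\<lambda>u. g (d u)) \<oplus>\<^bsub>fun_mod B\<^esub> zero_extend U B (\<lambda>u. h (d u))"
      by (auto simp: zero_extend_def fun_eq_iff)
  next
    fix m n r g assume "r \<in> gR m" "g \<in> Hom_family C V B W n"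
    show "zero_extend U B (\<lambda>u. (r \<odot>\<^bsub>fun_mod B\<^esub> g) (d u)) = r \<odot>\<^bsub>fun_mod B\<^esub> zero_extend U B (\<lambda>u. g (d u))"
      using gR_carrier[OF \<open>r \<in> gR m\<close>] by (auto simp: zero_extend_def fun_eq_iff)
  qed
qed

section \<open>Homomorphisms out of a free family\<close>

abbreviation Hom_free :: "(int \<times> nat) set \<Rightarrow> ('a, 'y, 't) module_scheme \<Rightarrow> (int \<Rightarrow> 'y set) \<Rightarrow> int \<Rightarrow> ((int \<times> nat \<Rightarrow> 'a) \<Rightarrow> 'y) set" where
  "Hom_free J B W \<equiv> Hom_family (fun_mod RM) (free_family J) B W"

definition eval_basis :: "(int \<times> nat) set \<Rightarrow> ('a, 'y, 't) module_scheme \<Rightarrow> ((int \<times> nat \<Rightarrow> 'a) \<Rightarrow> 'y) \<Rightarrow> int \<times> nat \<Rightarrow> 'y" where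
  "eval_basis J B f j = (if j \<in> J then f (unit_vec j) else \<zero>\<^bsub>B\<^esub>)"

definition extend_basis :: "(int \<times> nat) set \<Rightarrow> ('a, 'y, 't) module_scheme \<Rightarrow> (int \<times> nat \<Rightarrow> 'y) \<Rightarrow> (int \<times> nat \<Rightarrow> 'a) \<Rightarrow> 'y" where
  "extend_basis J B y = zero_extend (free_family J) B (\<lambda>c. lin_comb B J c y)"

text \<open>Evaluation at a basis vector raises the degree by \<open>fst j\<close>, whence the sign
  of the shift: a homomorphism of degree \<open>a\<close> takes it to degree
  \<open>a + fst j\<close>.\<close>

abbreviation PN :: "(int \<times> nat) set \<Rightarrow> ('a, 'y, 't) module_scheme \<Rightarrow> (int \<Rightarrow> 'y set) \<Rightarrow> int \<Rightarrow> (int \<times> nat \<Rightarrow> 'y) set" where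
  "PN J B W \<equiv> fun_family B W J (\<lambda>j. - fst j)"

lemma free_family_carrier: "c \<in> free_family J n \<Longrightarrow> c j \<in> carrier R"
  using fun_family_carrier[OF graded_sub_RM, of c J fst n j] by simp

lemma extend_basis_graded_hom:
  assumes W: "graded_sub B W" and J: "finite J"
  shows "extend_basis J B \<in> graded_hom (fun_mod B) (PN J B W) (fun_mod B) (Hom_free J B W) 0"
proof -
  interpret B: Module.module R B by (rule graded_subD(1)[OF W])
  have yc: "y j \<in> carrier B" if "y \<in> PN J B W a" for y a j using fun_family_carrier[OF W that] .
  show ?thesis
    unfolding graded_hom_def
  proof (intro CollectI conjI allI ballI)
    show "extend_basis J B y \<in> Hom_free J B W (0 + a)" if "y \<in> PN J B W a" for y a
      unfolding extend_basis_def using fun_family_on[OF that]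
      by (intro zero_extend_Hom_family[OF graded_sub_free_family] lin_comb_free_family_graded_hom[OF W J]) simp
  next
    fix n y z assume y: "y \<in> PN J B W n" "z \<in> PN J B W n"
    have "lin_comb B J c (\<lambda>i. y i \<oplus>\<^bsub>B\<^esub> z i) = lin_comb B J c y \<oplus>\<^bsub>B\<^esub> lin_comb B J c z" if "c \<in> free_family J m" for c m
    proof -
      have "lin_comb B J c (\<lambda>i. y i \<oplus>\<^bsub>B\<^esub> z i) = finsum B (\<lambda>j. c j \<odot>\<^bsub>B\<^esub> y j \<oplus>\<^bsub>B\<^esub> c j \<odot>\<^bsub>B\<^esub> z j) J"
        unfolding lin_comb_def using free_family_carrier[OF that] yc[OF y(1)] yc[OF y(2)]
        by (intro B.finsum_cong') (auto simp: B.smult_r_distr)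
      also have "\<dots> = lin_comb B J c y \<oplus>\<^bsub>B\<^esub> lin_comb B J c z"
        unfolding lin_comb_def using free_family_carrier[OF that] yc[OF y(1)] yc[OF y(2)] by (intro B.finsum_addf) auto
      finally show ?thesis .
    qed
    thus "extend_basis J B (y \<oplus>\<^bsub>fun_mod B\<^esub> z) = extend_basis J B y \<oplus>\<^bsub>fun_mod B\<^esub> extend_basis J B z"
      by (auto simp: extend_basis_def zero_extend_def fun_eq_iff)
  next
    fix m n r y assume r: "r \<in> gR m" and y: "y \<in> PN J B W n"
    have rc: "r \<in> carrier R" using r by (rule gR_carrier)
    have "lin_comb B J c (\<lambda>i. r \<odot>\<^bsub>B\<^esub> y i) = r \<odot>\<^bsub>B\<^esub> lin_comb B J c y" if "c \<in> free_family J k" for c k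
    proof -
      have "lin_comb B J c (\<lambda>i. r \<odot>\<^bsub>B\<^esub> y i) = finsum B (\<lambda>j. r \<odot>\<^bsub>B\<^esub> (c j \<odot>\<^bsub>B\<^esub> y j)) J"
        unfolding lin_comb_def using free_family_carrier[OF that] yc[OF y] rc
        by (intro B.finsum_cong') (auto simp: m_comm simp flip: B.smult_assoc1)
      also have "\<dots> = r \<odot>\<^bsub>B\<^esub> lin_comb B J c y"
        unfolding lin_comb_def using free_family_carrier[OF that] yc[OF y] rc J
        by (intro B.finsum_smult_ldistr[symmetric]) auto
      finally show ?thesis .
    qed
    thus "extend_basis J B (r \<odot>\<^bsub>fun_mod B\<^esub> y) = r \<odot>\<^bsub>fun_mod B\<^esub> extend_basis J B y"
      using rc by (auto simp: extend_basis_def zero_extend_def fun_eq_iff)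
  qed
qed

lemma eval_basis_graded_hom:
  assumes W: "graded_sub B W"
  shows "eval_basis J B \<in> graded_hom (fun_mod B) (Hom_free J B W) (fun_mod B) (PN J B W) 0"
proof -
  interpret B: Module.module R B by (rule graded_subD(1)[OF W])
  show ?thesis
    unfolding graded_hom_def
  proof (intro CollectI conjI allI ballI)
    show "eval_basis J B f \<in> PN J B W (0 + a)" if "f \<in> Hom_free J B W a" for f a
      using graded_homD(1)[OF Hom_family_graded_hom[OF that] unit_vec_free_family] by (auto simp: fun_family_def eval_basis_def)
  qed (use gR_carrier in \<open>auto simp: eval_basis_def fun_eq_iff\<close>)
qed

lemma extend_basis_eval_basis:
  assumes W: "graded_sub B W" and J: "finite J" and f: "f \<in> Hom_free J B W a"
  shows "extend_basis J B (eval_basis J B f) = f"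
proof (rule Hom_family_eqI[OF _ f])
  interpret B: Module.module R B by (rule graded_subD(1)[OF W])
  show "extend_basis J B (eval_basis J B f) \<in> Hom_free J B W a"
    using graded_homD0[OF extend_basis_graded_hom[OF W J] graded_homD0[OF eval_basis_graded_hom[OF W] f]] .
  fix n c assume c: "c \<in> free_family J n"
  have "extend_basis J B (eval_basis J B f) c = lin_comb B J c (eval_basis J B f)" using c by (simp add: extend_basis_def zero_extend_on)
  also have "\<dots> = lin_comb B J c (\<lambda>j. f (unit_vec j))"
    unfolding lin_comb_def using free_family_carrier[OF c] graded_subD(2)[OF W graded_homD(1)[OF Hom_family_graded_hom[OF f] unit_vec_free_family]]
    by (intro B.finsum_cong') (auto simp: eval_basis_def)
  also have "\<dots> = f (lin_comb (fun_mod RM) J c unit_vec)"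
    using fun_family_on[OF c] unit_vec_free_family
    by (intro graded_hom_lin_comb[OF graded_sub_free_family W Hom_family_graded_hom[OF f] J, where \<delta> = fst and n = n, symmetric]) auto
  finally show "extend_basis J B (eval_basis J B f) c = f c" using lin_comb_unit_vec[OF J c] by simp
qed

lemma lin_comb_of_unit_vec:
  assumes B: "Module.module R B" and J: "finite J" "i \<in> J" and y: "\<And>j. j \<in> J \<Longrightarrow> y j \<in> carrier B"
  shows "lin_comb B J (unit_vec i) y = y i"
proof -
  interpret B: Module.module R B by (rule B)
  have "lin_comb B J (unit_vec i) y = finsum B (\<lambda>j. if i = j then y j else \<zero>\<^bsub>B\<^esub>) J"
    unfolding lin_comb_def using y by (intro B.finsum_cong') (auto simp: unit_vec_def)
  also have "\<dots> = y i" using y by (intro B.finsum_singleton[OF J(2,1)]) auto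
  finally show ?thesis .
qed

lemma eval_basis_extend_basis:
  assumes W: "graded_sub B W" and J: "finite J" and y: "y \<in> PN J B W a"
  shows "eval_basis J B (extend_basis J B y) = y"
proof
  interpret B: Module.module R B by (rule graded_subD(1)[OF W])
  fix i
  have yc: "y j \<in> carrier B" for j using fun_family_carrier[OF W y] .
  show "eval_basis J B (extend_basis J B y) i = y i"
  proof (cases "i \<in> J")
    case True
    have "eval_basis J B (extend_basis J B y) i = lin_comb B J (unit_vec i) y"
      using True unit_vec_free_family[OF True] by (simp add: eval_basis_def extend_basis_def zero_extend_on)
    also have "\<dots> = y i" by (rule lin_comb_of_unit_vec[OF B.module_axioms J True yc])
    finally show ?thesis .
  next
    case False
    thus ?thesis using fun_family_off[OF y False] by (simp add: eval_basis_def)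
  qed
qed

text \<open>Everything is transported along the mutually inverse maps \<open>extend_basis\<close>
  and \<open>eval_basis\<close> from a finite sum of shifts of \<open>W\<close>. By the last part,
  generators of high degree make the module of homomorphisms Koszul exact already in low
  degrees.\<close>

lemma Hom_free_facts:
  assumes W: "fin_gen B W" and J: "finite J"
  shows "fin_gen (fun_mod B) (Hom_free J B W)" "hilb (fun_mod B) (Hom_free J B W) a = (\<Sum>j\<in>J. hilb B W (a + fst j))"
    "(\<And>i. i \<in> J \<Longrightarrow> koszul_exact B W k (n + fst i)) \<Longrightarrow> koszul_exact (fun_mod B) (Hom_free J B W) k n"
proof -
  note gW = fin_genD(1)[OF W]
  note gH = graded_sub_Hom_family[OF graded_sub_free_family gW, of J] and gP = graded_sub_fun_family[OF gW, of J "\<lambda>j. - fst j"]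
  note lin_comb = extend_basis_graded_hom[OF gW J] and ev = eval_basis_graded_hom[OF gW, of J]
  note fP = fin_gen_fun_family[OF W J, of "\<lambda>j. - fst j"]
  have im: "extend_basis J B ` PN J B W n = Hom_free J B W n" for n
  proof
    show "extend_basis J B ` PN J B W n \<subseteq> Hom_free J B W n" using graded_homD0[OF lin_comb] by blast
    show "Hom_free J B W n \<subseteq> extend_basis J B ` PN J B W n"
    proof
      fix f assume f: "f \<in> Hom_free J B W n"
      show "f \<in> extend_basis J B ` PN J B W n"
        using extend_basis_eval_basis[OF gW J f] graded_homD0[OF ev f] by (intro image_eqI[of _ _ "eval_basis J B f"]) simp_all
    qed
  qed
  show "fin_gen (fun_mod B) (Hom_free J B W)" by (rule fin_gen_image[OF fP gH lin_comb im])
  have inj: "y = \<zero>\<^bsub>fun_mod B\<^esub>" if "y \<in> PN J B W a" "extend_basis J B y = \<zero>\<^bsub>fun_mod B\<^esub>" for y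
  proof -
    have "y = eval_basis J B \<zero>\<^bsub>fun_mod B\<^esub>" using eval_basis_extend_basis[OF gW J that(1)] that(2) by simp
    thus ?thesis using graded_hom_zero[OF gH gP ev] by simp
  qed
  have "K_dim (fun_mod B) (Hom_free J B W a) = K_dim (fun_mod B) (PN J B W a)"
    using K_dim_injective[OF fin_genD(3,2)[OF fP] graded_hom_K_lin[OF gH lin_comb] inj] by (simp add: im)
  also have "\<dots> = (\<Sum>j\<in>J. K_dim B (W (a + fst j)))"
    using fun_family_dim(2)[OF gW J, of a "\<lambda>j. - fst j"] fin_genD(2)[OF W] by simp
  finally show "hilb (fun_mod B) (Hom_free J B W) a = (\<Sum>j\<in>J. hilb B W (a + fst j))" by (simp add: hilb_def)
  show "koszul_exact (fun_mod B) (Hom_free J B W) k n" if "\<And>i. i \<in> J \<Longrightarrow> koszul_exact B W k (n + fst i)"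
  proof (rule koszul_exact_retract[OF gP gH lin_comb ev])
    show "extend_basis J B (eval_basis J B f) = f" if "f \<in> Hom_free J B W a" for f a by (rule extend_basis_eval_basis[OF gW J that])
    show "koszul_exact (fun_mod B) (PN J B W) k n" using that by (intro koszul_exact_fun_family[OF gW]) simp
  qed
qed

end

locale hom_complex = generated_graded_algebra R gR x e dg
  for R :: "('a, 'r) ring_scheme" (structure) and gR x e dg +
  fixes M :: "('a, 'b, 's) module_scheme" and L :: "int \<Rightarrow> 'b set"
    and N :: "('a, 'c, 't) module_scheme" and W :: "int \<Rightarrow> 'c set"
    and J :: "nat \<Rightarrow> (int \<times> nat) set" and d :: "nat \<Rightarrow> (int \<times> nat \<Rightarrow> 'a) \<Rightarrow> int \<times> nat \<Rightarrow> 'a"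
    and \<epsilon> :: "(int \<times> nat \<Rightarrow> 'a) \<Rightarrow> 'b" and s :: int
  assumes fgM: "fin_gen M L" and fgN: "fin_gen N W"
    and res: "resolution (\<lambda>_. fun_mod RM) (\<lambda>i. free_family (J i)) d \<epsilon> M L"
    and J_finite: "finite (J i)" and J_deg: "j \<in> J i \<Longrightarrow> s + int i \<le> fst j"
begin

abbreviation PM :: "('a, (int \<times> nat \<Rightarrow> 'a) \<Rightarrow> 'c) module" where "PM \<equiv> fun_mod N"

abbreviation C where "C i \<equiv> Hom_free (J i) N W"

definition pre :: "nat \<Rightarrow> ((int \<times> nat \<Rightarrow> 'a) \<Rightarrow> 'c) \<Rightarrow> (int \<times> nat \<Rightarrow> 'a) \<Rightarrow> 'c" where
  "pre i g = zero_extend (free_family (J (Suc i))) N (\<lambda>u. g (d i u))"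

definition cocycle_family :: "nat \<Rightarrow> int \<Rightarrow> ((int \<times> nat \<Rightarrow> 'a) \<Rightarrow> 'c) set" where
  "cocycle_family i a = {z \<in> C i a. pre i z = \<zero>\<^bsub>fun_mod N\<^esub>}"

fun coboundary_family :: "nat \<Rightarrow> int \<Rightarrow> ((int \<times> nat \<Rightarrow> 'a) \<Rightarrow> 'c) set" where
  "coboundary_family 0 a = {\<zero>\<^bsub>fun_mod N\<^esub>}" | "coboundary_family (Suc i) a = pre i ` C i a"

text \<open>The dimension of the cohomology in one degree, as a difference: for this complex no
  quotient is formed, and \<open>hilbert_function_Ext\<close> identifies the value with the
  dimension of the given Ext piece.\<close>

definition ext_hilb :: "nat \<Rightarrow> int \<Rightarrow> rat" where "ext_hilb i a = hilb (fun_mod N) (cocycle_family i) a - hilb (fun_mod N) (coboundary_family i) a"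

lemma gN: "graded_sub N W" by (rule fin_genD(1)[OF fgN])

lemma C_facts: "graded_sub (fun_mod N) (C i)" "fin_gen (fun_mod N) (C i)" "hilb (fun_mod N) (C i) a = (\<Sum>j\<in>J i. hilb N W (a + fst j))"
  using graded_sub_Hom_family[OF graded_sub_free_family gN] Hom_free_facts(1,2)[OF fgN J_finite] by auto

lemma pre_graded_hom: "pre i \<in> graded_hom (fun_mod N) (C i) (fun_mod N) (C (Suc i)) 0"
  using precompose_graded_hom[OF graded_sub_free_family graded_sub_free_family gN resolutionD(4)[OF res, of i]] by (simp add: pre_def[abs_def])

lemma graded_sub_cocycle_family: "graded_sub (fun_mod N) (cocycle_family i)"
  unfolding cocycle_family_def[abs_def] by (rule graded_sub_kernel[OF C_facts(1) C_facts(1) pre_graded_hom])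

lemma graded_sub_coboundary_family: "graded_sub (PM) (coboundary_family i)"
proof (cases i)
  case 0
  interpret P: Module.module R PM by (rule graded_subD(1)[OF C_facts(1)])
  have 0: "coboundary_family i = (\<lambda>_. {\<zero>\<^bsub>PM\<^esub>})" using 0 by (simp add: fun_eq_iff)
  have "\<zero>\<^bsub>PM\<^esub> \<oplus>\<^bsub>PM\<^esub> \<zero>\<^bsub>PM\<^esub> = \<zero>\<^bsub>PM\<^esub>" by (rule P.l_zero[OF P.zero_closed])
  moreover have "r \<odot>\<^bsub>PM\<^esub> \<zero>\<^bsub>PM\<^esub> = \<zero>\<^bsub>PM\<^esub>" if "r \<in> gR m" for r m
    using gR_carrier[OF that] by (rule P.smult_r_null)
  ultimately show ?thesis
    unfolding graded_sub_def 0 using P.module_axioms P.zero_closed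
    by (intro conjI allI ballI) (simp_all del: fun_mod_simps)
next
  case (Suc k)
  have eq: "coboundary_family (Suc k) = (\<lambda>n. pre k ` C k n)" by (simp add: fun_eq_iff)
  show ?thesis unfolding Suc eq by (rule graded_sub_image[OF C_facts(1) C_facts(1) pre_graded_hom])
qed

lemma coboundary_family_cocycle_family: "coboundary_family i a \<subseteq> cocycle_family i a"
proof (cases i)
  case (Suc k)
  have "pre (Suc k) (pre k g) = \<zero>\<^bsub>fun_mod N\<^esub>" if g: "g \<in> C k a" for g
  proof
    fix u
    have "g (d k (d (Suc k) u)) = \<zero>\<^bsub>N\<^esub>" if u: "u \<in> free_family (J (Suc (Suc k))) n" for n
      unfolding resolutionD(9)[OF res u] by (rule graded_hom_zero[OF graded_sub_free_family gN Hom_family_graded_hom[OF g]])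
    moreover have "d (Suc k) u \<in> free_family (J (Suc k)) n" if u: "u \<in> free_family (J (Suc (Suc k))) n" for n
      by (rule graded_homD0[OF resolutionD(4)[OF res] u])
    ultimately show "pre (Suc k) (pre k g) u = \<zero>\<^bsub>fun_mod N\<^esub> u"
      unfolding pre_def zero_extend_def by auto
  qed
  moreover have "pre k g \<in> C (Suc k) a" if "g \<in> C k a" for g using graded_homD0[OF pre_graded_hom that] .
  ultimately show ?thesis unfolding Suc cocycle_family_def by auto
qed (use graded_subD(3)[OF graded_sub_cocycle_family] in auto)

lemma cocycle_family_C: "cocycle_family i a \<subseteq> C i a" by (auto simp: cocycle_family_def)

lemma fin_gen_cocycle_family: "fin_gen (fun_mod N) (cocycle_family i)" by (rule fin_gen_subfamily[OF C_facts(2) graded_sub_cocycle_family cocycle_family_C])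

lemma fin_gen_coboundary_family: "fin_gen (fun_mod N) (coboundary_family i)" by (rule fin_gen_subfamily[OF fin_gen_cocycle_family graded_sub_coboundary_family coboundary_family_cocycle_family])

lemma ext_hilb_series: "bounded_below (ext_hilb i)" "finite {n. \<phi> (ext_hilb i) n \<noteq> 0}"
proof -
  note z = fin_gen_hilb[OF fin_gen_cocycle_family[of i]] and b = fin_gen_hilb[OF fin_gen_coboundary_family[of i]]
  obtain p q where "\<forall>n<p. hilb (fun_mod N) (cocycle_family i) n = 0" "\<forall>n<q. hilb (fun_mod N) (coboundary_family i) n = 0"
    using z(1) b(1) by (auto simp: bounded_below_def)
  thus "bounded_below (ext_hilb i)" unfolding bounded_below_def ext_hilb_def by (intro exI[of _ "min p q"]) auto
  have "\<phi> (ext_hilb i) n = \<phi> (hilb (fun_mod N) (cocycle_family i)) n - \<phi> (hilb (fun_mod N) (coboundary_family i)) n" for n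
    by (simp add: \<phi>_def ext_hilb_def[abs_def] algebra_simps sum_subtractf)
  hence "{n. \<phi> (ext_hilb i) n \<noteq> 0} \<subseteq> {n. \<phi> (hilb (fun_mod N) (cocycle_family i)) n \<noteq> 0} \<union> {n. \<phi> (hilb (fun_mod N) (coboundary_family i)) n \<noteq> 0}"
    by (intro subsetI UnCI) simp
  from finite_subset[OF this] show "finite {n. \<phi> (ext_hilb i) n \<noteq> 0}" using z(2) b(2) by simp
qed

section \<open>Truncated Euler characteristics\<close>

lemma hilb_C: "hilb (fun_mod N) (C i) a = hilb (fun_mod N) (cocycle_family i) a + hilb (fun_mod N) (coboundary_family (Suc i)) a"
  using K_dim_ker_im(3)[OF fin_genD(3,2)[OF C_facts(2)] graded_hom_K_lin[OF C_facts(1) pre_graded_hom[of i], of a]]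
  by (simp add: hilb_def cocycle_family_def del: fun_mod_simps)

text \<open>Each cochain module contributes its cocycles and the next coboundaries, so the
  coboundaries telescope. Those in position 0 are zero, and those in position \<open>m\<close>
  remain as the error.\<close>

lemma alternating_C:
  "(\<Sum>i<m. (- 1) ^ i * hilb (fun_mod N) (C i) a) = (\<Sum>i<m. (- 1) ^ i * ext_hilb i a) - (- 1) ^ m * hilb (fun_mod N) (coboundary_family m) a"
proof (induction m)
  case 0
  thus ?case using K_fin_zero(3)[OF graded_subD(1)[OF C_facts(1)]] by (simp add: hilb_def del: fun_mod_simps)
qed (simp add: hilb_C ext_hilb_def algebra_simps del: coboundary_family.simps)

text \<open>Being the image of \<open>d i\<close>, this is what the truncation after position
  \<open>i\<close> leaves over.\<close>

definition syz :: "nat \<Rightarrow> int \<Rightarrow> (int \<times> nat \<Rightarrow> 'a) set" where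
  "syz i n = d i ` free_family (J (Suc i)) n"

lemma alternating_G:
  "hilb M L a = (\<Sum>i<Suc m. (- 1) ^ i * hilb (fun_mod RM) (free_family (J i)) a) - (- 1) ^ m * hilb (fun_mod RM) (syz m) a"
proof (induction m)
  case 0
  show ?case
    using K_dim_ker_im(3)[OF fin_genD(3,2)[OF fin_gen_free_family[OF J_finite]] graded_hom_K_lin[OF resolutionD(1,5)[OF res], of a]]
    by (simp add: hilb_def syz_def resolutionD(7,8)[OF res] del: fun_mod_simps)
next
  case (Suc m)
  have "hilb (fun_mod RM) (free_family (J (Suc m))) a = hilb (fun_mod RM) (syz m) a + hilb (fun_mod RM) (syz (Suc m)) a"
    using K_dim_ker_im(3)[OF fin_genD(3,2)[OF fin_gen_free_family[OF J_finite]] graded_hom_K_lin[OF graded_sub_free_family resolutionD(4)[OF res, of m], of a]]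
    by (simp add: hilb_def syz_def resolutionD(6)[OF res] del: fun_mod_simps)
  thus ?case using Suc by (simp add: algebra_simps)
qed

text \<open>As the image of the module in position \<open>Suc m\<close>, it starts no earlier than
  the generators of that module.\<close>

lemma syz_vanish:
  assumes "a < s + int m + 1" shows "hilb (fun_mod RM) (syz m) a = 0"
proof -
  have "c = \<zero>\<^bsub>fun_mod RM\<^esub>" if "c \<in> free_family (J (Suc m)) a" for c
  proof (rule free_family_vanish[OF _ assms that])
    show "s + int m + 1 \<le> fst j" if "j \<in> J (Suc m)" for j using J_deg[OF that] by simp
  qed
  hence "free_family (J (Suc m)) a = {\<zero>\<^bsub>fun_mod RM\<^esub>}" using graded_subD(3)[OF graded_sub_free_family] by blast
  hence "syz m a = {\<zero>\<^bsub>fun_mod RM\<^esub>}"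
    using graded_hom_zero[OF graded_sub_free_family graded_sub_free_family resolutionD(4)[OF res]] by (simp add: syz_def del: fun_mod_simps)
  thus ?thesis using K_fin_zero(3)[OF graded_subD(1)[OF graded_sub_free_family]] by (simp add: hilb_def del: fun_mod_simps)
qed

text \<open>From \<open>n0\<close> on there are short exact sequences 0 \<rightarrow> Z_i
  \<rightarrow> C_i \<rightarrow> Z_(i+1) \<rightarrow> 0, so exactness for Z_i in position
  \<open>j\<close> follows from C_i in position \<open>j\<close> and Z_(i+1) in position
  \<open>Suc j\<close>. The climb ends when \<open>j\<close> exceeds \<open>e\<close>, and the
  condition on \<open>a\<close> only weakens on the way; hence the bound holds for all later
  \<open>i\<close> with the same \<open>c\<close>.\<close>

lemma koszul_exact_cocycle_family:
  assumes c: "\<And>n j. c < n \<Longrightarrow> koszul_exact N W j n"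
    and vanish: "\<And>i a. n0 \<le> i \<Longrightarrow> cocycle_family i a = coboundary_family i a"
  shows "n0 \<le> i \<Longrightarrow> c - (s + int i) < a \<Longrightarrow> koszul_exact (fun_mod N) (cocycle_family i) j a"
proof (induction "Suc e - j" arbitrary: i j)
  case 0
  thus ?case by (intro koszul_exact_large[OF graded_sub_cocycle_family]) simp
next
  case (Suc k)
  have C: "koszul_exact (fun_mod N) (C i) j a"
  proof (rule Hom_free_facts(3)[OF fgN J_finite])
    show "koszul_exact N W j (a + fst l)" if "l \<in> J i" for l
      using J_deg[OF that] Suc.prems by (intro c) simp
  qed
  have p: "pre i \<in> graded_hom (fun_mod N) (C i) (fun_mod N) (cocycle_family (Suc i)) 0"
    using graded_homD[OF pre_graded_hom[of i]] vanish[of "Suc i"] Suc.prems(1) by (auto simp: graded_hom_def simp del: fun_mod_simps)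
  have im: "pre i ` C i n = cocycle_family (Suc i) n" for n using vanish[of "Suc i" n] Suc.prems(1) by simp
  have "koszul_exact (fun_mod N) (cocycle_family (Suc i)) (Suc j) a"
    using Suc.hyps(2) Suc.prems by (intro Suc.hyps(1)) auto
  from koszul_exact_shift[OF C_facts(1) graded_sub_cocycle_family p im graded_sub_cocycle_family _ C this] show ?case
    by (simp add: cocycle_family_def)
qed

theorem alternating_sum_rational:
  assumes vanish: "\<And>i a. n0 \<le> i \<Longrightarrow> cocycle_family i a = coboundary_family i a"
  shows "(\<Sum>i<n0. (- 1) ^ i * rational_series (ext_hilb i)) * subst_inverse_t (rational_series (hilb RM gR)) =
    subst_inverse_t (rational_series (hilb M L)) * rational_series (hilb N W)"
proof -
  define hX where "hX a = (\<Sum>i<n0. (- 1) ^ i * ext_hilb i a)" for a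
  have hX_m: "hX a = (\<Sum>i<m. (- 1) ^ i * ext_hilb i a)" if "n0 \<le> m" for m a
    unfolding hX_def using that vanish by (intro sum.mono_neutral_left) (auto simp: ext_hilb_def hilb_def)
  have "\<forall>i. \<exists>b. \<forall>n<b. ext_hilb i n = 0" using ext_hilb_series(1) by (simp add: bounded_below_def)
  then obtain b where b: "\<forall>i. \<forall>n<b i. ext_hilb i n = 0" by (rule choice[THEN exE])
  have X1: "bounded_below hX"
    unfolding bounded_below_def
  proof (intro exI allI impI)
    \<comment> \<open>Zero is inserted for the case \<open>n0 = 0\<close>.\<close>
    fix n assume n: "n < Min (insert 0 (b ` {..<n0}))"
    have "ext_hilb i n = 0" if "i < n0" for i using b n that by simp
    thus "hX n = 0" by (simp add: hX_def)
  qed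
  have "\<phi> hX n = (\<Sum>i<n0. (- 1) ^ i * \<phi> (ext_hilb i) n)" for n
    unfolding \<phi>_def hX_def sum_distrib_left by (subst sum.swap) (simp add: algebra_simps)
  hence "{n. \<phi> hX n \<noteq> 0} \<subseteq> (\<Union>i<n0. {n. \<phi> (ext_hilb i) n \<noteq> 0})"
    by (auto intro: ccontr)
  hence X2: "finite {n. \<phi> hX n \<noteq> 0}" using ext_hilb_series(2) by (meson finite_UN_I finite_lessThan finite_subset)
  obtain c where c: "\<And>n j. c < n \<Longrightarrow> koszul_exact N W j n" using koszul_exact_eventually[OF fgN] by blast
  have "rational_series hX * subst_inverse_t (rational_series (hilb RM gR)) =
    subst_inverse_t (rational_series (hilb M L)) * rational_series (hilb N W)"
  proof (rule approximation_identity[OF fin_gen_hilb[OF fgM] fin_gen_hilb[OF fgN] fin_gen_hilb[OF fin_gen_RM] X1 X2])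
    fix k :: int
    \<comment> \<open>Chosen so that position \<open>m\<close> is past all nonzero Ext, the syzygies
      start above degree \<open>k\<close>, and the Koszul bound for position \<open>Suc m\<close>
      lies below \<open>- k\<close>.\<close>
    define m where "m = max n0 (nat (\<bar>k\<bar> + \<bar>s\<bar> + \<bar>c\<bar>))"
    have m: "n0 \<le> m" "k < s + int m + 1" "c - (s + int (Suc m)) < - k" by (auto simp: m_def)
    \<comment> \<open>The terms of the Laurent polynomial: the position \<open>i\<close> gives the
      sign, and \<open>fst j\<close> the exponent.\<close>
    define T where "T = (SIGMA i:{..<Suc m}. J i)"
    define E where "E a = - ((- 1) ^ m * hilb (fun_mod RM) (syz m) a)" for a
    \<comment> \<open>The remainder consists of the coboundaries in position \<open>Suc m\<close>.
      By the vanishing of Ext these are the cocycles, for which Koszul exactness is known.\<close>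
    define Z where "Z a = (- 1) ^ Suc m * hilb (fun_mod N) (cocycle_family (Suc m)) a" for a
    have 1: "hilb M L a = (\<Sum>(i, j)\<in>T. (- 1) ^ i * hilb RM gR (a - fst j)) + E a" for a
    proof -
      have "hilb (fun_mod RM) (free_family (J i)) a = (\<Sum>j\<in>J i. hilb RM gR (a - fst j))" for i
        using fun_family_dim(2)[OF graded_sub_RM J_finite[of i] fin_genD(2)[OF fin_gen_RM], where n = a and \<delta> = fst]
        by (simp add: hilb_def)
      hence "(\<Sum>i<Suc m. (- 1) ^ i * hilb (fun_mod RM) (free_family (J i)) a) =
          (\<Sum>i<Suc m. \<Sum>j\<in>J i. (- 1) ^ i * hilb RM gR (a - fst j))"
        by (simp only: sum_distrib_left)
      also have "\<dots> = (\<Sum>(i, j)\<in>T. (- 1) ^ i * hilb RM gR (a - fst j))"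
        unfolding T_def by (rule sum.Sigma) (auto simp: J_finite)
      finally show ?thesis using alternating_G[of a m] by (simp add: E_def)
    qed
    have 2: "hX a = (\<Sum>(i, j)\<in>T. (- 1) ^ i * hilb N W (a + fst j)) + Z a" for a
    proof -
      have "(\<Sum>i<Suc m. (- 1) ^ i * hilb (fun_mod N) (C i) a) =
          (\<Sum>i<Suc m. \<Sum>j\<in>J i. (- 1) ^ i * hilb N W (a + fst j))"
        by (simp only: sum_distrib_left C_facts(3))
      also have "\<dots> = (\<Sum>(i, j)\<in>T. (- 1) ^ i * hilb N W (a + fst j))"
        unfolding T_def by (rule sum.Sigma) (auto simp: J_finite)
      finally have "(\<Sum>i<Suc m. (- 1) ^ i * hilb (fun_mod N) (C i) a) = \<dots>" .
      moreover have "hilb (fun_mod N) (coboundary_family (Suc m)) a = hilb (fun_mod N) (cocycle_family (Suc m)) a"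
        using vanish[of "Suc m" a] m(1) by (simp add: hilb_def)
      moreover have "hX a = (\<Sum>i<Suc m. (- 1) ^ i * ext_hilb i a)" by (rule hX_m) (use m(1) in simp)
      ultimately show ?thesis
        using alternating_C[where m = "Suc m" and a = a] by (simp add: Z_def del: sum.lessThan_Suc power_Suc coboundary_family.simps)
    qed
    have 3: "E a = 0" if "a < k" for a using syz_vanish[of a m] that m(2) by (simp add: E_def)
    have 4: "\<phi> Z a = 0" if "- k < a" for a
    proof -
      have "\<phi> (hilb (fun_mod N) (cocycle_family (Suc m))) a = 0"
        by (rule koszul_exact_\<phi>[OF fin_gen_cocycle_family koszul_exact_cocycle_family[OF c vanish]]) (use m that in auto)
      moreover have "\<phi> Z a = (- 1) ^ Suc m * \<phi> (hilb (fun_mod N) (cocycle_family (Suc m))) a"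
        unfolding \<phi>_def Z_def[abs_def] sum_distrib_left by (intro sum.cong) (simp_all only: ac_simps)
      ultimately show ?thesis by simp
    qed
    have T: "finite T" unfolding T_def using J_finite by simp
    show "\<exists>(J::(nat \<times> int \<times> nat) set) s \<delta> E Z. finite J \<and>
      (\<forall>a. hilb M L a = (\<Sum>j\<in>J. s j * hilb RM gR (a - \<delta> j)) + E a) \<and> (\<forall>a<k. E a = 0) \<and>
      (\<forall>a. hX a = (\<Sum>j\<in>J. s j * hilb N W (a + \<delta> j)) + Z a) \<and> (\<forall>a>-k. \<phi> Z a = 0)"
      using T 1 2 3 4 unfolding case_prod_beta
      by - (rule exI[of _ T], rule exI[of _ "\<lambda>j. (- 1) ^ fst j"], rule exI[of _ "\<lambda>j. fst (snd j)"],
        rule exI[of _ E], rule exI[of _ Z], simp)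
  qed
  moreover have "rational_series hX = (\<Sum>i<n0. (- 1) ^ i * rational_series (ext_hilb i))"
    by (rule rational_series_sum[OF ext_hilb_series X1 X2 hX_def])
  ultimately show ?thesis by simp
qed

end

section \<open>Homogeneous components\<close>

lemma module_hom_finsum:
  assumes A: "Module.module R A" and B: "Module.module R B" and h: "h \<in> module_hom R A B"
    and "finite S" "f \<in> S \<rightarrow> carrier A"
  shows "h (finsum A f S) = finsum B (\<lambda>j. h (f j)) S"
proof -
  interpret A: Module.module R A by (rule A)
  interpret B: Module.module R B by (rule B)
  note h' = module_hom_closed[OF h] module_hom_add[OF h] module_hom_smult[OF h]
  have "h \<zero>\<^bsub>A\<^esub> = h (\<zero>\<^bsub>R\<^esub> \<odot>\<^bsub>A\<^esub> \<zero>\<^bsub>A\<^esub>)" by simp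
  also have "\<dots> = \<zero>\<^bsub>R\<^esub> \<odot>\<^bsub>B\<^esub> h \<zero>\<^bsub>A\<^esub>" by (rule h'(3)) auto
  also have "\<dots> = \<zero>\<^bsub>B\<^esub>" using funcset_mem[OF h'(1) A.zero_closed] by simp
  finally have h0: "h \<zero>\<^bsub>A\<^esub> = \<zero>\<^bsub>B\<^esub>" .
  show ?thesis using assms(4,5)
  proof (induction S)
    case (insert j S)
    have "f j \<in> carrier A" "f \<in> S \<rightarrow> carrier A" "(\<lambda>j. h (f j)) \<in> S \<rightarrow> carrier B" "h (f j) \<in> carrier B"
      using insert.prems h'(1) by auto
    thus ?case using insert h'(2) by simp
  qed (simp add: h0)
qed

context graded_algebra begin

abbreviation graded_mod :: "('a, 'x, 's) module_scheme \<Rightarrow> (int \<Rightarrow> 'x set) \<Rightarrow> bool" where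
  "graded_mod A U \<equiv> graded_module R gR A U"

lemma graded_mod_module: "graded_mod A U \<Longrightarrow> Module.module R A" by (simp add: graded_module_def)

lemma graded_mod_graded_sub:
  assumes "graded_mod A U" shows "graded_sub A U"
proof -
  interpret A: graded_module R gR A U by (rule assms)
  have "additive_subgroup (U n) A" for n using A.grading by (simp add: grading_def)
  hence "U n \<subseteq> carrier A \<and> \<zero>\<^bsub>A\<^esub> \<in> U n \<and> (\<forall>u\<in>U n. \<forall>v\<in>U n. u \<oplus>\<^bsub>A\<^esub> v \<in> U n)" for n
    using additive_subgroup_iff[OF A.abelian_group_axioms, of "U n"] by simp
  thus ?thesis using A.module_axioms A.graded_smult by (simp add: graded_sub_def)
qed

definition component :: "('a, 'x, 's) module_scheme \<Rightarrow> (int \<Rightarrow> 'x set) \<Rightarrow> 'x \<Rightarrow> int \<Rightarrow> 'x" where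
  "component A U v = (THE f. (\<forall>n. f n \<in> U n) \<and> finite {n. f n \<noteq> \<zero>\<^bsub>A\<^esub>} \<and>
     v = (\<Oplus>\<^bsub>A\<^esub>n\<in>{n. f n \<noteq> \<zero>\<^bsub>A\<^esub>}. f n))"

definition supp :: "('a, 'x, 's) module_scheme \<Rightarrow> (int \<Rightarrow> 'x set) \<Rightarrow> 'x \<Rightarrow> int set" where
  "supp A U v = {n. component A U v n \<noteq> \<zero>\<^bsub>A\<^esub>}"

lemma component:
  assumes "graded_mod A U" "v \<in> carrier A"
  shows "component A U v n \<in> U n" "finite (supp A U v)" "v = finsum A (component A U v) (supp A U v)"
    "component A U v n \<in> carrier A"
proof -
  interpret A: graded_module R gR A U by (rule assms(1))
  have "\<exists>!f. (\<forall>n. f n \<in> U n) \<and> finite {n. f n \<noteq> \<zero>\<^bsub>A\<^esub>} \<and> v = (\<Oplus>\<^bsub>A\<^esub>n\<in>{n. f n \<noteq> \<zero>\<^bsub>A\<^esub>}. f n)"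
    using A.grading assms(2) unfolding grading_def by blast
  from theI'[OF this] show *: "component A U v n \<in> U n" and "finite (supp A U v)"
    "v = finsum A (component A U v) (supp A U v)" unfolding component_def[symmetric] supp_def by simp_all
  show "component A U v n \<in> carrier A" by (rule graded_subD(2)[OF graded_mod_graded_sub[OF assms(1)] *])
qed

text \<open>The uniqueness clause of the grading in usable form: any finite \<open>S\<close>
  containing the support is allowed, so supports need not be computed exactly.\<close>

lemma component_eqI:
  assumes A: "graded_mod A U" and f: "\<And>n. f n \<in> U n" and S: "finite S" "\<And>n. n \<notin> S \<Longrightarrow> f n = \<zero>\<^bsub>A\<^esub>"
    and v: "v = finsum A f S"
  shows "component A U v = f"
proof -
  interpret A: graded_module R gR A U by (rule A)
  have fc: "f n \<in> carrier A" for n by (rule graded_subD(2)[OF graded_mod_graded_sub[OF A] f])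
  have vc: "v \<in> carrier A" unfolding v using fc by (intro A.finsum_closed) auto
  have sub: "{n. f n \<noteq> \<zero>\<^bsub>A\<^esub>} \<subseteq> S" using S(2) by auto
  have v': "v = finsum A f {n. f n \<noteq> \<zero>\<^bsub>A\<^esub>}"
    unfolding v using fc by (intro A.add.finprod_mono_neutral_cong_right[OF S(1) sub]) auto
  have "\<exists>!f. (\<forall>n. f n \<in> U n) \<and> finite {n. f n \<noteq> \<zero>\<^bsub>A\<^esub>} \<and> v = (\<Oplus>\<^bsub>A\<^esub>n\<in>{n. f n \<noteq> \<zero>\<^bsub>A\<^esub>}. f n)"
    using A.grading vc unfolding grading_def by blast
  from the1_equality[OF this] show ?thesis
    unfolding component_def using f finite_subset[OF sub S(1)] v' by simp
qed

lemma component_sum: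
  assumes A: "graded_mod A U" "v \<in> carrier A" and S: "finite S" "supp A U v \<subseteq> S"
  shows "v = finsum A (component A U v) S"
proof -
  interpret A: graded_module R gR A U by (rule A(1))
  have "finsum A (component A U v) S = finsum A (component A U v) (supp A U v)"
    using component(4)[OF A] by (intro A.add.finprod_mono_neutral_cong_right[OF S]) (auto simp: supp_def)
  thus ?thesis using component(3)[OF A] by simp
qed

lemma component_add:
  assumes A: "graded_mod A U" and u: "u \<in> carrier A" and v: "v \<in> carrier A"
  shows "component A U (u \<oplus>\<^bsub>A\<^esub> v) n = component A U u n \<oplus>\<^bsub>A\<^esub> component A U v n"
proof -
  interpret A: graded_module R gR A U by (rule A)
  let ?S = "supp A U u \<union> supp A U v"
  have "component A U (u \<oplus>\<^bsub>A\<^esub> v) = (\<lambda>n. component A U u n \<oplus>\<^bsub>A\<^esub> component A U v n)"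
  proof (rule component_eqI[OF A])
    show "component A U u n \<oplus>\<^bsub>A\<^esub> component A U v n \<in> U n" for n
      by (rule graded_subD(4)[OF graded_mod_graded_sub[OF A] component(1)[OF A u] component(1)[OF A v]])
    show S: "finite ?S" using component(2)[OF A u] component(2)[OF A v] by simp
    have "u \<oplus>\<^bsub>A\<^esub> v = finsum A (component A U u) ?S \<oplus>\<^bsub>A\<^esub> finsum A (component A U v) ?S"
      using component_sum[OF A u S] component_sum[OF A v S] by simp
    also have "\<dots> = finsum A (\<lambda>n. component A U u n \<oplus>\<^bsub>A\<^esub> component A U v n) ?S"
      using component(4)[OF A u] component(4)[OF A v] by (intro A.finsum_addf[symmetric]) auto
    finally show "u \<oplus>\<^bsub>A\<^esub> v = finsum A (\<lambda>n. component A U u n \<oplus>\<^bsub>A\<^esub> component A U v n) ?S" .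
  qed (simp add: supp_def)
  thus ?thesis by simp
qed

lemma component_homogeneous:
  assumes A: "graded_mod A U" and u: "u \<in> U m"
  shows "component A U u n = (if n = m then u else \<zero>\<^bsub>A\<^esub>)"
proof -
  interpret A: graded_module R gR A U by (rule A)
  have "u \<in> carrier A" by (rule graded_subD(2)[OF graded_mod_graded_sub[OF A] u])
  hence "component A U u = (\<lambda>n. if n = m then u else \<zero>\<^bsub>A\<^esub>)"
    using u graded_subD(3)[OF graded_mod_graded_sub[OF A]] by (intro component_eqI[OF A, where S = "{m}"]) auto
  thus ?thesis by simp
qed

lemma component_zero: "graded_mod A U \<Longrightarrow> component A U \<zero>\<^bsub>A\<^esub> n = \<zero>\<^bsub>A\<^esub>"
  by (subst component_homogeneous[where m = n]) (auto intro: graded_subD(3) graded_mod_graded_sub)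

lemma component_finsum:
  assumes A: "graded_mod A U" and "finite S" "f \<in> S \<rightarrow> carrier A"
  shows "component A U (finsum A f S) n = finsum A (\<lambda>j. component A U (f j) n) S"
proof -
  interpret A: graded_module R gR A U by (rule A)
  show ?thesis using assms(2,3)
  proof (induction S)
    case (insert j S)
    hence "f j \<in> carrier A" "f \<in> S \<rightarrow> carrier A" "(\<lambda>j. component A U (f j) n) \<in> S \<rightarrow> carrier A"
      "component A U (f j) n \<in> carrier A" using component(4)[OF A] by (auto simp: Pi_iff)
    thus ?case using insert component_add[OF A] by simp
  qed (simp add: component_zero[OF A])
qed

lemma component_hom:
  assumes A: "graded_mod A U" and B: "graded_mod B V" and h: "h \<in> module_hom R A B" "\<And>n u. u \<in> U n \<Longrightarrow> h u \<in> V (a + n)"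
    and v: "v \<in> carrier A"
  shows "component B V (h v) (a + n) = h (component A U v n)"
proof -
  interpret A: graded_module R gR A U by (rule A)
  interpret B: graded_module R gR B V by (rule B)
  have h0: "h \<zero>\<^bsub>A\<^esub> = \<zero>\<^bsub>B\<^esub>"
    using module_hom_finsum[OF graded_mod_module[OF A] graded_mod_module[OF B] h(1), of "{}"] by simp
  have "component B V (h v) = (\<lambda>k. h (component A U v (k - a)))"
  proof (rule component_eqI[OF B])
    show "h (component A U v (k - a)) \<in> V k" for k using h(2)[OF component(1)[OF A v, of "k - a"]] by simp
    show "finite ((+) a ` supp A U v)" using component(2)[OF A v] by simp
    show "h (component A U v (k - a)) = \<zero>\<^bsub>B\<^esub>" if "k \<notin> (+) a ` supp A U v" for k
    proof -
      have "k - a \<notin> supp A U v" using that by (auto simp: image_iff)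
      thus ?thesis by (simp add: supp_def h0)
    qed
    have hc: "h (component A U v k) \<in> carrier B" for k
      using module_hom_closed[OF h(1)] component(4)[OF A v] by auto
    have "h v = h (finsum A (component A U v) (supp A U v))" using component(3)[OF A v] by simp
    also have "\<dots> = finsum B (\<lambda>k. h (component A U v k)) (supp A U v)"
      using component(2,4)[OF A v] by (intro module_hom_finsum[OF graded_mod_module[OF A] graded_mod_module[OF B] h(1)]) auto
    also have "\<dots> = finsum B (\<lambda>k. h (component A U v (k - a))) ((+) a ` supp A U v)"
      using hc by (subst B.finsum_reindex) auto
    finally show "h v = finsum B (\<lambda>k. h (component A U v (k - a))) ((+) a ` supp A U v)" .
  qed
  thus ?thesis by simp
qed

text \<open>Multiplication by a homogeneous scalar of degree \<open>m\<close> is an endomorphism of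
  degree \<open>m\<close>, so this is a case of \<open>component_hom\<close>.\<close>

lemma component_smult_homogeneous:
  assumes A: "graded_mod A U" and r: "r \<in> gR m" and v: "v \<in> carrier A"
  shows "component A U (r \<odot>\<^bsub>A\<^esub> v) n = r \<odot>\<^bsub>A\<^esub> component A U v (n - m)"
proof -
  interpret A: graded_module R gR A U by (rule A)
  have "(\<lambda>v. r \<odot>\<^bsub>A\<^esub> v) \<in> module_hom R A A"
    using gR_carrier[OF r] by (auto simp: module_hom_def A.smult_r_distr m_comm simp flip: A.smult_assoc1)
  from component_hom[OF A A this A.graded_smult[OF r] v, of "n - m"] show ?thesis by simp
qed

lemma RM_finsum: "finsum RM f S = finsum R f S"
  by (simp add: finsum_def ring_as_module_def finprod_def)

lemma graded_mod_RM: "graded_mod RM gR"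
proof -
  interpret RM: Module.module R RM by (rule module_RM)
  have "additive_subgroup (gR n) RM" for n
    unfolding additive_subgroup_iff[OF RM.abelian_group_axioms]
    using graded_subD(7)[OF graded_sub_RM, of n] graded_subD(3)[OF graded_sub_RM] graded_subD(4)[OF graded_sub_RM] graded_sub_neg[OF graded_sub_RM] by (intro conjI ballI) auto
  hence "Defs.grading RM gR" using grading by (simp add: grading_def RM_finsum)
  thus ?thesis
    using module_RM graded_mult by (simp add: graded_module_def graded_module_axioms_def)
qed

lemma component_smult_right:
  assumes A: "graded_mod A U" and r: "r \<in> carrier R" and b: "b \<in> U m"
  shows "component A U (r \<odot>\<^bsub>A\<^esub> b) n = component RM gR r (n - m) \<odot>\<^bsub>A\<^esub> b"
proof -
  interpret A: graded_module R gR A U by (rule A)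
  have bc: "b \<in> carrier A" by (rule graded_subD(2)[OF graded_mod_graded_sub[OF A] b])
  have h: "(\<lambda>r. r \<odot>\<^bsub>A\<^esub> b) \<in> module_hom R RM A"
    using bc by (auto simp: module_hom_def A.smult_l_distr A.smult_assoc1)
  have "u \<odot>\<^bsub>A\<^esub> b \<in> U (m + k)" if "u \<in> gR k" for u k using A.graded_smult[OF that b] by (simp add: add.commute)
  from component_hom[OF graded_mod_RM A h this, of r "n - m"] r show ?thesis by simp
qed

lemma component_smult:
  assumes A: "graded_mod A U" and r: "r \<in> carrier R" and v: "v \<in> carrier A"
  shows "component A U (r \<odot>\<^bsub>A\<^esub> v) n = finsum A (\<lambda>m. component RM gR r m \<odot>\<^bsub>A\<^esub> component A U v (n - m)) (supp RM gR r)"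
proof -
  interpret A: graded_module R gR A U by (rule A)
  have r': "r \<in> carrier RM" using r by simp
  have rc: "component RM gR r m \<in> carrier R" for m using component(4)[OF graded_mod_RM r'] by simp
  have h: "(\<lambda>r. r \<odot>\<^bsub>A\<^esub> v) \<in> module_hom R RM A"
    using v by (auto simp: module_hom_def A.smult_l_distr A.smult_assoc1)
  have "r \<odot>\<^bsub>A\<^esub> v = finsum RM (component RM gR r) (supp RM gR r) \<odot>\<^bsub>A\<^esub> v" using component(3)[OF graded_mod_RM r'] by simp
  also have "\<dots> = finsum A (\<lambda>m. component RM gR r m \<odot>\<^bsub>A\<^esub> v) (supp RM gR r)"
    using rc component(2)[OF graded_mod_RM r'] by (intro module_hom_finsum[OF module_RM A.module_axioms h]) auto
  finally have "component A U (r \<odot>\<^bsub>A\<^esub> v) n = finsum A (\<lambda>m. component A U (component RM gR r m \<odot>\<^bsub>A\<^esub> v) n) (supp RM gR r)"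
    using rc v component(2)[OF graded_mod_RM r'] component_finsum[OF A, of "supp RM gR r" "\<lambda>m. component RM gR r m \<odot>\<^bsub>A\<^esub> v"] by auto
  also have "\<dots> = finsum A (\<lambda>m. component RM gR r m \<odot>\<^bsub>A\<^esub> component A U v (n - m)) (supp RM gR r)"
    using rc component(4)[OF A v] component_smult_homogeneous[OF A component(1)[OF graded_mod_RM r'] v]
    by (intro A.finsum_cong') auto
  finally show ?thesis .
qed

end

context graded_algebra_elements begin

lemma x_smult_gens_smult:
  assumes U: "graded_sub A U" and u: "u \<in> U n"
  shows "k < j \<Longrightarrow> j \<le> e \<Longrightarrow> x k \<odot>\<^bsub>A\<^esub> u \<in> gens_smult A j U (dg k + n)"
proof (induction j)
  case (Suc j)
  interpret A: Module.module R A by (rule graded_subD(1)[OF U])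
  have k: "k < e" and j: "j < e" using Suc.prems by auto
  have xu: "x k \<odot>\<^bsub>A\<^esub> u \<in> carrier A" using gR_carrier[OF x_deg[OF k]] graded_subD(2)[OF U u] by simp
  show ?case
  proof (cases "k = j")
    case True
    have "\<zero>\<^bsub>A\<^esub> \<in> gens_smult A j U (dg k + n)" using graded_subD(3)[OF graded_sub_gens_smult(1)[OF U]] j by simp
    moreover have "u \<in> U (dg k + n - dg j)" using u True by simp
    moreover have "x k \<odot>\<^bsub>A\<^esub> u = \<zero>\<^bsub>A\<^esub> \<oplus>\<^bsub>A\<^esub> x j \<odot>\<^bsub>A\<^esub> u" using xu True by simp
    ultimately show ?thesis by auto
  next
    case False
    hence 1: "x k \<odot>\<^bsub>A\<^esub> u \<in> gens_smult A j U (dg k + n)" using Suc by simp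
    moreover have "\<zero>\<^bsub>A\<^esub> \<in> U (dg k + n - dg j)" by (rule graded_subD(3)[OF U])
    moreover have "x k \<odot>\<^bsub>A\<^esub> u = x k \<odot>\<^bsub>A\<^esub> u \<oplus>\<^bsub>A\<^esub> x j \<odot>\<^bsub>A\<^esub> \<zero>\<^bsub>A\<^esub>"
      using xu gR_carrier[OF x_deg[OF j]] by simp
    ultimately show ?thesis unfolding ideal_smult.simps by blast
  qed
qed simp

text \<open>Induction over the generated ring shows that all components of positive degree of an
  element lie in the ideal of the \<open>x k\<close>. For a term of a product the factor of positive
  degree supplies the membership; if the left factor has degree 0, this is the right one.\<close>

lemma generated:
  assumes gen: "generate_ring R (gR 0 \<union> x ` {..<e}) = carrier R" and n: "0 < n"
  shows "gR n \<subseteq> max_smult RM gR n"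
proof -
  interpret RM: Module.module R RM by (rule module_RM)
  note max_smult = graded_sub_gens_smult(1)[OF graded_sub_RM le_refl]
  have "r \<in> carrier R \<and> (\<forall>n>0. component RM gR r n \<in> max_smult RM gR n)" if "r \<in> generate_ring R (gR 0 \<union> x ` {..<e})" for r
    using that
  proof induction
    case one
    show ?case using component_homogeneous[OF graded_mod_RM gR_1] graded_subD(3)[OF max_smult] by simp
  next
    case (incl h)
    hence "h \<in> gR 0 \<or> (\<exists>k<e. h = x k)" by auto
    thus ?case
    proof
      assume h: "h \<in> gR 0"
      thus ?thesis using component_homogeneous[OF graded_mod_RM h] graded_subD(3)[OF max_smult] gR_carrier by simp
    next
      assume "\<exists>k<e. h = x k"
      then obtain k where k: "k < e" "h = x k" by blast
      have hc: "h \<in> carrier R" using gR_carrier[OF x_deg[OF k(1)]] k(2) by simp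
      have "h \<in> max_smult RM gR (dg k)"
        using x_smult_gens_smult[OF graded_sub_RM gR_1 k(1) le_refl] hc k(2) by simp
      thus ?thesis using hc component_homogeneous[OF graded_mod_RM x_deg[OF k(1)]] graded_subD(3)[OF max_smult] k(2) by simp
    qed
  next
    case (a_inv h)
    have "\<ominus> h = (\<ominus> \<one>) \<odot>\<^bsub>RM\<^esub> h" using a_inv by (simp add: l_minus)
    moreover have "component RM gR ((\<ominus> \<one>) \<odot>\<^bsub>RM\<^esub> h) n = (\<ominus> \<one>) \<odot>\<^bsub>RM\<^esub> component RM gR h (n - 0)" for n
      using a_inv by (intro component_smult_homogeneous[OF graded_mod_RM K_minus_1]) simp
    ultimately show ?case
      using a_inv graded_subD(6)[OF max_smult K_minus_1] by simp
  next
    case (eng_add h k)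
    thus ?case using component_add[OF graded_mod_RM, of h k] graded_subD(4)[OF max_smult] by simp
  next
    case (eng_mult h k)
    have hk: "h \<in> carrier RM" "k \<in> carrier RM" using eng_mult by simp_all
    have "component RM gR (h \<otimes> k) n \<in> max_smult RM gR n" if n: "0 < n" for n
    proof -
      have "component RM gR (h \<odot>\<^bsub>RM\<^esub> k) n = finsum RM (\<lambda>m. component RM gR h m \<odot>\<^bsub>RM\<^esub> component RM gR k (n - m)) (supp RM gR h)"
        using hk by (intro component_smult[OF graded_mod_RM]) auto
      also have "\<dots> \<in> max_smult RM gR n"
      proof (rule finsum_in[OF max_smult])
        fix m :: int
        note graded_hom = component(1)[OF graded_mod_RM hk(1), of m] and km = component(1)[OF graded_mod_RM hk(2), of "n - m"]
        consider "m < 0" | "m = 0" | "0 < m" by linarith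
        thus "component RM gR h m \<odot>\<^bsub>RM\<^esub> component RM gR k (n - m) \<in> max_smult RM gR n"
        proof cases
          case 1
          hence "component RM gR h m = \<zero>" using graded_hom neg_degree by auto
          thus ?thesis using gR_carrier[OF km] graded_subD(3)[OF max_smult] by simp
        next
          case 2
          have "component RM gR k n \<in> max_smult RM gR n" using eng_mult n by simp
          thus ?thesis using 2 graded_subD(6)[OF max_smult graded_hom, of "component RM gR k (n - m)" "n - m" n] by simp
        next
          case 3
          have "component RM gR h m \<in> max_smult RM gR m" using eng_mult 3 by simp
          from graded_subD(6)[OF max_smult km this, of n] show ?thesis
            using gR_carrier[OF graded_hom] gR_carrier[OF km] by (simp add: m_comm)
        qed
      qed
      finally show ?thesis by simp
    qed
    thus ?case using hk by simp
  qed
  hence 1: "component RM gR r n \<in> max_smult RM gR n" if "r \<in> gR n" for r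
    using that gR_carrier[OF that] n gen by simp
  show ?thesis
  proof
    fix r assume r: "r \<in> gR n"
    show "r \<in> max_smult RM gR n" using 1[OF r] component_homogeneous[OF graded_mod_RM r, of n] by simp
  qed
qed

end

context generated_graded_algebra begin

text \<open>The given finite generators may be inhomogeneous; their nonzero homogeneous components
  are finitely many and generate every piece, which exhibits \<open>U\<close> as the image of a free
  family.\<close>

lemma fin_gen_of_finite:
  assumes "finite_graded_module R gR A U" shows "fin_gen A U"
proof -
  obtain S where A: "graded_mod A U" and S: "finite S" "S \<subseteq> carrier A" "LinearCombinations.module.span R A S = carrier A"
    using assms by (auto simp: finite_graded_module_def)
  interpret A: graded_module R gR A U by (rule A)
  note gU = graded_mod_graded_sub[OF A]
  obtain h :: "_ \<Rightarrow> nat" where h: "inj_on h S" using finite_imp_inj_to_nat_seg[OF S(1)] by auto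
  define y where "y j = component A U (inv_into S h (snd j)) (fst j)" for j :: "int \<times> nat"
  \<comment> \<open>An index records the degree of a component and, through the injection
    \<open>h\<close>, the generator from which it comes.\<close>
  define J where "J = (\<lambda>(a, n). (n, h a)) ` (SIGMA a:S. supp A U a)"
  have Sc: "a \<in> carrier A" if "a \<in> S" for a using S(2) that by blast
  have J: "finite J" unfolding J_def using S(1) component(2)[OF A Sc] by auto
  have yS: "y (n, h a) = component A U a n" if "a \<in> S" for a n by (simp add: y_def inv_into_f_f[OF h that])
  have yU: "y j \<in> U (0 + fst j)" if "j \<in> J" for j
    using that yS component(1)[OF A Sc] by (auto simp: J_def)
  let ?p = "\<lambda>c. lin_comb A J c y"
  have p: "?p \<in> graded_hom (fun_mod RM) (free_family J) A U 0" by (rule lin_comb_free_family_graded_hom[OF gU J yU])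
  have gI: "graded_sub A (\<lambda>n. ?p ` free_family J n)" by (rule graded_sub_image[OF graded_sub_free_family gU p])
  have yI: "y j \<in> ?p ` free_family J (fst j)" if "j \<in> J" for j
  proof (rule image_eqI[OF _ unit_vec_free_family[OF that]])
    show "y j = ?p (unit_vec j)"
      using graded_subD(2)[OF gU yU] by (intro lin_comb_of_unit_vec[OF A.module_axioms J that, symmetric]) auto
  qed
  have cI: "component A U a n \<in> ?p ` free_family J n" if a: "a \<in> S" for a n
  proof (cases "component A U a n = \<zero>\<^bsub>A\<^esub>")
    case False
    hence "(n, h a) \<in> J" using a by (force simp: J_def supp_def)
    from yI[OF this] show ?thesis using yS[OF a] by simp
  qed (use graded_subD(3)[OF gI, of n] in simp)
  have vI: "component A U v n \<in> ?p ` free_family J n" if v: "v \<in> carrier A" for v n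
  proof -
    obtain c where c: "c \<in> S \<rightarrow> carrier R" "A.lincomb c S = v"
      using A.finite_in_span[OF S(1,2)] v S(3) by blast
    have cc: "c a \<in> carrier R" if "a \<in> S" for a using c(1) that by auto
    have "component A U v n = finsum A (\<lambda>a. component A U (c a \<odot>\<^bsub>A\<^esub> a) n) S"
      unfolding c(2)[symmetric] A.lincomb_def using cc Sc by (intro component_finsum[OF A S(1)]) auto
    also have "\<dots> \<in> ?p ` free_family J n"
    proof (rule finsum_in[OF gI])
      fix a assume a: "a \<in> S"
      have cm: "component RM gR (c a) m \<in> gR m" for m using cc[OF a] by (intro component(1)[OF graded_mod_RM]) simp
      show "component A U (c a \<odot>\<^bsub>A\<^esub> a) n \<in> ?p ` free_family J n"
        unfolding component_smult[OF A cc[OF a] Sc[OF a]]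
      proof (rule finsum_in[OF gI])
        show "component RM gR (c a) m \<odot>\<^bsub>A\<^esub> component A U a (n - m) \<in> ?p ` free_family J n" for m
          by (rule graded_subD(6)[OF gI cm cI[OF a]]) simp
      qed
    qed
    finally show ?thesis .
  qed
  have im: "?p ` free_family J n = U n" for n
  proof
    show "?p ` free_family J n \<subseteq> U n" using graded_homD0[OF p] by blast
    show "U n \<subseteq> ?p ` free_family J n"
    proof
      fix u assume u: "u \<in> U n"
      show "u \<in> ?p ` free_family J n" using vI[OF graded_subD(2)[OF gU u], of n] component_homogeneous[OF A u, of n] by simp
    qed
  qed
  show ?thesis by (rule fin_gen_image[OF fin_gen_free_family[OF J] gU p im])
qed

text \<open>The coordinates with respect to a homogeneous basis are unique, and uniqueness yields
  that they are additive, linear over scalars, and homogeneous of the right degree.\<close>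

lemma free_proj:
  assumes "finite_free_graded_module R gR A U" shows "proj A U" "graded_mod A U"
proof -
  obtain S where A: "graded_mod A U" and S: "finite S" "S \<subseteq> (\<Union>n. U n)"
    "LinearCombinations.module.span R A S = carrier A" "\<not> LinearCombinations.module.lin_dep R A S"
    using assms by (auto simp: finite_free_graded_module_def)
  show "graded_mod A U" by (rule A)
  interpret A: graded_module R gR A U by (rule A)
  note gU = graded_mod_graded_sub[OF A]
  have "\<forall>b\<in>S. \<exists>n. b \<in> U n" using S(2) by blast
  then obtain \<delta> where \<delta>: "\<forall>b\<in>S. b \<in> U (\<delta> b)" by (rule bchoice[THEN exE])
  have \<delta>': "b \<in> U (\<delta> b)" if "b \<in> S" for b using \<delta> that by blast
  have Sc: "b \<in> carrier A" if "b \<in> S" for b by (rule graded_subD(2)[OF gU \<delta>'[OF that]])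
  obtain h :: "_ \<Rightarrow> nat" where h: "inj_on h S" using finite_imp_inj_to_nat_seg[OF S(1)] by auto
  define J where "J = (\<lambda>b. (\<delta> b, h b)) ` S"
  define y where "y j = inv_into S h (snd j)" for j :: "int \<times> nat"
  have yS: "y (\<delta> b, h b) = b" if "b \<in> S" for b using that h by (simp add: y_def)
  have "\<forall>v\<in>carrier A. \<exists>c. c \<in> S \<rightarrow> carrier R \<and> A.lincomb c S = v"
    using A.finite_in_span[OF S(1)] Sc S(3) by blast
  then obtain cf where cf: "\<forall>v\<in>carrier A. cf v \<in> S \<rightarrow> carrier R \<and> A.lincomb (cf v) S = v"
    by (rule bchoice[THEN exE])
  have cfc: "cf v b \<in> carrier R" if "v \<in> carrier A" "b \<in> S" for v b using cf that by auto
  have lcf: "finsum A (\<lambda>b. cf v b \<odot>\<^bsub>A\<^esub> b) S = v" if "v \<in> carrier A" for v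
    using cf that by (simp add: A.lincomb_def)
  \<comment> \<open>Two different coordinate vectors would have a difference that is a linear
    dependency.\<close>
  have uniq: "c b = cf v b"
    if v: "v \<in> carrier A" and c: "\<And>b. b \<in> S \<Longrightarrow> c b \<in> carrier R" "finsum A (\<lambda>b. c b \<odot>\<^bsub>A\<^esub> b) S = v"
      and b: "b \<in> S" for c v b
  proof -
    let ?e = "\<lambda>b. c b \<ominus> cf v b"
    have "finsum A (\<lambda>b. ?e b \<odot>\<^bsub>A\<^esub> b) S \<oplus>\<^bsub>A\<^esub> v = finsum A (\<lambda>b. ?e b \<odot>\<^bsub>A\<^esub> b) S \<oplus>\<^bsub>A\<^esub> finsum A (\<lambda>b. cf v b \<odot>\<^bsub>A\<^esub> b) S"
      by (simp add: lcf[OF v])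
    also have "\<dots> = finsum A (\<lambda>b. ?e b \<odot>\<^bsub>A\<^esub> b \<oplus>\<^bsub>A\<^esub> cf v b \<odot>\<^bsub>A\<^esub> b) S"
      using c(1) cfc[OF v] Sc by (intro A.finsum_addf[symmetric]) auto
    also have "\<dots> = finsum A (\<lambda>b. c b \<odot>\<^bsub>A\<^esub> b) S"
      using c(1) cfc[OF v] Sc
      by (intro A.finsum_cong') (auto simp: add_diff_cancel simp flip: A.smult_l_distr)
    finally have "finsum A (\<lambda>b. ?e b \<odot>\<^bsub>A\<^esub> b) S \<oplus>\<^bsub>A\<^esub> v = v" by (simp add: c(2))
    moreover have "finsum A (\<lambda>b. ?e b \<odot>\<^bsub>A\<^esub> b) S \<in> carrier A"
      using c(1) cfc[OF v] Sc by (intro A.finsum_closed) auto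
    ultimately have "A.lincomb ?e S = \<zero>\<^bsub>A\<^esub>"
      using v unfolding A.lincomb_def by simp
    moreover have "?e \<in> S \<rightarrow> carrier R" using c(1) cfc[OF v] by auto
    ultimately have "?e b = \<zero>" using A.lin_dep_crit[OF S(1) subset_refl _ b] S(4) by blast
    thus ?thesis using c(1)[OF b] cfc[OF v b] by simp
  qed
  \<comment> \<open>Taking the component of degree \<open>n\<close> of the expansion of
    \<open>u\<close> gives another expansion of \<open>u\<close>, with homogeneous coefficients; by
    uniqueness these are the coordinates.\<close>
  have homog: "cf u b \<in> gR (n - \<delta> b)" if u: "u \<in> U n" and b: "b \<in> S" for u b n
  proof -
    have uc: "u \<in> carrier A" by (rule graded_subD(2)[OF gU u])
    let ?c = "\<lambda>b. component RM gR (cf u b) (n - \<delta> b)"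
    have cg: "?c b \<in> gR (n - \<delta> b)" if "b \<in> S" for b
      using cfc[OF uc that] by (intro component(1)[OF graded_mod_RM]) simp
    have "u = component A U (finsum A (\<lambda>b. cf u b \<odot>\<^bsub>A\<^esub> b) S) n"
      using component_homogeneous[OF A u] by (simp add: lcf[OF uc])
    also have "\<dots> = finsum A (\<lambda>b. component A U (cf u b \<odot>\<^bsub>A\<^esub> b) n) S"
      using cfc[OF uc] Sc by (intro component_finsum[OF A S(1)]) auto
    also have "\<dots> = finsum A (\<lambda>b. ?c b \<odot>\<^bsub>A\<^esub> b) S"
      using gR_carrier[OF cg] Sc component_smult_right[OF A cfc[OF uc] \<delta>']
      by (intro A.finsum_cong') auto
    finally have "?c b = cf u b" using gR_carrier[OF cg] by (intro uniq[OF uc _ _ b]) auto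
    thus ?thesis using cg[OF b] by simp
  qed
  have add: "cf (u \<oplus>\<^bsub>A\<^esub> v) b = cf u b \<oplus> cf v b" if u: "u \<in> carrier A" and v: "v \<in> carrier A" and b: "b \<in> S" for u v b
  proof (rule uniq[OF _ _ _ b, symmetric])
    have "finsum A (\<lambda>b. (cf u b \<oplus> cf v b) \<odot>\<^bsub>A\<^esub> b) S = finsum A (\<lambda>b. cf u b \<odot>\<^bsub>A\<^esub> b \<oplus>\<^bsub>A\<^esub> cf v b \<odot>\<^bsub>A\<^esub> b) S"
      using cfc[OF u] cfc[OF v] Sc by (intro A.finsum_cong') (auto simp: A.smult_l_distr)
    also have "\<dots> = u \<oplus>\<^bsub>A\<^esub> v"
      using cfc[OF u] cfc[OF v] Sc by (subst A.finsum_addf) (auto simp: lcf u v)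
    finally show "finsum A (\<lambda>b. (cf u b \<oplus> cf v b) \<odot>\<^bsub>A\<^esub> b) S = u \<oplus>\<^bsub>A\<^esub> v" .
  qed (use u v cfc in auto)
  have smult: "cf (r \<odot>\<^bsub>A\<^esub> u) b = r \<otimes> cf u b" if r: "r \<in> carrier R" and u: "u \<in> carrier A" and b: "b \<in> S" for r u b
  proof (rule uniq[OF _ _ _ b, symmetric])
    have "finsum A (\<lambda>b. (r \<otimes> cf u b) \<odot>\<^bsub>A\<^esub> b) S = finsum A (\<lambda>b. r \<odot>\<^bsub>A\<^esub> (cf u b \<odot>\<^bsub>A\<^esub> b)) S"
      using r cfc[OF u] Sc by (intro A.finsum_cong') (auto simp: A.smult_assoc1)
    also have "\<dots> = r \<odot>\<^bsub>A\<^esub> u"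
      using r cfc[OF u] Sc S(1) by (subst A.finsum_smult_ldistr[symmetric]) (auto simp: lcf u)
    finally show "finsum A (\<lambda>b. (r \<otimes> cf u b) \<odot>\<^bsub>A\<^esub> b) S = r \<odot>\<^bsub>A\<^esub> u" .
  qed (use r u cfc in auto)
  have expand: "u = lin_comb A J (\<lambda>j. cf u (y j)) y" if u: "u \<in> carrier A" for u
  proof -
    have "lin_comb A J (\<lambda>j. cf u (y j)) y = finsum A (\<lambda>b. cf u (y (\<delta> b, h b)) \<odot>\<^bsub>A\<^esub> y (\<delta> b, h b)) S"
      unfolding lin_comb_def J_def using cfc[OF u] Sc h
      by (intro A.finsum_reindex) (auto simp: yS inj_on_def)
    also have "\<dots> = finsum A (\<lambda>b. cf u b \<odot>\<^bsub>A\<^esub> b) S"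
      using cfc[OF u] Sc by (intro A.finsum_cong') (auto simp: yS)
    finally show ?thesis by (simp add: lcf[OF u])
  qed
  have Uc: "u \<in> carrier A" if "u \<in> U n" for u n by (rule graded_subD(2)[OF gU that])
  have yJ: "y j \<in> S" "y j \<in> U (fst j)" "\<delta> (y j) = fst j" if "j \<in> J" for j
    using that \<delta>' by (auto simp: J_def yS)
  show "proj A U"
    unfolding proj_def
  proof (intro conjI exI[of _ J] exI[of _ y] exI[of _ "\<lambda>u j. cf u (y j)"] allI ballI)
    show "finite J" using S(1) by (simp add: J_def)
    show "cf u (y j) \<in> gR (n - fst j)" if "u \<in> U n" "j \<in> J" for n u j
      using homog[OF that(1) yJ(1)[OF that(2)]] yJ(3)[OF that(2)] by simp
    show "cf (u \<oplus>\<^bsub>A\<^esub> v) (y j) = cf u (y j) \<oplus> cf v (y j)" if "u \<in> U n" "v \<in> U n" "j \<in> J" for u v j n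
      by (rule add[OF Uc[OF that(1)] Uc[OF that(2)] yJ(1)[OF that(3)]])
    show "cf (r \<odot>\<^bsub>A\<^esub> u) (y j) = r \<otimes> cf u (y j)" if "r \<in> gR m" "u \<in> U n" "j \<in> J" for m n r u j
      by (rule smult[OF gR_carrier[OF that(1)] Uc[OF that(2)] yJ(1)[OF that(3)]])
    show "u = lin_comb A J (\<lambda>j. cf u (y j)) y" if "u \<in> U n" for u n by (rule expand[OF Uc[OF that]])
  qed (use gU yJ(2) in auto)
qed

text \<open>Extends a map known on the homogeneous pieces to the whole module. The restriction to
  the carrier matches the representation of homomorphisms in \<open>hom_module\<close>.\<close>

definition full :: "('a, 'x, 's) module_scheme \<Rightarrow> (int \<Rightarrow> 'x set) \<Rightarrow> ('a, 'y, 't) module_scheme \<Rightarrow> ('x \<Rightarrow> 'y) \<Rightarrow> 'x \<Rightarrow> 'y" where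
  "full A U B f = (\<lambda>v\<in>carrier A. finsum B (\<lambda>n. f (component A U v n)) (supp A U v))"

lemma module_hom_eqI:
  assumes A: "graded_mod A U" and B: "Module.module R B" and f: "f \<in> module_hom R A B" and g: "g \<in> module_hom R A B"
    and eq: "\<And>n u. u \<in> U n \<Longrightarrow> f u = g u" and v: "v \<in> carrier A"
  shows "f v = g v"
proof -
  interpret A: graded_module R gR A U by (rule A)
  interpret B: Module.module R B by (rule B)
  have fin: "finite (supp A U v)" and c: "component A U v \<in> supp A U v \<rightarrow> carrier A" using component(2,4)[OF A v] by auto
  have "f v = f (finsum A (component A U v) (supp A U v))" using component(3)[OF A v] by simp
  also have "\<dots> = finsum B (\<lambda>n. f (component A U v n)) (supp A U v)"
    by (rule module_hom_finsum[OF A.module_axioms B f fin c])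
  also have "\<dots> = finsum B (\<lambda>n. g (component A U v n)) (supp A U v)"
    using eq[OF component(1)[OF A v]] by simp
  also have "\<dots> = g (finsum A (component A U v) (supp A U v))"
    by (rule module_hom_finsum[OF A.module_axioms B g fin c, symmetric])
  also have "\<dots> = g v" using component(3)[OF A v] by simp
  finally show ?thesis .
qed

lemma
  assumes A: "graded_mod A U" and W: "graded_sub B W" and f: "f \<in> graded_hom A U B W a"
  shows full_on: "u \<in> U n \<Longrightarrow> full A U B f u = f u"
    and full_hom: "full A U B f \<in> module_hom R A B"
proof -
  interpret A: graded_module R gR A U by (rule A)
  interpret B: Module.module R B by (rule graded_subD(1)[OF W])
  note gU = graded_mod_graded_sub[OF A]
  have f0: "f \<zero>\<^bsub>A\<^esub> = \<zero>\<^bsub>B\<^esub>" by (rule graded_hom_zero[OF gU W f])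
  have fc: "f u \<in> carrier B" if "u \<in> U n" for u n by (rule graded_subD(2)[OF W graded_homD(1)[OF f that]])
  have fcmp: "f (component A U v n) \<in> carrier B" if "v \<in> carrier A" for v n by (rule fc[OF component(1)[OF A that]])
  let ?F = "full A U B f"
  \<comment> \<open>The sum may run over any finite set containing the support, so values at
    different elements can be added over a common set.\<close>
  have Fsum: "?F v = finsum B (\<lambda>n. f (component A U v n)) S"
    if v: "v \<in> carrier A" and S: "finite S" "supp A U v \<subseteq> S" for v S
  proof -
    have "finsum B (\<lambda>n. f (component A U v n)) S = finsum B (\<lambda>n. f (component A U v n)) (supp A U v)"
      using fcmp[OF v] by (intro B.add.finprod_mono_neutral_cong_right[OF S]) (auto simp: supp_def f0)
    thus ?thesis using v by (simp add: full_def)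
  qed
  show on: "?F u = f u" if u: "u \<in> U n" for u n
  proof -
    have uc: "u \<in> carrier A" by (rule graded_subD(2)[OF gU u])
    have "?F u = finsum B (\<lambda>n. f (component A U u n)) {n}"
      using component_homogeneous[OF A u] by (intro Fsum[OF uc]) (auto simp: supp_def split: if_splits)
    thus ?thesis using fcmp[OF uc, of n] component_homogeneous[OF A u] by simp
  qed
  have Fc: "?F v \<in> carrier B" if "v \<in> carrier A" for v
    using that fcmp[OF that] by (auto simp: full_def)
  have Fadd: "?F (u \<oplus>\<^bsub>A\<^esub> v) = ?F u \<oplus>\<^bsub>B\<^esub> ?F v" if u: "u \<in> carrier A" and v: "v \<in> carrier A" for u v
  proof -
    let ?S = "supp A U u \<union> supp A U v"
    have S: "finite ?S" using component(2)[OF A u] component(2)[OF A v] by simp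
    have sub: "supp A U (u \<oplus>\<^bsub>A\<^esub> v) \<subseteq> ?S" by (auto simp: supp_def component_add[OF A u v])
    have "?F (u \<oplus>\<^bsub>A\<^esub> v) = finsum B (\<lambda>n. f (component A U u n) \<oplus>\<^bsub>B\<^esub> f (component A U v n)) ?S"
      unfolding Fsum[OF A.a_closed[OF u v] S sub]
      using fcmp[OF u] fcmp[OF v] graded_homD(2)[OF f component(1)[OF A u] component(1)[OF A v]]
      by (intro B.finsum_cong') (auto simp: component_add[OF A u v])
    also have "\<dots> = ?F u \<oplus>\<^bsub>B\<^esub> ?F v"
      unfolding Fsum[OF u S Un_upper1] Fsum[OF v S Un_upper2]
      using fcmp[OF u] fcmp[OF v] by (intro B.finsum_addf) auto
    finally show ?thesis .
  qed
  have Fhom: "?F (r \<odot>\<^bsub>A\<^esub> v) = r \<odot>\<^bsub>B\<^esub> ?F v" if r: "r \<in> gR m" and v: "v \<in> carrier A" for r m v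
  proof -
    have rc: "r \<in> carrier R" by (rule gR_carrier[OF r])
    have fin: "finite (supp A U v)" by (rule component(2)[OF A v])
    have cr: "component A U (r \<odot>\<^bsub>A\<^esub> v) n = r \<odot>\<^bsub>A\<^esub> component A U v (n - m)" for n by (rule component_smult_homogeneous[OF A r v])
    have sub: "supp A U (r \<odot>\<^bsub>A\<^esub> v) \<subseteq> (+) m ` supp A U v"
    proof
      fix n assume "n \<in> supp A U (r \<odot>\<^bsub>A\<^esub> v)"
      hence "n - m \<in> supp A U v" using rc by (auto simp: supp_def cr)
      thus "n \<in> (+) m ` supp A U v" by (rule image_eqI[rotated]) simp
    qed
    have "?F (r \<odot>\<^bsub>A\<^esub> v) = finsum B (\<lambda>n. f (component A U (r \<odot>\<^bsub>A\<^esub> v) n)) ((+) m ` supp A U v)"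
      using fin sub rc v by (intro Fsum) auto
    also have "\<dots> = finsum B (\<lambda>n. f (component A U (r \<odot>\<^bsub>A\<^esub> v) (m + n))) (supp A U v)"
      using rc v fcmp by (intro B.finsum_reindex) auto
    also have "\<dots> = finsum B (\<lambda>n. r \<odot>\<^bsub>B\<^esub> f (component A U v n)) (supp A U v)"
      using rc fcmp[OF v] graded_homD(3)[OF f r component(1)[OF A v]] by (intro B.finsum_cong') (auto simp: cr)
    also have "\<dots> = r \<odot>\<^bsub>B\<^esub> ?F v"
      unfolding Fsum[OF v fin subset_refl] using rc fcmp[OF v] fin
      by (intro B.finsum_smult_ldistr[symmetric]) auto
    finally show ?thesis .
  qed
  have F0: "?F \<zero>\<^bsub>A\<^esub> = \<zero>\<^bsub>B\<^esub>" using on[OF graded_subD(3)[OF gU]] f0 by simp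
  have Ffin: "?F (finsum A g S) = finsum B (\<lambda>j. ?F (g j)) S" if "finite S" "g \<in> S \<rightarrow> carrier A"
    for S :: "int set" and g using that
  proof (induction S)
    case (insert j S)
    hence "g j \<in> carrier A" "g \<in> S \<rightarrow> carrier A" "(\<lambda>j. ?F (g j)) \<in> S \<rightarrow> carrier B" "?F (g j) \<in> carrier B"
      using Fc by auto
    thus ?case using insert Fadd by simp
  qed (simp add: F0)
  \<comment> \<open>A general scalar is split into its components, and additivity reduces the claim
    to homogeneous scalars.\<close>
  have Fsmult: "?F (r \<odot>\<^bsub>A\<^esub> v) = r \<odot>\<^bsub>B\<^esub> ?F v" if r: "r \<in> carrier R" and v: "v \<in> carrier A" for r v
  proof -
    have r': "r \<in> carrier RM" using r by simp
    note fin = component(2)[OF graded_mod_RM r']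
    have cc: "component RM gR r \<in> supp RM gR r \<rightarrow> carrier RM" using component(4)[OF graded_mod_RM r'] by auto
    have hA: "(\<lambda>r. r \<odot>\<^bsub>A\<^esub> v) \<in> module_hom R RM A"
      using v by (auto simp: module_hom_def A.smult_l_distr A.smult_assoc1)
    have hB: "(\<lambda>r. r \<odot>\<^bsub>B\<^esub> ?F v) \<in> module_hom R RM B"
      using Fc[OF v] by (auto simp: module_hom_def B.smult_l_distr B.smult_assoc1)
    have "r \<odot>\<^bsub>A\<^esub> v = finsum A (\<lambda>m. component RM gR r m \<odot>\<^bsub>A\<^esub> v) (supp RM gR r)"
      using module_hom_finsum[OF module_RM A.module_axioms hA fin cc] component(3)[OF graded_mod_RM r'] by simp
    hence "?F (r \<odot>\<^bsub>A\<^esub> v) = finsum B (\<lambda>m. ?F (component RM gR r m \<odot>\<^bsub>A\<^esub> v)) (supp RM gR r)"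
      using Ffin[OF fin, of "\<lambda>m. component RM gR r m \<odot>\<^bsub>A\<^esub> v"] cc v by (simp add: Pi_iff)
    also have "\<dots> = finsum B (\<lambda>m. component RM gR r m \<odot>\<^bsub>B\<^esub> ?F v) (supp RM gR r)"
      using Fhom[OF component(1)[OF graded_mod_RM r'] v] by simp
    also have "\<dots> = r \<odot>\<^bsub>B\<^esub> ?F v"
      using module_hom_finsum[OF module_RM B.module_axioms hB fin cc] component(3)[OF graded_mod_RM r'] by simp
    finally show ?thesis .
  qed
  show "?F \<in> module_hom R A B" using Fc Fadd Fsmult by (auto simp: module_hom_def)
qed

text \<open>The degree \<open>a\<close> part of an arbitrary homomorphism. In the comparison of Ext
  it replaces a cochain that need not be homogeneous.\<close>

lemma homogeneous_part:
  assumes A: "graded_mod A U" and B: "graded_mod B W" and g: "g \<in> module_hom R A B"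
  shows "\<exists>f\<in>graded_hom A U B W a. \<forall>n. \<forall>u\<in>U n. f u = component B W (g u) (a + n)"
proof -
  interpret A: graded_module R gR A U by (rule A)
  interpret B: graded_module R gR B W by (rule B)
  note gU = graded_mod_graded_sub[OF A]
  have gc: "g u \<in> carrier B" if "u \<in> U n" for u n
    using module_hom_closed[OF g] graded_subD(2)[OF gU that] by auto
  have g0: "g \<zero>\<^bsub>A\<^esub> = \<zero>\<^bsub>B\<^esub>"
    using module_hom_finsum[OF A.module_axioms B.module_axioms g, of "{}"] by simp
  define f where "f u = component B W (g u) (a + (SOME n. u \<in> U n))" for u
  have f: "f u = component B W (g u) (a + n)" if u: "u \<in> U n" for u n
  proof (cases "u = \<zero>\<^bsub>A\<^esub>")
    case True
    thus ?thesis by (simp add: f_def g0 component_zero[OF B])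
  next
    case False
    have "(SOME n. u \<in> U n) = n"
    proof (rule some_equality)
      show "u \<in> U n" by (rule u)
      fix k assume k: "u \<in> U k"
      show "k = n" using component_homogeneous[OF A u, of n] component_homogeneous[OF A k, of n] False by (auto split: if_splits)
    qed
    thus ?thesis by (simp add: f_def)
  qed
  have "f \<in> graded_hom A U B W a"
    unfolding graded_hom_def
  proof (intro CollectI conjI allI ballI)
    show "f u \<in> W (a + n)" if "u \<in> U n" for u n unfolding f[OF that] by (rule component(1)[OF B gc[OF that]])
    show "f (u \<oplus>\<^bsub>A\<^esub> v) = f u \<oplus>\<^bsub>B\<^esub> f v" if "u \<in> U n" "v \<in> U n" for u v n
      unfolding f[OF that(1)] f[OF that(2)] f[OF graded_subD(4)[OF gU that]]
        module_hom_add[OF g graded_subD(2)[OF gU that(1)] graded_subD(2)[OF gU that(2)]]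
      by (rule component_add[OF B gc[OF that(1)] gc[OF that(2)]])
    show "f (r \<odot>\<^bsub>A\<^esub> u) = r \<odot>\<^bsub>B\<^esub> f u" if "r \<in> gR m" "u \<in> U n" for r u m n
      unfolding f[OF that(2)] f[OF graded_subD(5)[OF gU that]]
        module_hom_smult[OF g gR_carrier[OF that(1)] graded_subD(2)[OF gU that(2)]]
        component_smult_homogeneous[OF B that(1) gc[OF that(2)]]
      by (simp add: algebra_simps)
  qed
  thus ?thesis using f by blast
qed

section \<open>The module of homomorphisms\<close>

lemma hom_module_simps:
  "f \<in> carrier (hom_module R A B) \<longleftrightarrow> f \<in> module_hom R A B \<and> f \<in> extensional (carrier A)"
  "\<zero>\<^bsub>hom_module R A B\<^esub> = (\<lambda>x\<in>carrier A. \<zero>\<^bsub>B\<^esub>)"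
  "f \<oplus>\<^bsub>hom_module R A B\<^esub> g = (\<lambda>x\<in>carrier A. f x \<oplus>\<^bsub>B\<^esub> g x)"
  "r \<odot>\<^bsub>hom_module R A B\<^esub> f = (\<lambda>x\<in>carrier A. r \<odot>\<^bsub>B\<^esub> f x)"
  by (simp_all add: hom_module_def)

lemma module_hom_module:
  assumes A: "Module.module R A" and B: "Module.module R B"
  shows "Module.module R (hom_module R A B)"
proof -
  interpret A: Module.module R A by (rule A)
  interpret B: Module.module R B by (rule B)
  let ?H = "hom_module R A B"
  have Hc: "f v \<in> carrier B" if "f \<in> carrier ?H" "v \<in> carrier A" for f v
    using that module_hom_closed[of f R A B] by (auto simp: hom_module_simps)
  have Hadd: "f (u \<oplus>\<^bsub>A\<^esub> v) = f u \<oplus>\<^bsub>B\<^esub> f v" if "f \<in> carrier ?H" "u \<in> carrier A" "v \<in> carrier A" for f u v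
    using that module_hom_add[of f R A B] by (simp add: hom_module_simps)
  have Hsmult: "f (r \<odot>\<^bsub>A\<^esub> u) = r \<odot>\<^bsub>B\<^esub> f u" if "f \<in> carrier ?H" "r \<in> carrier R" "u \<in> carrier A" for f r u
    using that module_hom_smult[of f R A B] by (simp add: hom_module_simps)
  have HI: "(\<lambda>x\<in>carrier A. f x) \<in> carrier ?H"
    if "\<And>u. u \<in> carrier A \<Longrightarrow> f u \<in> carrier B"
      "\<And>u v. u \<in> carrier A \<Longrightarrow> v \<in> carrier A \<Longrightarrow> f (u \<oplus>\<^bsub>A\<^esub> v) = f u \<oplus>\<^bsub>B\<^esub> f v"
      "\<And>r u. r \<in> carrier R \<Longrightarrow> u \<in> carrier A \<Longrightarrow> f (r \<odot>\<^bsub>A\<^esub> u) = r \<odot>\<^bsub>B\<^esub> f u" for f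
    using that by (auto simp: hom_module_simps module_hom_def)
  have ext: "f = g" if "f \<in> carrier ?H" "g \<in> carrier ?H" "\<And>v. v \<in> carrier A \<Longrightarrow> f v = g v" for f g
    using that by (intro extensionalityI[of f "carrier A" g]) (auto simp: hom_module_simps)
  have add: "f \<oplus>\<^bsub>?H\<^esub> g \<in> carrier ?H" if "f \<in> carrier ?H" "g \<in> carrier ?H" for f g
    unfolding hom_module_simps(3) using that
    by (intro HI) (auto simp: Hc Hadd Hsmult B.a_ac B.smult_r_distr)
  have zero: "\<zero>\<^bsub>?H\<^esub> \<in> carrier ?H" unfolding hom_module_simps(2) by (intro HI) auto
  have smult: "r \<odot>\<^bsub>?H\<^esub> f \<in> carrier ?H" if "r \<in> carrier R" "f \<in> carrier ?H" for r f
    unfolding hom_module_simps(4) using that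
    by (intro HI) (auto simp: Hc Hadd Hsmult B.smult_r_distr m_comm simp flip: B.smult_assoc1)
  have neg: "\<exists>g\<in>carrier ?H. g \<oplus>\<^bsub>?H\<^esub> f = \<zero>\<^bsub>?H\<^esub>" if f: "f \<in> carrier ?H" for f
  proof (intro bexI[of _ "(\<ominus> \<one>) \<odot>\<^bsub>?H\<^esub> f"] ext)
    show m: "(\<ominus> \<one>) \<odot>\<^bsub>?H\<^esub> f \<in> carrier ?H" using f by (intro smult) auto
    show "(\<ominus> \<one>) \<odot>\<^bsub>?H\<^esub> f \<oplus>\<^bsub>?H\<^esub> f \<in> carrier ?H" by (rule add[OF m f])
    show "((\<ominus> \<one>) \<odot>\<^bsub>?H\<^esub> f \<oplus>\<^bsub>?H\<^esub> f) v = \<zero>\<^bsub>?H\<^esub> v" if "v \<in> carrier A" for v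
      using that Hc[OF f that] by (simp add: hom_module_simps B.smult_l_minus B.l_neg)
  qed (rule zero)
  have pt: "\<zero>\<^bsub>?H\<^esub> v = \<zero>\<^bsub>B\<^esub>" "(f \<oplus>\<^bsub>?H\<^esub> g) v = f v \<oplus>\<^bsub>B\<^esub> g v" "(r \<odot>\<^bsub>?H\<^esub> f) v = r \<odot>\<^bsub>B\<^esub> f v"
    if "v \<in> carrier A" for v f g r using that by (simp_all add: hom_module_simps)
  note closed = add zero smult
  show ?thesis
  proof (rule moduleI)
    show "cring R" by (rule is_cring)
    show "abelian_group ?H"
    proof (rule abelian_groupI)
      show "f \<oplus>\<^bsub>?H\<^esub> g \<oplus>\<^bsub>?H\<^esub> h = f \<oplus>\<^bsub>?H\<^esub> (g \<oplus>\<^bsub>?H\<^esub> h)"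
        if "f \<in> carrier ?H" "g \<in> carrier ?H" "h \<in> carrier ?H" for f g h
        by (rule ext) (use that in \<open>simp_all add: closed pt Hc B.a_assoc\<close>)
      show "f \<oplus>\<^bsub>?H\<^esub> g = g \<oplus>\<^bsub>?H\<^esub> f" if "f \<in> carrier ?H" "g \<in> carrier ?H" for f g
        by (rule ext) (use that in \<open>simp_all add: closed pt Hc B.a_comm\<close>)
      show "\<zero>\<^bsub>?H\<^esub> \<oplus>\<^bsub>?H\<^esub> f = f" if "f \<in> carrier ?H" for f
        by (rule ext) (use that in \<open>simp_all add: closed pt Hc\<close>)
    qed (rule closed neg; assumption)+
    show "(r \<oplus> q) \<odot>\<^bsub>?H\<^esub> f = r \<odot>\<^bsub>?H\<^esub> f \<oplus>\<^bsub>?H\<^esub> q \<odot>\<^bsub>?H\<^esub> f"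
      if "r \<in> carrier R" "q \<in> carrier R" "f \<in> carrier ?H" for r q f
      by (rule ext) (use that in \<open>simp_all add: closed pt Hc B.smult_l_distr\<close>)
    show "r \<odot>\<^bsub>?H\<^esub> (f \<oplus>\<^bsub>?H\<^esub> g) = r \<odot>\<^bsub>?H\<^esub> f \<oplus>\<^bsub>?H\<^esub> r \<odot>\<^bsub>?H\<^esub> g"
      if "r \<in> carrier R" "f \<in> carrier ?H" "g \<in> carrier ?H" for r f g
      by (rule ext) (use that in \<open>simp_all add: closed pt Hc B.smult_r_distr\<close>)
    show "(r \<otimes> q) \<odot>\<^bsub>?H\<^esub> f = r \<odot>\<^bsub>?H\<^esub> (q \<odot>\<^bsub>?H\<^esub> f)"
      if "r \<in> carrier R" "q \<in> carrier R" "f \<in> carrier ?H" for r q f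
      by (rule ext) (use that in \<open>simp_all add: closed pt Hc B.smult_assoc1\<close>)
    show "\<one> \<odot>\<^bsub>?H\<^esub> f = f" if "f \<in> carrier ?H" for f
      by (rule ext) (use that in \<open>simp_all add: closed pt Hc\<close>)
  qed (rule closed; assumption)
qed

end

section \<open>Comparison with the given resolution\<close>

context graded_algebra begin

text \<open>The axioms are inherited along a surjection that respects the operations. This gives the
  pieces of Ext their structure without computing with cosets.\<close>

lemma vectorspace_surj:
  assumes V: "vectorspace K V" and im: "f ` carrier V = carrier W"
    and add: "\<And>u v. u \<in> carrier V \<Longrightarrow> v \<in> carrier V \<Longrightarrow> f (u \<oplus>\<^bsub>V\<^esub> v) = f u \<oplus>\<^bsub>W\<^esub> f v"
    and smult: "\<And>k v. k \<in> gR 0 \<Longrightarrow> v \<in> carrier V \<Longrightarrow> f (k \<odot>\<^bsub>V\<^esub> v) = k \<odot>\<^bsub>W\<^esub> f v"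
    and zero: "f \<zero>\<^bsub>V\<^esub> = \<zero>\<^bsub>W\<^esub>"
  shows "vectorspace K W"
proof -
  interpret V: vectorspace K V by (rule V)
  have fW: "f v \<in> carrier W" if "v \<in> carrier V" for v using im that by blast
  have ex: "\<exists>v\<in>carrier V. w = f v" if "w \<in> carrier W" for w using im that by blast
  have addI: "f u \<oplus>\<^bsub>W\<^esub> f v = f (u \<oplus>\<^bsub>V\<^esub> v)" if "u \<in> carrier V" "v \<in> carrier V" for u v
    using add[OF that] by simp
  have smultI: "k \<odot>\<^bsub>W\<^esub> f v = f (k \<odot>\<^bsub>V\<^esub> v)" if "k \<in> gR 0" "v \<in> carrier V" for k v
    using smult[OF that] by simp
  have sc: "k \<odot>\<^bsub>V\<^esub> v \<in> carrier V" if "k \<in> gR 0" "v \<in> carrier V" for k v using V.smult_closed that by simp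
  have "Module.module K W"
  proof (rule moduleI)
    show "cring K" by (rule V.is_cring)
    show "abelian_group W"
    proof (rule abelian_groupI)
      show "u \<oplus>\<^bsub>W\<^esub> v \<in> carrier W" if "u \<in> carrier W" "v \<in> carrier W" for u v
        using ex[OF that(1)] ex[OF that(2)] by (auto simp: addI fW)
      show "\<zero>\<^bsub>W\<^esub> \<in> carrier W" unfolding zero[symmetric] by (rule fW[OF V.zero_closed])
      show "u \<oplus>\<^bsub>W\<^esub> v \<oplus>\<^bsub>W\<^esub> w = u \<oplus>\<^bsub>W\<^esub> (v \<oplus>\<^bsub>W\<^esub> w)"
        if "u \<in> carrier W" "v \<in> carrier W" "w \<in> carrier W" for u v w
        using ex[OF that(1)] ex[OF that(2)] ex[OF that(3)] by (auto simp: addI V.a_assoc)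
      show "u \<oplus>\<^bsub>W\<^esub> v = v \<oplus>\<^bsub>W\<^esub> u" if "u \<in> carrier W" "v \<in> carrier W" for u v
        using ex[OF that(1)] ex[OF that(2)] by (auto simp: addI V.a_comm)
      show "\<zero>\<^bsub>W\<^esub> \<oplus>\<^bsub>W\<^esub> u = u" if "u \<in> carrier W" for u
        using ex[OF that] by (auto simp: addI zero[symmetric])
      show "\<exists>v\<in>carrier W. v \<oplus>\<^bsub>W\<^esub> u = \<zero>\<^bsub>W\<^esub>" if u: "u \<in> carrier W" for u
      proof -
        obtain w where w: "w \<in> carrier V" "u = f w" using ex[OF u] by blast
        have "f (\<ominus>\<^bsub>V\<^esub> w) \<oplus>\<^bsub>W\<^esub> u = \<zero>\<^bsub>W\<^esub>" using w by (simp add: addI V.l_neg zero)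
        thus ?thesis using fW[OF V.a_inv_closed[OF w(1)]] by blast
      qed
    qed
    show "k \<odot>\<^bsub>W\<^esub> u \<in> carrier W" if "k \<in> carrier K" "u \<in> carrier W" for k u
      using ex[OF that(2)] that(1) by (auto simp: smultI fW sc)
    show "(k \<oplus>\<^bsub>K\<^esub> l) \<odot>\<^bsub>W\<^esub> u = k \<odot>\<^bsub>W\<^esub> u \<oplus>\<^bsub>W\<^esub> l \<odot>\<^bsub>W\<^esub> u"
      if "k \<in> carrier K" "l \<in> carrier K" "u \<in> carrier W" for k l u
      using ex[OF that(3)] that(1,2) V.smult_l_distr[OF that(1,2)] gR_add by (auto simp: smultI addI sc)
    show "k \<odot>\<^bsub>W\<^esub> (u \<oplus>\<^bsub>W\<^esub> v) = k \<odot>\<^bsub>W\<^esub> u \<oplus>\<^bsub>W\<^esub> k \<odot>\<^bsub>W\<^esub> v"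
      if "k \<in> carrier K" "u \<in> carrier W" "v \<in> carrier W" for k u v
      using ex[OF that(2)] ex[OF that(3)] that(1) V.smult_r_distr[OF that(1)] by (auto simp: smultI addI sc)
    show "(k \<otimes>\<^bsub>K\<^esub> l) \<odot>\<^bsub>W\<^esub> u = k \<odot>\<^bsub>W\<^esub> (l \<odot>\<^bsub>W\<^esub> u)"
      if "k \<in> carrier K" "l \<in> carrier K" "u \<in> carrier W" for k l u
      using ex[OF that(3)] that(1,2) V.smult_assoc1[OF that(1,2)] graded_mult[of k 0 l 0] by (auto simp: smultI sc)
    show "\<one>\<^bsub>K\<^esub> \<odot>\<^bsub>W\<^esub> u = u" if "u \<in> carrier W" for u
      using ex[OF that] gR_1 V.smult_one by (auto simp: smultI)
  qed
  thus ?thesis using K_field by (simp add: vectorspace_def)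
qed

end

context generated_graded_algebra begin

lemma graded_hom0D:
  assumes "h \<in> graded_hom0 R A U B V" shows "h \<in> module_hom R A B" "u \<in> U n \<Longrightarrow> h u \<in> V n"
  using assms by (auto simp: graded_hom0_def)

lemma graded_hom0_graded_hom:
  assumes "h \<in> graded_hom0 R A U B V" and U: "graded_sub A U" shows "h \<in> graded_hom A U B V 0"
  using graded_hom0D[OF assms(1)] module_hom_add[of h R A B] module_hom_smult[of h R A B]
    graded_subD(2)[OF U] gR_carrier unfolding graded_hom_def by auto

text \<open>The component of degree \<open>n\<close> of a preimage is a homogeneous preimage.
  Exactness of the given resolution thus becomes exactness in every degree.\<close>

lemma graded_hom0_image:
  assumes A: "graded_mod A U" and B: "graded_mod B V" and h: "h \<in> graded_hom0 R A U B V"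
  shows "h ` U n = V n \<inter> h ` carrier A"
proof
  show "h ` U n \<subseteq> V n \<inter> h ` carrier A"
    using graded_hom0D(2)[OF h] graded_subD(2)[OF graded_mod_graded_sub[OF A]] by blast
  show "V n \<inter> h ` carrier A \<subseteq> h ` U n"
  proof
    fix w assume w: "w \<in> V n \<inter> h ` carrier A"
    then obtain a where a: "a \<in> carrier A" "w = h a" by blast
    have "component B V (h a) (0 + n) = h (component A U a n)"
      using graded_hom0D[OF h] a(1) by (intro component_hom[OF A B]) auto
    hence "w = h (component A U a n)" using component_homogeneous[OF B, of w n n] w a(2) by simp
    thus "w \<in> h ` U n" using component(1)[OF A a(1)] by blast
  qed
qed

lemma free_resolution:
  assumes F: "graded_free_resolution R gR M gM F gF d \<epsilon>" and M: "graded_mod M gM"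
  shows "resolution F gF d \<epsilon> M gM"
proof -
  interpret F: graded_free_resolution R gR M gM F gF d \<epsilon> by (rule F)
  note fp = free_proj[OF F.free]
  show ?thesis
    unfolding resolution_def
  proof (intro conjI allI)
    show "graded_sub M gM" by (rule graded_mod_graded_sub[OF M])
    show "proj (F i) (gF i)" for i by (rule fp(1))
    show "d i \<in> graded_hom (F (Suc i)) (gF (Suc i)) (F i) (gF i) 0" for i
      by (rule graded_hom0_graded_hom[OF F.d_hom graded_mod_graded_sub[OF fp(2)]])
    show "\<epsilon> \<in> graded_hom (F 0) (gF 0) M gM 0" by (rule graded_hom0_graded_hom[OF F.\<epsilon>_hom graded_mod_graded_sub[OF fp(2)]])
    have sub: "u \<in> carrier (F i)" if "u \<in> gF i n" for u i n by (rule graded_subD(2)[OF graded_mod_graded_sub[OF fp(2)] that])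
    show "d (Suc i) ` gF (Suc (Suc i)) n = {u \<in> gF (Suc i) n. d i u = \<zero>\<^bsub>F i\<^esub>}" for i n
      unfolding graded_hom0_image[OF fp(2) fp(2) F.d_hom] F.exact using sub by blast
    show "d 0 ` gF (Suc 0) n = {u \<in> gF 0 n. \<epsilon> u = \<zero>\<^bsub>M\<^esub>}" for n
      unfolding graded_hom0_image[OF fp(2) fp(2) F.d_hom] F.exact_0 using sub by blast
    show "\<epsilon> ` gF 0 n = gM n" for n
      unfolding graded_hom0_image[OF fp(2) M F.\<epsilon>_hom] F.surj using graded_subD(7)[OF graded_mod_graded_sub[OF M]] by blast
  qed
qed

end

text \<open>\<open>u\<close> and \<open>v\<close> are comparison maps between the constructed and
  the given resolution, and \<open>hG\<close>, \<open>hF\<close> are homotopies from their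
  composites to the identities. Precomposition with \<open>v\<close> induces the map of cohomology;
  \<open>hF\<close> gives its surjectivity and \<open>hG\<close> its injectivity.\<close>

locale ext_comparison = hom_complex R gR x e dg M L N W J d \<epsilon> s
  for R :: "('a, 'r) ring_scheme" (structure) and gR x e dg
    and M :: "('a, 'b, 's) module_scheme" and L and N :: "('a, 'c, 't) module_scheme" and W J d \<epsilon> s +
  fixes F :: "nat \<Rightarrow> ('a, 'f, 'u) module_scheme" and gF :: "nat \<Rightarrow> int \<Rightarrow> 'f set"
    and dF :: "nat \<Rightarrow> 'f \<Rightarrow> 'f" and u v hG hF
  assumes gmN: "graded_mod N W" and gmF: "graded_mod (F i) (gF i)"
    and dF: "dF i \<in> graded_hom0 R (F (Suc i)) (gF (Suc i)) (F i) (gF i)"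
    and u: "u i \<in> graded_hom (fun_mod RM) (free_family (J i)) (F i) (gF i) 0"
    and v: "v i \<in> graded_hom (F i) (gF i) (fun_mod RM) (free_family (J i)) 0"
    and u_d: "c \<in> free_family (J (Suc i)) n \<Longrightarrow> dF i (u (Suc i) c) = u i (d i c)"
    and v_d: "y \<in> gF (Suc i) n \<Longrightarrow> d i (v (Suc i) y) = v i (dF i y)"
    and hG: "hG i \<in> graded_hom (fun_mod RM) (free_family (J i)) (fun_mod RM) (free_family (J (Suc i))) 0"
    and hG_0: "c \<in> free_family (J 0) n \<Longrightarrow> d 0 (hG 0 c) = v 0 (u 0 c) \<ominus>\<^bsub>fun_mod RM\<^esub> c"
    and hG_Suc: "c \<in> free_family (J (Suc i)) n \<Longrightarrow>
      d (Suc i) (hG (Suc i) c) = (v (Suc i) (u (Suc i) c) \<ominus>\<^bsub>fun_mod RM\<^esub> c) \<ominus>\<^bsub>fun_mod RM\<^esub> hG i (d i c)"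
    and hF: "hF i \<in> graded_hom (F i) (gF i) (F (Suc i)) (gF (Suc i)) 0"
    and hF_0: "y \<in> gF 0 n \<Longrightarrow> dF 0 (hF 0 y) = u 0 (v 0 y) \<ominus>\<^bsub>F 0\<^esub> y"
    and hF_Suc: "y \<in> gF (Suc i) n \<Longrightarrow>
      dF (Suc i) (hF (Suc i) y) = (u (Suc i) (v (Suc i) y) \<ominus>\<^bsub>F (Suc i)\<^esub> y) \<ominus>\<^bsub>F (Suc i)\<^esub> hF i (dF i y)"
begin

abbreviation H where "H i \<equiv> hom_module R (F i) N"
abbreviation S where "S i \<equiv> coboundaries R F dF N i"
abbreviation Ext where "Ext i \<equiv> Ext_module R F dF N i"

lemma mN: "Module.module R N" and mF: "Module.module R (F i)"
  using gmN gmF by (auto intro: graded_mod_module)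

lemma mH: "Module.module R (H i)" by (rule module_hom_module[OF mF mN])

lemma gF: "graded_sub (F i) (gF i)" by (rule graded_mod_graded_sub[OF gmF])

lemma dF_graded_hom: "dF i \<in> graded_hom (F (Suc i)) (gF (Suc i)) (F i) (gF i) 0" by (rule graded_hom0_graded_hom[OF dF gF])

lemma H_eqI:
  assumes f: "f \<in> carrier (H i)" and g: "g \<in> carrier (H i)" and eq: "\<And>n y. y \<in> gF i n \<Longrightarrow> f y = g y"
  shows "f = g"
proof (rule extensionalityI[where A = "carrier (F i)"])
  show "f y = g y" if "y \<in> carrier (F i)" for y
    using f g by (intro module_hom_eqI[OF gmF mN _ _ eq that]) (auto simp: hom_module_simps)
qed (use f g in \<open>auto simp: hom_module_simps\<close>)

definition cob :: "nat \<Rightarrow> ('f \<Rightarrow> 'c) \<Rightarrow> 'f \<Rightarrow> 'c" where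
  "cob i g = compose (carrier (F (Suc i))) g (dF i)"

lemma cob_on: "y \<in> carrier (F (Suc i)) \<Longrightarrow> cob i g y = g (dF i y)"
  by (simp add: cob_def compose_def)

lemma dF_closed: "y \<in> carrier (F (Suc i)) \<Longrightarrow> dF i y \<in> carrier (F i)"
  using module_hom_closed[OF graded_hom0D(1)[OF dF]] by auto

lemma cob_closed:
  assumes g: "g \<in> carrier (H i)" shows "cob i g \<in> carrier (H (Suc i))"
proof -
  interpret F: Module.module R "F (Suc i)" by (rule mF)
  have g': "g \<in> module_hom R (F i) N" using g by (simp add: hom_module_simps)
  note d' = graded_hom0D(1)[OF dF]
  show ?thesis
    using module_hom_add[OF g'] module_hom_smult[OF g'] module_hom_closed[OF g']
      module_hom_add[OF d'] module_hom_smult[OF d'] dF_closed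
    by (auto simp: hom_module_simps module_hom_def cob_on cob_def[unfolded compose_def] Pi_iff)
qed

lemma K_lin_cob: "K_lin (H i) (carrier (H i)) (H (Suc i)) (cob i)"
  using mH cob_closed dF_closed gR_carrier
  by (auto simp: K_lin_def hom_module_simps(3,4) cob_def compose_def fun_eq_iff)

lemma K_sub_H: "K_sub (H i) (carrier (H i))"
proof -
  interpret H: Module.module R "H i" by (rule mH)
  show ?thesis using H.module_axioms gR_carrier by (auto simp: K_sub_def)
qed

lemma K_sub_S: "K_sub (H i) (S i)"
proof (cases i)
  case (Suc k)
  have "S (Suc k) = cob k ` carrier (H k)" by (simp add: cob_def[abs_def])
  thus ?thesis unfolding Suc using K_sub_image[OF K_sub_H K_lin_cob] by simp
qed (use K_fin_zero(1)[OF mH] in simp)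

lemma cocycles_iff: "f \<in> cocycles R F dF N i \<longleftrightarrow> f \<in> carrier (H i) \<and> cob i f = \<zero>\<^bsub>H (Suc i)\<^esub>"
  by (simp add: cocycles_def cob_def)

lemma cocyclesI:
  assumes f: "f \<in> carrier (H i)" and eq: "\<And>n y. y \<in> gF (Suc i) n \<Longrightarrow> f (dF i y) = \<zero>\<^bsub>N\<^esub>"
  shows "f \<in> cocycles R F dF N i"
proof -
  interpret H: Module.module R "H (Suc i)" by (rule mH)
  have "cob i f = \<zero>\<^bsub>H (Suc i)\<^esub>"
    by (rule H_eqI[OF cob_closed[OF f] H.zero_closed])
      (use eq graded_subD(2)[OF gF] in \<open>auto simp: cob_on hom_module_simps(2)\<close>)
  thus ?thesis using f by (simp add: cocycles_iff)
qed

lemma cocycles_on: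
  assumes "f \<in> cocycles R F dF N i" "y \<in> carrier (F (Suc i))" shows "f (dF i y) = \<zero>\<^bsub>N\<^esub>"
proof -
  have "cob i f y = \<zero>\<^bsub>H (Suc i)\<^esub> y" using assms by (simp add: cocycles_iff)
  thus ?thesis using assms(2) by (simp add: cob_on hom_module_simps)
qed

lemma S_subgroup: "abelian_subgroup (S i) (H i)"
proof (rule abelian_subgroupI3)
  interpret H: Module.module R "H i" by (rule mH)
  show "abelian_group (H i)" by (rule H.abelian_group_axioms)
  show "additive_subgroup (S i) (H i)"
    using K_sub_S[of i] K_sub_neg[OF K_sub_S[of i]]
    by (auto simp: additive_subgroup_iff[OF H.abelian_group_axioms] K_sub_def)
qed

section \<open>The cochain map induced by the comparison map\<close>

abbreviation fl where "fl i \<equiv> full (F i) (gF i) N"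

lemma fl:
  assumes f: "f \<in> graded_hom (F i) (gF i) N W a"
  shows "fl i f \<in> carrier (H i)" "y \<in> gF i n \<Longrightarrow> fl i f y = f y"
    "fl i f \<in> hom_grading R (F i) (gF i) N W a"
proof -
  show 1: "fl i f \<in> carrier (H i)"
    using full_hom[OF gmF gN f] by (simp add: hom_module_simps full_def)
  show 2: "y \<in> gF i n \<Longrightarrow> fl i f y = f y" for y n by (rule full_on[OF gmF gN f])
  show "fl i f \<in> hom_grading R (F i) (gF i) N W a"
    unfolding hom_grading_def using 1 2 graded_homD(1)[OF f] by auto
qed

text \<open>Precomposition with \<open>v\<close>, extended from the homogeneous pieces by
  \<open>full\<close>: the passage from the families \<open>C i\<close> to genuine homomorphisms on
  \<open>F i\<close>.\<close>

definition p :: "nat \<Rightarrow> ((int \<times> nat \<Rightarrow> 'a) \<Rightarrow> 'c) \<Rightarrow> 'f \<Rightarrow> 'c" where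
  "p i z = fl i (\<lambda>y. z (v i y))"

lemma zero_extend_free_family: "c \<in> free_family (J i) n \<Longrightarrow> zero_extend (free_family (J i)) N f c = f c" by (rule zero_extend_on[where U = "free_family (J i)"])

lemma pre_on: "c \<in> free_family (J (Suc i)) n \<Longrightarrow> pre i g c = g (d i c)" unfolding pre_def by (rule zero_extend_free_family)

lemma p_graded_hom: "z \<in> C i a \<Longrightarrow> (\<lambda>y. z (v i y)) \<in> graded_hom (F i) (gF i) N W a"
  using graded_hom_comp[OF v Hom_family_graded_hom, of z i N W a] by simp

lemma p:
  assumes z: "z \<in> C i a"
  shows "p i z \<in> carrier (H i)" "y \<in> gF i n \<Longrightarrow> p i z y = z (v i y)"
    "p i z \<in> hom_grading R (F i) (gF i) N W a"
  unfolding p_def using fl[OF p_graded_hom[OF z]] by auto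

lemma cocycle_family_d:
  assumes z: "z \<in> cocycle_family i a" and c: "c \<in> free_family (J (Suc i)) n" shows "z (d i c) = \<zero>\<^bsub>N\<^esub>"
proof -
  have "pre i z c = \<zero>\<^bsub>PM\<^esub> c" using z by (simp add: cocycle_family_def)
  thus ?thesis using c by (simp add: pre_def zero_extend_on)
qed

lemma p_cocycle:
  assumes z: "z \<in> cocycle_family i a" shows "p i z \<in> cocycles R F dF N i"
proof (rule cocyclesI)
  have zC: "z \<in> C i a" using z cocycle_family_C by blast
  show "p i z \<in> carrier (H i)" by (rule p(1)[OF zC])
  fix n y assume y: "y \<in> gF (Suc i) n"
  have "p i z (dF i y) = z (v i (dF i y))" by (rule p(2)[OF zC graded_homD0[OF dF_graded_hom y]])
  also have "\<dots> = z (d i (v (Suc i) y))" using v_d[OF y] by simp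
  also have "\<dots> = \<zero>\<^bsub>N\<^esub>" by (rule cocycle_family_d[OF z graded_homD0[OF v y]])
  finally show "p i z (dF i y) = \<zero>\<^bsub>N\<^esub>" .
qed

lemma p_add:
  assumes z: "z \<in> C i a" "z' \<in> C i a" shows "p i (z \<oplus>\<^bsub>PM\<^esub> z') = p i z \<oplus>\<^bsub>H i\<^esub> p i z'"
proof (rule H_eqI)
  interpret H: Module.module R "H i" by (rule mH)
  have s: "z \<oplus>\<^bsub>PM\<^esub> z' \<in> C i a" by (rule graded_subD(4)[OF C_facts(1) z])
  show "p i (z \<oplus>\<^bsub>PM\<^esub> z') \<in> carrier (H i)" by (rule p(1)[OF s])
  show "p i z \<oplus>\<^bsub>H i\<^esub> p i z' \<in> carrier (H i)" by (rule H.a_closed[OF p(1)[OF z(1)] p(1)[OF z(2)]])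
  show "p i (z \<oplus>\<^bsub>PM\<^esub> z') y = (p i z \<oplus>\<^bsub>H i\<^esub> p i z') y" if y: "y \<in> gF i n" for y n
    unfolding p(2)[OF s y] using p(2)[OF z(1) y] p(2)[OF z(2) y] graded_subD(2)[OF gF y]
    by (simp add: hom_module_simps)
qed

lemma p_smult:
  assumes z: "z \<in> C i a" and k: "k \<in> gR 0" shows "p i (k \<odot>\<^bsub>PM\<^esub> z) = k \<odot>\<^bsub>H i\<^esub> p i z"
proof (rule H_eqI)
  interpret H: Module.module R "H i" by (rule mH)
  have s: "k \<odot>\<^bsub>PM\<^esub> z \<in> C i a" using graded_subD(6)[OF C_facts(1) k z] by simp
  show "p i (k \<odot>\<^bsub>PM\<^esub> z) \<in> carrier (H i)" by (rule p(1)[OF s])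
  show "k \<odot>\<^bsub>H i\<^esub> p i z \<in> carrier (H i)" by (rule H.smult_closed[OF gR_carrier[OF k] p(1)[OF z]])
  show "p i (k \<odot>\<^bsub>PM\<^esub> z) y = (k \<odot>\<^bsub>H i\<^esub> p i z) y" if y: "y \<in> gF i n" for y n
    unfolding p(2)[OF s y] using p(2)[OF z y] graded_subD(2)[OF gF y] by (simp add: hom_module_simps)
qed

text \<open>The cocycle \<open>f\<close> comes from f u, since f u v - f = f (d h + h d) and f d =
  0, so that the difference is the coboundary of f h. In position 0 the term with h d is absent and
  the difference is zero.\<close>

lemma p_surj:
  assumes f: "f \<in> cocycles R F dF N i" "f \<in> hom_grading R (F i) (gF i) N W a"
  shows "\<exists>z\<in>cocycle_family i a. p i z \<ominus>\<^bsub>H i\<^esub> f \<in> S i"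
proof -
  interpret N: Module.module R N by (rule mN)
  interpret H: Module.module R "H i" by (rule mH)
  have fH: "f \<in> carrier (H i)" using f(1) by (simp add: cocycles_iff)
  have fhom: "f \<in> module_hom R (F i) N" using fH by (simp add: hom_module_simps)
  have fdeg: "f y \<in> W (a + n)" if "y \<in> gF i n" for y n using f(2) that by (auto simp: hom_grading_def)
  have fhm: "f \<in> graded_hom (F i) (gF i) N W a"
    unfolding graded_hom_def
  proof (intro CollectI conjI allI ballI)
    show "f (y \<oplus>\<^bsub>F i\<^esub> y') = f y \<oplus>\<^bsub>N\<^esub> f y'" if "y \<in> gF i n" "y' \<in> gF i n" for y y' n
      by (rule module_hom_add[OF fhom graded_subD(2)[OF gF that(1)] graded_subD(2)[OF gF that(2)]])
    show "f (r \<odot>\<^bsub>F i\<^esub> y) = r \<odot>\<^bsub>N\<^esub> f y" if "r \<in> gR m" "y \<in> gF i n" for r y m n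
      by (rule module_hom_smult[OF fhom gR_carrier[OF that(1)] graded_subD(2)[OF gF that(2)]])
  qed (rule fdeg)
  have fu: "(\<lambda>c. f (u i c)) \<in> graded_hom (fun_mod RM) (free_family (J i)) N W a" using graded_hom_comp[OF u fhm] by simp
  define z where "z = zero_extend (free_family (J i)) N (\<lambda>c. f (u i c))"
  have zC: "z \<in> C i a" unfolding z_def by (rule zero_extend_Hom_family[OF graded_sub_free_family fu])
  have z_on: "z c = f (u i c)" if "c \<in> free_family (J i) n" for c n unfolding z_def by (rule zero_extend_free_family[OF that])
  have "pre i z = \<zero>\<^bsub>PM\<^esub>"
  proof
    fix c show "pre i z c = \<zero>\<^bsub>PM\<^esub> c"
    proof (cases "c \<in> (\<Union>n. free_family (J (Suc i)) n)")
      case True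
      then obtain n where c: "c \<in> free_family (J (Suc i)) n" by blast
      have "pre i z c = z (d i c)" by (rule pre_on[OF c])
      also have "\<dots> = f (u i (d i c))" by (rule z_on[OF graded_homD0[OF resolutionD(4)[OF res] c]])
      also have "\<dots> = f (dF i (u (Suc i) c))" using u_d[OF c] by simp
      also have "\<dots> = \<zero>\<^bsub>N\<^esub>" by (rule cocycles_on[OF f(1) graded_subD(2)[OF gF graded_homD0[OF u c]]])
      finally show ?thesis by simp
    qed (simp add: pre_def zero_extend_def)
  qed
  hence z: "z \<in> cocycle_family i a" using zC by (simp add: cocycle_family_def)
  have fc: "f y \<in> carrier N" if "y \<in> gF i n" for y n by (rule graded_subD(2)[OF gN graded_homD(1)[OF fhm that]])
  \<comment> \<open>Evaluated pointwise, to avoid computing negatives in the module of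
    homomorphisms.\<close>
  have diff: "(p i z \<ominus>\<^bsub>H i\<^esub> f) y = f (u i (v i y) \<ominus>\<^bsub>F i\<^esub> y)" if y: "y \<in> gF i n" for y n
  proof -
    interpret Fi: Module.module R "F i" by (rule mF)
    have yc: "y \<in> carrier (F i)" by (rule graded_subD(2)[OF gF y])
    have uv: "u i (v i y) \<in> gF i n" by (rule graded_homD0[OF u graded_homD0[OF v y]])
    have "(p i z \<ominus>\<^bsub>H i\<^esub> f) \<oplus>\<^bsub>H i\<^esub> f = p i z" by (rule H.add_diff_cancel(3)[OF p(1)[OF zC] fH])
    from fun_cong[OF this, of y] have "(p i z \<ominus>\<^bsub>H i\<^esub> f) y \<oplus>\<^bsub>N\<^esub> f y = f (u i (v i y))"
      using yc p(2)[OF zC y] z_on[OF graded_homD0[OF v y]] by (simp add: hom_module_simps)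
    moreover have "(p i z \<ominus>\<^bsub>H i\<^esub> f) y \<in> carrier N"
      using H.minus_closed[OF p(1)[OF zC] fH] yc module_hom_closed[of _ R "F i" N] by (auto simp: hom_module_simps)
    ultimately have "(p i z \<ominus>\<^bsub>H i\<^esub> f) y = f (u i (v i y)) \<ominus>\<^bsub>N\<^esub> f y"
      using fc[OF y] N.add_diff_cancel(1)[of "f y" "(p i z \<ominus>\<^bsub>H i\<^esub> f) y"] by (simp add: N.a_comm)
    thus ?thesis using graded_hom_diff[OF gF gN fhm uv y] by simp
  qed
  have "p i z \<ominus>\<^bsub>H i\<^esub> f \<in> S i"
  proof (cases i)
    case 0
    have "p i z \<ominus>\<^bsub>H i\<^esub> f = \<zero>\<^bsub>H i\<^esub>"
    proof (rule H_eqI[OF H.minus_closed[OF p(1)[OF zC] fH] H.zero_closed])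
      fix n y assume y: "y \<in> gF i n"
      have "f (u i (v i y) \<ominus>\<^bsub>F i\<^esub> y) = f (dF i (hF i y))" using hF_0[of y n] y 0 by simp
      also have "\<dots> = \<zero>\<^bsub>N\<^esub>" by (rule cocycles_on[OF f(1) graded_subD(2)[OF gF graded_homD0[OF hF y]]])
      finally show "(p i z \<ominus>\<^bsub>H i\<^esub> f) y = \<zero>\<^bsub>H i\<^esub> y"
        using diff[OF y] graded_subD(2)[OF gF y] by (simp add: hom_module_simps)
    qed
    thus ?thesis using 0 by simp
  next
    case (Suc k)
    have fh: "(\<lambda>y. f (hF k y)) \<in> graded_hom (F k) (gF k) N W a" using graded_hom_comp[OF hF[of k]] fhm Suc by fastforce
    have "p i z \<ominus>\<^bsub>H i\<^esub> f = cob k (fl k (\<lambda>y. f (hF k y)))"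
    proof (rule H_eqI[OF H.minus_closed[OF p(1)[OF zC] fH]])
      show "cob k (fl k (\<lambda>y. f (hF k y))) \<in> carrier (H i)" unfolding Suc by (rule cob_closed[OF fl(1)[OF fh]])
      fix n y assume y: "y \<in> gF i n"
      have y': "y \<in> gF (Suc k) n" using y Suc by simp
      interpret Fi: Module.module R "F i" by (rule mF)
      have dh: "dF i (hF i y) \<in> gF i n" by (rule graded_homD0[OF dF_graded_hom graded_homD0[OF hF y]])
      have hd: "hF k (dF k y) \<in> gF i n" using graded_homD0[OF hF graded_homD0[OF dF_graded_hom y']] Suc by simp
      have uvy: "u i (v i y) \<ominus>\<^bsub>F i\<^esub> y \<in> gF i n" by (rule graded_sub_diff[OF gF graded_homD0[OF u graded_homD0[OF v y]] y])
      have "u i (v i y) \<ominus>\<^bsub>F i\<^esub> y = dF i (hF i y) \<oplus>\<^bsub>F i\<^esub> hF k (dF k y)"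
        using hF_Suc[OF y'] Fi.add_diff_cancel(3)[OF graded_subD(2)[OF gF uvy] graded_subD(2)[OF gF hd]] Suc by simp
      hence "f (u i (v i y) \<ominus>\<^bsub>F i\<^esub> y) = f (dF i (hF i y)) \<oplus>\<^bsub>N\<^esub> f (hF k (dF k y))"
        using graded_homD(2)[OF fhm dh hd] by simp
      also have "f (dF i (hF i y)) = \<zero>\<^bsub>N\<^esub>" by (rule cocycles_on[OF f(1) graded_subD(2)[OF gF graded_homD0[OF hF y]]])
      also have "\<zero>\<^bsub>N\<^esub> \<oplus>\<^bsub>N\<^esub> f (hF k (dF k y)) = f (hF k (dF k y))" using fc[OF hd] by simp
      also have "\<dots> = fl k (\<lambda>y. f (hF k y)) (dF k y)" using fl(2)[OF fh graded_homD0[OF dF_graded_hom y']] by simp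
      finally show "(p i z \<ominus>\<^bsub>H i\<^esub> f) y = cob k (fl k (\<lambda>y. f (hF k y))) y"
        using diff[OF y] graded_subD(2)[OF gF y'] by (simp add: cob_on)
    qed
    thus ?thesis using fl(1)[OF fh] Suc by (auto simp: cob_def)
  qed
  thus ?thesis using z by blast
qed

text \<open>If z v = g d, the homotopy gives z = z v u - z h d = (g u - z h) d, because z d = 0. The
  converse is the compatibility of \<open>v\<close> with the differentials.\<close>

lemma p_ker:
  assumes z: "z \<in> cocycle_family i a" shows "p i z \<in> S i \<longleftrightarrow> z \<in> coboundary_family i a"
proof
  interpret N: Module.module R N by (rule mN)
  interpret H: Module.module R "H i" by (rule mH)
  have zC: "z \<in> C i a" using z cocycle_family_C by blast
  have zhm: "z \<in> graded_hom (fun_mod RM) (free_family (J i)) N W a" by (rule Hom_family_graded_hom[OF zC])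
  have zc: "z c \<in> carrier N" if "c \<in> free_family (J i) n" for c n by (rule graded_subD(2)[OF gN graded_homD(1)[OF zhm that]])
  show "p i z \<in> S i" if "z \<in> coboundary_family i a"
  proof (cases i)
    case 0
    hence "z = \<zero>\<^bsub>PM\<^esub>" using that by simp
    hence "p i z = \<zero>\<^bsub>H i\<^esub>"
      by (intro H_eqI[OF p(1)[OF zC] H.zero_closed]) (use p(2)[OF zC] graded_subD(2)[OF gF] in \<open>auto simp: hom_module_simps(2)\<close>)
    thus ?thesis using 0 by simp
  next
    case (Suc k)
    hence "z \<in> pre k ` C k a" using that by simp
    then obtain g where g: "g \<in> C k a" "z = pre k g" by blast
    have "p i z = cob k (p k g)"
    proof (rule H_eqI[OF p(1)[OF zC]])
      show "cob k (p k g) \<in> carrier (H i)" unfolding Suc by (rule cob_closed[OF p(1)[OF g(1)]])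
      fix n y assume y: "y \<in> gF i n"
      have y': "y \<in> gF (Suc k) n" using y Suc by simp
      have "p i z y = g (d k (v (Suc k) y))"
        using p(2)[OF zC y] pre_on[OF graded_homD0[OF v y']] g(2) Suc by simp
      also have "\<dots> = g (v k (dF k y))" using v_d[OF y'] by simp
      also have "\<dots> = p k g (dF k y)" by (rule p(2)[OF g(1) graded_homD0[OF dF_graded_hom y'], symmetric])
      finally show "p i z y = cob k (p k g) y" using graded_subD(2)[OF gF y'] by (simp add: cob_on)
    qed
    thus ?thesis using p(1)[OF g(1)] Suc by (auto simp: cob_def)
  qed
  have p_u: "p i z (u i c) = z (v i (u i c))" if "c \<in> free_family (J i) n" for c n
    by (rule p(2)[OF zC graded_homD0[OF u that]])
  assume pS: "p i z \<in> S i"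
  show "z \<in> coboundary_family i a"
  proof (cases i)
    case 0
    have "z = \<zero>\<^bsub>PM\<^esub>"
    proof (rule Hom_family_eqI[OF zC graded_subD(3)[OF C_facts(1)]])
      fix n c assume c: "c \<in> free_family (J i) n"
      have vu: "v i (u i c) \<in> free_family (J i) n" by (rule graded_homD0[OF v graded_homD0[OF u c]])
      have "z (v i (u i c)) = \<zero>\<^bsub>N\<^esub>"
        using pS 0 p_u[OF c] graded_subD(2)[OF gF graded_homD0[OF u c]] by (simp add: hom_module_simps)
      moreover have "z (v i (u i c) \<ominus>\<^bsub>fun_mod RM\<^esub> c) = \<zero>\<^bsub>N\<^esub>"
        using cocycle_family_d[OF z graded_homD0[OF hG c]] hG_0[of c n] c 0 by simp
      ultimately have "\<zero>\<^bsub>N\<^esub> \<ominus>\<^bsub>N\<^esub> z c = \<zero>\<^bsub>N\<^esub>" using graded_hom_diff[OF graded_sub_free_family gN zhm vu c] by simp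
      thus "z c = \<zero>\<^bsub>PM\<^esub> c" using zc[OF c] by simp
    qed
    thus ?thesis using 0 by simp
  next
    case (Suc k)
    then obtain g where g: "g \<in> carrier (H k)" "p i z = cob k g" using pS by (auto simp: cob_def)
    have ghom: "g \<in> module_hom R (F k) N" using g(1) by (simp add: hom_module_simps)
    \<comment> \<open>Membership in \<open>S i\<close> provides an arbitrary homomorphism
      \<open>g\<close>, while the coboundary must come from degree \<open>a\<close>. Its part of
      degree \<open>a\<close> suffices, as the values of \<open>g\<close> used below already lie in
      the right pieces.\<close>
    obtain ga where ga: "ga \<in> graded_hom (F k) (gF k) N W a" "\<forall>n. \<forall>y\<in>gF k n. ga y = component N W (g y) (a + n)"
      using homogeneous_part[OF gmF gmN ghom] by blast
    have zhm': "z \<in> graded_hom (fun_mod RM) (free_family (J (Suc k))) N W a" using zhm Suc by simp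
    let ?g = "\<lambda>c. ga (u k c) \<ominus>\<^bsub>N\<^esub> z (hG k c)"
    have g': "?g \<in> graded_hom (fun_mod RM) (free_family (J k)) N W a"
      using graded_hom_sub[OF graded_sub_free_family gN graded_hom_comp[OF u ga(1)], of "\<lambda>c. z (hG k c)"] graded_hom_comp[OF hG zhm'] by simp
    have gz: "zero_extend (free_family (J k)) N ?g \<in> C k a" by (rule zero_extend_Hom_family[OF graded_sub_free_family g'])
    have "z = pre k (zero_extend (free_family (J k)) N ?g)"
    proof (rule Hom_family_eqI[OF zC])
      show "pre k (zero_extend (free_family (J k)) N ?g) \<in> C i a" unfolding Suc by (rule graded_homD0[OF pre_graded_hom gz])
      fix n c assume c: "c \<in> free_family (J i) n"
      have c': "c \<in> free_family (J (Suc k)) n" using c Suc by simp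
      have dc: "d k c \<in> free_family (J k) n" by (rule graded_homD0[OF resolutionD(4)[OF res] c'])
      have udc: "u k (d k c) \<in> gF k n" by (rule graded_homD0[OF u dc])
      have hd: "hG k (d k c) \<in> free_family (J i) n" using graded_homD0[OF hG dc] Suc by simp
      have vu: "v i (u i c) \<in> free_family (J i) n" by (rule graded_homD0[OF v graded_homD0[OF u c]])
      have vuc: "v i (u i c) \<ominus>\<^bsub>fun_mod RM\<^esub> c \<in> free_family (J i) n" by (rule graded_sub_diff[OF graded_sub_free_family vu c])
      have uc: "u i c \<in> carrier (F (Suc k))" using graded_subD(2)[OF gF graded_homD0[OF u c]] Suc by simp
      have 1: "z (v i (u i c)) = g (u k (d k c))"
        using p_u[OF c] g(2) cob_on[OF uc] u_d[OF c'] Suc by simp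
      have "z ((v i (u i c) \<ominus>\<^bsub>fun_mod RM\<^esub> c) \<ominus>\<^bsub>fun_mod RM\<^esub> hG k (d k c)) = \<zero>\<^bsub>N\<^esub>"
        using cocycle_family_d[OF z graded_homD0[OF hG c]] hG_Suc[OF c'] Suc by simp
      hence 2: "(g (u k (d k c)) \<ominus>\<^bsub>N\<^esub> z c) \<ominus>\<^bsub>N\<^esub> z (hG k (d k c)) = \<zero>\<^bsub>N\<^esub>"
        using graded_hom_diff[OF graded_sub_free_family gN zhm vuc hd] graded_hom_diff[OF graded_sub_free_family gN zhm vu c] 1 by simp
      have gc: "g (u k (d k c)) \<in> carrier N" using 1 zc[OF vu] by simp
      have "z c = g (u k (d k c)) \<ominus>\<^bsub>N\<^esub> z (hG k (d k c))"
      proof -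
        have "g (u k (d k c)) \<ominus>\<^bsub>N\<^esub> z c = z (hG k (d k c))"
          using 2 gc zc[OF c] zc[OF hd] by simp
        moreover have "(g (u k (d k c)) \<ominus>\<^bsub>N\<^esub> z c) \<oplus>\<^bsub>N\<^esub> z c = g (u k (d k c))"
          by (rule N.add_diff_cancel(3)[OF gc zc[OF c]])
        ultimately show ?thesis using N.add_diff_cancel(1)[OF zc[OF hd] zc[OF c]] by simp
      qed
      moreover have "g (u k (d k c)) \<in> W (a + n)" using 1 graded_homD(1)[OF zhm vu] by simp
      ultimately have "z c = ga (u k (d k c)) \<ominus>\<^bsub>N\<^esub> z (hG k (d k c))"
        using ga(2) udc component_homogeneous[OF gmN, of "g (u k (d k c))" "a + n" "a + n"] by simp
      thus "z c = pre k (zero_extend (free_family (J k)) N ?g) c"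
        unfolding pre_on[OF c'] zero_extend_free_family[OF dc] .
    qed
    thus ?thesis using gz Suc by auto
  qed
qed

section \<open>Cosets and the dimensions of the pieces of Ext\<close>

abbreviation coset where "coset i f \<equiv> S i +>\<^bsub>H i\<^esub> f"

lemma Ext_simps:
  "carrier (Ext i) = coset i ` cocycles R F dF N i" "\<zero>\<^bsub>Ext i\<^esub> = S i"
  "Q \<oplus>\<^bsub>Ext i\<^esub> Q' = Q <+>\<^bsub>H i\<^esub> Q'" "r \<odot>\<^bsub>Ext i\<^esub> Q = (\<Union>f\<in>Q. coset i (r \<odot>\<^bsub>H i\<^esub> f))"
  by (auto simp: Ext_module_def quotient_module_def A_RCOSETS_def' a_r_coset_def' set_add_def')

lemma coset_eq_S: "f \<in> carrier (H i) \<Longrightarrow> coset i f = S i \<longleftrightarrow> f \<in> S i"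
proof -
  interpret S: abelian_subgroup "S i" "H i" by (rule S_subgroup)
  assume f: "f \<in> carrier (H i)"
  show ?thesis using S.a_rcos_self[OF f] S.a_rcos_const[of f] by auto
qed

text \<open>Scalar multiplication on a quotient is a union over all representatives; the cosets in
  this union coincide because \<open>S i\<close> is stable under \<open>gR 0\<close>.\<close>

lemma Ext_smult:
  assumes k: "k \<in> gR 0" and f: "f \<in> carrier (H i)" shows "k \<odot>\<^bsub>Ext i\<^esub> coset i f = coset i (k \<odot>\<^bsub>H i\<^esub> f)"
proof -
  interpret S: abelian_subgroup "S i" "H i" by (rule S_subgroup)
  interpret H: Module.module R "H i" by (rule mH)
  have kc: "k \<in> carrier R" by (rule gR_carrier[OF k])
  have eq: "coset i (k \<odot>\<^bsub>H i\<^esub> g) = coset i (k \<odot>\<^bsub>H i\<^esub> f)" if g: "g \<in> coset i f" for g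
  proof -
    obtain q where q: "q \<in> S i" "g = q \<oplus>\<^bsub>H i\<^esub> f" using g by (auto simp: a_r_coset_def')
    have qc: "q \<in> carrier (H i)" using q(1) K_sub_S[of i] by (auto simp: K_sub_def)
    have kq: "k \<odot>\<^bsub>H i\<^esub> q \<in> S i" using q(1) k K_sub_S[of i] by (auto simp: K_sub_def)
    have "k \<odot>\<^bsub>H i\<^esub> g = k \<odot>\<^bsub>H i\<^esub> q \<oplus>\<^bsub>H i\<^esub> k \<odot>\<^bsub>H i\<^esub> f" using qc f kc by (simp add: q(2) H.smult_r_distr)
    hence "k \<odot>\<^bsub>H i\<^esub> g \<in> coset i (k \<odot>\<^bsub>H i\<^esub> f)" using kq by (auto simp: a_r_coset_def')
    thus ?thesis using S.a_repr_independence'[of _ "k \<odot>\<^bsub>H i\<^esub> f"] H.smult_closed[OF kc f] by blast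
  qed
  show ?thesis unfolding Ext_simps using eq S.a_rcos_self[OF f] by blast
qed

definition \<Psi> :: "nat \<Rightarrow> ((int \<times> nat \<Rightarrow> 'a) \<Rightarrow> 'c) \<Rightarrow> ('f \<Rightarrow> 'c) set" where "\<Psi> i z = coset i (p i z)"

abbreviation gExt where "gExt i \<equiv> Ext_grading R F gF dF N W i"

lemma \<Psi>_image: "\<Psi> i ` cocycle_family i a = gExt i a"
proof
  show "\<Psi> i ` cocycle_family i a \<subseteq> gExt i a"
    using p_cocycle p(3)[OF subsetD[OF cocycle_family_C]] by (auto simp: \<Psi>_def Ext_grading_def)
  show "gExt i a \<subseteq> \<Psi> i ` cocycle_family i a"
  proof
    fix Q assume "Q \<in> gExt i a"
    then obtain f where f: "f \<in> cocycles R F dF N i" "f \<in> hom_grading R (F i) (gF i) N W a" "Q = coset i f"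
      by (auto simp: Ext_grading_def)
    obtain z where z: "z \<in> cocycle_family i a" "p i z \<ominus>\<^bsub>H i\<^esub> f \<in> S i" using p_surj[OF f(1,2)] by blast
    interpret S: abelian_subgroup "S i" "H i" by (rule S_subgroup)
    have c: "f \<in> carrier (H i)" "p i z \<in> carrier (H i)"
      using f(1) p_cocycle[OF z(1)] by (simp_all add: cocycles_iff)
    have "p i z \<in> coset i f" using S.a_rcos_module_rev[OF c] z(2) by (simp add: a_minus_def)
    hence "Q = \<Psi> i z" unfolding f(3) \<Psi>_def by (rule S.a_repr_independence'[OF _ c(1)])
    thus "Q \<in> \<Psi> i ` cocycle_family i a" using z(1) by blast
  qed
qed

lemma \<Psi>_zero: "z \<in> cocycle_family i a \<Longrightarrow> \<Psi> i z = \<zero>\<^bsub>Ext i\<^esub> \<longleftrightarrow> z \<in> coboundary_family i a"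
  using coset_eq_S[OF p(1)[OF subsetD[OF cocycle_family_C]]] p_ker unfolding \<Psi>_def Ext_simps by blast

lemma \<Psi>_linear:
  assumes z: "z \<in> cocycle_family i a"
  shows "z' \<in> cocycle_family i a \<Longrightarrow> \<Psi> i (z \<oplus>\<^bsub>PM\<^esub> z') = \<Psi> i z \<oplus>\<^bsub>Ext i\<^esub> \<Psi> i z'"
    and "k \<in> gR 0 \<Longrightarrow> \<Psi> i (k \<odot>\<^bsub>PM\<^esub> z) = k \<odot>\<^bsub>Ext i\<^esub> \<Psi> i z"
proof -
  have zC: "z \<in> C i a" using z cocycle_family_C by blast
  show "\<Psi> i (z \<oplus>\<^bsub>PM\<^esub> z') = \<Psi> i z \<oplus>\<^bsub>Ext i\<^esub> \<Psi> i z'" if "z' \<in> cocycle_family i a"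
  proof -
    have z'C: "z' \<in> C i a" using that cocycle_family_C by blast
    interpret S: abelian_subgroup "S i" "H i" by (rule S_subgroup)
    show ?thesis
      unfolding \<Psi>_def Ext_simps p_add[OF zC z'C] by (rule S.a_rcos_sum[OF p(1)[OF zC] p(1)[OF z'C], symmetric])
  qed
  show "\<Psi> i (k \<odot>\<^bsub>PM\<^esub> z) = k \<odot>\<^bsub>Ext i\<^esub> \<Psi> i z" if "k \<in> gR 0"
    unfolding \<Psi>_def p_smult[OF zC that] by (rule Ext_smult[OF that p(1)[OF zC], symmetric])
qed

text \<open>Rank and nullity for \<open>\<Psi>\<close>, which maps the cocycles of degree
  \<open>a\<close> onto the piece of Ext, with the coboundaries as kernel.\<close>

theorem hilbert_function_Ext:
  "of_nat (hilbert_function R gR (Ext i) (gExt i) a) = ext_hilb i a"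
proof -
  let ?W = "res (Ext i) (gExt i a)"
  note k = fin_genD(3,2)[OF fin_gen_cocycle_family, of i a]
  have V: "vectorspace K (res PM (cocycle_family i a))" by (rule K_sub_vectorspace[OF k(1)])
  have zero: "\<zero>\<^bsub>PM\<^esub> \<in> cocycle_family i a" "\<zero>\<^bsub>PM\<^esub> \<in> coboundary_family i a" using graded_subD(3)[OF graded_sub_cocycle_family] graded_subD(3)[OF graded_sub_coboundary_family] by auto
  have W: "vectorspace K ?W"
  proof (rule vectorspace_surj[OF V, where f = "\<Psi> i"])
    show "\<Psi> i \<zero>\<^bsub>res PM (cocycle_family i a)\<^esub> = \<zero>\<^bsub>?W\<^esub>" using \<Psi>_zero[OF zero(1)] zero(2) by simp
  qed (use \<Psi>_image \<Psi>_linear in \<open>simp_all del: fun_mod_simps\<close>)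
  have "K_dim PM (cocycle_family i a) = vectorspace.dim K ?W + K_dim PM {z \<in> cocycle_family i a. \<Psi> i z = \<zero>\<^bsub>?W\<^esub>}"
    by (rule rank_nullity(2)[OF k W]) (use \<Psi>_image \<Psi>_linear in \<open>simp_all del: fun_mod_simps, blast\<close>)
  also have "{z \<in> cocycle_family i a. \<Psi> i z = \<zero>\<^bsub>?W\<^esub>} = coboundary_family i a" using \<Psi>_zero[of _ i a] coboundary_family_cocycle_family[of i a] by auto
  finally show ?thesis by (simp add: ext_hilb_def hilb_def hilbert_function_def)
qed

lemma Ext_trivial:
  assumes "carrier (Ext i) = {\<zero>\<^bsub>Ext i\<^esub>}" shows "cocycle_family i a = coboundary_family i a"
proof
  show "coboundary_family i a \<subseteq> cocycle_family i a" by (rule coboundary_family_cocycle_family)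
  show "cocycle_family i a \<subseteq> coboundary_family i a"
  proof
    fix z assume z: "z \<in> cocycle_family i a"
    have "\<Psi> i z \<in> carrier (Ext i)" unfolding Ext_simps \<Psi>_def using p_cocycle[OF z] by blast
    thus "z \<in> coboundary_family i a" using assms \<Psi>_zero[OF z] by simp
  qed
qed

end

context generated_graded_algebra begin

lemma homotopy_id:
  assumes P: "resolution A P d \<epsilon> M L"
    and f: "\<And>i. f i \<in> graded_hom (A i) (P i) (A i) (P i) 0" "\<And>n u. u \<in> P 0 n \<Longrightarrow> \<epsilon> (f 0 u) = \<epsilon> u"
    "\<And>i n u. u \<in> P (Suc i) n \<Longrightarrow> d i (f (Suc i) u) = f i (d i u)"
  shows "\<exists>h. (\<forall>i. h i \<in> graded_hom (A i) (P i) (A (Suc i)) (P (Suc i)) 0) \<and>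
    (\<forall>n. \<forall>u\<in>P 0 n. d 0 (h 0 u) = f 0 u \<ominus>\<^bsub>A 0\<^esub> u) \<and>
    (\<forall>i n. \<forall>u\<in>P (Suc i) n. d (Suc i) (h (Suc i) u) = (f (Suc i) u \<ominus>\<^bsub>A (Suc i)\<^esub> u) \<ominus>\<^bsub>A (Suc i)\<^esub> h i (d i u))"
proof -
  note P' = resolutionD[OF P]
  show ?thesis
  proof (rule homotopy[OF P, where w = "\<lambda>i u. f i u \<ominus>\<^bsub>A i\<^esub> u"])
    show "(\<lambda>u. f i u \<ominus>\<^bsub>A i\<^esub> u) \<in> graded_hom (A i) (P i) (A i) (P i) 0" for i
      by (rule graded_hom_sub[OF P'(3) P'(3) f(1) graded_hom_id[OF P'(3)]])
    show "\<epsilon> (f 0 u \<ominus>\<^bsub>A 0\<^esub> u) = \<zero>\<^bsub>M\<^esub>" if u: "u \<in> P 0 n" for n u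
    proof -
      interpret M: Module.module R M by (rule graded_subD(1)[OF P'(1)])
      show ?thesis
        using graded_hom_diff[OF P'(3) P'(1) P'(5) graded_homD0[OF f(1) u] u] f(2)[OF u] graded_subD(2)[OF P'(1) graded_homD0[OF P'(5) u]]
        by (simp add: a_minus_def M.r_neg)
    qed
    show "d i (f (Suc i) u \<ominus>\<^bsub>A (Suc i)\<^esub> u) = f i (d i u) \<ominus>\<^bsub>A i\<^esub> d i u" if u: "u \<in> P (Suc i) n" for i n u
      using graded_hom_diff[OF P'(3) P'(3) P'(4) graded_homD0[OF f(1) u] u] f(3)[OF u] by simp
  qed
qed

section \<open>The equation of Hilbert series\<close>

lemma hilbert_series_hilb: "hilbert_series R gR A U = rational_series (hilb A U)"
  by (simp add: hilbert_series_def rational_series_def hilb_def K_dim_def hilbert_function_def)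

text \<open>Its constant coefficient is the dimension of \<open>gR 0\<close> over itself, which is
  1. The division in the final equation depends on this.\<close>

lemma hilbert_series_ring_nonzero: "hilbert_series R gR RM gR \<noteq> 0"
proof
  assume "hilbert_series R gR RM gR = 0"
  moreover have "fls_nth (laurent_expansion (rational_series (hilb RM gR))) 0 = hilb RM gR 0"
    by (rule rational_series(1)[OF fin_gen_hilb[OF fin_gen_RM]])
  ultimately show False by (simp add: hilbert_series_hilb laurent_expansion_0 hilb_def RM_one_dim)
qed

end

text \<open>Past the nonvanishing modules the sum is extended to all \<open>i < n0\<close>: a
  trivial Ext module has zero coefficients and hence the zero series.\<close>

lemma (in ext_comparison) alternating_hilbert_series:
  assumes "\<forall>\<^sub>F i in sequentially. carrier (Ext i) = {\<zero>\<^bsub>Ext i\<^esub>}"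
  shows "(\<Sum>i | carrier (Ext i) \<noteq> {\<zero>\<^bsub>Ext i\<^esub>}. (- 1) ^ i * hilbert_series R gR (Ext i) (gExt i)) *
      subst_inverse_t (hilbert_series R gR RM gR) =
    subst_inverse_t (hilbert_series R gR M L) * hilbert_series R gR N W"
proof -
  obtain n0 where n0: "\<And>i. n0 \<le> i \<Longrightarrow> carrier (Ext i) = {\<zero>\<^bsub>Ext i\<^esub>}"
    using assms by (auto simp: eventually_sequentially)
  have hs: "hilbert_series R gR (Ext i) (gExt i) = rational_series (ext_hilb i)" for i
    unfolding hilbert_series_def rational_series_def by (simp only: hilbert_function_Ext)
  have zero: "rational_series (ext_hilb i) = 0" if "carrier (Ext i) = {\<zero>\<^bsub>Ext i\<^esub>}" for i
  proof -
    have "laurent_expansion (rational_series (ext_hilb i)) = 0"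
      using rational_series(1)[OF ext_hilb_series, of i] Ext_trivial[OF that]
      by (intro fls_eqI) (simp add: ext_hilb_def hilb_def)
    thus ?thesis by (simp add: laurent_expansion_eq_0_iff)
  qed
  have "(\<Sum>i | carrier (Ext i) \<noteq> {\<zero>\<^bsub>Ext i\<^esub>}. (- 1) ^ i * hilbert_series R gR (Ext i) (gExt i)) =
      (\<Sum>i<n0. (- 1) ^ i * rational_series (ext_hilb i))"
    unfolding hs
  proof (rule sum.mono_neutral_left)
    show "{i. carrier (Ext i) \<noteq> {\<zero>\<^bsub>Ext i\<^esub>}} \<subseteq> {..<n0}" using n0 not_less by auto
  qed (use zero in auto)
  thus ?thesis unfolding hilbert_series_hilb using alternating_sum_rational[OF Ext_trivial[OF n0]] by simp
qed

theorem theorem1: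
  fixes R :: "('a, 'r) ring_scheme" and gR :: "int \<Rightarrow> 'a set"
    and M :: "('a, 'b, 's) module_scheme" and gM :: "int \<Rightarrow> 'b set"
    and N :: "('a, 'c, 't) module_scheme" and gN :: "int \<Rightarrow> 'c set"
    and F :: "nat \<Rightarrow> ('a, 'f, 'u) module_scheme" and gF :: "nat \<Rightarrow> int \<Rightarrow> 'f set"
    and d :: "nat \<Rightarrow> 'f \<Rightarrow> 'f" and \<epsilon> :: "'f \<Rightarrow> 'b"
  assumes R_graded: "graded_ring R gR"
    and R_nonneg: "\<And>n. n < 0 \<Longrightarrow> gR n = {\<zero>\<^bsub>R\<^esub>}"
    and K_field: "subfield (gR 0) R"
    and R_generated: "\<exists>A. finite A \<and> A \<subseteq> (\<Union>n\<in>{0<..}. gR n) \<and>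
                          generate_ring R (gR 0 \<union> A) = carrier R"
    and M_finite: "finite_graded_module R gR M gM"
    and N_finite: "finite_graded_module R gR N gN"
    and F_resolution: "graded_free_resolution R gR M gM F gF d \<epsilon>"
    and Ext_vanishes: "\<forall>\<^sub>F i in sequentially.
                          carrier (Ext_module R F d N i) = {\<zero>\<^bsub>Ext_module R F d N i\<^esub>}"
  shows "(\<Sum>i | carrier (Ext_module R F d N i) \<noteq> {\<zero>\<^bsub>Ext_module R F d N i\<^esub>}.
            (- 1) ^ i * hilbert_series R gR (Ext_module R F d N i) (Ext_grading R F gF d N gN i)) =
         subst_inverse_t (hilbert_series R gR M gM) * hilbert_series R gR N gN /
         subst_inverse_t (hilbert_series R gR (ring_as_module R) gR)"
proof -
  interpret R0: graded_algebra R gR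
    using R_graded R_nonneg K_field by (simp add: graded_algebra_def graded_algebra_axioms_def)
  obtain A where A: "finite A" "A \<subseteq> (\<Union>n\<in>{0<..}. gR n)" "generate_ring R (gR 0 \<union> A) = carrier R"
    using R_generated by blast
  obtain x :: "nat \<Rightarrow> 'a" and e where x: "A = x ` {..<e}"
    using finite_imp_nat_seg_image_inj_on[OF A(1)] by (auto simp: lessThan_def)
  have "\<forall>k\<in>{..<e}. \<exists>n. 0 < n \<and> x k \<in> gR n" using A(2) x by auto
  then obtain dg where dg: "\<forall>k\<in>{..<e}. 0 < dg k \<and> x k \<in> gR (dg k)" by (rule bchoice[THEN exE])
  interpret R1: graded_algebra_elements R gR x e dg by unfold_locales (use dg in auto)
  interpret R2: generated_graded_algebra R gR x e dg
    using R1.generated A(3) x by unfold_locales blast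
  have fgM: "R2.fin_gen M gM" and fgN: "R2.fin_gen N gN" using R2.fin_gen_of_finite M_finite N_finite by auto
  have gmM: "graded_module R gR M gM" and gmN: "graded_module R gR N gN"
    using M_finite N_finite by (auto simp: finite_graded_module_def)
  obtain s where s: "\<forall>n<s. gM n = {\<zero>\<^bsub>M\<^esub>}" using fgM by (auto simp: R2.fin_gen_def)
  obtain J d' \<epsilon>' where G: "R2.resolution (\<lambda>_. fun_mod R0.RM) (\<lambda>i. R2.free_family (J i)) d' \<epsilon>' M gM"
    "\<forall>i. finite (J i)" "\<forall>i. \<forall>j\<in>J i. s + int i \<le> fst j"
    using R2.resolution_exists[OF fgM s] by blast
  have F: "R2.resolution F gF d \<epsilon> M gM" by (rule R2.free_resolution[OF F_resolution gmM])
  obtain u where u: "\<forall>i. u i \<in> R0.graded_hom (fun_mod R0.RM) (R2.free_family (J i)) (F i) (gF i) 0"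
    "\<forall>n. \<forall>c\<in>R2.free_family (J 0) n. \<epsilon> (u 0 c) = \<epsilon>' c"
    "\<forall>i n. \<forall>c\<in>R2.free_family (J (Suc i)) n. d i (u (Suc i) c) = u i (d' i c)"
    using R2.comparison[OF G(1) F] by blast
  obtain v where v: "\<forall>i. v i \<in> R0.graded_hom (F i) (gF i) (fun_mod R0.RM) (R2.free_family (J i)) 0"
    "\<forall>n. \<forall>y\<in>gF 0 n. \<epsilon>' (v 0 y) = \<epsilon> y"
    "\<forall>i n. \<forall>y\<in>gF (Suc i) n. d' i (v (Suc i) y) = v i (d i y)"
    using R2.comparison[OF F G(1)] by blast
  \<comment> \<open>The composites of \<open>u\<close> and \<open>v\<close> in both orders lift the
    identity of \<open>M\<close>, so each differs from the identity by a homotopy.\<close>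
  have "\<exists>h. (\<forall>i. h i \<in> R0.graded_hom (fun_mod R0.RM) (R2.free_family (J i)) (fun_mod R0.RM) (R2.free_family (J (Suc i))) 0) \<and>
    (\<forall>n. \<forall>c\<in>R2.free_family (J 0) n. d' 0 (h 0 c) = v 0 (u 0 c) \<ominus>\<^bsub>fun_mod R0.RM\<^esub> c) \<and>
    (\<forall>i n. \<forall>c\<in>R2.free_family (J (Suc i)) n. d' (Suc i) (h (Suc i) c) =
      (v (Suc i) (u (Suc i) c) \<ominus>\<^bsub>fun_mod R0.RM\<^esub> c) \<ominus>\<^bsub>fun_mod R0.RM\<^esub> h i (d' i c))"
  proof (rule R2.homotopy_id[OF G(1), where f = "\<lambda>i c. v i (u i c)"])
    show "(\<lambda>c. v i (u i c)) \<in> R0.graded_hom (fun_mod R0.RM) (R2.free_family (J i)) (fun_mod R0.RM) (R2.free_family (J i)) 0" for i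
      by (rule R2.graded_hom_comp0[OF spec[OF u(1)] spec[OF v(1)]])
    show "\<epsilon>' (v 0 (u 0 c)) = \<epsilon>' c" if c: "c \<in> R2.free_family (J 0) n" for n c
      using v(2) u(2) c R0.graded_homD0[OF spec[OF u(1)] c] by simp
    show "d' i (v (Suc i) (u (Suc i) c)) = v i (u i (d' i c))" if c: "c \<in> R2.free_family (J (Suc i)) n" for i n c
      using v(3) u(3) c R0.graded_homD0[OF spec[OF u(1)] c] by simp
  qed
  then obtain hG where hG: "\<forall>i. hG i \<in> R0.graded_hom (fun_mod R0.RM) (R2.free_family (J i)) (fun_mod R0.RM) (R2.free_family (J (Suc i))) 0"
    "\<forall>n. \<forall>c\<in>R2.free_family (J 0) n. d' 0 (hG 0 c) = v 0 (u 0 c) \<ominus>\<^bsub>fun_mod R0.RM\<^esub> c"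
    "\<forall>i n. \<forall>c\<in>R2.free_family (J (Suc i)) n. d' (Suc i) (hG (Suc i) c) =
      (v (Suc i) (u (Suc i) c) \<ominus>\<^bsub>fun_mod R0.RM\<^esub> c) \<ominus>\<^bsub>fun_mod R0.RM\<^esub> hG i (d' i c)"
    by blast
  have "\<exists>h. (\<forall>i. h i \<in> R0.graded_hom (F i) (gF i) (F (Suc i)) (gF (Suc i)) 0) \<and>
    (\<forall>n. \<forall>y\<in>gF 0 n. d 0 (h 0 y) = u 0 (v 0 y) \<ominus>\<^bsub>F 0\<^esub> y) \<and>
    (\<forall>i n. \<forall>y\<in>gF (Suc i) n. d (Suc i) (h (Suc i) y) =
      (u (Suc i) (v (Suc i) y) \<ominus>\<^bsub>F (Suc i)\<^esub> y) \<ominus>\<^bsub>F (Suc i)\<^esub> h i (d i y))"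
  proof (rule R2.homotopy_id[OF F, where f = "\<lambda>i y. u i (v i y)"])
    show "(\<lambda>y. u i (v i y)) \<in> R0.graded_hom (F i) (gF i) (F i) (gF i) 0" for i
      by (rule R2.graded_hom_comp0[OF spec[OF v(1)] spec[OF u(1)]])
    show "\<epsilon> (u 0 (v 0 y)) = \<epsilon> y" if y: "y \<in> gF 0 n" for n y
      using v(2) u(2) y R0.graded_homD0[OF spec[OF v(1)] y] by simp
    show "d i (u (Suc i) (v (Suc i) y)) = u i (v i (d i y))" if y: "y \<in> gF (Suc i) n" for i n y
      using v(3) u(3) y R0.graded_homD0[OF spec[OF v(1)] y] by simp
  qed
  then obtain hF where hF: "\<forall>i. hF i \<in> R0.graded_hom (F i) (gF i) (F (Suc i)) (gF (Suc i)) 0"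
    "\<forall>n. \<forall>y\<in>gF 0 n. d 0 (hF 0 y) = u 0 (v 0 y) \<ominus>\<^bsub>F 0\<^esub> y"
    "\<forall>i n. \<forall>y\<in>gF (Suc i) n. d (Suc i) (hF (Suc i) y) =
      (u (Suc i) (v (Suc i) y) \<ominus>\<^bsub>F (Suc i)\<^esub> y) \<ominus>\<^bsub>F (Suc i)\<^esub> hF i (d i y)"
    by blast
  interpret C: hom_complex R gR x e dg M gM N gN J d' \<epsilon>' s
    by unfold_locales (use fgM fgN G in auto)
  interpret ext_comparison R gR x e dg M gM N gN J d' \<epsilon>' s F gF d u v hG hF
  proof (intro ext_comparison.intro ext_comparison_axioms.intro)
    show "hom_complex R gR x e dg M gM N gN J d' \<epsilon>' s" by (rule C.hom_complex_axioms)
    show "R0.graded_mod (F i) (gF i)" for i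
      by (rule R2.free_proj(2)[OF graded_free_resolution.free[OF F_resolution]])
    show "d i \<in> graded_hom0 R (F (Suc i)) (gF (Suc i)) (F i) (gF i)" for i
      by (rule graded_free_resolution.d_hom[OF F_resolution])
  qed (use gmN u(1,3) v(1,3) hG hF in \<open>simp_all del: fun_mod_simps\<close>)
  have "subst_inverse_t (hilbert_series R gR (ring_as_module R) gR) \<noteq> 0"
    by (simp add: subst_inverse_t_eq_0_iff R2.hilbert_series_ring_nonzero)
  thus ?thesis using alternating_hilbert_series[OF Ext_vanishes] by (simp add: eq_divide_eq)
qed

end
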